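(* Let $\delta>0$. Let $X$ be a random $n\times p$ matrix whose rows $x_i$, $i=1,\dots,n$, are i.i.d. and have the form $x_i=\Gamma^{1/2}z_i$, where the $z_i\in\mathbb{R}^p$ have i.i.d. entries with mean zero, unit variance and uniformly bounded $(8+\delta)$-th moment, and $\Gamma$ is an invertible $p\times p$ covariance matrix. Let $Y=X\beta+\varepsilon$, where $\varepsilon$ is independent of $X$ and has independent mean-zero entries $\varepsilon_i$ with diagonal covariance matrix $\Sigma$, and assume that for all $i\in\{1,\dots,n\}$ the fourth moment of $\varepsilon_i$ is less than a constant $C\ge3$ times the squared variance of $\varepsilon_i$. Let $V$ denote the vector of variances (given $X$) of the entries of the ordinary least-squares estimator $\hat\beta=(X^\top X)^{-1}X^\top Y$, let $\hat V=(S\odot S)(Q\odot Q)^{-1}(\hat\varepsilon\odot\hat\varepsilon)$ be the Hadamard estimator, and let $\gamma_{p,n}=p/n$. Then, as $n,p\to\infty$ such that $\limsup\gamma_{p,n}<1/2$, for any constant $c>1$ and some constant $C'>1$ we have, for all $n$ large enough (and $t>0$), $$\mathbb{P}\left(\frac{\|\hat V-V\|}{\|\vec\Sigma\|}\ge\frac{t}{n}\right)\le\frac{2c}{t^2}\,\frac{1}{\left[\sigma_{\min}(\Gamma)\,(1-\gamma_{p,n}^{1/2})^2\,(1-2\gamma_{p,n})\right]^2}+C'n^{-1-\delta/4}.$$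
   Context: All objects are indexed by a sequence of pairs $(n,p)$ with $n,p\to\infty$; the bound on the $(8+\delta)$-th absolute moment of the entries of the $z_i$ is uniform along the sequence, and $C$ does not depend on $n,p$. $\Gamma^{1/2}$ is the symmetric square root of $\Gamma$; $\sigma_{\min}(\Gamma)$ is its smallest singular value (the smallest singular value of $\Gamma$ itself). $S=(X^\top X)^{-1}X^\top$, $Q=I_n-X(X^\top X)^{-1}X^\top$, $\hat\varepsilon=Y-X\hat\beta$, and $V=\mathrm{diag}(S\Sigma S^\top)$ (vector of diagonal entries). $\vec\Sigma$ is the vector of diagonal entries of $\Sigma$. $\|\cdot\|$ is the Euclidean norm, and $\odot$ is the Hadamard (entrywise) product. On the event that $X^\top X$ or $Q\odot Q$ is singular, so that $\hat V$ is not defined, the inequality inside the probability is counted as holding. *)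

theory Defs
  imports
    "HOL-Probability.Probability"
    "Jordan_Normal_Form.Gauss_Jordan_Elimination"
    "Jordan_Normal_Form.Spectral_Radius"
begin

text \<open>The dimensions vary along a sequence, so vectors and matrices are those of
  \<^theory>\<open>Jordan_Normal_Form.Matrix\<close>; the clashing notation for
  \<^typ>\<open>real\<close>-vectors indexed by a finite type is switched off.\<close>

unbundle no vec_syntax
unbundle no inner_syntax

subsection \<open>Matrices\<close>

text \<open>Only meaningful for invertible \<open>A\<close>; otherwise the value is unspecified.\<close>

definition minv :: "real mat \<Rightarrow> real mat" where
  "minv A = the (mat_inverse A)"

definition hadamard_mat :: "real mat \<Rightarrow> real mat \<Rightarrow> real mat" (infixl "\<odot>\<^sub>m" 70) where
  "A \<odot>\<^sub>m B = Matrix.mat (dim_row A) (dim_col A) (\<lambda>ij. A $$ ij * B $$ ij)"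

definition hadamard_vec :: "real Matrix.vec \<Rightarrow> real Matrix.vec \<Rightarrow> real Matrix.vec"
  (infixl "\<odot>\<^sub>v" 70) where
  "u \<odot>\<^sub>v v = Matrix.vec (dim_vec u) (\<lambda>i. u $ i * v $ i)"

definition diag_vec :: "real mat \<Rightarrow> real Matrix.vec" where
  "diag_vec A = Matrix.vec (dim_row A) (\<lambda>i. A $$ (i, i))"

definition enorm :: "real Matrix.vec \<Rightarrow> real" where
  "enorm v = sqrt (v \<bullet> v)"

definition psd_mat :: "nat \<Rightarrow> real mat \<Rightarrow> bool" where
  "psd_mat m A \<longleftrightarrow> A \<in> carrier_mat m m \<and> transpose_mat A = A \<and>
     (\<forall>v\<in>carrier_vec m. 0 \<le> v \<bullet> (A *\<^sub>v v))"

text \<open>\<open>R\<close> is the symmetric square root of the covariance matrix \<open>G\<close>. As usual this is the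
  positive semidefinite root, which makes it unique.\<close>

definition is_sqrt_mat :: "nat \<Rightarrow> real mat \<Rightarrow> real mat \<Rightarrow> bool" where
  "is_sqrt_mat m R G \<longleftrightarrow> psd_mat m R \<and> R * R = G"

text \<open>The singular values of \<open>A\<close> are the square roots of the eigenvalues of \<open>A\<^sup>T A\<close>.\<close>

definition sigma_min :: "real mat \<Rightarrow> real" where
  "sigma_min A = Min (sqrt ` spectrum (transpose_mat A * A))"

subsection \<open>Random vectors and matrices\<close>

definition iid_vars :: "'a measure \<Rightarrow> 'b measure \<Rightarrow> ('i \<Rightarrow> 'a \<Rightarrow> 'b) \<Rightarrow> 'i set \<Rightarrow> bool" where
  "iid_vars M N X I \<longleftrightarrow> prob_space.indep_vars M (\<lambda>_. N) X I \<and>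
     (\<forall>i\<in>I. \<forall>j\<in>I. distr M N (X i) = distr M N (X j))"

text \<open>\<open>indep_var\<close> of the library needs both variables to have the same value type; this is the
  characterization \<open>indep_var_eq\<close> without that restriction.\<close>

definition indep_rvs ::
  "'a measure \<Rightarrow> 'b measure \<Rightarrow> ('a \<Rightarrow> 'b) \<Rightarrow> 'c measure \<Rightarrow> ('a \<Rightarrow> 'c) \<Rightarrow> bool" where
  "indep_rvs M S X T Y \<longleftrightarrow> X \<in> measurable M S \<and> Y \<in> measurable M T \<and>
     prob_space.indep_set M
       (sigma_sets (space M) {X -` A \<inter> space M |A. A \<in> sets S})
       (sigma_sets (space M) {Y -` A \<inter> space M |A. A \<in> sets T})"

text \<open>Matrix.vec and mat carry no sigma-algebra; random vectors and matrices are therefore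
  read through their coordinate families, as elements of a finite product of Borel spaces.\<close>

definition vec_coords :: "nat \<Rightarrow> real Matrix.vec \<Rightarrow> nat \<Rightarrow> real" where
  "vec_coords m v = (\<lambda>i\<in>{..<m}. v $ i)"

definition vec_space_borel :: "nat \<Rightarrow> (nat \<Rightarrow> real) measure" where
  "vec_space_borel m = Pi\<^sub>M {..<m} (\<lambda>_. borel)"

definition mat_coords :: "nat \<Rightarrow> nat \<Rightarrow> real mat \<Rightarrow> nat \<times> nat \<Rightarrow> real" where
  "mat_coords n p A = (\<lambda>ij\<in>{..<n} \<times> {..<p}. A $$ ij)"

definition mat_space_borel :: "nat \<Rightarrow> nat \<Rightarrow> (nat \<times> nat \<Rightarrow> real) measure" where
  "mat_space_borel n p = Pi\<^sub>M ({..<n} \<times> {..<p}) (\<lambda>_. borel)"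

definition cov_mat :: "'a measure \<Rightarrow> nat \<Rightarrow> ('a \<Rightarrow> real Matrix.vec) \<Rightarrow> real mat" where
  "cov_mat M m e = Matrix.mat m m (\<lambda>(i, j).
     \<integral>\<omega>. (e \<omega> $ i - (\<integral>\<omega>'. e \<omega>' $ i \<partial>M)) * (e \<omega> $ j - (\<integral>\<omega>'. e \<omega>' $ j \<partial>M)) \<partial>M)"

subsection \<open>Ordinary least squares and the Hadamard estimator\<close>

definition ols_S :: "real mat \<Rightarrow> real mat" where
  "ols_S X = minv (transpose_mat X * X) * transpose_mat X"

definition ols_Q :: "real mat \<Rightarrow> real mat" where
  "ols_Q X = 1\<^sub>m (dim_row X) - X * minv (transpose_mat X * X) * transpose_mat X"

definition ols_beta :: "real mat \<Rightarrow> real Matrix.vec \<Rightarrow> real Matrix.vec" where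
  "ols_beta X Y = minv (transpose_mat X * X) * transpose_mat X *\<^sub>v Y"

definition ols_resid :: "real mat \<Rightarrow> real Matrix.vec \<Rightarrow> real Matrix.vec" where
  "ols_resid X Y = Y - X *\<^sub>v ols_beta X Y"

text \<open>The conditional covariance matrix of the least-squares estimator given \<open>X\<close> is
  \<open>S \<Sigma> S\<^sup>T\<close>, because the noise is independent of \<open>X\<close>; its diagonal is the vector
  of variances.\<close>

definition ols_var :: "real mat \<Rightarrow> real mat \<Rightarrow> real Matrix.vec" where
  "ols_var X \<Sigma> = diag_vec (ols_S X * \<Sigma> * transpose_mat (ols_S X))"

definition hadamard_est :: "real mat \<Rightarrow> real Matrix.vec \<Rightarrow> real Matrix.vec" where
  "hadamard_est X Y = (ols_S X \<odot>\<^sub>m ols_S X) * minv (ols_Q X \<odot>\<^sub>m ols_Q X)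
     *\<^sub>v (ols_resid X Y \<odot>\<^sub>v ols_resid X Y)"

definition hadamard_est_defined :: "real mat \<Rightarrow> bool" where
  "hadamard_est_defined X \<longleftrightarrow>
     invertible_mat (transpose_mat X * X) \<and> invertible_mat (ols_Q X \<odot>\<^sub>m ols_Q X)"

end

theory Submission
  imports Defs
begin

text \<open>
  Given the design, the Hadamard estimator is unbiased, and its error is a centred quadratic form in
  the noise. Its conditional mean squared norm is therefore at most a constant times the sum of the squared noise
  variances, weighted by functions of the design (\<open>noise_weight\<close>, \<open>error_second_moment\<close>). The sum of the weights is
  controlled by the fourth powers of the entries of \<open>S\<close>, as soon as all leverages stay below one half: then
  \<open>Q\<odot>Q\<close> is bounded below (\<open>projsq_form\<close>), in particular invertible. The rows of the design
  are exchangeable, so all weights have the same expectation, namely the \<open>n\<close>-th part of that of their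
  sum (\<open>noise_weight_expect\<close>). This expectation is of the order \<open>n powr -3\<close> divided by the square
  of the smallest singular value of the covariance matrix, and Markov's inequality at the level \<open>t / n\<close>
  gives a probability of the order \<open>1 / n\<close> times \<open>1 / t\<^sup>2\<close>. For large \<open>n\<close> this is below the first term
  of the claim, whose factor in \<open>\<gamma>\<close> is at most one before inversion.

  The second term of the claim is the probability that the design is not \<open>well_conditioned\<close>: some leverage
  is too close to one half, or some diagonal entry of the inverse Gram matrix is not of the order \<open>1 / n\<close>. Both
  are governed by quadratic forms: the leverage of a row is a quadratic form in that row given
  the others, and the reciprocal of a diagonal entry is the residual sum of squares of a column, a quadratic form in
  that column given the others. Moments of order \<open>8 + \<delta>\<close> of the entries yield moments of order \<open>q = 4 + \<delta>/2\<close> of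
  centred quadratic forms (\<open>quadratic_form_moment\<close>), so that one such event has probability of the order \<open>n powr (- q/2)\<close>, and a union
  over the \<open>n\<close> rows and \<open>p\<close> columns gives \<open>n powr (- 1 - \<delta>/4)\<close> (\<open>well_conditioned_prob\<close>).

  The leverages need the expected trace of the second power of the inverse Gram matrix, and the weights that of the fourth power, to be of the
  order that bounded eigenvalues of the normalized Gram matrix would give. Instead of bounding the smallest
  eigenvalue, which would take random matrix theory, the traces are estimated directly by inserting one column at a time
  and bounding its contribution by linear forms in it (\<open>good_trace2_expect\<close>, \<open>good_trace4_expect\<close>).
  A small ridge penalty keeps all inverses with deleted rows or columns defined meanwhile; it is removed at
  the end at the cost of a constant factor (\<open>ridge_to_ols\<close>).
\<close>

section \<open>Inequalities for real powers\<close>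

lemma powr_bernoulli:
  fixes x s :: real
  assumes "x > 0" "s \<ge> 1"
  shows "1 + s * (x - 1) \<le> x powr s"
proof -
  have "1 - 1/s \<ge> 0" using assms by (simp add: field_simps)
  have "ln x \<le> ln ((x powr s) / s + (1 - 1/s))"
  proof -
    have "x powr s > 0" using assms by simp
    have "ln ((1/s) *\<^sub>R (x powr s) + (1 - 1/s) *\<^sub>R 1) \<ge> (1/s) * ln (x powr s) + (1 - 1/s) * ln (1::real)"
      using ln_concave[unfolded concave_on_iff, THEN conjunct2, rule_format, of "x powr s" 1 "1/s" "1 - 1/s"]
        \<open>1 - 1/s \<ge> 0\<close> \<open>x powr s > 0\<close> assms by simp
    then show ?thesis using assms by (simp add: ln_powr)
  qed
  moreover have "(x powr s) / s + (1 - 1/s) > 0" using assms \<open>1 - 1/s \<ge> 0\<close>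
    by (intro add_pos_nonneg) auto
  ultimately have "x \<le> (x powr s) / s + (1 - 1/s)" using assms by simp
  then have "s * x \<le> s * ((x powr s) / s + (1 - 1/s))" using assms by (intro mult_left_mono) auto
  also have "\<dots> = x powr s + s - 1" using assms by (simp add: distrib_left right_diff_distrib)
  finally show ?thesis by (simp add: right_diff_distrib)
qed

text \<open>The tangent-line bound for the convex function \<open>u \<mapsto> u powr r\<close>. It turns the recursion of
  \<open>moment_step\<close> into a bound that is additive under the power \<open>q/2\<close>.\<close>

lemma powr_add_lower:
  fixes x y r :: real
  assumes "x \<ge> 0" "y \<ge> 0" "r \<ge> 1"
  shows "x powr r + r * x powr (r - 1) * y \<le> (x + y) powr r"
proof (cases "x = 0")
  case True then show ?thesis using assms by auto
next
  case False
  have "(x + y) powr r = x powr r * (1 + y/x) powr r"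
  proof -
    have "x + y = x * (1 + y/x)" using False by (simp add: distrib_left)
    then show ?thesis by (simp add: powr_mult)
  qed
  also have "(1 + y/x) powr r \<ge> 1 + r * (y/x)"
    using powr_bernoulli[of "1 + y/x" r] assms False by (simp add: add_pos_nonneg)
  then have "x powr r * (1 + y/x) powr r \<ge> x powr r * (1 + r * (y/x))"
    by (intro mult_left_mono) auto
  also have "x powr r * (1 + r * (y/x)) = x powr r + r * x powr (r - 1) * y"
    using assms False by (simp add: powr_diff algebra_simps)
  finally show ?thesis by linarith
qed

lemma powr_superadd:
  fixes x y r :: real
  assumes "x \<ge> 0" "y \<ge> 0" "r \<ge> 1"
  shows "x powr r + y powr r \<le> (x + y) powr r"
proof (cases "x + y = 0")
  case True
  then have "x = 0" "y = 0" using assms by linarith+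
  then show ?thesis by simp
next
  case False
  define s where "s = x + y"
  have s: "s > 0" using False assms by (auto simp: s_def)
  have *: "u powr r \<le> u * s powr (r - 1)" if "0 \<le> u" "u \<le> s" for u
  proof (cases "u = 0")
    case False
    have "u powr r = u * u powr (r - 1)" using False that by (simp add: powr_diff)
    also have "\<dots> \<le> u * s powr (r - 1)" using that assms by (intro mult_left_mono powr_mono2) auto
    finally show ?thesis .
  qed auto
  have "x powr r + y powr r \<le> x * s powr (r-1) + y * s powr (r-1)"
    using *[of x] *[of y] assms by (auto simp: s_def)
  also have "\<dots> = s * s powr (r - 1)" by (simp add: s_def algebra_simps)
  also have "\<dots> = s powr r" using s by (simp add: powr_diff)
  finally show ?thesis by (simp add: s_def)
qed

lemma powr_add_upper:
  fixes a b q :: real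
  assumes "q \<ge> 0"
  shows "\<bar>a + b\<bar> powr q \<le> 2 powr q * (\<bar>a\<bar> powr q + \<bar>b\<bar> powr q)"
proof -
  have "\<bar>a + b\<bar> powr q \<le> (2 * max \<bar>a\<bar> \<bar>b\<bar>) powr q" using assms by (intro powr_mono2) auto
  also have "\<dots> = 2 powr q * (max \<bar>a\<bar> \<bar>b\<bar>) powr q" by (rule powr_mult)
  also have "\<dots> \<le> 2 powr q * (\<bar>a\<bar> powr q + \<bar>b\<bar> powr q)"
    by (intro mult_left_mono) (auto simp: max_def)
  finally show ?thesis .
qed

text \<open>Up to the factor \<open>s + 1\<close> this is the derivative of \<open>\<bar>x\<bar> powr (s + 1)\<close>.\<close>

definition sgn_powr :: "real \<Rightarrow> real \<Rightarrow> real" where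
  "sgn_powr s x = sgn x * \<bar>x\<bar> powr s"

definition step_const :: "real \<Rightarrow> real" where
  "step_const q = q * q * 2 powr q"

text \<open>The second-order Taylor estimate of \<open>\<bar>x\<bar> powr q\<close> at \<open>a\<close>. The first-order term is kept exactly,
  because it has expectation zero for orthogonal increments; both remainders are then of the second order
  in \<open>b\<close> up to powers of the right size.\<close>

lemma powr_taylor2:
  fixes a b q :: real
  assumes q: "q \<ge> 2"
  shows "\<bar>a + b\<bar> powr q \<le> \<bar>a\<bar> powr q + q * sgn_powr (q - 1) a * b
           + step_const q * (\<bar>a\<bar> powr (q - 2) * b\<^sup>2 + \<bar>b\<bar> powr q)"
proof (cases "a = 0")
  case True
  have "1 \<le> q * q * 2 powr q"
  proof -
    have "1 * 1 * 1 \<le> q * q * 2 powr q" using q by (intro mult_mono) (auto simp: ge_one_powr_ge_zero)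
    then show ?thesis by simp
  qed
  then have "1 * \<bar>b\<bar> powr q \<le> q * q * 2 powr q * \<bar>b\<bar> powr q" by (intro mult_right_mono) auto
  moreover have "0 \<le> step_const q * ((0::real) powr (q-2) * b\<^sup>2)" by simp
  ultimately show ?thesis using True by (simp add: sgn_powr_def step_const_def algebra_simps)
next
  case a: False
  show ?thesis
  proof (cases "\<bar>a\<bar> \<le> \<bar>b\<bar>")
    case True
    have b: "b \<noteq> 0" using a True by auto
    have 1: "\<bar>a + b\<bar> powr q \<le> 2 powr q * \<bar>b\<bar> powr q"
    proof -
      have "\<bar>a + b\<bar> powr q \<le> (2 * \<bar>b\<bar>) powr q" using True q by (intro powr_mono2) auto
      then show ?thesis by (simp add: powr_mult)
    qed
    have 2: "\<bar>q * sgn_powr (q - 1) a * b\<bar> \<le> q * \<bar>b\<bar> powr q"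
    proof -
      have "\<bar>q * sgn_powr (q - 1) a * b\<bar> = q * (\<bar>a\<bar> powr (q-1) * \<bar>b\<bar>)"
        using a q by (simp add: sgn_powr_def abs_mult)
      also have "\<dots> \<le> q * (\<bar>b\<bar> powr (q-1) * \<bar>b\<bar>)"
        using True q by (intro mult_left_mono mult_right_mono powr_mono2) auto
      also have "\<bar>b\<bar> powr (q-1) * \<bar>b\<bar> = \<bar>b\<bar> powr q" using b by (simp add: powr_diff)
      finally show ?thesis .
    qed
    have 3: "(2 powr q + q) * \<bar>b\<bar> powr q \<le> step_const q * \<bar>b\<bar> powr q"
    proof (rule mult_right_mono)
      have "1 \<le> 2 powr q" using q by (simp add: ge_one_powr_ge_zero)
      then have "q * 1 \<le> q * 2 powr q" using q by (intro mult_left_mono) auto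
      moreover have "2 powr q * 1 \<le> q * 2 powr q" using q by simp
      moreover have "2 * (q * 2 powr q) \<le> q * (q * 2 powr q)" using q by (intro mult_right_mono) auto
      ultimately have "2 powr q + q \<le> q * (q * 2 powr q)" by linarith
      then show "2 powr q + q \<le> step_const q" by (simp add: step_const_def mult.assoc)
    qed auto
    have 4: "0 \<le> step_const q * (\<bar>a\<bar> powr (q - 2) * b\<^sup>2)" using q by (simp add: step_const_def)
    have 5: "0 \<le> \<bar>a\<bar> powr q" by simp
    from 2 have "- (q * \<bar>b\<bar> powr q) \<le> q * sgn_powr (q - 1) a * b" by linarith
    with 1 3 4 5 show ?thesis unfolding distrib_left distrib_right by linarith
  next
    case False
    define t where "t = b / a"
    have t: "\<bar>t\<bar> < 1" using a False by (simp add: t_def)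
    define u where "u = 1 + t"
    have u: "0 < u" "u \<le> 2" using t by (auto simp: u_def)
    have b: "b = a * t" using a by (simp add: t_def)
    have A: "1 - s * (t / u) \<le> 1 / u powr s" if "s \<ge> 1" for s
    proof -
      have "1 + s * (1/u - 1) \<le> (1/u) powr s" using u that by (intro powr_bernoulli) auto
      moreover have "(1/u - 1) = - t / u" using u by (simp add: u_def field_simps)
      ultimately show ?thesis using u by (simp add: powr_divide)
    qed
    have B: "u powr s - s * t * u powr (s - 1) \<le> 1" if "s \<ge> 1" for s
    proof -
      have "(1 - s * (t / u)) * u powr s \<le> 1 / u powr s * u powr s"
        using A[OF that] by (intro mult_right_mono) auto
      then show ?thesis using u by (simp add: powr_diff algebra_simps)
    qed
    have C: "t * (u powr (q - 1) - 1) \<le> (q - 1) * 2 powr q * t\<^sup>2"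
    proof (cases "t \<ge> 0")
      case True
      have "u powr (q - 1) - 1 \<le> (q - 1) * t * u powr (q - 2)" using B[of "q - 1"] q by simp
      also have "\<dots> \<le> (q - 1) * t * 2 powr q"
        using q u True
        by (intro mult_left_mono order_trans[OF powr_mono2[of "q-2" u 2]] powr_mono) auto
      finally have "t * (u powr (q - 1) - 1) \<le> t * ((q - 1) * t * 2 powr q)"
        using True by (intro mult_left_mono) auto
      then show ?thesis by (simp add: power2_eq_square algebra_simps)
    next
      case False
      have "1 + (q - 1) * (u - 1) \<le> u powr (q - 1)" using u q by (intro powr_bernoulli) auto
      then have "u powr (q - 1) - 1 \<ge> (q - 1) * t" by (simp add: u_def)
      then have "t * (u powr (q - 1) - 1) \<le> t * ((q - 1) * t)"
        using False by (intro mult_left_mono_neg) auto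
      also have "\<dots> = (q - 1) * t\<^sup>2 * 1" by (simp add: power2_eq_square)
      also have "\<dots> \<le> (q - 1) * t\<^sup>2 * 2 powr q"
        using q by (intro mult_left_mono) (auto simp: ge_one_powr_ge_zero)
      finally show ?thesis by (simp add: algebra_simps)
    qed
    have D: "u powr q \<le> 1 + q * t + step_const q * t\<^sup>2"
    proof -
      have "u powr q \<le> 1 + q * t * u powr (q - 1)" using B[of q] q by simp
      also have "\<dots> = 1 + q * t + q * (t * (u powr (q - 1) - 1))" by (simp add: algebra_simps)
      also have "q * (t * (u powr (q - 1) - 1)) \<le> q * ((q - 1) * 2 powr q * t\<^sup>2)"
        using C q by (intro mult_left_mono) auto
      also have "\<dots> \<le> q * (q * 2 powr q * t\<^sup>2)" using q by (intro mult_left_mono mult_right_mono) auto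
      finally show ?thesis by (simp add: step_const_def algebra_simps)
    qed
    have "\<bar>a + b\<bar> powr q = \<bar>a\<bar> powr q * u powr q"
    proof -
      have "a + b = a * u" by (simp add: b u_def distrib_left)
      then have "\<bar>a + b\<bar> = \<bar>a\<bar> * u" using u by (simp add: abs_mult)
      then show ?thesis using u by (simp add: powr_mult)
    qed
    also have "\<dots> \<le> \<bar>a\<bar> powr q * (1 + q * t + step_const q * t\<^sup>2)"
      using D by (intro mult_left_mono) auto
    also have "\<bar>a\<bar> powr q * t = sgn_powr (q - 1) a * b"
      using a by (simp add: sgn_powr_def powr_diff t_def sgn_if)
    then have "\<bar>a\<bar> powr q * (1 + q * t + step_const q * t\<^sup>2)
      = \<bar>a\<bar> powr q + q * sgn_powr (q - 1) a * b + step_const q * (\<bar>a\<bar> powr q * t\<^sup>2)"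
      by (simp add: algebra_simps)
    also have "\<bar>a\<bar> powr q * t\<^sup>2 = \<bar>a\<bar> powr (q - 2) * b\<^sup>2"
      using a by (simp add: powr_diff b power_mult_distrib)
    also have "step_const q * (\<bar>a\<bar> powr (q - 2) * b\<^sup>2) \<le> step_const q * (\<bar>a\<bar> powr (q - 2) * b\<^sup>2 + \<bar>b\<bar> powr q)"
      by (intro mult_left_mono) (auto simp: step_const_def)
    finally show ?thesis by simp
  qed
qed

lemma mult_powr_le_max:
  fixes u v q :: real
  assumes "u \<ge> 0" "v \<ge> 0" "q \<ge> s" "s \<ge> 0"
  shows "u powr (q - s) * v powr s \<le> u powr q + v powr q"
proof -
  define m where "m = max u v"
  show ?thesis
  proof (cases "m = 0")
    case True then show ?thesis using assms by (auto simp: m_def max_def split: if_splits)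
  next
    case False
    have "u powr (q - s) * v powr s \<le> m powr (q - s) * m powr s"
      using assms by (intro mult_mono powr_mono2) (auto simp: m_def)
    also have "\<dots> = m powr q" using False by (simp add: powr_diff)
    also have "\<dots> \<le> u powr q + v powr q" by (auto simp: m_def max_def)
    finally show ?thesis .
  qed
qed

text \<open>Lets variance proxies that vanish be handled by adding \<open>e\<close> to them.\<close>

lemma le_powr_limit:
  fixes E X r :: real
  assumes "\<And>e. e > 0 \<Longrightarrow> E \<le> (X + e) powr r" "X \<ge> 0" "r > 0"
  shows "E \<le> X powr r"
proof -
  have "((\<lambda>e. (X + e) powr r) \<longlongrightarrow> (X + 0) powr r) (at_right 0)"
    using assms by (intro tendsto_powr2 tendsto_intros eventually_at_rightI[of 0 1]) auto
  moreover have "eventually (\<lambda>e. E \<le> (X + e) powr r) (at_right 0)"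
    using assms(1) by (intro eventually_at_rightI[of 0 1]) auto
  ultimately have "E \<le> (X + 0) powr r" by (rule tendsto_lowerbound) auto
  then show ?thesis by simp
qed

section \<open>Moments of sums of orthogonal increments\<close>

lemma integrable_abs_powr_add:
  fixes S b :: "'a \<Rightarrow> real"
  assumes "q \<ge> 0" "S \<in> borel_measurable M" "b \<in> borel_measurable M"
    "integrable M (\<lambda>\<omega>. \<bar>S \<omega>\<bar> powr q)" "integrable M (\<lambda>\<omega>. \<bar>b \<omega>\<bar> powr q)"
  shows "integrable M (\<lambda>\<omega>. \<bar>S \<omega> + b \<omega>\<bar> powr q)"
proof (rule Bochner_Integration.integrable_bound)
  show "integrable M (\<lambda>\<omega>. 2 powr q * (\<bar>S \<omega>\<bar> powr q + \<bar>b \<omega>\<bar> powr q))"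
    using assms by auto
  show "(\<lambda>\<omega>. \<bar>S \<omega> + b \<omega>\<bar> powr q) \<in> borel_measurable M" using assms by measurable
  show "AE x in M. norm (\<bar>S x + b x\<bar> powr q) \<le> norm (2 powr q * (\<bar>S x\<bar> powr q + \<bar>b x\<bar> powr q))"
    using powr_add_upper[OF assms(1)] by (auto intro!: always_eventually)
qed

text \<open>With \<open>r = q/2\<close>, the Taylor estimate and Young's inequality bound the new moment by
  \<open>A powr r\<close> plus a multiple of \<open>A powr (r - 1) * B\<close> and of \<open>B powr r\<close>, and these are the lower bounds
  for \<open>(A + c * B) powr r\<close> from \<open>powr_add_lower\<close> and \<open>powr_superadd\<close>. The form of the conclusion
  is what makes the step iterate without a loss that depends on the number of summands.\<close>

lemma moment_step:
  fixes S b :: "'a \<Rightarrow> real" and q A B :: real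
  assumes q: "q \<ge> 2" and A: "A > 0" and B: "B > 0"
    and meas: "S \<in> borel_measurable M" "b \<in> borel_measurable M"
    and iS: "integrable M (\<lambda>\<omega>. \<bar>S \<omega>\<bar> powr q)" and ib: "integrable M (\<lambda>\<omega>. \<bar>b \<omega>\<bar> powr q)"
    and S: "(\<integral>\<omega>. \<bar>S \<omega>\<bar> powr q \<partial>M) \<le> A powr (q/2)"
    and b: "(\<integral>\<omega>. \<bar>b \<omega>\<bar> powr q \<partial>M) \<le> B powr (q/2)"
    and orth: "(\<integral>\<omega>. sgn_powr (q - 1) (S \<omega>) * b \<omega> \<partial>M) = 0"
  shows "(\<integral>\<omega>. \<bar>S \<omega> + b \<omega>\<bar> powr q \<partial>M) \<le> (A + 4 * step_const q * B) powr (q/2)"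
proof -
  define r where "r = q/2"
  have r: "r \<ge> 1" "q = 2 * r" using q by (auto simp: r_def)
  define c where "c = step_const q"
  have c: "c \<ge> 1"
  proof -
    have "1 * 1 * 1 \<le> q * q * 2 powr q" using q by (intro mult_mono) (auto simp: ge_one_powr_ge_zero)
    then show ?thesis by (simp add: c_def step_const_def)
  qed
  have young: "\<bar>S \<omega>\<bar> powr (q - 2) * (b \<omega>)\<^sup>2
      \<le> A powr (r - 1) * B * (\<bar>S \<omega>\<bar> powr q / A powr r + \<bar>b \<omega>\<bar> powr q / B powr r)" for \<omega>
  proof -
    have "(\<bar>S \<omega>\<bar> / sqrt A) powr (q - 2) * (\<bar>b \<omega>\<bar> / sqrt B) powr 2
       \<le> (\<bar>S \<omega>\<bar> / sqrt A) powr q + (\<bar>b \<omega>\<bar> / sqrt B) powr q"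
      using q A B by (intro mult_powr_le_max) auto
    also have "(\<bar>S \<omega>\<bar> / sqrt A) powr q = \<bar>S \<omega>\<bar> powr q / A powr r"
      using A by (simp add: powr_divide powr_half_sqrt[symmetric] powr_powr r)
    also have "(\<bar>b \<omega>\<bar> / sqrt B) powr q = \<bar>b \<omega>\<bar> powr q / B powr r"
      using B by (simp add: powr_divide powr_half_sqrt[symmetric] powr_powr r)
    also have "(\<bar>S \<omega>\<bar> / sqrt A) powr (q - 2) = \<bar>S \<omega>\<bar> powr (q - 2) / A powr (r - 1)"
      using A by (simp add: powr_divide powr_half_sqrt[symmetric] powr_powr r(2) diff_divide_distrib)
    also have "(\<bar>b \<omega>\<bar> / sqrt B) powr 2 = (b \<omega>)\<^sup>2 / B"
      using B by (auto simp: powr_divide power2_eq_square powr_numeral)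
    finally have *: "\<bar>S \<omega>\<bar> powr (q - 2) / A powr (r - 1) * ((b \<omega>)\<^sup>2 / B) \<le> \<bar>S \<omega>\<bar> powr q / A powr r + \<bar>b \<omega>\<bar> powr q / B powr r" .
    have "\<bar>S \<omega>\<bar> powr (q - 2) * (b \<omega>)\<^sup>2 = A powr (r - 1) * B * (\<bar>S \<omega>\<bar> powr (q - 2) / A powr (r - 1) * ((b \<omega>)\<^sup>2 / B))"
      using A B by simp
    also have "\<dots> \<le> A powr (r - 1) * B * (\<bar>S \<omega>\<bar> powr q / A powr r + \<bar>b \<omega>\<bar> powr q / B powr r)"
      using * A B by (intro mult_left_mono) auto
    finally show ?thesis .
  qed
  have iorth: "integrable M (\<lambda>\<omega>. sgn_powr (q - 1) (S \<omega>) * b \<omega>)"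
  proof (rule Bochner_Integration.integrable_bound)
    show "integrable M (\<lambda>\<omega>. \<bar>S \<omega>\<bar> powr q + \<bar>b \<omega>\<bar> powr q)" using iS ib by auto
    show "(\<lambda>\<omega>. sgn_powr (q - 1) (S \<omega>) * b \<omega>) \<in> borel_measurable M"
      using meas unfolding sgn_powr_def by measurable
    have "\<bar>sgn_powr (q - 1) (S x) * b x\<bar> \<le> \<bar>S x\<bar> powr q + \<bar>b x\<bar> powr q" for x
    proof -
      have "\<bar>sgn_powr (q - 1) (S x) * b x\<bar> \<le> \<bar>S x\<bar> powr (q - 1) * \<bar>b x\<bar> powr 1"
        by (auto simp: sgn_powr_def abs_mult sgn_if)
      also have "\<dots> \<le> \<bar>S x\<bar> powr q + \<bar>b x\<bar> powr q" using q by (intro mult_powr_le_max) auto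
      finally show ?thesis .
    qed
    then show "AE x in M. norm (sgn_powr (q - 1) (S x) * b x) \<le> norm (\<bar>S x\<bar> powr q + \<bar>b x\<bar> powr q)"
      by (intro always_eventually) (auto simp: order.trans[OF _ abs_ge_self])
  qed
  define D where "D = A powr (r - 1) * B"
  have D: "D \<ge> 0" using B by (simp add: D_def)
  let ?g = "\<lambda>\<omega>. \<bar>S \<omega>\<bar> powr q + q * (sgn_powr (q - 1) (S \<omega>) * b \<omega>)
           + c * (D * (\<bar>S \<omega>\<bar> powr q / A powr r + \<bar>b \<omega>\<bar> powr q / B powr r) + \<bar>b \<omega>\<bar> powr q)"
  have "(\<integral>\<omega>. \<bar>S \<omega> + b \<omega>\<bar> powr q \<partial>M) \<le> (\<integral>\<omega>. ?g \<omega> \<partial>M)"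
  proof (rule integral_mono)
    show "integrable M (\<lambda>\<omega>. \<bar>S \<omega> + b \<omega>\<bar> powr q)"
      using q meas iS ib by (intro integrable_abs_powr_add) auto
    show "integrable M ?g" using iS ib iorth by auto
    fix \<omega>
    have "\<bar>S \<omega> + b \<omega>\<bar> powr q \<le> \<bar>S \<omega>\<bar> powr q + q * (sgn_powr (q - 1) (S \<omega>) * b \<omega>)
           + c * (\<bar>S \<omega>\<bar> powr (q - 2) * (b \<omega>)\<^sup>2 + \<bar>b \<omega>\<bar> powr q)"
      using powr_taylor2[OF q, of "S \<omega>" "b \<omega>"] by (simp add: c_def mult.assoc)
    also have "\<dots> \<le> ?g \<omega>" using young[of \<omega>] c D_def
      by (intro add_mono[OF order_refl] mult_left_mono add_mono[OF _ order_refl]) auto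
    finally show "\<bar>S \<omega> + b \<omega>\<bar> powr q \<le> ?g \<omega>" .
  qed
  also have "\<dots> = (\<integral>\<omega>. \<bar>S \<omega>\<bar> powr q \<partial>M) + q * 0
      + c * (D * ((\<integral>\<omega>. \<bar>S \<omega>\<bar> powr q \<partial>M) / A powr r + (\<integral>\<omega>. \<bar>b \<omega>\<bar> powr q \<partial>M) / B powr r)
         + (\<integral>\<omega>. \<bar>b \<omega>\<bar> powr q \<partial>M))"
    using iS ib iorth orth by simp
  also have "\<dots> \<le> A powr r + q * 0 + c * (D * (1 + 1) + B powr r)"
    using S b c D A B q
    by (intro add_mono mult_left_mono) (auto simp: r_def)
  also have "\<dots> \<le> (A + 4 * c * B) powr r"
  proof -
    have 1: "A powr r + r * A powr (r - 1) * (4 * c * B) \<le> (A + 4 * c * B) powr r"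
      using A B c r by (intro powr_add_lower) auto
    have 2: "A powr r + (4 * c * B) powr r \<le> (A + 4 * c * B) powr r"
      using A B c r by (intro powr_superadd) auto
    have "4 * c * B powr r \<le> (4 * c) powr r * B powr r"
    proof (rule mult_right_mono)
      have "(4 * c) powr 1 \<le> (4 * c) powr r" using r c by (intro powr_mono) auto
      then show "4 * c \<le> (4 * c) powr r" using c by simp
    qed auto
    also have "\<dots> = (4 * c * B) powr r" by (simp add: powr_mult)
    finally have 3: "4 * c * B powr r \<le> (4 * c * B) powr r" .
    have 4: "4 * (c * D) \<le> r * A powr (r - 1) * (4 * c * B)"
    proof -
      have "1 * (4 * (c * D)) \<le> r * (4 * (c * D))" using r c D by (intro mult_right_mono) auto
      then show ?thesis by (simp add: D_def ac_simps)
    qed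
    have 5: "c * (D * (1 + 1) + B powr r) = 2 * (c * D) + c * B powr r" by (simp add: algebra_simps)
    have 6: "c * B powr r \<ge> 0" using c by auto
    show ?thesis using 1 2 3 4 6 unfolding 5 by (simp add: mult.assoc)
  qed
  finally show ?thesis by (simp add: c_def r_def)
qed

text \<open>The proxies are shifted by \<open>e\<close> because \<open>moment_step\<close> needs them positive.\<close>

lemma moment_sum_aux:
  fixes b :: "nat \<Rightarrow> 'a \<Rightarrow> real" and q e :: real and B :: "nat \<Rightarrow> real"
  assumes q: "q \<ge> 2" and e: "e > 0"
    and B: "\<And>i. i < N \<Longrightarrow> B i \<ge> 0"
    and meas: "\<And>i. i < N \<Longrightarrow> b i \<in> borel_measurable M"
    and ib: "\<And>i. i < N \<Longrightarrow> integrable M (\<lambda>\<omega>. \<bar>b i \<omega>\<bar> powr q)"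
    and b: "\<And>i. i < N \<Longrightarrow> (\<integral>\<omega>. \<bar>b i \<omega>\<bar> powr q \<partial>M) \<le> B i powr (q/2)"
    and orth: "\<And>i. i < N \<Longrightarrow> (\<integral>\<omega>. sgn_powr (q - 1) (\<Sum>l<i. b l \<omega>) * b i \<omega> \<partial>M) = 0"
  shows "integrable M (\<lambda>\<omega>. \<bar>\<Sum>i<N. b i \<omega>\<bar> powr q) \<and>
    (\<integral>\<omega>. \<bar>\<Sum>i<N. b i \<omega>\<bar> powr q \<partial>M) \<le> (e + (\<Sum>i<N. 4 * step_const q * (B i + e))) powr (q/2)"
  using B meas ib b orth
proof (induction N)
  case 0
  then show ?case using e by simp
next
  case (Suc N)
  have IH: "integrable M (\<lambda>\<omega>. \<bar>\<Sum>i<N. b i \<omega>\<bar> powr q)"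
    "(\<integral>\<omega>. \<bar>\<Sum>i<N. b i \<omega>\<bar> powr q \<partial>M) \<le> (e + (\<Sum>i<N. 4 * step_const q * (B i + e))) powr (q/2)"
    using Suc.IH Suc.prems by auto
  have m: "(\<lambda>\<omega>. \<Sum>i<N. b i \<omega>) \<in> borel_measurable M" "b N \<in> borel_measurable M"
    using Suc.prems(2) by (auto intro!: borel_measurable_sum)
  have "0 \<le> (\<Sum>i<N. 4 * step_const q * (B i + e))"
    using Suc.prems(1) e by (intro sum_nonneg) (auto simp: step_const_def)
  then have A: "e + (\<Sum>i<N. 4 * step_const q * (B i + e)) > 0" using e by linarith
  have BN: "B N + e > 0" "B N \<ge> 0" using Suc.prems(1)[of N] e by auto
  have "(\<integral>\<omega>. \<bar>b N \<omega>\<bar> powr q \<partial>M) \<le> (B N + e) powr (q/2)"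
    using Suc.prems(4)[of N] powr_mono2[of "q/2" "B N" "B N + e"] q e BN by auto
  from moment_step[OF q A BN(1) m IH(1) _ IH(2) this] Suc.prems(3)[of N] Suc.prems(5)[of N]
  have "(\<integral>\<omega>. \<bar>(\<Sum>i<N. b i \<omega>) + b N \<omega>\<bar> powr q \<partial>M)
    \<le> (e + (\<Sum>i<N. 4 * step_const q * (B i + e)) + 4 * step_const q * (B N + e)) powr (q/2)" by simp
  moreover have "integrable M (\<lambda>\<omega>. \<bar>(\<Sum>i<N. b i \<omega>) + b N \<omega>\<bar> powr q)"
    using q m IH(1) Suc.prems(3)[of N] by (intro integrable_abs_powr_add) auto
  ultimately show ?case by (simp add: add.assoc)
qed

text \<open>An inequality of Burkholder or Rosenthal type, in the weak form that suffices here: the increments need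
  only be orthogonal to \<open>sgn_powr (q - 1)\<close> of the partial sums, and proxies \<open>B i\<close> for their squared
  \<open>q\<close>-norms add up.\<close>

lemma moment_sum:
  fixes b :: "nat \<Rightarrow> 'a \<Rightarrow> real" and q :: real and B :: "nat \<Rightarrow> real"
  assumes q: "q \<ge> 2"
    and B: "\<And>i. i < N \<Longrightarrow> B i \<ge> 0"
    and meas: "\<And>i. i < N \<Longrightarrow> b i \<in> borel_measurable M"
    and ib: "\<And>i. i < N \<Longrightarrow> integrable M (\<lambda>\<omega>. \<bar>b i \<omega>\<bar> powr q)"
    and b: "\<And>i. i < N \<Longrightarrow> (\<integral>\<omega>. \<bar>b i \<omega>\<bar> powr q \<partial>M) \<le> B i powr (q/2)"
    and orth: "\<And>i. i < N \<Longrightarrow> (\<integral>\<omega>. sgn_powr (q - 1) (\<Sum>l<i. b l \<omega>) * b i \<omega> \<partial>M) = 0"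
  shows "integrable M (\<lambda>\<omega>. \<bar>\<Sum>i<N. b i \<omega>\<bar> powr q)"
    and "(\<integral>\<omega>. \<bar>\<Sum>i<N. b i \<omega>\<bar> powr q \<partial>M) \<le> (4 * step_const q * (\<Sum>i<N. B i)) powr (q/2)"
proof -
  have aux: "integrable M (\<lambda>\<omega>. \<bar>\<Sum>i<N. b i \<omega>\<bar> powr q) \<and>
    (\<integral>\<omega>. \<bar>\<Sum>i<N. b i \<omega>\<bar> powr q \<partial>M) \<le> (e + (\<Sum>i<N. 4 * step_const q * (B i + e))) powr (q/2)"
    if "e > 0" for e
    by (rule moment_sum_aux[OF q that B meas ib b orth])
  show "integrable M (\<lambda>\<omega>. \<bar>\<Sum>i<N. b i \<omega>\<bar> powr q)" using aux[of 1] by auto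
  have c: "step_const q \<ge> 0" by (simp add: step_const_def)
  show "(\<integral>\<omega>. \<bar>\<Sum>i<N. b i \<omega>\<bar> powr q \<partial>M) \<le> (4 * step_const q * (\<Sum>i<N. B i)) powr (q/2)"
  proof (rule le_powr_limit)
    fix e :: real assume e: "e > 0"
    define d where "d = e / (1 + 4 * step_const q * real N)"
    have den: "1 + 4 * step_const q * real N > 0" using c by (intro add_pos_nonneg mult_nonneg_nonneg) auto
    then have d: "d > 0" using e by (simp add: d_def)
    have "d + (\<Sum>i<N. 4 * step_const q * (B i + d)) = 4 * step_const q * (\<Sum>i<N. B i) + d * (1 + 4 * step_const q * real N)"
    proof -
      have "(\<Sum>i<N. 4 * step_const q * (B i + d)) = 4 * step_const q * ((\<Sum>i<N. B i) + real N * d)"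
        by (simp only: sum_distrib_left[symmetric] sum.distrib sum_constant card_lessThan)
      then show ?thesis by (simp add: algebra_simps)
    qed
    also have "d * (1 + 4 * step_const q * real N) = e" using den by (simp add: d_def)
    finally show "(\<integral>\<omega>. \<bar>\<Sum>i<N. b i \<omega>\<bar> powr q \<partial>M) \<le> (4 * step_const q * (\<Sum>i<N. B i) + e) powr (q/2)"
      using aux[OF d] by auto
  qed (use q c B in \<open>auto intro!: mult_nonneg_nonneg sum_nonneg\<close>)
qed

section \<open>Moments of linear and quadratic forms\<close>

text \<open>A function of the variables before \<open>i\<close> is independent of the variable \<open>i\<close>.\<close>

lemma (in prob_space) expect_past_mult:
  fixes z :: "nat \<Rightarrow> 'a \<Rightarrow> real"
  assumes ind: "indep_vars (\<lambda>_. borel) z {..<N}" and i: "i < N"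
    and f: "f \<in> borel_measurable (PiM {..<i} (\<lambda>_. borel))" and g: "g \<in> borel_measurable borel"
    and F: "\<And>\<omega>. F \<omega> = f (\<lambda>l\<in>{..<i}. z l \<omega>)"
    and iF: "integrable M F" and ig: "integrable M (\<lambda>\<omega>. g (z i \<omega>) :: real)"
  shows "integrable M (\<lambda>\<omega>. F \<omega> * g (z i \<omega>))"
    and "(\<integral>\<omega>. F \<omega> * g (z i \<omega>) \<partial>M) = (\<integral>\<omega>. F \<omega> \<partial>M) * (\<integral>\<omega>. g (z i \<omega>) \<partial>M)"
proof -
  have "indep_var (PiM {..<i} (\<lambda>_. borel)) (\<lambda>\<omega>. restrict (\<lambda>l. z l \<omega>) {..<i})
     (PiM {i} (\<lambda>_. borel)) (\<lambda>\<omega>. restrict (\<lambda>l. z l \<omega>) {i})"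
    using ind i by (intro indep_var_restrict[OF ind]) auto
  then have "indep_var borel (f \<circ> (\<lambda>\<omega>. restrict (\<lambda>l. z l \<omega>) {..<i}))
     borel ((\<lambda>u. g (u i)) \<circ> (\<lambda>\<omega>. restrict (\<lambda>l. z l \<omega>) {i}))"
    by (rule indep_var_compose) (use f g in measurable)
  then have "indep_var borel F borel (\<lambda>\<omega>. g (z i \<omega>))"
    by (simp add: comp_def F[abs_def])
  from indep_var_lebesgue_integral[OF this iF ig] indep_var_integrable[OF this iF ig]
  show "integrable M (\<lambda>\<omega>. F \<omega> * g (z i \<omega>))"
    "(\<integral>\<omega>. F \<omega> * g (z i \<omega>) \<partial>M) = (\<integral>\<omega>. F \<omega> \<partial>M) * (\<integral>\<omega>. g (z i \<omega>) \<partial>M)" by auto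
qed

lemma powr_le_one_plus:
  fixes x s t :: real
  assumes "0 \<le> s" "s \<le> t" "x \<ge> 0"
  shows "x powr s \<le> 1 + x powr t"
proof (cases "x \<le> 1")
  case True
  have "x powr s \<le> 1 powr s" using True assms by (intro powr_mono2) auto
  then show ?thesis by (simp add: add_increasing2)
next
  case False
  have "x powr s \<le> x powr t" using False assms by (intro powr_mono) auto
  then show ?thesis by simp
qed

lemma (in prob_space) lower_moment:
  fixes Z :: "'a \<Rightarrow> real"
  assumes Z: "Z \<in> borel_measurable M" and st: "0 \<le> s" "s \<le> t"
    and i: "integrable M (\<lambda>\<omega>. \<bar>Z \<omega>\<bar> powr t)" and K: "(\<integral>\<omega>. \<bar>Z \<omega>\<bar> powr t \<partial>M) \<le> K"
  shows "integrable M (\<lambda>\<omega>. \<bar>Z \<omega>\<bar> powr s)" "(\<integral>\<omega>. \<bar>Z \<omega>\<bar> powr s \<partial>M) \<le> 1 + K"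
proof -
  show 1: "integrable M (\<lambda>\<omega>. \<bar>Z \<omega>\<bar> powr s)"
  proof (rule Bochner_Integration.integrable_bound)
    show "integrable M (\<lambda>\<omega>. 1 + \<bar>Z \<omega>\<bar> powr t)" using i by auto
    show "(\<lambda>\<omega>. \<bar>Z \<omega>\<bar> powr s) \<in> borel_measurable M" using Z by measurable
  qed (use powr_le_one_plus[OF st] in \<open>auto intro!: always_eventually\<close>)
  have "(\<integral>\<omega>. \<bar>Z \<omega>\<bar> powr s \<partial>M) \<le> (\<integral>\<omega>. 1 + \<bar>Z \<omega>\<bar> powr t \<partial>M)"
    using 1 i powr_le_one_plus[OF st] by (intro integral_mono) auto
  also have "\<dots> = 1 + (\<integral>\<omega>. \<bar>Z \<omega>\<bar> powr t \<partial>M)" using i by (simp add: prob_space)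
  finally show "(\<integral>\<omega>. \<bar>Z \<omega>\<bar> powr s \<partial>M) \<le> 1 + K" using K by simp
qed

lemma integrable_abs_powr_sum:
  fixes b :: "nat \<Rightarrow> 'a \<Rightarrow> real"
  assumes "q \<ge> 0" "\<And>i. i < N \<Longrightarrow> b i \<in> borel_measurable M"
    "\<And>i. i < N \<Longrightarrow> integrable M (\<lambda>\<omega>. \<bar>b i \<omega>\<bar> powr q)"
  shows "integrable M (\<lambda>\<omega>. \<bar>\<Sum>i<N. b i \<omega>\<bar> powr q)"
  using assms
proof (induction N)
  case (Suc N)
  then have "integrable M (\<lambda>\<omega>. \<bar>(\<Sum>i<N. b i \<omega>) + b N \<omega>\<bar> powr q)"
    by (intro integrable_abs_powr_add) (auto intro!: borel_measurable_sum)
  then show ?case by simp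
qed simp

lemma (in prob_space) integrable_sgn_powr_mult:
  fixes S w :: "'a \<Rightarrow> real"
  assumes q: "q \<ge> 1" and m: "S \<in> borel_measurable M" "w \<in> borel_measurable M"
    and i: "integrable M (\<lambda>\<omega>. \<bar>S \<omega>\<bar> powr q)" "integrable M (\<lambda>\<omega>. \<bar>w \<omega>\<bar> powr q)"
  shows "integrable M (\<lambda>\<omega>. sgn_powr (q - 1) (S \<omega>) * w \<omega>)"
proof (rule Bochner_Integration.integrable_bound)
  show "integrable M (\<lambda>\<omega>. \<bar>S \<omega>\<bar> powr q + \<bar>w \<omega>\<bar> powr q)" using i by auto
  show "(\<lambda>\<omega>. sgn_powr (q - 1) (S \<omega>) * w \<omega>) \<in> borel_measurable M"
    using m unfolding sgn_powr_def by measurable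
  have "\<bar>sgn_powr (q - 1) (S x) * w x\<bar> \<le> \<bar>S x\<bar> powr q + \<bar>w x\<bar> powr q" for x
  proof -
    have "\<bar>sgn_powr (q - 1) (S x) * w x\<bar> \<le> \<bar>S x\<bar> powr (q - 1) * \<bar>w x\<bar> powr 1"
      by (auto simp: sgn_powr_def abs_mult sgn_if)
    also have "\<dots> \<le> \<bar>S x\<bar> powr q + \<bar>w x\<bar> powr q" using q by (intro mult_powr_le_max) auto
    finally show ?thesis .
  qed
  then show "AE x in M. norm (sgn_powr (q - 1) (S x) * w x) \<le> norm (\<bar>S x\<bar> powr q + \<bar>w x\<bar> powr q)"
    by (intro always_eventually) (auto simp: order.trans[OF _ abs_ge_self])
qed

lemma abs_powr_eq_sq_powr: "q > 0 \<Longrightarrow> \<bar>x\<bar> powr q = (x\<^sup>2) powr (q/2)" for x q :: real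
proof -
  assume "q > 0"
  have "x\<^sup>2 = \<bar>x\<bar> powr 2" by (simp add: powr_numeral)
  then have "(x\<^sup>2) powr (q/2) = (\<bar>x\<bar> powr 2) powr (q/2)" by simp
  also have "\<dots> = \<bar>x\<bar> powr q" by (simp only: powr_powr) simp
  finally show ?thesis by simp
qed

definition lin_const :: "real \<Rightarrow> real \<Rightarrow> real" where
  "lin_const q K = 4 * step_const q * (1 + K)"

text \<open>The summands are independent and centred, so each one is orthogonal to every function of the earlier
  ones and \<open>moment_sum\<close> applies with \<open>B i\<close> a multiple of \<open>(a i)\<^sup>2\<close>.\<close>

lemma (in prob_space) linear_form_moment:
  fixes z :: "nat \<Rightarrow> 'a \<Rightarrow> real"
  assumes q: "q \<ge> 2" and K: "K \<ge> 0"
    and ind: "indep_vars (\<lambda>_. borel) z {..<N}"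
    and mean: "\<And>i. i < N \<Longrightarrow> (\<integral>\<omega>. z i \<omega> \<partial>M) = 0"
    and int: "\<And>i. i < N \<Longrightarrow> integrable M (\<lambda>\<omega>. \<bar>z i \<omega>\<bar> powr q)"
    and mom: "\<And>i. i < N \<Longrightarrow> (\<integral>\<omega>. \<bar>z i \<omega>\<bar> powr q \<partial>M) \<le> K"
  shows "integrable M (\<lambda>\<omega>. \<bar>\<Sum>i<N. a i * z i \<omega>\<bar> powr q)"
    and "(\<integral>\<omega>. \<bar>\<Sum>i<N. a i * z i \<omega>\<bar> powr q \<partial>M) \<le> (lin_const q K * (\<Sum>i<N. (a i)\<^sup>2)) powr (q/2)"
proof -
  have zm[measurable]: "z i \<in> borel_measurable M" if "i < N" for i
    using ind that by (auto simp: indep_vars_def)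
  have bi: "integrable M (\<lambda>\<omega>. \<bar>a i * z i \<omega>\<bar> powr q)" if "i < N" for i
    using int[OF that] by (simp add: abs_mult powr_mult)
  have bm: "(\<integral>\<omega>. \<bar>a i * z i \<omega>\<bar> powr q \<partial>M) \<le> ((1 + K) * (a i)\<^sup>2) powr (q/2)" if "i < N" for i
  proof -
    have "(\<integral>\<omega>. \<bar>a i * z i \<omega>\<bar> powr q \<partial>M) = \<bar>a i\<bar> powr q * (\<integral>\<omega>. \<bar>z i \<omega>\<bar> powr q \<partial>M)"
      by (simp add: abs_mult powr_mult)
    also have "\<dots> \<le> \<bar>a i\<bar> powr q * (1 + K) powr (q/2)"
    proof (rule mult_left_mono)
      have "(1 + K) powr 1 \<le> (1 + K) powr (q/2)" using K q by (intro powr_mono) auto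
      then show "(\<integral>\<omega>. \<bar>z i \<omega>\<bar> powr q \<partial>M) \<le> (1 + K) powr (q/2)" using mom[OF that] K by simp
    qed auto
    also have "\<bar>a i\<bar> powr q = ((a i)\<^sup>2) powr (q/2)" using q by (intro abs_powr_eq_sq_powr) auto
    finally show ?thesis by (simp add: powr_mult mult.commute)
  qed
  have S: "integrable M (\<lambda>\<omega>. \<bar>\<Sum>l<i. a l * z l \<omega>\<bar> powr q)" if "i < N" for i
    using q bi that by (intro integrable_abs_powr_sum) auto
  have orth: "(\<integral>\<omega>. sgn_powr (q - 1) (\<Sum>l<i. a l * z l \<omega>) * (a i * z i \<omega>) \<partial>M) = 0" if i: "i < N" for i
  proof -
    have iz: "integrable M (z i)"
    proof -
      have "integrable M (\<lambda>\<omega>. \<bar>z i \<omega>\<bar> powr 1)"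
        using lower_moment(1)[OF zm[OF i] _ _ int[OF i] mom[OF i], of 1] q by simp
      then show ?thesis using zm[OF i] by (auto intro: integrable_abs_cancel)
    qed
    have "(\<integral>\<omega>. sgn_powr (q - 1) (\<Sum>l<i. a l * z l \<omega>) * (\<lambda>x. a i * x) (z i \<omega>) \<partial>M) =
        (\<integral>\<omega>. sgn_powr (q - 1) (\<Sum>l<i. a l * z l \<omega>) \<partial>M) * (\<integral>\<omega>. (\<lambda>x. a i * x) (z i \<omega>) \<partial>M)"
    proof (rule expect_past_mult(2)[OF ind i, where f = "\<lambda>u. sgn_powr (q - 1) (\<Sum>l<i. a l * u l)"])
      show "(\<lambda>u. sgn_powr (q - 1) (\<Sum>l<i. a l * u l)) \<in> borel_measurable (Pi\<^sub>M {..<i} (\<lambda>_. borel))"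
        unfolding sgn_powr_def by measurable
      have "integrable M (\<lambda>\<omega>. sgn_powr (q - 1) (\<Sum>l<i. a l * z l \<omega>) * 1)"
        using q S[OF i] i by (intro integrable_sgn_powr_mult) auto
      then show "integrable M (\<lambda>\<omega>. sgn_powr (q - 1) (\<Sum>l<i. a l * z l \<omega>))" by simp
    qed (use iz in auto)
    also have "\<dots> = 0" using mean[OF i] by simp
    finally show ?thesis by simp
  qed
  have B: "(1 + K) * (a i)\<^sup>2 \<ge> 0" for i using K by simp
  have bmeas: "(\<lambda>\<omega>. a i * z i \<omega>) \<in> borel_measurable M" if "i < N" for i using that by measurable
  show "integrable M (\<lambda>\<omega>. \<bar>\<Sum>i<N. a i * z i \<omega>\<bar> powr q)"
    by (rule moment_sum(1)[OF q B bmeas bi bm orth])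
  have "(\<integral>\<omega>. \<bar>\<Sum>i<N. a i * z i \<omega>\<bar> powr q \<partial>M) \<le> (4 * step_const q * (\<Sum>i<N. (1 + K) * (a i)\<^sup>2)) powr (q/2)"
    by (rule moment_sum(2)[OF q B bmeas bi bm orth])
  also have "4 * step_const q * (\<Sum>i<N. (1 + K) * (a i)\<^sup>2) = lin_const q K * (\<Sum>i<N. (a i)\<^sup>2)"
    by (simp only: lin_const_def sum_distrib_left[symmetric] mult.assoc)
  finally show "(\<integral>\<omega>. \<bar>\<Sum>i<N. a i * z i \<omega>\<bar> powr q \<partial>M) \<le> (lin_const q K * (\<Sum>i<N. (a i)\<^sup>2)) powr (q/2)" .
qed

definition quad_step_const :: "real \<Rightarrow> real \<Rightarrow> real" where
  "quad_step_const q K = 1 + 2 powr q * (2 powr q * (K + (1 + K) powr q) + (1 + K) * lin_const q (1 + K) powr (q/2))"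

text \<open>The increments \<open>b i\<close> are a diagonal part and the variable \<open>z i\<close> times a linear form in its
  predecessors. The latter has moments controlled by \<open>linear_form_moment\<close>, and both are
  orthogonal to functions of the past, so \<open>moment_sum\<close> applies once more.\<close>

lemma (in prob_space) quadratic_form_moment_aux:
  fixes z :: "nat \<Rightarrow> 'a \<Rightarrow> real" and D :: "nat \<Rightarrow> real" and A :: "nat \<Rightarrow> nat \<Rightarrow> real"
  assumes q: "q \<ge> 2" and K: "K \<ge> 0"
    and ind: "indep_vars (\<lambda>_. borel) z {..<N}"
    and mean: "\<And>i. i < N \<Longrightarrow> (\<integral>\<omega>. z i \<omega> \<partial>M) = 0"
    and int: "\<And>i. i < N \<Longrightarrow> integrable M (\<lambda>\<omega>. \<bar>z i \<omega>\<bar> powr (2 * q))"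
    and mom: "\<And>i. i < N \<Longrightarrow> (\<integral>\<omega>. \<bar>z i \<omega>\<bar> powr (2 * q) \<partial>M) \<le> K"
  defines "v \<equiv> \<lambda>i. (\<integral>\<omega>. (z i \<omega>)\<^sup>2 \<partial>M)"
  defines "b \<equiv> \<lambda>i \<omega>. D i * ((z i \<omega>)\<^sup>2 - v i) + (\<Sum>m<i. A i m * z m \<omega>) * z i \<omega>"
  shows "integrable M (\<lambda>\<omega>. \<bar>\<Sum>i<N. b i \<omega>\<bar> powr q)"
    and "(\<integral>\<omega>. \<bar>\<Sum>i<N. b i \<omega>\<bar> powr q \<partial>M)
      \<le> (4 * step_const q * quad_step_const q K * (\<Sum>i<N. (D i)\<^sup>2 + (\<Sum>m<i. (A i m)\<^sup>2))) powr (q/2)"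
proof -
  have zm[measurable]: "z i \<in> borel_measurable M" if "i < N" for i
    using ind that by (auto simp: indep_vars_def)
  have zq: "integrable M (\<lambda>\<omega>. \<bar>z i \<omega>\<bar> powr q)" "(\<integral>\<omega>. \<bar>z i \<omega>\<bar> powr q \<partial>M) \<le> 1 + K" if "i < N" for i
    using lower_moment[OF zm[OF that] _ _ int[OF that] mom[OF that], of q] q by auto
  have z2: "integrable M (\<lambda>\<omega>. (z i \<omega>)\<^sup>2)" "v i \<le> 1 + K" "v i \<ge> 0" if "i < N" for i
  proof -
    have e: "\<bar>z i \<omega>\<bar> powr 2 = (z i \<omega>)\<^sup>2" for \<omega> by (simp add: powr_numeral)
    show "integrable M (\<lambda>\<omega>. (z i \<omega>)\<^sup>2)" "v i \<le> 1 + K"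
      using lower_moment[OF zm[OF that] _ _ int[OF that] mom[OF that], of 2] q by (auto simp: e v_def)
    show "v i \<ge> 0" by (simp add: v_def)
  qed
  have iz: "integrable M (z i)" if i: "i < N" for i
  proof -
    have "integrable M (\<lambda>\<omega>. \<bar>z i \<omega>\<bar> powr 1)"
      using lower_moment(1)[OF zm[OF i] _ _ int[OF i] mom[OF i], of 1] q by simp
    then show ?thesis using zm[OF i] by (auto intro: integrable_abs_cancel)
  qed
  define w where "w i \<omega> = (\<Sum>m<i. A i m * z m \<omega>)" for i \<omega>
  have wm[measurable]: "w i \<in> borel_measurable M" if "i < N" for i
    unfolding w_def using that by (intro borel_measurable_sum borel_measurable_times) (auto intro: zm)
  have w: "integrable M (\<lambda>\<omega>. \<bar>w i \<omega>\<bar> powr q)"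
     "(\<integral>\<omega>. \<bar>w i \<omega>\<bar> powr q \<partial>M) \<le> lin_const q (1 + K) powr (q/2) * (\<Sum>m<i. (A i m)\<^sup>2) powr (q/2)" if "i < N" for i
  proof -
    have ind': "indep_vars (\<lambda>_. borel) z {..<i}"
      using ind by (rule indep_vars_subset) (use that in auto)
    note L = linear_form_moment[OF q _ ind', of "1 + K" "A i"]
    show "integrable M (\<lambda>\<omega>. \<bar>w i \<omega>\<bar> powr q)"
      using L(1) K mean zq that unfolding w_def by auto
    have "(\<integral>\<omega>. \<bar>w i \<omega>\<bar> powr q \<partial>M) \<le> (lin_const q (1 + K) * (\<Sum>m<i. (A i m)\<^sup>2)) powr (q/2)"
      using L(2) K mean zq that unfolding w_def by auto
    then show "(\<integral>\<omega>. \<bar>w i \<omega>\<bar> powr q \<partial>M) \<le> lin_const q (1 + K) powr (q/2) * (\<Sum>m<i. (A i m)\<^sup>2) powr (q/2)"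
      by (simp add: powr_mult)
  qed
  have zz: "integrable M (\<lambda>\<omega>. \<bar>D i * ((z i \<omega>)\<^sup>2 - v i)\<bar> powr q)"
    "(\<integral>\<omega>. \<bar>D i * ((z i \<omega>)\<^sup>2 - v i)\<bar> powr q \<partial>M) \<le> ((D i)\<^sup>2) powr (q/2) * (2 powr q * (K + (1 + K) powr q))" if i: "i < N" for i
  proof -
    have e: "\<bar>(z i \<omega>)\<^sup>2\<bar> powr q = \<bar>z i \<omega>\<bar> powr (2 * q)" for \<omega>
      using abs_powr_eq_sq_powr[of "2 * q" "z i \<omega>"] q by simp
    have 1: "integrable M (\<lambda>\<omega>. \<bar>(z i \<omega>)\<^sup>2\<bar> powr q)" using int[OF i] by (simp only: e)
    have 2: "integrable M (\<lambda>\<omega>. \<bar>(z i \<omega>)\<^sup>2 + - v i\<bar> powr q)"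
      using q 1 i by (intro integrable_abs_powr_add) (auto simp: prob_space)
    have "(\<integral>\<omega>. \<bar>(z i \<omega>)\<^sup>2 + - v i\<bar> powr q \<partial>M) \<le> (\<integral>\<omega>. 2 powr q * (\<bar>(z i \<omega>)\<^sup>2\<bar> powr q + \<bar>- v i\<bar> powr q) \<partial>M)"
      using 1 2 q by (intro integral_mono powr_add_upper) auto
    also have "\<dots> = 2 powr q * ((\<integral>\<omega>. \<bar>z i \<omega>\<bar> powr (2*q) \<partial>M) + \<bar>v i\<bar> powr q)"
      using 1 by (simp add: prob_space e[simplified])
    also have "\<dots> \<le> 2 powr q * (K + (1 + K) powr q)"
      using mom[OF i] z2[OF i] q by (intro mult_left_mono add_mono powr_mono2) auto
    finally have 3: "(\<integral>\<omega>. \<bar>(z i \<omega>)\<^sup>2 - v i\<bar> powr q \<partial>M) \<le> 2 powr q * (K + (1 + K) powr q)" by simp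
    show "integrable M (\<lambda>\<omega>. \<bar>D i * ((z i \<omega>)\<^sup>2 - v i)\<bar> powr q)"
      using 2 by (simp add: abs_mult powr_mult)
    have "(\<integral>\<omega>. \<bar>D i * ((z i \<omega>)\<^sup>2 - v i)\<bar> powr q \<partial>M) = \<bar>D i\<bar> powr q * (\<integral>\<omega>. \<bar>(z i \<omega>)\<^sup>2 - v i\<bar> powr q \<partial>M)"
      by (simp add: abs_mult powr_mult)
    also have "\<dots> \<le> \<bar>D i\<bar> powr q * (2 powr q * (K + (1 + K) powr q))"
      using 3 by (intro mult_left_mono) auto
    finally show "(\<integral>\<omega>. \<bar>D i * ((z i \<omega>)\<^sup>2 - v i)\<bar> powr q \<partial>M) \<le> ((D i)\<^sup>2) powr (q/2) * (2 powr q * (K + (1 + K) powr q))"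
      using q by (simp add: abs_powr_eq_sq_powr)
  qed
  have wz: "integrable M (\<lambda>\<omega>. \<bar>w i \<omega> * z i \<omega>\<bar> powr q)"
    "(\<integral>\<omega>. \<bar>w i \<omega> * z i \<omega>\<bar> powr q \<partial>M) \<le> (\<Sum>m<i. (A i m)\<^sup>2) powr (q/2) * ((1 + K) * lin_const q (1 + K) powr (q/2))"
    if i: "i < N" for i
  proof -
    note E = expect_past_mult[OF ind i, where f = "\<lambda>u. \<bar>\<Sum>m<i. A i m * u m\<bar> powr q" and g = "\<lambda>x. \<bar>x\<bar> powr q"
        and F = "\<lambda>\<omega>. \<bar>w i \<omega>\<bar> powr q", OF _ _ _ w(1)[OF i] zq(1)[OF i]]
    have "integrable M (\<lambda>\<omega>. \<bar>w i \<omega>\<bar> powr q * \<bar>z i \<omega>\<bar> powr q)"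
      by (rule E(1)) (auto simp: w_def)
    then show "integrable M (\<lambda>\<omega>. \<bar>w i \<omega> * z i \<omega>\<bar> powr q)" by (simp add: abs_mult powr_mult)
    have "(\<integral>\<omega>. \<bar>w i \<omega>\<bar> powr q * \<bar>z i \<omega>\<bar> powr q \<partial>M) = (\<integral>\<omega>. \<bar>w i \<omega>\<bar> powr q \<partial>M) * (\<integral>\<omega>. \<bar>z i \<omega>\<bar> powr q \<partial>M)"
      by (rule E(2)) (auto simp: w_def)
    also have "\<dots> \<le> (lin_const q (1 + K) powr (q/2) * (\<Sum>m<i. (A i m)\<^sup>2) powr (q/2)) * (1 + K)"
      using w(2)[OF i] zq(2)[OF i] by (intro mult_mono) auto
    finally show "(\<integral>\<omega>. \<bar>w i \<omega> * z i \<omega>\<bar> powr q \<partial>M) \<le> (\<Sum>m<i. (A i m)\<^sup>2) powr (q/2) * ((1 + K) * lin_const q (1 + K) powr (q/2))"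
      by (simp add: abs_mult powr_mult ac_simps)
  qed
  have b_alt: "b i \<omega> = D i * ((z i \<omega>)\<^sup>2 - v i) + w i \<omega> * z i \<omega>" for i \<omega>
    by (simp add: b_def w_def)
  have bmeas[measurable]: "b i \<in> borel_measurable M" if "i < N" for i
    unfolding b_alt using that by measurable
  have bi: "integrable M (\<lambda>\<omega>. \<bar>b i \<omega>\<bar> powr q)" if i: "i < N" for i
    unfolding b_alt using q i zz(1)[OF i] wz(1)[OF i]
    by (intro integrable_abs_powr_add) auto
  define a where "a i = (D i)\<^sup>2 + (\<Sum>m<i. (A i m)\<^sup>2)" for i
  have a: "a i \<ge> 0" for i by (auto simp: a_def intro!: add_nonneg_nonneg sum_nonneg)
  define Q where "Q = quad_step_const q K"
  have Q: "Q \<ge> 1" using K by (auto simp: Q_def quad_step_const_def)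
  have bm: "(\<integral>\<omega>. \<bar>b i \<omega>\<bar> powr q \<partial>M) \<le> (Q * a i) powr (q/2)" if i: "i < N" for i
  proof -
    have "(\<integral>\<omega>. \<bar>b i \<omega>\<bar> powr q \<partial>M) \<le> (\<integral>\<omega>. 2 powr q * (\<bar>D i * ((z i \<omega>)\<^sup>2 - v i)\<bar> powr q + \<bar>w i \<omega> * z i \<omega>\<bar> powr q) \<partial>M)"
      using bi[OF i] zz(1)[OF i] wz(1)[OF i] q unfolding b_alt by (intro integral_mono powr_add_upper) auto
    also have "\<dots> = 2 powr q * ((\<integral>\<omega>. \<bar>D i * ((z i \<omega>)\<^sup>2 - v i)\<bar> powr q \<partial>M) + (\<integral>\<omega>. \<bar>w i \<omega> * z i \<omega>\<bar> powr q \<partial>M))"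
      using zz(1)[OF i] wz(1)[OF i] by simp
    also have "\<dots> \<le> 2 powr q * (((D i)\<^sup>2) powr (q/2) * (2 powr q * (K + (1 + K) powr q))
        + (\<Sum>m<i. (A i m)\<^sup>2) powr (q/2) * ((1 + K) * lin_const q (1 + K) powr (q/2)))"
      using zz(2)[OF i] wz(2)[OF i] by (intro mult_left_mono add_mono) auto
    also have "\<dots> \<le> 2 powr q * (a i powr (q/2) * (2 powr q * (K + (1 + K) powr q))
        + a i powr (q/2) * ((1 + K) * lin_const q (1 + K) powr (q/2)))"
      using q K by (intro mult_left_mono add_mono mult_right_mono powr_mono2)
         (auto simp: a_def intro!: sum_nonneg)
    also have "\<dots> = (Q - 1) * a i powr (q/2)" by (simp add: Q_def quad_step_const_def algebra_simps)
    also have "\<dots> \<le> Q powr (q/2) * a i powr (q/2)"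
    proof (rule mult_right_mono)
      have "Q powr 1 \<le> Q powr (q/2)" using Q q by (intro powr_mono) auto
      then show "Q - 1 \<le> Q powr (q/2)" using Q by simp
    qed auto
    finally show ?thesis by (simp add: powr_mult)
  qed
  have S: "integrable M (\<lambda>\<omega>. \<bar>\<Sum>l<i. b l \<omega>\<bar> powr q)" if "i < N" for i
    using q bi that by (intro integrable_abs_powr_sum) auto
  have orth: "(\<integral>\<omega>. sgn_powr (q - 1) (\<Sum>l<i. b l \<omega>) * b i \<omega> \<partial>M) = 0" if i: "i < N" for i
  proof -
    define f where "f u = sgn_powr (q - 1) (\<Sum>l<i. D l * ((u l)\<^sup>2 - v l) + (\<Sum>m<l. A l m * u m) * u l)" for u :: "nat \<Rightarrow> real"
    have fS: "sgn_powr (q - 1) (\<Sum>l<i. b l \<omega>) = f (\<lambda>l\<in>{..<i}. z l \<omega>)" for \<omega>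
      unfolding f_def b_def
      by (intro arg_cong[where f = "sgn_powr (q - 1)"] sum.cong refl arg_cong2[where f = "(+)"] arg_cong2[where f = "(*)"]) auto
    have fm[measurable]: "f \<in> borel_measurable (Pi\<^sub>M {..<i} (\<lambda>_. borel))"
    proof -
      have [measurable]: "(\<lambda>u. u l) \<in> borel_measurable (Pi\<^sub>M {..<i} (\<lambda>_. borel))" if "l < i" for l
        by (rule measurable_component_singleton) (use that in auto)
      have [measurable]: "(\<lambda>u. \<Sum>l<i. D l * ((u l)\<^sup>2 - v l) + (\<Sum>m<l. A l m * u m) * u l) \<in> borel_measurable (Pi\<^sub>M {..<i} (\<lambda>_. borel))"
        by (intro borel_measurable_sum borel_measurable_add borel_measurable_times borel_measurable_diff borel_measurable_power) auto
      show ?thesis unfolding f_def sgn_powr_def by measurable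
    qed
    have Sm: "(\<lambda>\<omega>. \<Sum>l<i. b l \<omega>) \<in> borel_measurable M" using i by (intro borel_measurable_sum) auto
    have i1: "integrable M (\<lambda>\<omega>. sgn_powr (q - 1) (\<Sum>l<i. b l \<omega>))"
      using integrable_sgn_powr_mult[of q, OF _ Sm _ S[OF i], of "\<lambda>_. 1"] q by simp
    have i2: "integrable M (\<lambda>\<omega>. sgn_powr (q - 1) (\<Sum>l<i. b l \<omega>) * w i \<omega>)"
      using q i S[OF i] w(1)[OF i] Sm by (intro integrable_sgn_powr_mult) auto
    have A1: "integrable M (\<lambda>\<omega>. sgn_powr (q - 1) (\<Sum>l<i. b l \<omega>) * (D i * ((z i \<omega>)\<^sup>2 - v i)))"
      "(\<integral>\<omega>. sgn_powr (q - 1) (\<Sum>l<i. b l \<omega>) * (D i * ((z i \<omega>)\<^sup>2 - v i)) \<partial>M) =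
        (\<integral>\<omega>. sgn_powr (q - 1) (\<Sum>l<i. b l \<omega>) \<partial>M) * (\<integral>\<omega>. D i * ((z i \<omega>)\<^sup>2 - v i) \<partial>M)"
      using expect_past_mult[OF ind i fm, where g = "\<lambda>x. D i * (x\<^sup>2 - v i)", OF _ fS i1] z2(1)[OF i] by auto
    have A2: "integrable M (\<lambda>\<omega>. (sgn_powr (q - 1) (\<Sum>l<i. b l \<omega>) * w i \<omega>) * z i \<omega>)"
      "(\<integral>\<omega>. (sgn_powr (q - 1) (\<Sum>l<i. b l \<omega>) * w i \<omega>) * z i \<omega> \<partial>M) =
        (\<integral>\<omega>. sgn_powr (q - 1) (\<Sum>l<i. b l \<omega>) * w i \<omega> \<partial>M) * (\<integral>\<omega>. z i \<omega> \<partial>M)"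
    proof -
      have m: "(\<lambda>u. f u * (\<Sum>m<i. A i m * u m)) \<in> borel_measurable (Pi\<^sub>M {..<i} (\<lambda>_. borel))"
        by measurable
      have e: "sgn_powr (q - 1) (\<Sum>l<i. b l \<omega>) * w i \<omega>
         = f (\<lambda>l\<in>{..<i}. z l \<omega>) * (\<Sum>m<i. A i m * (\<lambda>l\<in>{..<i}. z l \<omega>) m)" for \<omega>
        by (simp add: fS w_def)
      show "integrable M (\<lambda>\<omega>. (sgn_powr (q - 1) (\<Sum>l<i. b l \<omega>) * w i \<omega>) * z i \<omega>)"
      "(\<integral>\<omega>. (sgn_powr (q - 1) (\<Sum>l<i. b l \<omega>) * w i \<omega>) * z i \<omega> \<partial>M) =
        (\<integral>\<omega>. sgn_powr (q - 1) (\<Sum>l<i. b l \<omega>) * w i \<omega> \<partial>M) * (\<integral>\<omega>. z i \<omega> \<partial>M)"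
        using expect_past_mult[OF ind i m, where g = "\<lambda>x. x", OF _ e i2] iz[OF i] by auto
    qed
    have "(\<integral>\<omega>. D i * ((z i \<omega>)\<^sup>2 - v i) \<partial>M) = 0"
      using z2(1)[OF i] by (simp add: v_def prob_space)
    then have "(\<integral>\<omega>. sgn_powr (q - 1) (\<Sum>l<i. b l \<omega>) * (D i * ((z i \<omega>)\<^sup>2 - v i))
        + (sgn_powr (q - 1) (\<Sum>l<i. b l \<omega>) * w i \<omega>) * z i \<omega> \<partial>M) = 0"
      using A1 A2 mean[OF i] by simp
    then show ?thesis unfolding b_alt[of i] by (simp add: algebra_simps)
  qed
  have Qa: "Q * a i \<ge> 0" for i using Q a[of i] by auto
  show "integrable M (\<lambda>\<omega>. \<bar>\<Sum>i<N. b i \<omega>\<bar> powr q)"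
    by (rule moment_sum(1)[OF q Qa bmeas bi bm orth])
  have "(\<integral>\<omega>. \<bar>\<Sum>i<N. b i \<omega>\<bar> powr q \<partial>M) \<le> (4 * step_const q * (\<Sum>i<N. Q * a i)) powr (q/2)"
    by (rule moment_sum(2)[OF q Qa bmeas bi bm orth])
  then show "(\<integral>\<omega>. \<bar>\<Sum>i<N. b i \<omega>\<bar> powr q \<partial>M)
      \<le> (4 * step_const q * quad_step_const q K * (\<Sum>i<N. (D i)\<^sup>2 + (\<Sum>m<i. (A i m)\<^sup>2))) powr (q/2)"
    by (simp add: sum_distrib_left[symmetric] Q_def a_def mult.assoc)
qed

lemma double_sum_split:
  fixes f :: "nat \<Rightarrow> nat \<Rightarrow> real"
  shows "(\<Sum>i<N. \<Sum>k<N. f i k) = (\<Sum>i<N. f i i + (\<Sum>m<i. f i m + f m i))"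
  by (induction N) (auto simp: sum.distrib)

definition quad_const :: "real \<Rightarrow> real \<Rightarrow> real" where
  "quad_const q K = 8 * step_const q * quad_step_const q K"

lemma quad_const_pos: "K \<ge> 0 \<Longrightarrow> q \<ge> 2 \<Longrightarrow> quad_const q K > 0"
  unfolding quad_const_def quad_step_const_def step_const_def
  by (intro mult_pos_pos add_pos_nonneg) (auto intro!: mult_nonneg_nonneg add_nonneg_nonneg)

text \<open>A centred quadratic form is a martingale: ordering the double sum by the larger index makes it a sum of
  the increments of \<open>quadratic_form_moment_aux\<close>. The squared Frobenius norm of the matrix plays the
  role of the variance.\<close>

lemma (in prob_space) quadratic_form_moment:
  fixes z :: "nat \<Rightarrow> 'a \<Rightarrow> real" and B :: "nat \<Rightarrow> nat \<Rightarrow> real"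
  assumes q: "q \<ge> 2" and K: "K \<ge> 0"
    and ind: "indep_vars (\<lambda>_. borel) z {..<N}"
    and mean: "\<And>i. i < N \<Longrightarrow> (\<integral>\<omega>. z i \<omega> \<partial>M) = 0"
    and int: "\<And>i. i < N \<Longrightarrow> integrable M (\<lambda>\<omega>. \<bar>z i \<omega>\<bar> powr (2 * q))"
    and mom: "\<And>i. i < N \<Longrightarrow> (\<integral>\<omega>. \<bar>z i \<omega>\<bar> powr (2 * q) \<partial>M) \<le> K"
  defines "T \<equiv> \<lambda>\<omega>. (\<Sum>i<N. \<Sum>k<N. B i k * z i \<omega> * z k \<omega>) - (\<Sum>i<N. B i i * (\<integral>\<omega>. (z i \<omega>)\<^sup>2 \<partial>M))"
  shows "integrable M (\<lambda>\<omega>. \<bar>T \<omega>\<bar> powr q)"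
    and "(\<integral>\<omega>. \<bar>T \<omega>\<bar> powr q \<partial>M) \<le> (quad_const q K * (\<Sum>i<N. \<Sum>k<N. (B i k)\<^sup>2)) powr (q/2)"
proof -
  let ?v = "\<lambda>i. (\<integral>\<omega>. (z i \<omega>)\<^sup>2 \<partial>M)"
  have T: "T \<omega> = (\<Sum>i<N. B i i * ((z i \<omega>)\<^sup>2 - ?v i) + (\<Sum>m<i. (B i m + B m i) * z m \<omega>) * z i \<omega>)" for \<omega>
  proof -
    have "T \<omega> = (\<Sum>i<N. B i i * z i \<omega> * z i \<omega> + (\<Sum>m<i. B i m * z i \<omega> * z m \<omega> + B m i * z m \<omega> * z i \<omega>)) - (\<Sum>i<N. B i i * ?v i)"
      unfolding T_def by (subst double_sum_split) simp
    also have "\<dots> = (\<Sum>i<N. B i i * z i \<omega> * z i \<omega> + (\<Sum>m<i. B i m * z i \<omega> * z m \<omega> + B m i * z m \<omega> * z i \<omega>) - B i i * ?v i)"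
      by (simp add: sum_subtractf)
    also have "\<dots> = (\<Sum>i<N. B i i * ((z i \<omega>)\<^sup>2 - ?v i) + (\<Sum>m<i. (B i m + B m i) * z m \<omega>) * z i \<omega>)"
      by (intro sum.cong refl) (simp add: sum_distrib_left sum_distrib_right sum.distrib power2_eq_square algebra_simps)
    finally show ?thesis .
  qed
  note aux = quadratic_form_moment_aux[OF q K ind mean int mom, where D = "\<lambda>i. B i i" and A = "\<lambda>i m. B i m + B m i"]
  show "integrable M (\<lambda>\<omega>. \<bar>T \<omega>\<bar> powr q)"
    unfolding T using aux(1) by simp
  have "(\<integral>\<omega>. \<bar>T \<omega>\<bar> powr q \<partial>M) \<le> (4 * step_const q * quad_step_const q K * (\<Sum>i<N. (B i i)\<^sup>2 + (\<Sum>m<i. (B i m + B m i)\<^sup>2))) powr (q/2)"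
    unfolding T using aux(2) by simp
  also have "\<dots> \<le> (quad_const q K * (\<Sum>i<N. \<Sum>k<N. (B i k)\<^sup>2)) powr (q/2)"
  proof (rule powr_mono2)
    have c: "0 \<le> 4 * step_const q * quad_step_const q K"
      using quad_const_pos[OF K q] by (simp add: quad_const_def)
    have "(\<Sum>i<N. (B i i)\<^sup>2 + (\<Sum>m<i. (B i m + B m i)\<^sup>2)) \<le> (\<Sum>i<N. 2 * ((B i i)\<^sup>2 + (\<Sum>m<i. (B i m)\<^sup>2 + (B m i)\<^sup>2)))"
    proof (rule sum_mono)
      fix i
      have "(\<Sum>m<i. (B i m + B m i)\<^sup>2) \<le> (\<Sum>m<i. 2 * ((B i m)\<^sup>2 + (B m i)\<^sup>2))"
      proof (rule sum_mono)
        fix m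
        have "0 \<le> (B i m - B m i)\<^sup>2" by simp
        then show "(B i m + B m i)\<^sup>2 \<le> 2 * ((B i m)\<^sup>2 + (B m i)\<^sup>2)" by (simp add: power2_eq_square algebra_simps)
      qed
      then show "(B i i)\<^sup>2 + (\<Sum>m<i. (B i m + B m i)\<^sup>2) \<le> 2 * ((B i i)\<^sup>2 + (\<Sum>m<i. (B i m)\<^sup>2 + (B m i)\<^sup>2))"
        unfolding sum_distrib_left[symmetric] distrib_left[of 2 "(B i i)\<^sup>2"] by (intro add_mono) auto
    qed
    also have "\<dots> = 2 * (\<Sum>i<N. \<Sum>k<N. (B i k)\<^sup>2)"
      by (subst double_sum_split) (simp add: sum_distrib_left)
    finally show "4 * step_const q * quad_step_const q K * (\<Sum>i<N. (B i i)\<^sup>2 + (\<Sum>m<i. (B i m + B m i)\<^sup>2)) \<le> quad_const q K * (\<Sum>i<N. \<Sum>k<N. (B i k)\<^sup>2)"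
      using mult_left_mono[OF _ c] by (fastforce simp: quad_const_def)
    show "0 \<le> 4 * step_const q * quad_step_const q K * (\<Sum>i<N. (B i i)\<^sup>2 + (\<Sum>m<i. (B i m + B m i)\<^sup>2))"
      by (rule mult_nonneg_nonneg[OF c]) (auto intro!: sum_nonneg add_nonneg_nonneg)
  qed (use q in auto)
  finally show "(\<integral>\<omega>. \<bar>T \<omega>\<bar> powr q \<partial>M) \<le> (quad_const q K * (\<Sum>i<N. \<Sum>k<N. (B i k)\<^sup>2)) powr (q/2)" .
qed

section \<open>Vectors and matrices as arrays\<close>

text \<open>Matrices are modified by deleting rows and columns throughout, with the dimensions kept. Functions on
  the indices make this painless; \<open>ip\<close> and \<open>mv\<close> are the inner product and the product of
  a matrix with a vector.\<close>

definition ip :: "nat \<Rightarrow> (nat \<Rightarrow> real) \<Rightarrow> (nat \<Rightarrow> real) \<Rightarrow> real" where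
  "ip m u v = (\<Sum>k<m. u k * v k)"

definition mv :: "nat \<Rightarrow> (nat \<Rightarrow> nat \<Rightarrow> real) \<Rightarrow> (nat \<Rightarrow> real) \<Rightarrow> nat \<Rightarrow> real" where
  "mv m A v i = (\<Sum>k<m. A i k * v k)"

lemma ip_commute: "ip m u v = ip m v u" by (simp add: ip_def mult.commute)
lemma ip_add_right: "ip m u (\<lambda>k. v k + w k) = ip m u v + ip m u w"
  by (simp add: ip_def sum.distrib distrib_left)
lemma ip_diff_right: "ip m u (\<lambda>k. v k - w k) = ip m u v - ip m u w"
  by (simp add: ip_def sum_subtractf right_diff_distrib)
lemma ip_scale_right: "ip m u (\<lambda>k. c * v k) = c * ip m u v"
  by (simp add: ip_def sum_distrib_left ac_simps)
lemma ip_add_left: "ip m (\<lambda>k. v k + w k) u = ip m v u + ip m w u"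
  by (simp add: ip_def sum.distrib distrib_right)
lemma ip_diff_left: "ip m (\<lambda>k. v k - w k) u = ip m v u - ip m w u"
  by (simp add: ip_def sum_subtractf left_diff_distrib)
lemma ip_scale_left: "ip m (\<lambda>k. c * v k) u = c * ip m v u"
  by (simp add: ip_def sum_distrib_left ac_simps)
lemmas ip_linear = ip_add_right ip_diff_right ip_scale_right ip_add_left ip_diff_left ip_scale_left
lemma ip_self_nonneg: "ip m u u \<ge> 0" by (simp add: ip_def sum_nonneg)
lemma ip_cong: "(\<And>k. k < m \<Longrightarrow> u k = u' k) \<Longrightarrow> (\<And>k. k < m \<Longrightarrow> v k = v' k) \<Longrightarrow> ip m u v = ip m u' v'"
  by (simp add: ip_def)
lemma ip_unit: "j < m \<Longrightarrow> ip m u (\<lambda>k. if k = j then c else 0) = u j * c"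
  by (simp add: ip_def if_distrib[of "\<lambda>a. _ * a"] cong: if_cong)

lemma ip_unit_left: "j < m \<Longrightarrow> ip m (\<lambda>k. if k = j then c else 0) u = c * u j"
  by (subst ip_commute) (simp add: ip_unit)

lemma mv_add: "mv m A (\<lambda>k. v k + w k) i = mv m A v i + mv m A w i"
  by (simp add: mv_def sum.distrib distrib_left)
lemma mv_diff: "mv m A (\<lambda>k. v k - w k) i = mv m A v i - mv m A w i"
  by (simp add: mv_def sum_subtractf right_diff_distrib)
lemma mv_scale: "mv m A (\<lambda>k. c * v k) i = c * mv m A v i"
  by (simp add: mv_def sum_distrib_left ac_simps)
lemmas mv_linear = mv_add mv_diff mv_scale
lemma mv_cong: "(\<And>k. k < m \<Longrightarrow> v k = v' k) \<Longrightarrow> mv m A v i = mv m A v' i"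
  by (simp add: mv_def)
lemma mv_unit: "j < m \<Longrightarrow> mv m A (\<lambda>k. if k = j then c else 0) i = A i j * c"
  by (simp add: mv_def if_distrib[of "\<lambda>a. _ * a"] cong: if_cong)

lemma ip_mv_adjoint: "ip n w (mv p A v) = ip p (\<lambda>k. ip n (\<lambda>i. A i k) w) v"
  unfolding ip_def mv_def sum_distrib_left sum_distrib_right
  by (subst sum.swap) (simp add: ac_simps)

text \<open>The common core of all Cauchy--Schwarz inequalities below.\<close>

lemma discriminant_bound:
  fixes a b c :: real
  assumes "\<And>t. a + 2 * t * b + t\<^sup>2 * c \<ge> 0" "c \<ge> 0"
  shows "b\<^sup>2 \<le> a * c"
proof (cases "c = 0")
  case True
  have "b = 0"
  proof (rule ccontr)
    assume "b \<noteq> 0"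
    then show False using assms(1)[of "-(a + 1) / (2 * b)"] True by (simp add: field_simps)
  qed
  then show ?thesis using True by simp
next
  case False
  then have "c > 0" using assms(2) by simp
  then show ?thesis using assms(1)[of "- b / c"] by (simp add: field_simps power2_eq_square)
qed

section \<open>Ridge inverses\<close>

text \<open>The operator \<open>Z\<^sup>T Z + l\<close>.\<close>

definition rop :: "nat \<Rightarrow> nat \<Rightarrow> real \<Rightarrow> (nat \<Rightarrow> nat \<Rightarrow> real) \<Rightarrow> (nat \<Rightarrow> real) \<Rightarrow> nat \<Rightarrow> real" where
  "rop n p l Z v j = ip n (\<lambda>i. Z i j) (mv p Z v) + l * v j"

text \<open>The inverse of \<open>Z\<^sup>T Z + l\<close>. Symmetry and vanishing outside of the index range are included, so
  that an inverse is unique as a function. The penalty \<open>l\<close> is a device: for \<open>l > 0\<close> inverses exist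
  after any deletion of rows and columns, whereas the least-squares case \<open>l = 0\<close> may be singular.\<close>

definition is_rinv :: "nat \<Rightarrow> nat \<Rightarrow> real \<Rightarrow> (nat \<Rightarrow> nat \<Rightarrow> real) \<Rightarrow> (nat \<Rightarrow> nat \<Rightarrow> real) \<Rightarrow> bool" where
  "is_rinv n p l Z x \<longleftrightarrow> (\<forall>j k. x j k = x k j) \<and> (\<forall>j k. p \<le> j \<or> p \<le> k \<longrightarrow> x j k = 0) \<and>
     (\<forall>j<p. \<forall>k<p. rop n p l Z (\<lambda>m. x m k) j = (if j = k then 1 else 0))"

lemma rop_form: "ip p u (rop n p l Z v) = ip n (mv p Z u) (mv p Z v) + l * ip p u v"
proof -
  have "ip p u (rop n p l Z v) = ip p u (\<lambda>k. ip n (\<lambda>i. Z i k) (mv p Z v)) + l * ip p u v"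
    by (simp add: rop_def[abs_def] ip_linear)
  also have "ip p u (\<lambda>k. ip n (\<lambda>i. Z i k) (mv p Z v)) = ip n (mv p Z v) (mv p Z u)"
    by (simp only: ip_mv_adjoint[of n "mv p Z v" p Z u] ip_commute[of p u])
  finally show ?thesis by (simp only: ip_commute[of n "mv p Z v"])
qed

lemma rop_sym: "ip p u (rop n p l Z v) = ip p (rop n p l Z u) v"
  by (simp only: rop_form ip_commute[of p "rop n p l Z u"] ip_commute[of n "mv p Z u"] ip_commute[of p u v])

lemma rop_add: "rop n p l Z (\<lambda>k. v k + w k) j = rop n p l Z v j + rop n p l Z w j"
  and rop_diff: "rop n p l Z (\<lambda>k. v k - w k) j = rop n p l Z v j - rop n p l Z w j"
  and rop_scale: "rop n p l Z (\<lambda>k. c * v k) j = c * rop n p l Z v j"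
  by (simp_all add: rop_def mv_linear[abs_def] ip_linear algebra_simps)

context
  fixes n p :: nat and l :: real and Z x :: "nat \<Rightarrow> nat \<Rightarrow> real"
  assumes inv: "is_rinv n p l Z x"
begin

lemma rinv_sym: "x j k = x k j" using inv by (auto simp: is_rinv_def)
lemma rinv_out: "p \<le> j \<or> p \<le> k \<Longrightarrow> x j k = 0" using inv by (auto simp: is_rinv_def)
lemma rinv_col: "j < p \<Longrightarrow> k < p \<Longrightarrow> rop n p l Z (\<lambda>m. x m k) j = (if j = k then 1 else 0)"
  using inv by (auto simp: is_rinv_def)

lemma rinv_unique:
  assumes y: "\<And>j. j < p \<Longrightarrow> rop n p l Z y j = v j" and j: "j < p"
  shows "y j = mv p x v j"
proof -
  have "mv p x v j = ip p (\<lambda>k. x k j) v" by (simp add: mv_def ip_def rinv_sym[of j])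
  also have "\<dots> = ip p (\<lambda>k. x k j) (rop n p l Z y)" using y by (intro ip_cong) auto
  also have "\<dots> = ip p (rop n p l Z (\<lambda>k. x k j)) y" by (rule rop_sym)
  also have "\<dots> = ip p y (\<lambda>k. if k = j then 1 else 0)"
    using rinv_col j by (subst ip_commute) (auto intro!: ip_cong)
  also have "\<dots> = y j" using j by (simp add: ip_unit)
  finally show ?thesis by simp
qed

lemma rinv_solves:
  assumes j: "j < p"
  shows "rop n p l Z (mv p x v) j = v j"
proof -
  have "rop n p l Z (mv p x v) j = (\<Sum>k<p. v k * rop n p l Z (\<lambda>m. x m k) j)"
  proof -
    have m: "mv p Z (mv p x v) i = (\<Sum>k<p. v k * mv p Z (\<lambda>m. x m k) i)" for i
      unfolding mv_def sum_distrib_left by (subst sum.swap) (simp add: ac_simps)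
    have "ip n (\<lambda>i. Z i j) (mv p Z (mv p x v)) = (\<Sum>k<p. v k * ip n (\<lambda>i. Z i j) (mv p Z (\<lambda>m. x m k)))"
      unfolding ip_def m sum_distrib_left by (subst sum.swap) (simp add: ac_simps)
    then show ?thesis
      unfolding rop_def by (simp add: mv_def[of p x v] sum_distrib_left sum.distrib algebra_simps)
  qed
  also have "\<dots> = (\<Sum>k<p. v k * (if j = k then 1 else 0))" using j by (intro sum.cong) (auto simp: rinv_col)
  also have "\<dots> = v j" using j by (simp add: if_distrib[of "\<lambda>a. _ * a"] cong: if_cong)
  finally show ?thesis .
qed

lemma rinv_form: "ip p u (mv p x v) = ip n (mv p Z (mv p x u)) (mv p Z (mv p x v)) + l * ip p (mv p x u) (mv p x v)"
proof -
  have "ip p u (mv p x v) = ip p (rop n p l Z (mv p x u)) (mv p x v)"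
    by (intro ip_cong) (auto simp: rinv_solves)
  also have "\<dots> = ip p (mv p x u) (rop n p l Z (mv p x v))" by (rule rop_sym[symmetric])
  finally show ?thesis by (simp add: rop_form)
qed

lemma mv_rinv_out: "p \<le> j \<Longrightarrow> mv p x v j = 0"
  by (simp add: mv_def rinv_out)

lemma ip_mv_rinv_sym: "ip p u (mv p x v) = ip p (mv p x u) v"
  unfolding ip_mv_adjoint by (intro ip_cong) (simp_all add: mv_def ip_def rinv_sym)

lemma rinv_col_eq: "k < p \<Longrightarrow> (\<lambda>m. x m k) = mv p x (\<lambda>m. if m = k then 1 else 0)"
  by (rule ext) (simp add: mv_unit)

lemma rinv_entry: "j < p \<Longrightarrow> k < p \<Longrightarrow> x j k = ip p (\<lambda>m. if m = j then 1 else 0) (mv p x (\<lambda>m. if m = k then 1 else 0))"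
  by (simp add: ip_unit_left mv_unit)

lemma rinv_diag: "k < p \<Longrightarrow> x k k = ip n (mv p Z (\<lambda>m. x m k)) (mv p Z (\<lambda>m. x m k)) + l * ip p (\<lambda>m. x m k) (\<lambda>m. x m k)"
  using rinv_form[of "\<lambda>m. if m = k then 1 else 0" "\<lambda>m. if m = k then 1 else 0"]
  by (simp only: rinv_col_eq[symmetric] ip_unit_left mult_1)

context assumes l: "l \<ge> 0" begin

lemma rinv_psd: "ip p v (mv p x v) \<ge> 0"
  using l rinv_form[of v v] by (simp add: ip_self_nonneg)

lemma rinv_diag_nonneg: "x k k \<ge> 0"
  using l by (cases "k < p") (simp_all add: rinv_diag ip_self_nonneg rinv_out)

lemma rinv_cauchy: "(ip p u (mv p x v))\<^sup>2 \<le> ip p u (mv p x u) * ip p v (mv p x v)"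
proof (rule discriminant_bound[OF _ rinv_psd])
  fix t :: real
  have "ip p (\<lambda>k. u k + t * v k) (mv p x (\<lambda>k. u k + t * v k)) \<ge> 0" by (rule rinv_psd)
  moreover have "ip p v (mv p x u) = ip p u (mv p x v)"
    by (subst ip_mv_rinv_sym) (rule ip_commute)
  ultimately show "ip p u (mv p x u) + 2 * t * ip p u (mv p x v) + t\<^sup>2 * ip p v (mv p x v) \<ge> 0"
    by (simp add: mv_linear[abs_def] ip_linear power2_eq_square algebra_simps)
qed

text \<open>The largest eigenvalue of a positive semidefinite matrix is at most its trace.\<close>

lemma rinv_trace_bound: "ip p v (mv p x v) \<le> (\<Sum>k<p. x k k) * ip p v v"
proof -
  have e: "\<bar>x j k\<bar> \<le> sqrt (x j j) * sqrt (x k k)" if "j < p" "k < p" for j k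
  proof -
    have "(x j k)\<^sup>2 \<le> x j j * x k k"
      using rinv_cauchy[of "\<lambda>m. if m = j then 1 else 0" "\<lambda>m. if m = k then 1 else 0"] that
      by (simp add: rinv_entry[symmetric])
    then have "sqrt ((x j k)\<^sup>2) \<le> sqrt (x j j * x k k)" by (rule real_sqrt_le_mono)
    then show ?thesis by (simp add: real_sqrt_mult)
  qed
  have "ip p v (mv p x v) = (\<Sum>j<p. \<Sum>k<p. v j * (x j k * v k))"
    by (simp add: ip_def mv_def sum_distrib_left)
  also have "\<dots> \<le> (\<Sum>j<p. \<Sum>k<p. (sqrt (x j j) * \<bar>v j\<bar>) * (sqrt (x k k) * \<bar>v k\<bar>))"
  proof (intro sum_mono)
    fix j k assume "j \<in> {..<p}" "k \<in> {..<p}"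
    then have "\<bar>v j\<bar> * (\<bar>x j k\<bar> * \<bar>v k\<bar>) \<le> \<bar>v j\<bar> * ((sqrt (x j j) * sqrt (x k k)) * \<bar>v k\<bar>)"
      using e by (intro mult_left_mono mult_right_mono) auto
    then show "v j * (x j k * v k) \<le> (sqrt (x j j) * \<bar>v j\<bar>) * (sqrt (x k k) * \<bar>v k\<bar>)"
      using abs_ge_self[of "v j * (x j k * v k)"] by (simp add: abs_mult ac_simps)
  qed
  also have "\<dots> = (\<Sum>j<p. sqrt (x j j) * \<bar>v j\<bar>)\<^sup>2"
    by (simp add: power2_eq_square sum_product)
  also have "\<dots> \<le> (\<Sum>j<p. (sqrt (x j j))\<^sup>2) * (\<Sum>j<p. \<bar>v j\<bar>\<^sup>2)"
    by (rule Cauchy_Schwarz_ineq_sum)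
  also have "\<dots> = (\<Sum>k<p. x k k) * ip p v v"
    using rinv_diag_nonneg by (simp add: ip_def power2_eq_square)
  finally show ?thesis .
qed

end
end

text \<open>The residual of the penalized regression of \<open>w\<close> on the columns of \<open>Z\<close>; \<open>resmat\<close> is its matrix
  \<open>I - Z x Z\<^sup>T\<close>, a projection for \<open>l = 0\<close>.\<close>

definition res :: "nat \<Rightarrow> nat \<Rightarrow> (nat \<Rightarrow> nat \<Rightarrow> real) \<Rightarrow> (nat \<Rightarrow> nat \<Rightarrow> real) \<Rightarrow> (nat \<Rightarrow> real) \<Rightarrow> nat \<Rightarrow> real" where
  "res n p Z x w i = w i - mv p Z (mv p x (\<lambda>k. ip n (\<lambda>i. Z i k) w)) i"

definition resmat :: "nat \<Rightarrow> nat \<Rightarrow> (nat \<Rightarrow> nat \<Rightarrow> real) \<Rightarrow> (nat \<Rightarrow> nat \<Rightarrow> real) \<Rightarrow> nat \<Rightarrow> nat \<Rightarrow> real" where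
  "resmat n p Z x i k = (if i = k then 1 else 0) - (\<Sum>a<p. \<Sum>b<p. Z i a * x a b * Z k b)"

lemma res_resmat:
  assumes "i < n"
  shows "res n p Z x w i = (\<Sum>k<n. resmat n p Z x i k * w k)"
proof -
  have "mv p Z (mv p x (\<lambda>k. ip n (\<lambda>i. Z i k) w)) i = (\<Sum>a<p. \<Sum>b<p. \<Sum>k<n. Z i a * x a b * Z k b * w k)"
    by (simp add: mv_def ip_def sum_distrib_left mult.assoc)
  also have "\<dots> = (\<Sum>a<p. \<Sum>k<n. \<Sum>b<p. Z i a * x a b * Z k b * w k)"
    by (intro sum.cong refl sum.swap)
  also have "\<dots> = (\<Sum>k<n. \<Sum>a<p. \<Sum>b<p. Z i a * x a b * Z k b * w k)" by (rule sum.swap)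
  finally show ?thesis using assms
    by (simp add: res_def resmat_def left_diff_distrib sum_subtractf sum_distrib_right if_distrib[of "\<lambda>a. a * _"] cong: if_cong)
qed

context
  fixes n p :: nat and l :: real and Z x :: "nat \<Rightarrow> nat \<Rightarrow> real"
  assumes inv: "is_rinv n p l Z x"
begin

abbreviation (input) "lscoef w \<equiv> mv p x (\<lambda>k. ip n (\<lambda>i. Z i k) w)"

lemma res_orth: "k < p \<Longrightarrow> ip n (\<lambda>i. Z i k) (res n p Z x w) = l * lscoef w k"
  using rinv_solves[OF inv, of k "\<lambda>k. ip n (\<lambda>i. Z i k) w"]
  by (simp add: res_def[abs_def] ip_linear rop_def)

lemma res_orth_mv: "ip n (res n p Z x w) (mv p Z b) = l * ip p (lscoef w) b"
proof -
  have "ip n (res n p Z x w) (mv p Z b) = ip p (\<lambda>k. ip n (\<lambda>i. Z i k) (res n p Z x w)) b"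
    by (simp add: ip_mv_adjoint)
  also have "\<dots> = ip p (\<lambda>k. l * lscoef w k) b" by (intro ip_cong) (simp_all add: res_orth)
  finally show ?thesis by (simp add: ip_linear)
qed

lemma res_form: "ip n w (res n p Z x w') = ip n (res n p Z x w) (res n p Z x w') + l * ip p (lscoef w) (lscoef w')"
proof -
  have "ip n w (res n p Z x w') = ip n (\<lambda>i. res n p Z x w i + mv p Z (lscoef w) i) (res n p Z x w')"
    by (simp add: res_def)
  also have "\<dots> = ip n (res n p Z x w) (res n p Z x w') + ip n (res n p Z x w') (mv p Z (lscoef w))"
    by (simp add: ip_linear ip_commute[of n _ "mv p Z (lscoef w)"])
  finally show ?thesis by (simp add: res_orth_mv ip_commute)
qed

lemma res_sym: "ip n w (res n p Z x w') = ip n (res n p Z x w) w'"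
  using res_form[of w w'] res_form[of w' w] by (simp add: ip_commute)

lemma resmat_eq: "i < n \<Longrightarrow> k < n \<Longrightarrow> resmat n p Z x i k = res n p Z x (\<lambda>m. if m = k then 1 else 0) i"
  by (simp add: res_resmat if_distrib[of "\<lambda>a. _ * a"] cong: if_cong)

context assumes l: "l \<ge> 0" begin

text \<open>The residual minimizes the penalized sum of squares. Evaluating the sum at a competitor \<open>b\<close> yields
  contraction and monotonicity without any eigenvalue argument.\<close>

lemma res_variational:
  "ip n w (res n p Z x w) \<le> ip n (\<lambda>i. w i - mv p Z b i) (\<lambda>i. w i - mv p Z b i) + l * ip p b b"
proof -
  define e where "e k = b k - lscoef w k" for k
  have b: "b = (\<lambda>k. lscoef w k + e k)" by (simp add: e_def)
  have w: "w i - mv p Z b i = res n p Z x w i - mv p Z e i" for i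
    unfolding b by (simp add: res_def mv_linear)
  have "ip n (\<lambda>i. w i - mv p Z b i) (\<lambda>i. w i - mv p Z b i) + l * ip p b b
    = ip n (res n p Z x w) (res n p Z x w) + l * ip p (lscoef w) (lscoef w) + (ip n (mv p Z e) (mv p Z e) + l * ip p e e)"
    unfolding w by (simp add: ip_linear b res_orth_mv ip_commute[of n "mv p Z e" "res n p Z x w"] ip_commute[of p e "lscoef w"] algebra_simps)
  then show ?thesis using l ip_self_nonneg[of n "mv p Z e"] ip_self_nonneg[of p e] by (simp add: res_form[of w w])
qed

lemma res_norm_le: "ip n (res n p Z x w) (res n p Z x w) \<le> ip n w (res n p Z x w)"
  using l ip_self_nonneg[of p "lscoef w"] by (simp add: res_form[of w w])

lemma resmat_diag_le_1: assumes "i < n" shows "resmat n p Z x i i \<le> 1"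
proof -
  have "resmat n p Z x i i = ip n (\<lambda>m. if m = i then 1 else 0) (res n p Z x (\<lambda>m. if m = i then 1 else 0))"
    using assms by (simp add: ip_unit_left resmat_eq)
  also have "\<dots> \<le> ip n (\<lambda>m. if m = i then 1 else 0) (\<lambda>m. if m = i then 1 else 0)"
    using res_variational[of "\<lambda>m. if m = i then 1 else 0" "\<lambda>_. 0"] by (simp add: mv_def[of p Z "\<lambda>_. 0"] ip_def[of p "\<lambda>_. 0"])
  also have "\<dots> = 1" using assms by (simp add: ip_unit)
  finally show ?thesis .
qed

lemma resmat_col_norm:
  assumes "k < n"
  shows "(\<Sum>i<n. (resmat n p Z x i k)\<^sup>2) \<le> resmat n p Z x k k"
proof -
  let ?e = "\<lambda>m. if m = k then (1::real) else 0"
  have "(\<Sum>i<n. (resmat n p Z x i k)\<^sup>2) = ip n (res n p Z x ?e) (res n p Z x ?e)"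
    using assms by (simp add: ip_def resmat_eq power2_eq_square)
  also have "\<dots> \<le> ip n ?e (res n p Z x ?e)" by (rule res_norm_le)
  also have "\<dots> = resmat n p Z x k k"
    using assms by (simp add: ip_unit_left resmat_eq)
  finally show ?thesis .
qed

lemma resmat_frob: "(\<Sum>i<n. \<Sum>k<n. (resmat n p Z x i k)\<^sup>2) \<le> real n"
proof -
  have "(\<Sum>k<n. \<Sum>i<n. (resmat n p Z x i k)\<^sup>2) \<le> (\<Sum>k<n. 1)"
    by (intro sum_mono order_trans[OF resmat_col_norm resmat_diag_le_1]) auto
  then show ?thesis by (subst sum.swap) simp
qed

lemma resmat_trace: "(\<Sum>i<n. resmat n p Z x i i) \<ge> real n - real p"
proof -
  have "(\<Sum>i<n. \<Sum>a<p. \<Sum>b<p. Z i a * x a b * Z i b) = (\<Sum>a<p. \<Sum>i<n. \<Sum>b<p. Z i a * x a b * Z i b)"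
    by (rule sum.swap)
  also have "\<dots> = (\<Sum>a<p. ip n (\<lambda>i. Z i a) (mv p Z (\<lambda>m. x m a)))"
    by (simp add: ip_def mv_def sum_distrib_left rinv_sym[OF inv] ac_simps)
  also have "\<dots> = (\<Sum>a<p. 1 - l * x a a)"
    using rinv_col[OF inv] by (intro sum.cong) (auto simp: rop_def algebra_simps)
  also have "\<dots> \<le> (\<Sum>a<p. 1)"
    using l rinv_diag_nonneg[OF inv] by (intro sum_mono) simp
  finally show ?thesis by (simp add: resmat_def sum_subtractf)
qed

end
end

section \<open>Inserting a column\<close>

text \<open>Deleted columns and rows are set to zero.\<close>

definition zcol :: "nat \<Rightarrow> (nat \<Rightarrow> nat \<Rightarrow> real) \<Rightarrow> nat \<Rightarrow> nat \<Rightarrow> real" where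
  "zcol j Z i k = (if k = j then 0 else Z i k)"

definition zrow :: "nat \<Rightarrow> (nat \<Rightarrow> nat \<Rightarrow> real) \<Rightarrow> nat \<Rightarrow> nat \<Rightarrow> real" where
  "zrow r Z i k = (if i = r then 0 else Z i k)"

lemma sq_diff_le: "(a - b)\<^sup>2 \<le> 2 * a\<^sup>2 + 2 * b\<^sup>2" for a b :: real
proof -
  have "0 \<le> (a + b)\<^sup>2" by simp
  then show ?thesis by (simp add: power2_eq_square algebra_simps)
qed

text \<open>The inverse \<open>x\<close> expressed through the inverse \<open>x0\<close> of the array without column \<open>j\<close>: the
  Schur complement formula, written for the symmetric vector \<open>yh\<close>, the column minus its regression on
  the other columns, and for the Schur complement \<open>d\<close>.\<close>

locale col_split =
  fixes n p :: nat and l :: real and Z x x0 :: "nat \<Rightarrow> nat \<Rightarrow> real" and j :: nat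
  assumes x: "is_rinv n p l Z x" and x0: "is_rinv n p l (zcol j Z) x0"
    and j: "j < p" and l: "l > 0"
begin

definition c :: "nat \<Rightarrow> real" where "c i = Z i j"
definition y :: "nat \<Rightarrow> real" where "y = mv p x0 (\<lambda>k. ip n (\<lambda>i. zcol j Z i k) c)"
definition r :: "nat \<Rightarrow> real" where "r = res n p (zcol j Z) x0 c"
definition d :: real where "d = l + ip n c r"
definition yh :: "nat \<Rightarrow> real" where "yh k = (if k = j then 1 else 0) - y k"

lemma x0_row: "i < p \<Longrightarrow> l * x0 j i = (if j = i then 1 else 0)"
  using rinv_col[OF x0 j, of i] by (simp add: rop_def zcol_def ip_def)

lemma x0_off: "i < p \<Longrightarrow> i \<noteq> j \<Longrightarrow> x0 j i = 0" "i < p \<Longrightarrow> i \<noteq> j \<Longrightarrow> x0 i j = 0"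
  using x0_row[of i] l rinv_sym[OF x0, of i j] by auto

lemma y_j: "y j = 0"
  using rinv_solves[OF x0 j, of "\<lambda>k. ip n (\<lambda>i. zcol j Z i k) c"] l
  by (simp add: rop_def y_def) (simp add: zcol_def ip_def)

lemma r_eq: "r i = c i - mv p (zcol j Z) y i"
  by (simp add: r_def res_def y_def)

lemma mv_zcol: "v j = 0 \<Longrightarrow> mv p Z v i = mv p (zcol j Z) v i"
  unfolding mv_def by (intro sum.cong) (auto simp: zcol_def)

lemma mv_Z_yh: "mv p Z yh i = r i"
proof -
  have "mv p Z yh i = Z i j - mv p Z y i"
    unfolding yh_def[abs_def] using j by (simp add: mv_linear mv_unit)
  then show ?thesis using mv_zcol[of y i] y_j by (simp add: r_eq c_def)
qed

lemma ip_c_r: "ip n c r = ip n r r + l * ip p y y"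
  using res_form[OF x0, of c c] by (simp add: r_def y_def)

lemma d_ge: "d \<ge> l" and d_pos: "d > 0"
proof -
  show "d \<ge> l" using ip_self_nonneg[of n r] ip_self_nonneg[of p y] l by (simp add: d_def ip_c_r)
  then show "d > 0" using l by simp
qed

lemma rop_yh: assumes k: "k < p" shows "rop n p l Z yh k = (if k = j then d else 0)"
proof (cases "k = j")
  case True
  then show ?thesis using y_j by (simp add: rop_def mv_Z_yh[abs_def] yh_def d_def c_def[abs_def])
next
  case False
  have "ip n (\<lambda>i. Z i k) r = ip n (\<lambda>i. zcol j Z i k) r" using False by (simp add: zcol_def)
  also have "\<dots> = l * y k" using res_orth[OF x0 k, of c] by (simp add: r_def y_def)
  finally show ?thesis using False by (simp add: rop_def mv_Z_yh[abs_def] yh_def)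
qed

lemma x_col: assumes k: "k < p" shows "x k j = yh k / d"
proof -
  have "yh k = mv p x (\<lambda>m. if m = j then d else 0) k"
    by (rule rinv_unique[OF x rop_yh k])
  also have "\<dots> = x k j * d" using j by (simp add: mv_unit)
  finally show ?thesis using d_pos by simp
qed

lemma x_diag_j: "x j j = 1 / d"
  using x_col[OF j] y_j by (simp add: yh_def)

lemma x_off: assumes i: "i < p" "i \<noteq> j" and k: "k < p"
  shows "x k i = x0 k i + yh k * yh i / d"
proof -
  let ?u = "\<lambda>k. x0 k i + yh i / d * yh k"
  have xj: "x0 j i = 0" using i x0_off by auto
  have "rop n p l Z ?u m = (if m = i then 1 else 0)" if m: "m < p" for m
  proof -
    have e: "mv p Z (\<lambda>k. x0 k i) = mv p (zcol j Z) (\<lambda>k. x0 k i)"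
      by (rule ext) (simp add: mv_zcol xj)
    have "rop n p l Z ?u m = rop n p l Z (\<lambda>k. x0 k i) m + yh i / d * (if m = j then d else 0)"
      using rop_yh[OF m] by (simp only: rop_add rop_scale)
    also have "rop n p l Z (\<lambda>k. x0 k i) m = (if m = i then 1 else 0) + (if m = j then y i else 0)"
    proof (cases "m = j")
      case False
      have "rop n p l Z (\<lambda>k. x0 k i) m = rop n p l (zcol j Z) (\<lambda>k. x0 k i) m"
        using False by (simp add: rop_def e) (simp add: zcol_def)
      then show ?thesis using rinv_col[OF x0 m i(1)] False by simp
    next
      case True
      have "rop n p l Z (\<lambda>k. x0 k i) m = ip n c (mv p (zcol j Z) (\<lambda>k. x0 k i))"
        using True xj by (simp add: rop_def e c_def[abs_def])
      also have "\<dots> = ip p (\<lambda>k. ip n (\<lambda>i. zcol j Z i k) c) (\<lambda>k. x0 k i)" by (rule ip_mv_adjoint)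
      also have "\<dots> = y i"
        by (simp add: y_def ip_def mv_def rinv_sym[OF x0, of i] mult.commute)
      finally show ?thesis using True i by simp
    qed
    finally show ?thesis using i d_pos by (auto simp: yh_def)
  qed
  then have "?u k = mv p x (\<lambda>m. if m = i then 1 else 0) k"
    by (rule rinv_unique[OF x _ k])
  also have "\<dots> = x k i" using i by (simp add: mv_unit)
  finally show ?thesis by (simp add: mult.commute)
qed

lemma x_diag_ge: "i < p \<Longrightarrow> i \<noteq> j \<Longrightarrow> x0 i i \<le> x i i"
  using x_off[of i i] d_pos by simp

lemma sum_yh_sq: "(\<Sum>k<p. (yh k)\<^sup>2) = 1 + ip p y y"
proof -
  have "(yh k)\<^sup>2 = (if k = j then 1 else 0) + y k * y k" for k
    using y_j by (auto simp: yh_def power2_eq_square)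
  then show ?thesis using j by (simp add: sum.distrib ip_def)
qed

lemma x_col_norm: "(\<Sum>k<p. (x k j)\<^sup>2) = (1 + ip p y y) * (x j j)\<^sup>2"
  using sum_yh_sq by (simp add: x_col x_diag_j power_divide sum_divide_distrib[symmetric])

lemma mv_x_yh: assumes k: "k < p"
  shows "mv p x yh k = yh k * (1 + ip p y y) / d - mv p x0 y k"
proof -
  have "x k i * yh i = yh i * yh i * yh k / d - x0 k i * y i" if "i < p" for i
  proof (cases "i = j")
    case True then show ?thesis using y_j x_col[OF k] by (simp add: yh_def)
  next
    case False then show ?thesis using x_off[OF that False k] by (simp add: yh_def algebra_simps)
  qed
  then have "mv p x yh k = (\<Sum>i<p. yh i * yh i * yh k / d - x0 k i * y i)"
    unfolding mv_def by (intro sum.cong) auto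
  also have "\<dots> = (\<Sum>i<p. (yh i)\<^sup>2) * yh k / d - mv p x0 y k"
    by (simp add: sum_subtractf mv_def sum_distrib_right sum_divide_distrib power2_eq_square)
  finally show ?thesis by (simp add: sum_yh_sq mult.commute)
qed

text \<open>The columns of \<open>x\<^sup>2\<close> are needed for the trace of \<open>x\<^sup>4\<close>. The bound involves the column \<open>j\<close>
  of the array only through \<open>y\<close> and \<open>mv p x0 y\<close>, which are linear in it, and through \<open>x j j\<close>, which is
  small on the good event.\<close>

lemma x2_col_norm:
  "(\<Sum>k<p. (mv p x (\<lambda>m. x m j) k)\<^sup>2) \<le> 2 * (x j j)\<^sup>2 * ((x j j)\<^sup>2 * (1 + ip p y y) ^ 3 + ip p (mv p x0 y) (mv p x0 y))"
proof -
  have e: "mv p x (\<lambda>m. x m j) k = (x j j) * mv p x yh k" for k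
    unfolding mv_scale[symmetric] by (intro mv_cong) (simp add: x_col x_diag_j)
  let ?w = "mv p x0 y" and ?b = "1 + ip p y y"
  have "(\<Sum>k<p. (mv p x (\<lambda>m. x m j) k)\<^sup>2) = (x j j)\<^sup>2 * (\<Sum>k<p. (yh k * ?b / d - ?w k)\<^sup>2)"
    by (simp add: e mv_x_yh power_mult_distrib sum_distrib_left)
  also have "\<dots> \<le> (x j j)\<^sup>2 * (\<Sum>k<p. 2 * ((yh k)\<^sup>2 * ((x j j)\<^sup>2 * ?b\<^sup>2)) + 2 * (?w k)\<^sup>2)"
  proof (intro mult_left_mono sum_mono)
    fix k
    have "(yh k * ?b / d - ?w k)\<^sup>2 \<le> 2 * (yh k * ?b / d)\<^sup>2 + 2 * (?w k)\<^sup>2" by (rule sq_diff_le)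
    also have "(yh k * ?b / d)\<^sup>2 = (yh k)\<^sup>2 * ((x j j)\<^sup>2 * ?b\<^sup>2)"
      by (simp add: x_diag_j power_mult_distrib power_divide)
    finally show "(yh k * ?b / d - ?w k)\<^sup>2 \<le> 2 * ((yh k)\<^sup>2 * ((x j j)\<^sup>2 * ?b\<^sup>2)) + 2 * (?w k)\<^sup>2" by simp
  qed simp
  also have "(\<Sum>k<p. 2 * ((yh k)\<^sup>2 * ((x j j)\<^sup>2 * ?b\<^sup>2)) + 2 * (?w k)\<^sup>2)
     = 2 * (?b * ((x j j)\<^sup>2 * ?b\<^sup>2)) + 2 * ip p ?w ?w"
    by (simp only: sum.distrib sum_distrib_left[symmetric] sum_distrib_right[symmetric] sum_yh_sq)
       (simp add: ip_def power2_eq_square)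
  finally show ?thesis by (simp add: power2_eq_square power3_eq_cube algebra_simps)
qed

text \<open>The coefficient vectors of \<open>y\<close> and of \<open>mv p x0 y\<close> as linear forms in the column \<open>c\<close>; they depend
  on the other columns only.\<close>

definition g :: "nat \<Rightarrow> nat \<Rightarrow> real" where "g k = mv p (zcol j Z) (\<lambda>m. x0 m k)"
definition h :: "nat \<Rightarrow> nat \<Rightarrow> real" where "h k = mv p (zcol j Z) (mv p x0 (\<lambda>m. x0 m k))"

lemma y_lin: "k < p \<Longrightarrow> y k = ip n (g k) c"
proof -
  have "ip n (g k) c = ip p (\<lambda>m. x0 m k) (\<lambda>m. ip n (\<lambda>i. zcol j Z i m) c)"
    unfolding g_def by (subst ip_commute) (simp add: ip_mv_adjoint ip_commute)
  then show ?thesis by (simp add: y_def ip_def mv_def rinv_sym[OF x0, of k])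
qed

lemma w_lin: "k < p \<Longrightarrow> mv p x0 y k = ip n (h k) c"
proof -
  have "ip n (h k) c = ip p (mv p x0 (\<lambda>m. x0 m k)) (\<lambda>m. ip n (\<lambda>i. zcol j Z i m) c)"
    unfolding h_def by (subst ip_commute) (simp add: ip_mv_adjoint ip_commute)
  also have "\<dots> = ip p (\<lambda>m. x0 m k) y"
    by (simp add: y_def ip_mv_rinv_sym[OF x0])
  finally show ?thesis by (simp add: ip_def mv_def rinv_sym[OF x0, of k])
qed

lemma zero_col:
  assumes k: "k < p" and z: "\<And>i. zcol j Z i k = 0"
  shows "g k i = 0" and "h k i = 0"
proof -
  have e: "x0 m k = (if m = k then 1 / l else 0)" if m: "m < p" for m
    using rinv_col[OF x0 k m] l unfolding rop_def by (simp add: z ip_def rinv_sym[OF x0, of k m] field_simps split: if_splits)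
  have "g k i = mv p (zcol j Z) (\<lambda>m. if m = k then 1 / l else 0) i"
    unfolding g_def by (intro mv_cong) (simp add: e)
  then show "g k i = 0" using k by (simp add: mv_unit z)
  have "mv p x0 (\<lambda>m. x0 m k) a = (if a = k then 1 / l * (1 / l) else 0)" if "a < p" for a
  proof -
    have "mv p x0 (\<lambda>m. x0 m k) a = mv p x0 (\<lambda>m. if m = k then 1 / l else 0) a"
      by (intro mv_cong) (simp add: e)
    then show ?thesis using e[OF that] k by (simp add: mv_unit)
  qed
  then have "h k i = mv p (zcol j Z) (\<lambda>m. if m = k then 1 / l * (1 / l) else 0) i"
    unfolding h_def by (intro mv_cong) simp
  then show "h k i = 0" using k by (simp add: mv_unit z)
qed

lemma g_norm: "k < p \<Longrightarrow> ip n (g k) (g k) \<le> x0 k k"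
  using rinv_diag[OF x0, of k] l ip_self_nonneg[of p "\<lambda>m. x0 m k"] by (simp add: g_def)

lemma h_norm: "k < p \<Longrightarrow> ip n (h k) (h k) \<le> ip p (\<lambda>m. x0 m k) (mv p x0 (\<lambda>m. x0 m k))"
  using rinv_form[OF x0, of "\<lambda>m. x0 m k" "\<lambda>m. x0 m k"] l ip_self_nonneg[of p "mv p x0 (\<lambda>m. x0 m k)"]
  by (simp add: h_def)

end

section \<open>Deleting a row\<close>

lemma rop_zrow:
  assumes r: "r < n"
  shows "rop n p l Z v k = rop n p l (zrow r Z) v k + Z r k * ip p (Z r) v"
proof -
  have "ip n (\<lambda>i. Z i k) (mv p Z v) = (\<Sum>i<n. (zrow r Z) i k * mv p (zrow r Z) v i + (if i = r then Z r k * ip p (Z r) v else 0))"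
    unfolding ip_def by (intro sum.cong) (auto simp: zrow_def mv_def ip_def)
  also have "\<dots> = ip n (\<lambda>i. zrow r Z i k) (mv p (zrow r Z) v) + Z r k * ip p (Z r) v"
    using r by (simp add: sum.distrib ip_def)
  finally show ?thesis by (simp add: rop_def)
qed

text \<open>The rank-one update formula of Sherman and Morrison.\<close>

lemma row_removal:
  assumes x: "is_rinv n p l Z x" and x': "is_rinv n p l (zrow r Z) x'" and r: "r < n"
  shows "k < p \<Longrightarrow> mv p x' (Z r) k = (1 + ip p (Z r) (mv p x' (Z r))) * mv p x (Z r) k"
    and "ip p (Z r) (mv p x' (Z r)) = (1 + ip p (Z r) (mv p x' (Z r))) * ip p (Z r) (mv p x (Z r))"
proof -
  let ?a = "ip p (Z r) (mv p x' (Z r))"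
  have *: "mv p x' (Z r) k = (1 + ?a) * mv p x (Z r) k" if k: "k < p" for k
  proof -
    have "rop n p l Z (mv p x' (Z r)) m = (1 + ?a) * Z r m" if "m < p" for m
      using rinv_solves[OF x' that, of "Z r"] by (simp add: rop_zrow[OF r, of p l Z] algebra_simps)
    then have "mv p x' (Z r) k = mv p x (\<lambda>m. (1 + ?a) * Z r m) k"
      by (rule rinv_unique[OF x _ k])
    then show ?thesis by (simp add: mv_scale)
  qed
  then show "k < p \<Longrightarrow> mv p x' (Z r) k = (1 + ?a) * mv p x (Z r) k" .
  have "?a = ip p (Z r) (\<lambda>k. (1 + ?a) * mv p x (Z r) k)"
    using * by (intro ip_cong) auto
  then show "?a = (1 + ?a) * ip p (Z r) (mv p x (Z r))" by (simp add: ip_scale_right)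
qed

lemma row_removal_exists:
  assumes x: "is_rinv n p l Z x" and r: "r < n"
    and h: "ip p (Z r) (mv p x (Z r)) < 1"
  defines "x' \<equiv> \<lambda>i k. x i k + mv p x (Z r) i * mv p x (Z r) k / (1 - ip p (Z r) (mv p x (Z r)))"
  shows "is_rinv n p l (zrow r Z) x'"
  unfolding is_rinv_def
proof (intro conjI allI impI)
  let ?h = "ip p (Z r) (mv p x (Z r))" and ?u = "mv p x (Z r)"
  show "x' j k = x' k j" for j k by (simp add: x'_def rinv_sym[OF x, of j k] mult.commute)
  show "x' j k = 0" if "p \<le> j \<or> p \<le> k" for j k
    using that by (auto simp: x'_def rinv_out[OF x] mv_rinv_out[OF x])
  fix j k assume j: "j < p" and k: "k < p"
  have R: "rop n p l (zrow r Z) v j = rop n p l Z v j - Z r j * ip p (Z r) v" for v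
    by (simp add: rop_zrow[OF r, of p l Z])
  have x'c: "(\<lambda>m. x' m k) = (\<lambda>m. x m k + ?u k / (1 - ?h) * ?u m)"
    by (rule ext) (simp add: x'_def mult.commute)
  have uk: "ip p (Z r) (\<lambda>m. x m k) = ?u k"
    by (simp add: ip_def mv_def rinv_sym[OF x, of k] mult.commute)
  have "rop n p l Z (\<lambda>m. x' m k) j = (if j = k then 1 else 0) + ?u k / (1 - ?h) * Z r j"
    unfolding x'c by (simp only: rop_add rop_scale rinv_col[OF x j k] rinv_solves[OF x j])
  moreover have "ip p (Z r) (\<lambda>m. x' m k) = ?u k + ?u k / (1 - ?h) * ?h"
    unfolding x'c by (simp only: ip_linear uk)
  moreover have "?u k + ?u k / (1 - ?h) * ?h = ?u k / (1 - ?h)"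
    using h by (simp add: field_simps)
  ultimately show "rop n p l (zrow r Z) (\<lambda>m. x' m k) j = (if j = k then 1 else 0)"
    by (simp add: R)
qed

text \<open>An observation with leverage at most one half can be deleted at the cost of a factor two, after
  which its row is independent of the remaining inverse.\<close>

lemma row_removal_diag:
  assumes x: "is_rinv n p l Z x" and l: "l \<ge> 0" and x': "is_rinv n p l (zrow r Z) x'" and r: "r < n"
    and h: "ip p (Z r) (mv p x (Z r)) \<le> 1/2" and k: "k < p"
  shows "x' k k \<le> 2 * x k k"
proof -
  let ?h = "ip p (Z r) (mv p x (Z r))" and ?u = "mv p x (Z r)"
  let ?x = "\<lambda>i k. x i k + ?u i * ?u k / (1 - ?h)"
  have X: "is_rinv n p l (zrow r Z) ?x" using row_removal_exists[OF x r] h by simp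
  have "x' k k = mv p ?x (\<lambda>m. if m = k then 1 else 0) k"
    by (rule rinv_unique[OF X _ k]) (use rinv_col[OF x' _ k] in auto)
  then have e: "x' k k = x k k + ?u k * ?u k / (1 - ?h)" using k by (simp add: mv_unit)
  have "(?u k)\<^sup>2 \<le> x k k * ?h"
    using rinv_cauchy[OF x l, of "\<lambda>m. if m = k then 1 else 0" "Z r"] k
    by (simp add: ip_unit_left mv_unit)
  also have "\<dots> \<le> x k k * (1 - ?h)"
    using h rinv_diag_nonneg[OF x l] by (intro mult_left_mono) auto
  finally have "?u k * ?u k / (1 - ?h) \<le> x k k"
    using h by (simp add: pos_divide_le_eq power2_eq_square)
  with e show ?thesis by simp
qed

text \<open>Since \<open>1 / x' j j\<close> is a penalized residual sum of squares, deleting a row lowers it by the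
  squared residual of that row divided by the corresponding diagonal entry of the residual matrix. The
  hypothesis \<open>small\<close> is exactly what bounds this quotient by \<open>e\<close>; it is stated for the full array, where
  the residual is a linear form in the column \<open>j\<close>.\<close>

lemma row_col_removal:
  assumes A: "col_split n p l Z x x0 j" and B: "col_split n p l (zrow r Z) x' x0' j" and r: "r < n"
    and e: "e \<ge> 0"
    and small: "(res n p (zcol j Z) x0 (\<lambda>i. Z i j) r)\<^sup>2 \<le> e * resmat n p (zcol j Z) x0 r r"
  shows "ip n (\<lambda>i. Z i j) (res n p (zcol j Z) x0 (\<lambda>i. Z i j)) - e \<le> 1 / x' j j"
proof -
  interpret A: col_split n p l Z x x0 j by (rule A)
  interpret B: col_split n p l "zrow r Z" x' x0' j by (rule B)
  let ?Z0 = "zcol j Z" and ?c = "\<lambda>i. Z i j"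
  define b where "b = B.y"
  define t where "t = ?c r - mv p ?Z0 b r"
  define u where "u i = ?c i - t * (if i = r then 1 else 0)" for i
  let ?P = "resmat n p ?Z0 x0 r r" and ?s = "res n p ?Z0 x0 ?c r"
  have zz: "zcol j (zrow r Z) i k = (if i = r then 0 else ?Z0 i k)" for i k by (simp add: zcol_def zrow_def)
  have BR: "B.r i = (if i = r then 0 else ?c i - mv p ?Z0 b i)" for i
  proof -
    have "mv p (zcol j (zrow r Z)) b i = (if i = r then 0 else mv p ?Z0 b i)" by (simp add: mv_def zz)
    then show ?thesis by (simp add: B.r_eq B.c_def b_def zrow_def)
  qed
  have "1 / x' j j = l + (ip n B.r B.r + l * ip p b b)"
    using B.x_diag_j B.ip_c_r by (simp add: B.d_def b_def)
  also have "ip n B.r B.r = ip n (\<lambda>i. u i - mv p ?Z0 b i) (\<lambda>i. u i - mv p ?Z0 b i)"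
    by (intro ip_cong) (auto simp: BR u_def t_def)
  also have "l + (ip n (\<lambda>i. u i - mv p ?Z0 b i) (\<lambda>i. u i - mv p ?Z0 b i) + l * ip p b b)
     \<ge> ip n u (res n p ?Z0 x0 u)"
    using res_variational[OF A.x0, of u b] A.l by simp
  also have "ip n u (res n p ?Z0 x0 u) = ip n ?c (res n p ?Z0 x0 ?c) - 2 * t * ?s + t\<^sup>2 * ?P"
  proof -
    let ?e = "\<lambda>i. if i = r then 1 else (0::real)"
    have R: "res n p ?Z0 x0 u i = res n p ?Z0 x0 ?c i - t * res n p ?Z0 x0 ?e i" for i
      by (simp add: res_def u_def[abs_def] ip_linear mv_linear[abs_def] algebra_simps)
    have 1: "ip n ?e (res n p ?Z0 x0 ?c) = ?s" using r by (simp add: ip_unit_left)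
    have 2: "ip n ?c (res n p ?Z0 x0 ?e) = ?s"
      using r by (simp add: res_sym[OF A.x0] ip_unit)
    have 3: "ip n ?e (res n p ?Z0 x0 ?e) = ?P" using r by (simp add: ip_unit_left resmat_eq[OF A.x0])
    show ?thesis
      unfolding R[abs_def] unfolding u_def
      by (simp only: ip_linear 1 2 3) (simp add: power2_eq_square algebra_simps)
  qed
  finally have M: "ip n ?c (res n p ?Z0 x0 ?c) - 2 * t * ?s + t\<^sup>2 * ?P \<le> 1 / x' j j" .
  have "- 2 * t * ?s + t\<^sup>2 * ?P \<ge> - e"
  proof (cases "?P = 0")
    case True
    then have "?s = 0" using small by simp
    then show ?thesis using True e by simp
  next
    case False
    have "?P \<ge> 0" using resmat_col_norm[OF A.x0 _ r] A.l sum_nonneg[of "{..<n}" "\<lambda>i. (resmat n p ?Z0 x0 i r)\<^sup>2"] by (simp add: order_trans)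
    with False have P: "?P > 0" by simp
    have "0 \<le> (t * ?P - ?s)\<^sup>2" by simp
    then have "2 * t * ?s * ?P - t\<^sup>2 * ?P * ?P \<le> ?s\<^sup>2" by (simp add: power2_eq_square algebra_simps)
    also note small
    finally have "(2 * t * ?s - t\<^sup>2 * ?P) * ?P \<le> e * ?P" by (simp add: algebra_simps)
    then have "2 * t * ?s - t\<^sup>2 * ?P \<le> e" using P by (rule mult_right_le_imp_le)
    then show ?thesis by simp
  qed
  with M show ?thesis by simp
qed

section \<open>Removing the penalty\<close>

text \<open>The two inverses satisfy \<open>x0 = x + l x x0\<close>, and \<open>l x\<close> has norm at most the trace of \<open>l x\<close>, which is
  at most one half.\<close>

lemma ridge_to_ols:
  assumes x: "is_rinv n p l Z x" and x0: "is_rinv n p 0 Z x0" and l: "l > 0"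
    and t: "l * (\<Sum>k<p. x k k) \<le> 1/2"
  shows "ip p v (mv p x0 v) \<le> ip p v (mv p x v) / (1 - l * (\<Sum>k<p. x k k))"
    and "ip p (mv p x0 v) (mv p x0 v) \<le> 4 * ip p (mv p x v) (mv p x v)"
proof -
  let ?T = "\<Sum>k<p. x k k"
  let ?u = "mv p x0 v" and ?w = "mv p x v"
  define e where "e k = ?u k - ?w k" for k
  have e: "e k = l * mv p x ?u k" if k: "k < p" for k
  proof -
    have "rop n p l Z ?u m = v m + l * ?u m" if "m < p" for m
      using rinv_solves[OF x0 that, of v] by (simp add: rop_def)
    then have "?u k = mv p x (\<lambda>m. v m + l * ?u m) k" by (rule rinv_unique[OF x _ k])
    then show ?thesis by (simp add: mv_linear e_def)
  qed
  have e': "?u k = ?w k + l * mv p x ?u k" if k: "k < p" for k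
    using e[OF k] unfolding e_def by linarith
  have l0: "l \<ge> 0" using l by simp
  have T: "?T \<ge> 0" using rinv_diag_nonneg[OF x l0] by (intro sum_nonneg) auto
  have nxu: "ip p (mv p x a) (mv p x a) \<le> ?T * ip p a (mv p x a)" for a
  proof -
    have "(ip p (mv p x a) (mv p x a))\<^sup>2 \<le> ip p (mv p x a) (mv p x (mv p x a)) * ip p a (mv p x a)"
      using rinv_cauchy[OF x l0, of "mv p x a" a] by simp
    also have "\<dots> \<le> (?T * ip p (mv p x a) (mv p x a)) * ip p a (mv p x a)"
      using rinv_trace_bound[OF x l0] rinv_psd[OF x l0] by (intro mult_right_mono) auto
    finally have *: "ip p (mv p x a) (mv p x a) * ip p (mv p x a) (mv p x a) \<le> (?T * ip p a (mv p x a)) * ip p (mv p x a) (mv p x a)"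
      by (simp add: power2_eq_square algebra_simps)
    show ?thesis
    proof (cases "ip p (mv p x a) (mv p x a) = 0")
      case True then show ?thesis using T rinv_psd[OF x l0] by simp
    next
      case False
      then have "ip p (mv p x a) (mv p x a) > 0" using ip_self_nonneg[of p "mv p x a"] by simp
      then show ?thesis using * by simp
    qed
  qed
  define v' where "v' k = v k + l * ?u k" for k
  have u: "?u k = mv p x v' k" if k: "k < p" for k
  proof -
    have "rop n p l Z ?u m = v' m" if "m < p" for m
      using rinv_solves[OF x0 that, of v] by (simp add: rop_def v'_def)
    then show ?thesis by (rule rinv_unique[OF x _ k])
  qed
  have ipu: "ip p a (mv p x v') = ip p a ?u" for a by (intro ip_cong) (simp_all add: u)
  have uu: "ip p ?u ?u \<le> ?T * ip p v' ?u"
  proof -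
    have "ip p ?u ?u = ip p (mv p x v') (mv p x v')" by (intro ip_cong) (simp_all only: u)
    then show ?thesis using nxu[of v'] by (simp only: ipu)
  qed
  have v'u: "ip p v' ?u = ip p v ?u + l * ip p ?u ?u" by (simp add: v'_def[abs_def] ip_linear)
  have pos: "1 - l * ?T > 0" using t by simp
  have vu: "ip p v ?u \<ge> 0" by (rule rinv_psd[OF x0]) simp
  show "ip p v ?u \<le> ip p v ?w / (1 - l * ?T)"
  proof -
    have "l * ip p ?u ?u \<le> l * (?T * ip p v' ?u)" using uu l by (intro mult_left_mono) auto
    then have "ip p v' ?u * (1 - l * ?T) \<le> ip p v ?u" using v'u by (simp add: algebra_simps)
    then have 1: "ip p v' ?u \<le> ip p v ?u / (1 - l * ?T)" using pos by (simp add: pos_le_divide_eq)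
    have "(ip p v ?u)\<^sup>2 \<le> ip p v ?w * ip p v' ?u"
      using rinv_cauchy[OF x l0, of v v'] by (simp add: ipu)
    also have "\<dots> \<le> ip p v ?w * (ip p v ?u / (1 - l * ?T))"
      using 1 rinv_psd[OF x l0] by (intro mult_left_mono) auto
    finally have 2: "ip p v ?u * ip p v ?u \<le> (ip p v ?w / (1 - l * ?T)) * ip p v ?u"
      by (simp add: power2_eq_square)
    show ?thesis
    proof (cases "ip p v ?u = 0")
      case True then show ?thesis using pos rinv_psd[OF x l0] by simp
    next
      case False
      then have "ip p v ?u > 0" using vu by simp
      with 2 show ?thesis by (rule mult_right_le_imp_le)
    qed
  qed
  show "ip p ?u ?u \<le> 4 * ip p ?w ?w"
  proof -
    have "ip p ?u ?u = ip p (\<lambda>k. ?w k + l * mv p x ?u k) (\<lambda>k. ?w k + l * mv p x ?u k)"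
      by (intro ip_cong e')
    also have "\<dots> \<le> 2 * ip p ?w ?w + 2 * (l\<^sup>2 * ip p (mv p x ?u) (mv p x ?u))"
    proof -
      have "0 \<le> ip p (\<lambda>k. ?w k - l * mv p x ?u k) (\<lambda>k. ?w k - l * mv p x ?u k)" by (rule ip_self_nonneg)
      then show ?thesis by (simp add: ip_linear ip_commute[of p "mv p x ?u" ?w] power2_eq_square algebra_simps)
    qed
    also have "l\<^sup>2 * ip p (mv p x ?u) (mv p x ?u) \<le> l\<^sup>2 * (?T * (?T * ip p ?u ?u))"
      using nxu[of ?u] rinv_trace_bound[OF x l0, of ?u] T
      by (intro mult_left_mono order_trans[OF nxu]) (auto intro: mult_left_mono)
    also have "l\<^sup>2 * (?T * (?T * ip p ?u ?u)) = (l * ?T)\<^sup>2 * ip p ?u ?u" by (simp add: power2_eq_square)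
    also have "\<dots> \<le> (1/2)\<^sup>2 * ip p ?u ?u"
      using t l T by (intro mult_right_mono power_mono ip_self_nonneg) auto
    finally show ?thesis by (simp add: power2_eq_square)
  qed
qed

section \<open>Matrix inverses\<close>

lemma minv_inverse:
  assumes A: "A \<in> carrier_mat m m" and d: "det A \<noteq> 0"
  shows "minv A \<in> carrier_mat m m" "A * minv A = 1\<^sub>m m" "minv A * A = 1\<^sub>m m"
proof -
  have "mat_inverse A \<noteq> None"
    using mat_inverse(1)[OF A, of "()"] det_non_zero_imp_unit[OF A d, of "()"] by auto
  then obtain B where "mat_inverse A = Some B" by auto
  with mat_inverse(2)[OF A this]
  show "minv A \<in> carrier_mat m m" "A * minv A = 1\<^sub>m m" "minv A * A = 1\<^sub>m m" by (auto simp: minv_def)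
qed

lemma minv_unique:
  assumes A: "A \<in> carrier_mat m m" and B: "B \<in> carrier_mat m m" and AB: "A * B = 1\<^sub>m m"
  shows "minv A = B" "det A \<noteq> 0"
proof -
  have "det A * det B = 1" using det_mult[OF A B] AB by simp
  then show d: "det A \<noteq> 0" by auto
  note I = minv_inverse[OF A d]
  have "minv A = minv A * (A * B)" using I(1) AB by simp
  also have "\<dots> = (minv A * A) * B" using assoc_mult_mat[OF I(1) A B] by simp
  also have "\<dots> = B" using I(3) B by simp
  finally show "minv A = B" .
qed

lemma invertible_mat_iff_det:
  fixes A :: "real mat"
  assumes A: "A \<in> carrier_mat m m"
  shows "invertible_mat A \<longleftrightarrow> det A \<noteq> 0"
proof
  assume "invertible_mat A"
  then obtain B where B: "A * B = 1\<^sub>m (dim_row A)" "B * A = 1\<^sub>m (dim_row B)"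
    unfolding invertible_mat_def inverts_mat_def by auto
  have "dim_col (A * B) = m" using B(1) A by simp
  then have c: "dim_col B = m" by simp
  have "dim_col (B * A) = dim_row B" using B(2) by simp
  then have r: "dim_row B = m" using A by simp
  have "B \<in> carrier_mat m m" using c r by auto
  from minv_unique(2)[OF A this] B(1) A show "det A \<noteq> 0" by simp
next
  assume d: "det A \<noteq> 0"
  note I = minv_inverse[OF A d]
  have "inverts_mat A (minv A)" "inverts_mat (minv A) A"
    using I A by (auto simp: inverts_mat_def)
  then show "invertible_mat A" using A by (auto simp: invertible_mat_def)
qed

text \<open>The unspecified value is at least the same for all singular matrices. This makes \<open>minv\<close> a measurable
  function without any case distinction in the statements that use it.\<close>

lemma minv_singular:
  assumes A: "A \<in> carrier_mat m m" and d: "det A = 0"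
  shows "minv A = the None"
proof (cases "mat_inverse A")
  case None then show ?thesis by (simp add: minv_def)
next
  case (Some B)
  from mat_inverse(2)[OF A this] have "A * B = 1\<^sub>m m" "B \<in> carrier_mat m m" by auto
  from minv_unique(2)[OF A this(2,1)] d show ?thesis by simp
qed

text \<open>Cramer's rule, from which the measurability of the inverse follows.\<close>

lemma minv_adj:
  assumes A: "A \<in> carrier_mat m m" and d: "det A \<noteq> 0" and ij: "i < m" "j < m"
  shows "minv A $$ (i, j) = cofactor A j i / det A"
proof -
  let ?B = "(1 / det A) \<cdot>\<^sub>m adj_mat A"
  note a = adj_mat[OF A]
  have "A * ?B = (1 / det A) \<cdot>\<^sub>m (A * adj_mat A)" using A a by (intro mult_smult_distrib) auto
  also have "\<dots> = 1\<^sub>m m" using a d by (auto intro!: eq_matI)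
  finally have "minv A = ?B" using minv_unique(1)[OF A _ ] a by auto
  then show ?thesis using ij a A by (auto simp: adj_mat_def)
qed

lemma borel_measurable_det:
  assumes A: "\<And>\<omega>. \<omega> \<in> space N \<Longrightarrow> A \<omega> \<in> carrier_mat m m"
    and e: "\<And>i j. i < m \<Longrightarrow> j < m \<Longrightarrow> (\<lambda>\<omega>. A \<omega> $$ (i, j) :: real) \<in> borel_measurable N"
  shows "(\<lambda>\<omega>. det (A \<omega>)) \<in> borel_measurable N"
proof -
  have "(\<lambda>\<omega>. \<Sum> p \<in> {p. p permutes {0 ..< m}}. signof p * (\<Prod> i = 0 ..< m. A \<omega> $$ (i, p i))) \<in> borel_measurable N"
  proof (intro borel_measurable_sum borel_measurable_times borel_measurable_const borel_measurable_prod)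
    fix p i assume p: "p \<in> {p. p permutes {0..<m}}" and i: "i \<in> {0..<m}"
    then have "p i < m" using permutes_in_image[of p "{0..<m}" i] by auto
    then show "(\<lambda>\<omega>. A \<omega> $$ (i, p i)) \<in> borel_measurable N" using e i by auto
  qed
  then show ?thesis by (subst measurable_cong[OF det_def'[OF A]])
qed

lemma borel_measurable_cofactor:
  assumes A: "\<And>\<omega>. \<omega> \<in> space N \<Longrightarrow> A \<omega> \<in> carrier_mat m m"
    and e: "\<And>i j. i < m \<Longrightarrow> j < m \<Longrightarrow> (\<lambda>\<omega>. A \<omega> $$ (i, j) :: real) \<in> borel_measurable N"
    and ij: "i < m" "j < m"
  shows "(\<lambda>\<omega>. cofactor (A \<omega>) i j) \<in> borel_measurable N"
proof -
  have "(\<lambda>\<omega>. det (mat_delete (A \<omega>) i j)) \<in> borel_measurable N"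
  proof (rule borel_measurable_det)
    show "mat_delete (A \<omega>) i j \<in> carrier_mat (m - 1) (m - 1)" if "\<omega> \<in> space N" for \<omega>
      by (rule mat_delete_carrier[OF A[OF that]])
    fix i' j' assume b: "i' < m - 1" "j' < m - 1"
    have "(\<lambda>\<omega>. A \<omega> $$ (if i' < i then i' else Suc i', if j' < j then j' else Suc j')) \<in> borel_measurable N"
      using b by (intro e) auto
    moreover have "mat_delete (A \<omega>) i j $$ (i', j') = A \<omega> $$ (if i' < i then i' else Suc i', if j' < j then j' else Suc j')"
      if "\<omega> \<in> space N" for \<omega>
      using A[OF that] b by (auto simp: mat_delete_def)
    ultimately show "(\<lambda>\<omega>. mat_delete (A \<omega>) i j $$ (i', j')) \<in> borel_measurable N"
      by (subst measurable_cong) auto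
  qed
  then show ?thesis unfolding cofactor_def by measurable
qed

lemma borel_measurable_minv:
  assumes A: "\<And>\<omega>. \<omega> \<in> space N \<Longrightarrow> A \<omega> \<in> carrier_mat m m"
    and e: "\<And>i j. i < m \<Longrightarrow> j < m \<Longrightarrow> (\<lambda>\<omega>. A \<omega> $$ (i, j) :: real) \<in> borel_measurable N"
    and ij: "i < m" "j < m"
  shows "(\<lambda>\<omega>. minv (A \<omega>) $$ (i, j)) \<in> borel_measurable N"
proof -
  note [measurable] = borel_measurable_det[OF A e] borel_measurable_cofactor[OF A e ij(2,1)]
  have "(\<lambda>\<omega>. if det (A \<omega>) = 0 then (the None :: real mat) $$ (i, j) else cofactor (A \<omega>) j i / det (A \<omega>)) \<in> borel_measurable N"
    by measurable
  moreover have "minv (A \<omega>) $$ (i, j) = (if det (A \<omega>) = 0 then (the None :: real mat) $$ (i, j) else cofactor (A \<omega>) j i / det (A \<omega>))"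
    if "\<omega> \<in> space N" for \<omega>
    using minv_adj[OF A[OF that] _ ij] minv_singular[OF A[OF that]] by auto
  ultimately show ?thesis by (subst measurable_cong) auto
qed

text \<open>The bridge from arrays to matrices. For a singular Gram matrix \<open>rinv\<close> has a meaningless but measurable
  value.\<close>

definition gram :: "nat \<Rightarrow> nat \<Rightarrow> real \<Rightarrow> (nat \<Rightarrow> nat \<Rightarrow> real) \<Rightarrow> real mat" where
  "gram n p l Z = Matrix.mat p p (\<lambda>(j, k). ip n (\<lambda>i. Z i j) (\<lambda>i. Z i k) + (if j = k then l else 0))"

definition rinv :: "nat \<Rightarrow> nat \<Rightarrow> real \<Rightarrow> (nat \<Rightarrow> nat \<Rightarrow> real) \<Rightarrow> nat \<Rightarrow> nat \<Rightarrow> real" where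
  "rinv n p l Z j k = (if j < p \<and> k < p then minv (gram n p l Z) $$ (j, k) else 0)"

lemma gram_carrier[simp]: "gram n p l Z \<in> carrier_mat p p" by (simp add: gram_def)

lemma gram_dim[simp]: "dim_row (gram n p l Z) = p" "dim_col (gram n p l Z) = p" by (simp_all add: gram_def)

lemma gram_rop:
  assumes j: "j < p"
  shows "(\<Sum>k<p. gram n p l Z $$ (j, k) * v k) = rop n p l Z v j"
proof -
  have "(\<Sum>k<p. gram n p l Z $$ (j, k) * v k) = (\<Sum>k<p. ip n (\<lambda>i. Z i j) (\<lambda>i. Z i k) * v k + (if k = j then l * v j else 0))"
    using j by (intro sum.cong) (auto simp: gram_def algebra_simps)
  also have "\<dots> = (\<Sum>k<p. ip n (\<lambda>i. Z i j) (\<lambda>i. Z i k) * v k) + l * v j"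
    using j by (simp add: sum.distrib)
  also have "(\<Sum>k<p. ip n (\<lambda>i. Z i j) (\<lambda>i. Z i k) * v k) = ip n (\<lambda>i. Z i j) (mv p Z v)"
    unfolding ip_def mv_def sum_distrib_left sum_distrib_right
    by (subst sum.swap) (simp add: ac_simps)
  finally show ?thesis by (simp add: rop_def)
qed

lemma rinv_is_rinv:
  assumes d: "det (gram n p l Z) \<noteq> 0"
  shows "is_rinv n p l Z (rinv n p l Z)"
proof -
  let ?G = "gram n p l Z"
  note I = minv_inverse[OF gram_carrier d]
  have GT: "transpose_mat ?G = ?G"
    by (intro eq_matI) (auto simp: gram_def ip_commute)
  have "transpose_mat (minv ?G) * ?G = 1\<^sub>m p"
  proof -
    have "transpose_mat (?G * minv ?G) = transpose_mat (minv ?G) * transpose_mat ?G"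
      using I by (intro transpose_mult[of _ p p _ p]) auto
    then show ?thesis using I GT by simp
  qed
  then have "?G * transpose_mat (minv ?G) = 1\<^sub>m p"
    using mat_mult_left_right_inverse[of "transpose_mat (minv ?G)" p ?G] I by auto
  then have S: "minv ?G = transpose_mat (minv ?G)"
    using minv_unique(1)[of ?G p "transpose_mat (minv ?G)"] I by auto
  have sym: "minv ?G $$ (j, k) = minv ?G $$ (k, j)" if "j < p" "k < p" for j k
    using that I by (subst S) auto
  show ?thesis unfolding is_rinv_def
  proof (intro conjI allI impI)
    fix j k assume j: "j < p" and k: "k < p"
    have "(?G * minv ?G) $$ (j, k) = (\<Sum>m<p. ?G $$ (j, m) * minv ?G $$ (m, k))"
      using j k I(1) by (auto simp: scalar_prod_def atLeast0LessThan intro!: sum.cong)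
    also have "\<dots> = (\<Sum>m<p. ?G $$ (j, m) * rinv n p l Z m k)"
      using k by (intro sum.cong) (auto simp: rinv_def)
    also have "\<dots> = rop n p l Z (\<lambda>m. rinv n p l Z m k) j" by (rule gram_rop[OF j])
    finally show "rop n p l Z (\<lambda>m. rinv n p l Z m k) j = (if j = k then 1 else 0)"
      using I(2) j k by simp
  qed (auto simp: rinv_def sym)
qed

text \<open>An injective operator on a finite-dimensional space is invertible.\<close>

lemma det_gram_nonzeroI:
  assumes inj: "\<And>v. (\<And>j. j < p \<Longrightarrow> rop n p l Z v j = 0) \<Longrightarrow> (\<And>j. j < p \<Longrightarrow> v j = 0)"
  shows "det (gram n p l Z) \<noteq> 0"
proof
  assume "det (gram n p l Z) = 0"
  then obtain v where v: "v \<in> carrier_vec p" "v \<noteq> 0\<^sub>v p" "gram n p l Z *\<^sub>v v = 0\<^sub>v p"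
    using det_0_iff_vec_prod_zero_field[OF gram_carrier[of n p l Z]] by auto
  have "rop n p l Z (\<lambda>k. v $ k) j = 0" if j: "j < p" for j
  proof -
    have "(gram n p l Z *\<^sub>v v) $ j = (\<Sum>k<p. gram n p l Z $$ (j, k) * v $ k)"
      using j v(1) by (auto simp: scalar_prod_def atLeast0LessThan intro!: sum.cong)
    then show ?thesis using gram_rop[OF j, of n l Z "\<lambda>k. v $ k"] v(3) j by simp
  qed
  from inj[OF this] have "v = 0\<^sub>v p" using v(1) by (intro eq_vecI) auto
  with v(2) show False by simp
qed

lemma ip_self_zero: "ip p v v = 0 \<Longrightarrow> j < p \<Longrightarrow> v j = 0"
  by (simp add: ip_def sum_nonneg_eq_0_iff)

lemma ridge_det:
  assumes l: "l > 0" shows "det (gram n p l Z) \<noteq> 0"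
proof (rule det_gram_nonzeroI)
  fix v j assume v: "\<And>j. j < p \<Longrightarrow> rop n p l Z v j = 0" and j: "j < p"
  have "ip p v (rop n p l Z v) = 0" using v by (simp add: ip_def)
  then have "ip n (mv p Z v) (mv p Z v) + l * ip p v v = 0" by (simp add: rop_form)
  then have "l * ip p v v \<le> 0" using ip_self_nonneg[of n "mv p Z v"] by linarith
  then have "ip p v v = 0" using l ip_self_nonneg[of p v] by (simp add: mult_le_0_iff)
  from ip_self_zero[OF this j] show "v j = 0" .
qed

lemma ridge_inv: "l > 0 \<Longrightarrow> is_rinv n p l Z (rinv n p l Z)"
  by (rule rinv_is_rinv[OF ridge_det])

text \<open>A null vector of \<open>Z\<^sup>T Z\<close> would be an eigenvector of the ridge inverse with eigenvalue \<open>1 / l\<close>,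
  and this exceeds the trace.\<close>

lemma ols_det:
  assumes x: "is_rinv n p l Z x" and l: "l > 0" and t: "l * (\<Sum>k<p. x k k) \<le> 1/2"
  shows "det (gram n p 0 Z) \<noteq> 0"
proof (rule det_gram_nonzeroI)
  fix v j assume v: "\<And>j. j < p \<Longrightarrow> rop n p 0 Z v j = 0" and j: "j < p"
  have "rop n p l Z v m = l * v m" if "m < p" for m
    using v[OF that] by (simp add: rop_def)
  from rinv_unique[OF x this] have e: "v k = l * mv p x v k" if "k < p" for k
    using that by (simp add: mv_scale)
  have "ip p v v = ip p v (\<lambda>k. l * mv p x v k)" using e by (intro ip_cong) auto
  also have "\<dots> = l * ip p v (mv p x v)" by (simp add: ip_linear)
  also have "\<dots> \<le> l * ((\<Sum>k<p. x k k) * ip p v v)"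
    using rinv_trace_bound[OF x] l by (intro mult_left_mono) auto
  also have "\<dots> \<le> 1/2 * ip p v v" using mult_right_mono[OF t ip_self_nonneg[of p v]] by (simp add: mult.assoc)
  finally have "ip p v v = 0" using ip_self_nonneg[of p v] by simp
  from ip_self_zero[OF this j] show "v j = 0" .
qed

lemma rinv_eq:
  assumes x: "is_rinv n p l Z x"
  shows "rinv n p l Z = x" "det (gram n p l Z) \<noteq> 0"
proof -
  show d: "det (gram n p l Z) \<noteq> 0"
  proof (rule det_gram_nonzeroI)
    fix v j assume "\<And>j. j < p \<Longrightarrow> rop n p l Z v j = 0" and j: "j < p"
    then have "v j = mv p x (\<lambda>_. 0) j" by (intro rinv_unique[OF x]) auto
    then show "v j = 0" by (simp add: mv_def)
  qed
  note R = rinv_is_rinv[OF d]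
  show "rinv n p l Z = x"
  proof (intro ext)
    fix j k
    show "rinv n p l Z j k = x j k"
    proof (cases "j < p \<and> k < p")
      case True
      then have "rinv n p l Z j k = mv p x (\<lambda>m. if m = k then 1 else 0) j"
        using rinv_col[OF R] by (intro rinv_unique[OF x]) auto
      then show ?thesis using True by (simp add: mv_unit)
    next
      case False then show ?thesis using rinv_out[OF x, of j k] by (auto simp: rinv_def)
    qed
  qed
qed

lemma borel_measurable_gram:
  assumes "\<And>i k. i < n \<Longrightarrow> k < p \<Longrightarrow> (\<lambda>\<omega>. Z \<omega> i k) \<in> borel_measurable N" "j < p" "k < p"
  shows "(\<lambda>\<omega>. gram n p l (Z \<omega>) $$ (j, k)) \<in> borel_measurable N"
  using assms by (auto simp: gram_def ip_def intro!: borel_measurable_add borel_measurable_sum borel_measurable_times)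

lemma borel_measurable_rinv:
  assumes "\<And>i k. i < n \<Longrightarrow> k < p \<Longrightarrow> (\<lambda>\<omega>. Z \<omega> i k) \<in> borel_measurable N"
  shows "(\<lambda>\<omega>. rinv n p l (Z \<omega>) j k) \<in> borel_measurable N"
proof (cases "j < p \<and> k < p")
  case True
  then show ?thesis using borel_measurable_minv[of N "\<lambda>\<omega>. gram n p l (Z \<omega>)" p j k]
    borel_measurable_gram[OF assms] by (simp add: rinv_def)
next
  case False
  then have "(\<lambda>\<omega>. rinv n p l (Z \<omega>) j k) = (\<lambda>\<omega>. 0)" by (auto simp: rinv_def fun_eq_iff)
  then show ?thesis by simp
qed

lemma borel_measurable_det_gram:
  assumes "\<And>i k. i < n \<Longrightarrow> k < p \<Longrightarrow> (\<lambda>\<omega>. Z \<omega> i k) \<in> borel_measurable N"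
  shows "(\<lambda>\<omega>. det (gram n p l (Z \<omega>))) \<in> borel_measurable N"
  by (rule borel_measurable_det[of N _ p]) (auto intro: borel_measurable_gram[OF assms])

section \<open>Conditioning on part of an array\<close>

text \<open>Conditional expectation given \<open>U\<close> in the elementary form in which it is used: by independence the
  value of \<open>U\<close> may be treated as a constant while integrating over \<open>V\<close>.\<close>

lemma (in prob_space) nn_freeze:
  fixes f :: "'b \<times> 'c \<Rightarrow> ennreal"
  assumes U[measurable]: "U \<in> measurable M S" and V[measurable]: "V \<in> measurable M T"
    and prod: "distr M S U \<Otimes>\<^sub>M distr M T V = distr M (S \<Otimes>\<^sub>M T) (\<lambda>\<omega>. (U \<omega>, V \<omega>))"
    and f[measurable]: "f \<in> borel_measurable (S \<Otimes>\<^sub>M T)" and g[measurable]: "g \<in> borel_measurable S"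
    and bound: "\<And>u. u \<in> space S \<Longrightarrow> (\<integral>\<^sup>+\<omega>. f (u, V \<omega>) \<partial>M) \<le> g u"
  shows "(\<integral>\<^sup>+\<omega>. f (U \<omega>, V \<omega>) \<partial>M) \<le> (\<integral>\<^sup>+\<omega>. g (U \<omega>) \<partial>M)"
proof -
  interpret V: prob_space "distr M T V" by (rule prob_space_distr) (rule V)
  have "(\<integral>\<^sup>+\<omega>. f (U \<omega>, V \<omega>) \<partial>M) = (\<integral>\<^sup>+w. f w \<partial>distr M (S \<Otimes>\<^sub>M T) (\<lambda>\<omega>. (U \<omega>, V \<omega>)))"
    by (subst nn_integral_distr) auto
  also have "\<dots> = (\<integral>\<^sup>+w. f w \<partial>(distr M S U \<Otimes>\<^sub>M distr M T V))" by (simp only: prod)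
  also have "\<dots> = (\<integral>\<^sup>+u. \<integral>\<^sup>+v. f (u, v) \<partial>distr M T V \<partial>distr M S U)"
    by (rule V.nn_integral_fst[symmetric]) measurable
  also have "\<dots> \<le> (\<integral>\<^sup>+u. g u \<partial>distr M S U)"
  proof (rule nn_integral_mono)
    fix u assume "u \<in> space (distr M S U)"
    then have u: "u \<in> space S" by simp
    have "(\<integral>\<^sup>+v. f (u, v) \<partial>distr M T V) = (\<integral>\<^sup>+\<omega>. f (u, V \<omega>) \<partial>M)"
      using u by (subst nn_integral_distr) auto
    then show "(\<integral>\<^sup>+v. f (u, v) \<partial>distr M T V) \<le> g u" using bound[OF u] by simp
  qed
  also have "\<dots> = (\<integral>\<^sup>+\<omega>. g (U \<omega>) \<partial>M)" by (subst nn_integral_distr) auto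
  finally show ?thesis .
qed

definition mask :: "(nat \<times> nat) set \<Rightarrow> (nat \<Rightarrow> nat \<Rightarrow> real) \<Rightarrow> nat \<Rightarrow> nat \<Rightarrow> real" where
  "mask S Z i k = (if (i, k) \<in> S then Z i k else 0)"

text \<open>The same for two disjoint sets of entries of an array with independent entries. The measurability
  hypotheses quantify over all random arrays, so that they are discharged by structural rules and no
  sigma-algebra on arrays is needed.\<close>

lemma (in prob_space) array_freeze:
  fixes Z :: "'a \<Rightarrow> nat \<Rightarrow> nat \<Rightarrow> real"
    and F :: "(nat \<Rightarrow> nat \<Rightarrow> real) \<Rightarrow> (nat \<Rightarrow> nat \<Rightarrow> real) \<Rightarrow> ennreal"
  assumes ind: "indep_vars (\<lambda>_. borel) (\<lambda>(i, k) \<omega>. Z \<omega> i k) I"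
    and AB: "A \<inter> B = {}" "A \<subseteq> I" "B \<subseteq> I"
    and F: "\<And>(N :: ((nat \<times> nat \<Rightarrow> real) \<times> (nat \<times> nat \<Rightarrow> real)) measure) Y W.
        (\<And>i k. (\<lambda>\<omega>. Y \<omega> i k) \<in> borel_measurable N) \<Longrightarrow> (\<And>i k. (\<lambda>\<omega>. W \<omega> i k) \<in> borel_measurable N) \<Longrightarrow>
        (\<lambda>\<omega>. F (Y \<omega>) (W \<omega>)) \<in> borel_measurable N"
    and G: "\<And>(N :: (nat \<times> nat \<Rightarrow> real) measure) Y. (\<And>i k. (\<lambda>\<omega>. Y \<omega> i k) \<in> borel_measurable N) \<Longrightarrow>
        (\<lambda>\<omega>. G (Y \<omega>)) \<in> borel_measurable N"
    and bound: "\<And>Y. Y = mask A Y \<Longrightarrow> (\<integral>\<^sup>+\<omega>. F Y (mask B (Z \<omega>)) \<partial>M) \<le> G Y"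
  shows "(\<integral>\<^sup>+\<omega>. F (mask A (Z \<omega>)) (mask B (Z \<omega>)) \<partial>M) \<le> (\<integral>\<^sup>+\<omega>. G (mask A (Z \<omega>)) \<partial>M)"
proof -
  define arr where "arr S u i k = (if (i, k) \<in> S then u (i, k) else (0::real))" for S and u :: "nat \<times> nat \<Rightarrow> real" and i k
  let ?S = "PiM A (\<lambda>_. borel :: real measure)" and ?T = "PiM B (\<lambda>_. borel :: real measure)"
  let ?R = "\<lambda>C \<omega>. restrict (\<lambda>(i, k). Z \<omega> i k) C"
  have IV: "indep_var ?S (?R A) ?T (?R B)"
    using indep_var_restrict[OF ind AB] by (simp add: case_prod_beta' restrict_def)
  have m: "random_variable ?S (?R A)" "random_variable ?T (?R B)"
    and pr: "distr M ?S (?R A) \<Otimes>\<^sub>M distr M ?T (?R B) = distr M (?S \<Otimes>\<^sub>M ?T) (\<lambda>\<omega>. (?R A \<omega>, ?R B \<omega>))"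
    using IV unfolding indep_var_distribution_eq by auto
  have arrm: "(\<lambda>u. arr C u i k) \<in> borel_measurable (PiM C (\<lambda>_. borel))" for C i k
  proof (cases "(i, k) \<in> C")
    case True
    then show ?thesis unfolding arr_def by simp
  qed (simp add: arr_def)
  have arrR: "arr C (?R C \<omega>) = mask C (Z \<omega>)" for C \<omega>
    by (rule ext)+ (simp add: arr_def mask_def)
  have "(\<integral>\<^sup>+\<omega>. (\<lambda>w. F (arr A (fst w)) (arr B (snd w))) (?R A \<omega>, ?R B \<omega>) \<partial>M) \<le> (\<integral>\<^sup>+\<omega>. (\<lambda>u. G (arr A u)) (?R A \<omega>) \<partial>M)"
  proof (rule nn_freeze[OF m pr])
    show "(\<lambda>w. F (arr A (fst w)) (arr B (snd w))) \<in> borel_measurable (?S \<Otimes>\<^sub>M ?T)"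
      by (intro F measurable_compose[OF measurable_fst arrm] measurable_compose[OF measurable_snd arrm])
    show "(\<lambda>u. G (arr A u)) \<in> borel_measurable ?S" by (intro G arrm)
    fix u
    have "arr A u = mask A (arr A u)" by (rule ext)+ (simp add: arr_def mask_def)
    from bound[OF this] show "(\<integral>\<^sup>+\<omega>. F (arr A (fst (u, ?R B \<omega>))) (arr B (snd (u, ?R B \<omega>))) \<partial>M) \<le> G (arr A u)"
      by (simp add: arrR)
  qed
  then show ?thesis by (simp add: arrR)
qed

lemma powr_convex_nonneg:
  fixes s :: real
  assumes s: "s \<ge> 1"
  shows "convex_on {0..} (\<lambda>u. u powr s)"
proof (rule convex_onI)
  have scale: "(a * u) powr s \<le> a * u powr s" if "0 < a" "a < 1" "0 \<le> u" for a u :: real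
  proof -
    have "a powr s \<le> a powr 1" using that s by (intro powr_mono') auto
    then show ?thesis using that by (simp add: powr_mult mult_right_mono)
  qed
  fix t x y :: real assume t: "0 < t" "t < 1" and xy: "x \<in> {0..}" "y \<in> {0..}"
  consider "x = 0" | "y = 0" | "x > 0" "y > 0" using xy by fastforce
  then show "((1 - t) *\<^sub>R x + t *\<^sub>R y) powr s \<le> (1 - t) * x powr s + t * y powr s"
  proof cases
    case 1 then show ?thesis using scale[of t y] t xy by simp
  next
    case 2 then show ?thesis using scale[of "1 - t" x] t xy by simp
  next
    case 3
    then show ?thesis using convex_onD[OF powr_convex[OF s], of t x y] t by simp
  qed
qed simp

text \<open>Jensen's inequality for the weights \<open>w i\<close>.\<close>

lemma powr_sum_le:
  fixes w t :: "'i \<Rightarrow> real"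
  assumes I: "finite I" and w: "\<And>i. i \<in> I \<Longrightarrow> w i \<ge> 0" and t: "\<And>i. i \<in> I \<Longrightarrow> t i \<ge> 0" and s: "s \<ge> 1"
  shows "(\<Sum>i\<in>I. w i * t i) powr s \<le> (\<Sum>i\<in>I. w i) powr (s - 1) * (\<Sum>i\<in>I. w i * t i powr s)"
proof (cases "(\<Sum>i\<in>I. w i) = 0")
  case True
  then have "w i = 0" if "i \<in> I" for i using that w I by (simp add: sum_nonneg_eq_0_iff)
  then show ?thesis by simp
next
  case False
  define W where "W = (\<Sum>i\<in>I. w i)"
  have W: "W > 0" using False w by (simp add: W_def less_le sum_nonneg)
  have ne: "I \<noteq> {}" using False by auto
  have "(\<Sum>i\<in>I. (w i / W) *\<^sub>R t i) powr s \<le> (\<Sum>i\<in>I. (w i / W) * t i powr s)"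
  proof (rule convex_on_sum[OF I ne, where C = "{0..}" and f = "\<lambda>u. u powr s"])
    show "convex_on {0..} (\<lambda>u::real. u powr s)" using s by (rule powr_convex_nonneg)
    show "(\<Sum>i\<in>I. w i / W) = 1" using W by (simp add: sum_divide_distrib[symmetric] W_def[symmetric])
  qed (use w t W in auto)
  then have 1: "((\<Sum>i\<in>I. w i * t i) / W) powr s \<le> (\<Sum>i\<in>I. w i * t i powr s) / W"
    by (simp add: sum_divide_distrib)
  have nn: "(\<Sum>i\<in>I. w i * t i) \<ge> 0" using w t by (intro sum_nonneg) auto
  have "(\<Sum>i\<in>I. w i * t i) powr s = W powr s * ((\<Sum>i\<in>I. w i * t i) / W) powr s"
    using W nn by (simp add: powr_divide)
  also have "\<dots> \<le> W powr s * ((\<Sum>i\<in>I. w i * t i powr s) / W)" using 1 by (intro mult_left_mono) auto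
  also have "\<dots> = W powr (s - 1) * (\<Sum>i\<in>I. w i * t i powr s)"
    using W by (simp add: powr_diff)
  finally show ?thesis by (simp add: W_def)
qed

text \<open>By Jensen's inequality it is enough to bound the moment of a single linear form, the weights being the
  squared norms of the forms.\<close>

lemma (in prob_space) linear_forms_moment:
  fixes z :: "nat \<Rightarrow> 'a \<Rightarrow> real" and g :: "'i \<Rightarrow> nat \<Rightarrow> real"
  assumes q: "q \<ge> 1" and K: "K \<ge> 0"
    and ind: "indep_vars (\<lambda>_. borel) z {..<N}"
    and mean: "\<And>i. i < N \<Longrightarrow> (\<integral>\<omega>. z i \<omega> \<partial>M) = 0"
    and int: "\<And>i. i < N \<Longrightarrow> integrable M (\<lambda>\<omega>. \<bar>z i \<omega>\<bar> powr (2 * q))"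
    and mom: "\<And>i. i < N \<Longrightarrow> (\<integral>\<omega>. \<bar>z i \<omega>\<bar> powr (2 * q) \<partial>M) \<le> K"
    and I: "finite I"
  shows "(\<integral>\<^sup>+\<omega>. ennreal ((\<Sum>k\<in>I. (ip N (g k) (\<lambda>i. z i \<omega>))\<^sup>2) powr q) \<partial>M)
     \<le> ennreal ((lin_const (2 * q) K * (\<Sum>k\<in>I. ip N (g k) (g k))) powr q)"
proof -
  define a where "a k = ip N (g k) (g k)" for k
  have a: "a k \<ge> 0" for k by (simp add: a_def ip_self_nonneg)
  define L where "L = lin_const (2 * q) K"
  have L: "L \<ge> 0" using K q by (simp add: L_def lin_const_def step_const_def)
  have zm[measurable]: "z i \<in> borel_measurable M" if "i < N" for i
    using ind that by (auto simp: indep_vars_def)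
  define t where "t k \<omega> = (ip N (g k) (\<lambda>i. z i \<omega>))\<^sup>2 / a k" for k \<omega>
  have at: "(ip N (g k) (\<lambda>i. z i \<omega>))\<^sup>2 = a k * t k \<omega>" for k \<omega>
  proof (cases "a k = 0")
    case True
    then have "g k i = 0" if "i < N" for i using that by (simp add: a_def ip_def sum_nonneg_eq_0_iff)
    then have "ip N (g k) (\<lambda>i. z i \<omega>) = 0" by (simp add: ip_def)
    then show ?thesis by (simp add: t_def)
  qed (simp add: t_def)
  have ipm[measurable]: "(\<lambda>\<omega>. ip N (g k) (\<lambda>i. z i \<omega>)) \<in> borel_measurable M" for k
    unfolding ip_def by measurable
  have tm[measurable]: "t k \<in> borel_measurable M" for k unfolding t_def by measurable
  have tb: "(\<integral>\<^sup>+\<omega>. ennreal (t k \<omega> powr q) \<partial>M) \<le> ennreal (L powr q)" for k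
  proof (cases "a k = 0")
    case True then show ?thesis by (simp add: t_def)
  next
    case False
    then have ak: "a k > 0" using a[of k] by simp
    note M2 = linear_form_moment[of "2 * q", OF _ K ind mean int mom, where a = "g k"]
    have e: "t k \<omega> powr q = \<bar>\<Sum>i<N. g k i * z i \<omega>\<bar> powr (2 * q) / a k powr q" for \<omega>
      using ak abs_powr_eq_sq_powr[of "2 * q" "\<Sum>i<N. g k i * z i \<omega>"] q by (simp add: t_def ip_def powr_divide)
    have "(\<integral>\<^sup>+\<omega>. ennreal (t k \<omega> powr q) \<partial>M) = ennreal (\<integral>\<omega>. t k \<omega> powr q \<partial>M)"
      using M2(1) q unfolding e by (intro nn_integral_eq_integral) auto
    also have "(\<integral>\<omega>. t k \<omega> powr q \<partial>M) = (\<integral>\<omega>. \<bar>\<Sum>i<N. g k i * z i \<omega>\<bar> powr (2 * q) \<partial>M) / a k powr q"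
      unfolding e by simp
    also have "\<dots> \<le> (L * a k) powr (2 * q / 2) / a k powr q"
      using M2(2) q by (intro divide_right_mono) (auto simp: L_def a_def ip_def power2_eq_square)
    also have "\<dots> = L powr q" using ak L by (simp add: powr_mult)
    finally show ?thesis by (simp add: ennreal_leI)
  qed
  have "(\<integral>\<^sup>+\<omega>. ennreal ((\<Sum>k\<in>I. (ip N (g k) (\<lambda>i. z i \<omega>))\<^sup>2) powr q) \<partial>M)
     \<le> (\<integral>\<^sup>+\<omega>. ennreal ((\<Sum>k\<in>I. a k) powr (q - 1)) * (\<Sum>k\<in>I. ennreal (a k) * ennreal (t k \<omega> powr q)) \<partial>M)"
  proof (rule nn_integral_mono)
    fix \<omega>
    have "(\<Sum>k\<in>I. a k * t k \<omega>) powr q \<le> (\<Sum>k\<in>I. a k) powr (q - 1) * (\<Sum>k\<in>I. a k * t k \<omega> powr q)"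
      using I a q by (intro powr_sum_le) (auto simp: t_def)
    then have "ennreal ((\<Sum>k\<in>I. a k * t k \<omega>) powr q) \<le> ennreal ((\<Sum>k\<in>I. a k) powr (q - 1) * (\<Sum>k\<in>I. a k * t k \<omega> powr q))"
      by (rule ennreal_leI)
    also have "\<dots> = ennreal ((\<Sum>k\<in>I. a k) powr (q - 1)) * (\<Sum>k\<in>I. ennreal (a k) * ennreal (t k \<omega> powr q))"
      using a by (simp add: ennreal_mult' sum_ennreal[symmetric] ennreal_mult)
    finally show "ennreal ((\<Sum>k\<in>I. (ip N (g k) (\<lambda>i. z i \<omega>))\<^sup>2) powr q)
      \<le> ennreal ((\<Sum>k\<in>I. a k) powr (q - 1)) * (\<Sum>k\<in>I. ennreal (a k) * ennreal (t k \<omega> powr q))"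
      by (simp add: at)
  qed
  also have "\<dots> = ennreal ((\<Sum>k\<in>I. a k) powr (q - 1)) * (\<Sum>k\<in>I. ennreal (a k) * (\<integral>\<^sup>+\<omega>. ennreal (t k \<omega> powr q) \<partial>M))"
    by (simp add: nn_integral_cmult nn_integral_sum)
  also have "\<dots> \<le> ennreal ((\<Sum>k\<in>I. a k) powr (q - 1)) * (\<Sum>k\<in>I. ennreal (a k) * ennreal (L powr q))"
    using tb by (intro mult_left_mono sum_mono) auto
  also have "\<dots> = ennreal ((\<Sum>k\<in>I. a k) powr (q - 1) * ((\<Sum>k\<in>I. a k) * L powr q))"
    using a by (simp add: ennreal_mult[symmetric] sum_nonneg sum_distrib_right)
  also have "(\<Sum>k\<in>I. a k) powr (q - 1) * ((\<Sum>k\<in>I. a k) * L powr q) = (L * (\<Sum>k\<in>I. a k)) powr q"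
  proof (cases "(\<Sum>k\<in>I. a k) = 0")
    case True then show ?thesis using q by simp
  next
    case False
    then have "(\<Sum>k\<in>I. a k) > 0" using a by (simp add: less_le sum_nonneg)
    then show ?thesis using L by (simp add: powr_mult powr_diff)
  qed
  finally show ?thesis by (simp add: L_def a_def)
qed

section \<open>Building an array column by column\<close>

text \<open>The array with only the columns in \<open>J\<close>. The induction adds the columns one at a time.\<close>

definition keep :: "nat set \<Rightarrow> (nat \<Rightarrow> nat \<Rightarrow> real) \<Rightarrow> nat \<Rightarrow> nat \<Rightarrow> real" where
  "keep J Z i k = (if k \<in> J then Z i k else 0)"

text \<open>For a column \<open>c\<close> outside of \<open>Y\<close>, \<open>yv\<close> is its vector of regression coefficients on \<open>Y\<close> and
  \<open>wv\<close> a further application of the ridge inverse; \<open>gv\<close> and \<open>hv\<close> are the corresponding coefficient vectors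
  in the linear forms. They are the total versions, as functions of arrays, of \<open>y\<close>, \<open>mv p x0 y\<close>, \<open>g\<close>
  and \<open>h\<close> in \<open>col_split\<close>.\<close>

definition yv :: "nat \<Rightarrow> nat \<Rightarrow> real \<Rightarrow> (nat \<Rightarrow> nat \<Rightarrow> real) \<Rightarrow> (nat \<Rightarrow> real) \<Rightarrow> nat \<Rightarrow> real" where
  "yv n p l Y c = mv p (rinv n p l Y) (\<lambda>k. ip n (\<lambda>i. Y i k) c)"

definition wv :: "nat \<Rightarrow> nat \<Rightarrow> real \<Rightarrow> (nat \<Rightarrow> nat \<Rightarrow> real) \<Rightarrow> (nat \<Rightarrow> real) \<Rightarrow> nat \<Rightarrow> real" where
  "wv n p l Y c = mv p (rinv n p l Y) (yv n p l Y c)"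

definition gv :: "nat \<Rightarrow> nat \<Rightarrow> real \<Rightarrow> (nat \<Rightarrow> nat \<Rightarrow> real) \<Rightarrow> nat \<Rightarrow> nat \<Rightarrow> real" where
  "gv n p l Y k = mv p Y (\<lambda>m. rinv n p l Y m k)"

definition hv :: "nat \<Rightarrow> nat \<Rightarrow> real \<Rightarrow> (nat \<Rightarrow> nat \<Rightarrow> real) \<Rightarrow> nat \<Rightarrow> nat \<Rightarrow> real" where
  "hv n p l Y k = mv p Y (mv p (rinv n p l Y) (\<lambda>m. rinv n p l Y m k))"

text \<open>On this event the diagonal of the ridge inverse is of the order \<open>t\<close>, which will be a multiple of
  \<open>1 / n\<close>. It is inherited by sets of fewer columns, so it may be assumed in an induction over columns.\<close>

definition good :: "nat \<Rightarrow> nat \<Rightarrow> real \<Rightarrow> real \<Rightarrow> nat set \<Rightarrow> (nat \<Rightarrow> nat \<Rightarrow> real) \<Rightarrow> bool" where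
  "good n p l t J Y \<longleftrightarrow> (\<forall>k\<in>J. rinv n p l Y k k \<le> t)"

text \<open>The traces of the second and fourth power of the ridge inverse, restricted to the columns \<open>J\<close>.\<close>

definition trace2 :: "nat \<Rightarrow> nat \<Rightarrow> real \<Rightarrow> nat set \<Rightarrow> (nat \<Rightarrow> nat \<Rightarrow> real) \<Rightarrow> real" where
  "trace2 n p l J Y = (\<Sum>j\<in>J. \<Sum>k<p. (rinv n p l Y k j)\<^sup>2)"

definition trace4 :: "nat \<Rightarrow> nat \<Rightarrow> real \<Rightarrow> nat set \<Rightarrow> (nat \<Rightarrow> nat \<Rightarrow> real) \<Rightarrow> real" where
  "trace4 n p l J Y = (\<Sum>j\<in>J. \<Sum>k<p. (mv p (rinv n p l Y) (\<lambda>m. rinv n p l Y m j) k)\<^sup>2)"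

lemma col_split_ridge:
  assumes "j < p" "l > 0" "Y = zcol j Z"
  shows "col_split n p l Z (rinv n p l Z) (rinv n p l Y) j"
  using assms ridge_inv by unfold_locales auto

lemma forms_fixed:
  assumes j: "j < p" and l: "l > 0" and Y: "\<And>i. Y i j = 0" and k: "k < p"
  shows "yv n p l Y c k = ip n (gv n p l Y k) c" "wv n p l Y c k = ip n (hv n p l Y k) c"
    "ip n (gv n p l Y k) (gv n p l Y k) \<le> rinv n p l Y k k"
    "ip n (hv n p l Y k) (hv n p l Y k) \<le> ip p (\<lambda>m. rinv n p l Y m k) (mv p (rinv n p l Y) (\<lambda>m. rinv n p l Y m k))"
    "(\<And>i. Y i k = 0) \<Longrightarrow> gv n p l Y k = (\<lambda>_. 0)" "(\<And>i. Y i k = 0) \<Longrightarrow> hv n p l Y k = (\<lambda>_. 0)"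
proof -
  define Z where "Z i k = (if k = j then c i else Y i k)" for i k
  have YZ: "Y = zcol j Z" using Y by (auto simp: zcol_def Z_def fun_eq_iff)
  interpret C: col_split n p l Z "rinv n p l Z" "rinv n p l Y" j by (rule col_split_ridge[OF j l YZ])
  have c: "C.c = c" by (simp add: C.c_def Z_def fun_eq_iff)
  have y: "C.y = yv n p l Y c" by (simp add: C.y_def yv_def c YZ[symmetric])
  have g: "C.g = gv n p l Y" by (rule ext) (simp add: C.g_def gv_def YZ[symmetric])
  have h: "C.h = hv n p l Y" by (rule ext) (simp add: C.h_def hv_def YZ[symmetric])
  show "yv n p l Y c k = ip n (gv n p l Y k) c" using C.y_lin[OF k] by (simp add: y g c)
  show "wv n p l Y c k = ip n (hv n p l Y k) c" using C.w_lin[OF k] by (simp add: y h c wv_def)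
  show "ip n (gv n p l Y k) (gv n p l Y k) \<le> rinv n p l Y k k" using C.g_norm[OF k] by (simp add: g)
  show "ip n (hv n p l Y k) (hv n p l Y k) \<le> ip p (\<lambda>m. rinv n p l Y m k) (mv p (rinv n p l Y) (\<lambda>m. rinv n p l Y m k))"
    using C.h_norm[OF k] by (simp add: h)
  show "gv n p l Y k = (\<lambda>_. 0)" if "\<And>i. Y i k = 0"
    using C.zero_col(1)[OF k] that by (simp add: g YZ[symmetric] fun_eq_iff)
  show "hv n p l Y k = (\<lambda>_. 0)" if "\<And>i. Y i k = 0"
    using C.zero_col(2)[OF k] that by (simp add: h YZ[symmetric] fun_eq_iff)
qed

lemma keep_zcol: "zcol j (keep J Z) = keep (J - {j}) Z"
  by (auto simp: zcol_def keep_def fun_eq_iff)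

definition bv :: "nat \<Rightarrow> nat \<Rightarrow> real \<Rightarrow> (nat \<Rightarrow> nat \<Rightarrow> real) \<Rightarrow> (nat \<Rightarrow> real) \<Rightarrow> real" where
  "bv n p l Y c = 1 + ip p (yv n p l Y c) (yv n p l Y c)"

definition uv :: "nat \<Rightarrow> nat \<Rightarrow> real \<Rightarrow> (nat \<Rightarrow> nat \<Rightarrow> real) \<Rightarrow> (nat \<Rightarrow> real) \<Rightarrow> real" where
  "uv n p l Y c = ip p (wv n p l Y c) (wv n p l Y c)"

lemma bv_ge: "bv n p l Y c \<ge> 1" by (simp add: bv_def ip_self_nonneg)
lemma uv_nonneg: "uv n p l Y c \<ge> 0" by (simp add: uv_def ip_self_nonneg)

text \<open>The contribution of one column to the traces, bounded by linear forms in that column whose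
  coefficients depend on the other columns only.\<close>

lemma column_bounds:
  assumes j: "j \<in> J" and J: "J \<subseteq> {..<p}" and l: "l > 0" and t: "good n p l t J (keep J Z)"
  defines "x \<equiv> rinv n p l (keep J Z)" and "Y \<equiv> keep (J - {j}) Z" and "c \<equiv> (\<lambda>i. Z i j)"
  shows "good n p l t (J - {j}) Y"
    "(\<Sum>k<p. (x k j)\<^sup>2) \<le> t\<^sup>2 * bv n p l Y c"
    "(\<Sum>k<p. (mv p x (\<lambda>m. x m j) k)\<^sup>2) \<le> 2 * t\<^sup>2 * (t\<^sup>2 * bv n p l Y c ^ 3 + uv n p l Y c)"
proof -
  have jp: "j < p" using j J by auto
  have YZ: "Y = zcol j (keep J Z)" by (simp add: Y_def keep_zcol)
  interpret C: col_split n p l "keep J Z" "rinv n p l (keep J Z)" "rinv n p l Y" j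
    by (rule col_split_ridge[OF jp l YZ])
  have c: "C.c = c" using j by (simp add: C.c_def c_def keep_def fun_eq_iff)
  have y: "C.y = yv n p l Y c" by (simp add: C.y_def yv_def c YZ[symmetric])
  have b: "1 + ip p C.y C.y = bv n p l Y c" by (simp add: bv_def y)
  have xj: "0 \<le> x j j" "x j j \<le> t"
    using t j C.x_diag_j C.d_pos by (auto simp: good_def x_def)
  then have x2: "(x j j)\<^sup>2 \<le> t\<^sup>2" by (intro power_mono)
  show "good n p l t (J - {j}) Y"
    unfolding good_def
  proof
    fix k assume k: "k \<in> J - {j}"
    then have "rinv n p l Y k k \<le> rinv n p l (keep J Z) k k" using J by (intro C.x_diag_ge) auto
    also have "\<dots> \<le> t" using t k by (auto simp: good_def)
    finally show "rinv n p l Y k k \<le> t" .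
  qed
  have "(\<Sum>k<p. (x k j)\<^sup>2) = bv n p l Y c * (x j j)\<^sup>2" using C.x_col_norm b by (simp add: x_def)
  also have "\<dots> \<le> bv n p l Y c * t\<^sup>2" using x2 bv_ge[of n p l Y c] by (intro mult_left_mono) auto
  finally show "(\<Sum>k<p. (x k j)\<^sup>2) \<le> t\<^sup>2 * bv n p l Y c" by (simp add: mult.commute)
  have "(\<Sum>k<p. (mv p x (\<lambda>m. x m j) k)\<^sup>2) \<le> 2 * (x j j)\<^sup>2 * ((x j j)\<^sup>2 * bv n p l Y c ^ 3 + uv n p l Y c)"
    using C.x2_col_norm unfolding b unfolding y by (simp add: x_def uv_def wv_def)
  also have "\<dots> \<le> 2 * t\<^sup>2 * (t\<^sup>2 * bv n p l Y c ^ 3 + uv n p l Y c)"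
    using x2 bv_ge[of n p l Y c] uv_nonneg[of n p l Y c]
    by (intro mult_mono add_mono order_refl) auto
  finally show "(\<Sum>k<p. (mv p x (\<lambda>m. x m j) k)\<^sup>2) \<le> 2 * t\<^sup>2 * (t\<^sup>2 * bv n p l Y c ^ 3 + uv n p l Y c)" .
qed

section \<open>Measurability of functions of an array\<close>

lemma meas_mv: "(\<And>i k. (\<lambda>\<omega>. A \<omega> i k) \<in> borel_measurable N) \<Longrightarrow> (\<And>k. (\<lambda>\<omega>. v \<omega> k) \<in> borel_measurable N) \<Longrightarrow>
    (\<lambda>\<omega>. mv m (A \<omega>) (v \<omega>) i) \<in> borel_measurable N"
  unfolding mv_def by (intro borel_measurable_sum borel_measurable_times)

lemma meas_ip: "(\<And>k. (\<lambda>\<omega>. u \<omega> k) \<in> borel_measurable N) \<Longrightarrow> (\<And>k. (\<lambda>\<omega>. v \<omega> k) \<in> borel_measurable N) \<Longrightarrow>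
    (\<lambda>\<omega>. ip m (u \<omega>) (v \<omega>)) \<in> borel_measurable N"
  unfolding ip_def by (intro borel_measurable_sum borel_measurable_times)

lemma meas_rinv: "(\<And>i k. (\<lambda>\<omega>. Y \<omega> i k) \<in> borel_measurable N) \<Longrightarrow> (\<lambda>\<omega>. rinv n p l (Y \<omega>) j k) \<in> borel_measurable N"
  by (rule borel_measurable_rinv)

lemma meas_yv: "(\<And>i k. (\<lambda>\<omega>. Y \<omega> i k) \<in> borel_measurable N) \<Longrightarrow> (\<And>i. (\<lambda>\<omega>. c \<omega> i) \<in> borel_measurable N) \<Longrightarrow>
    (\<lambda>\<omega>. yv n p l (Y \<omega>) (c \<omega>) k) \<in> borel_measurable N"
  unfolding yv_def by (intro meas_mv meas_ip meas_rinv)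

lemma meas_bv: "(\<And>i k. (\<lambda>\<omega>. Y \<omega> i k) \<in> borel_measurable N) \<Longrightarrow> (\<And>i. (\<lambda>\<omega>. c \<omega> i) \<in> borel_measurable N) \<Longrightarrow>
    (\<lambda>\<omega>. bv n p l (Y \<omega>) (c \<omega>)) \<in> borel_measurable N"
  unfolding bv_def by (intro borel_measurable_add borel_measurable_const meas_ip meas_yv)

lemma meas_uv: "(\<And>i k. (\<lambda>\<omega>. Y \<omega> i k) \<in> borel_measurable N) \<Longrightarrow> (\<And>i. (\<lambda>\<omega>. c \<omega> i) \<in> borel_measurable N) \<Longrightarrow>
    (\<lambda>\<omega>. uv n p l (Y \<omega>) (c \<omega>)) \<in> borel_measurable N"
  unfolding uv_def wv_def by (intro meas_mv meas_ip meas_rinv meas_yv)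

lemma meas_good: "(\<And>i k. (\<lambda>\<omega>. Y \<omega> i k) \<in> borel_measurable N) \<Longrightarrow> finite J \<Longrightarrow>
    {\<omega> \<in> space N. good n p l t J (Y \<omega>)} \<in> sets N"
proof -
  assume Y: "\<And>i k. (\<lambda>\<omega>. Y \<omega> i k) \<in> borel_measurable N" and J: "finite J"
  have [measurable]: "(\<lambda>\<omega>. rinv n p l (Y \<omega>) k k) \<in> borel_measurable N" for k by (rule meas_rinv[OF Y])
  show ?thesis unfolding good_def using J by measurable
qed

lemma meas_trace2: "(\<And>i k. (\<lambda>\<omega>. Y \<omega> i k) \<in> borel_measurable N) \<Longrightarrow> (\<lambda>\<omega>. trace2 n p l J (Y \<omega>)) \<in> borel_measurable N"
  unfolding trace2_def by (intro borel_measurable_sum borel_measurable_power meas_rinv)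

lemma meas_trace4: "(\<And>i k. (\<lambda>\<omega>. Y \<omega> i k) \<in> borel_measurable N) \<Longrightarrow> (\<lambda>\<omega>. trace4 n p l J (Y \<omega>)) \<in> borel_measurable N"
  unfolding trace4_def by (intro borel_measurable_sum borel_measurable_power meas_rinv meas_mv)

lemma meas_keep: "(\<And>i k. (\<lambda>\<omega>. Y \<omega> i k) \<in> borel_measurable N) \<Longrightarrow> (\<lambda>\<omega>. keep J (Y \<omega>) i k) \<in> borel_measurable N"
  by (simp add: keep_def)

lemma trace2_nonneg: "trace2 n p l J Y \<ge> 0" by (simp add: trace2_def sum_nonneg)
lemma trace4_nonneg: "trace4 n p l J Y \<ge> 0" by (simp add: trace4_def sum_nonneg)

section \<open>Arrays with independent entries\<close>

text \<open>Entries outside of the index range are zero, so that the deletions above act on random arrays without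
  side conditions. The moment exponent is \<open>2 * q\<close> because squares of linear forms and quadratic forms
  in the entries are to have \<open>q\<close>-th moments.\<close>

locale indep_array = prob_space M for M :: "'a measure" +
  fixes Z :: "'a \<Rightarrow> nat \<Rightarrow> nat \<Rightarrow> real" and n p :: nat and q K :: real
  assumes q3: "q \<ge> 3" and K0: "K \<ge> 0"
    and ind: "indep_vars (\<lambda>_. borel) (\<lambda>(i, k) \<omega>. Z \<omega> i k) ({..<n} \<times> {..<p})"
    and out: "n \<le> i \<or> p \<le> k \<Longrightarrow> Z \<omega> i k = 0"
    and mean: "i < n \<Longrightarrow> k < p \<Longrightarrow> (\<integral>\<omega>. Z \<omega> i k \<partial>M) = 0"
    and int: "i < n \<Longrightarrow> k < p \<Longrightarrow> integrable M (\<lambda>\<omega>. \<bar>Z \<omega> i k\<bar> powr (2 * q))"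
    and mom: "i < n \<Longrightarrow> k < p \<Longrightarrow> (\<integral>\<omega>. \<bar>Z \<omega> i k\<bar> powr (2 * q) \<partial>M) \<le> K"
begin

lemma Z_meas[measurable]: "(\<lambda>\<omega>. Z \<omega> i k) \<in> borel_measurable M"
proof (cases "i < n \<and> k < p")
  case True
  then show ?thesis using ind unfolding indep_vars_def by auto
next
  case False
  then have "(\<lambda>\<omega>. Z \<omega> i k) = (\<lambda>\<omega>. 0)" using out by (auto simp: fun_eq_iff)
  then show ?thesis by simp
qed

lemma col_indep: assumes k: "k < p" shows "indep_vars (\<lambda>_. borel) (\<lambda>i \<omega>. Z \<omega> i k) {..<n}"
proof -
  have "indep_vars (\<lambda>i. PiM {(i, k)} (\<lambda>_. borel)) (\<lambda>i \<omega>. restrict (\<lambda>ik. (case ik of (i, k) \<Rightarrow> \<lambda>\<omega>. Z \<omega> i k) \<omega>) {(i, k)}) {..<n}"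
    using k by (intro indep_vars_restrict[OF ind]) (auto simp: disjoint_family_on_def)
  from indep_vars_compose2[OF this, of "\<lambda>i u. u (i, k)" "\<lambda>_. borel"]
  show ?thesis by simp
qed

lemma row_indep: assumes i: "i < n" shows "indep_vars (\<lambda>_. borel) (\<lambda>k \<omega>. Z \<omega> i k) {..<p}"
proof -
  have "indep_vars (\<lambda>k. PiM {(i, k)} (\<lambda>_. borel)) (\<lambda>k \<omega>. restrict (\<lambda>ik. (case ik of (i, k) \<Rightarrow> \<lambda>\<omega>. Z \<omega> i k) \<omega>) {(i, k)}) {..<p}"
    using i by (intro indep_vars_restrict[OF ind]) (auto simp: disjoint_family_on_def)
  from indep_vars_compose2[OF this, of "\<lambda>k u. u (i, k)" "\<lambda>_. borel"]
  show ?thesis by simp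
qed

lemma second_moment:
  assumes "i < n" "k < p"
  shows "integrable M (\<lambda>\<omega>. \<bar>Z \<omega> i k\<bar> powr 2)" "(\<integral>\<omega>. \<bar>Z \<omega> i k\<bar> powr 2 \<partial>M) \<le> 1 + K"
  using lower_moment[OF Z_meas _ _ int[OF assms] mom[OF assms], of 2] q3 by auto

text \<open>Instances of \<open>array_freeze\<close> for one column against other columns, and for one row against the rest.\<close>

lemma col_freeze:
  assumes j: "j < p" and J: "J \<subseteq> {..<p}" "j \<notin> J"
    and F: "\<And>(N :: ((nat \<times> nat \<Rightarrow> real) \<times> (nat \<times> nat \<Rightarrow> real)) measure) Y c.
        (\<And>i k. (\<lambda>\<omega>. Y \<omega> i k) \<in> borel_measurable N) \<Longrightarrow> (\<And>i. (\<lambda>\<omega>. c \<omega> i) \<in> borel_measurable N) \<Longrightarrow>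
        (\<lambda>\<omega>. F (Y \<omega>) (c \<omega>)) \<in> borel_measurable N"
    and G: "\<And>(N :: (nat \<times> nat \<Rightarrow> real) measure) Y. (\<And>i k. (\<lambda>\<omega>. Y \<omega> i k) \<in> borel_measurable N) \<Longrightarrow>
        (\<lambda>\<omega>. G (Y \<omega>)) \<in> borel_measurable N"
    and bound: "\<And>Y. Y = keep J Y \<Longrightarrow> (\<integral>\<^sup>+\<omega>. F Y (\<lambda>i. Z \<omega> i j) \<partial>M) \<le> G Y"
  shows "(\<integral>\<^sup>+\<omega>. F (keep J (Z \<omega>)) (\<lambda>i. Z \<omega> i j) \<partial>M) \<le> (\<integral>\<^sup>+\<omega>. G (keep J (Z \<omega>)) \<partial>M)"
proof -
  let ?A = "{..<n} \<times> J" and ?B = "{..<n} \<times> {j}"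
  have mA: "mask ?A (Z \<omega>) = keep J (Z \<omega>)" for \<omega>
    using out[of _ _ \<omega>] by (auto simp: mask_def keep_def fun_eq_iff not_less)
  have mB: "(\<lambda>i. mask ?B (Z \<omega>) i j) = (\<lambda>i. Z \<omega> i j)" for \<omega>
    using out[of _ _ \<omega>] by (auto simp: mask_def fun_eq_iff not_less)
  have "(\<integral>\<^sup>+\<omega>. (\<lambda>Y W. F Y (\<lambda>i. W i j)) (mask ?A (Z \<omega>)) (mask ?B (Z \<omega>)) \<partial>M) \<le> (\<integral>\<^sup>+\<omega>. G (mask ?A (Z \<omega>)) \<partial>M)"
  proof (rule array_freeze[OF ind])
    show "?A \<inter> ?B = {}" "?A \<subseteq> {..<n} \<times> {..<p}" "?B \<subseteq> {..<n} \<times> {..<p}" using J j by auto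
    show "(\<integral>\<^sup>+\<omega>. F Y (\<lambda>i. mask ?B (Z \<omega>) i j) \<partial>M) \<le> G Y" if "Y = mask ?A Y" for Y
    proof -
      have "Y i k = keep J Y i k" for i k by (subst that) (simp add: keep_def mask_def that[symmetric], metis (no_types) SigmaD2 mask_def that)
      then have "Y = keep J Y" by (intro ext)
      then show ?thesis unfolding mB by (rule bound)
    qed
  qed (intro F G; assumption)+
  then show ?thesis by (simp only: mA mB)
qed

lemma row_freeze:
  assumes r: "r < n"
    and F: "\<And>(N :: ((nat \<times> nat \<Rightarrow> real) \<times> (nat \<times> nat \<Rightarrow> real)) measure) Y c.
        (\<And>i k. (\<lambda>\<omega>. Y \<omega> i k) \<in> borel_measurable N) \<Longrightarrow> (\<And>i. (\<lambda>\<omega>. c \<omega> i) \<in> borel_measurable N) \<Longrightarrow>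
        (\<lambda>\<omega>. F (Y \<omega>) (c \<omega>)) \<in> borel_measurable N"
    and G: "\<And>(N :: (nat \<times> nat \<Rightarrow> real) measure) Y. (\<And>i k. (\<lambda>\<omega>. Y \<omega> i k) \<in> borel_measurable N) \<Longrightarrow>
        (\<lambda>\<omega>. G (Y \<omega>)) \<in> borel_measurable N"
    and bound: "\<And>Y. (\<integral>\<^sup>+\<omega>. F Y (Z \<omega> r) \<partial>M) \<le> G Y"
  shows "(\<integral>\<^sup>+\<omega>. F (zrow r (Z \<omega>)) (Z \<omega> r) \<partial>M) \<le> (\<integral>\<^sup>+\<omega>. G (zrow r (Z \<omega>)) \<partial>M)"
proof -
  let ?A = "({..<n} - {r}) \<times> {..<p}" and ?B = "{r} \<times> {..<p}"
  have mA: "mask ?A (Z \<omega>) = zrow r (Z \<omega>)" for \<omega>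
    using out[of _ _ \<omega>] by (auto simp: mask_def zrow_def fun_eq_iff not_less)
  have mB: "(\<lambda>k. mask ?B (Z \<omega>) r k) = Z \<omega> r" for \<omega>
    using out[of _ _ \<omega>] by (auto simp: mask_def fun_eq_iff not_less)
  have "(\<integral>\<^sup>+\<omega>. (\<lambda>Y W. F Y (\<lambda>k. W r k)) (mask ?A (Z \<omega>)) (mask ?B (Z \<omega>)) \<partial>M) \<le> (\<integral>\<^sup>+\<omega>. G (mask ?A (Z \<omega>)) \<partial>M)"
  proof (rule array_freeze[OF ind])
    show "?A \<inter> ?B = {}" "?A \<subseteq> {..<n} \<times> {..<p}" "?B \<subseteq> {..<n} \<times> {..<p}" using r by auto
    show "(\<integral>\<^sup>+\<omega>. F Y (\<lambda>k. mask ?B (Z \<omega>) r k) \<partial>M) \<le> G Y" for Y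
      unfolding mB by (rule bound)
  qed (intro F G; assumption)+
  then show ?thesis by (simp only: mA mB)
qed

end

section \<open>Expected traces of powers of the ridge inverse\<close>

lemma ip_le_weighted:
  assumes "\<rho> > 0"
  shows "ip p u v \<le> (\<rho> * ip p u u + ip p v v / \<rho>) / 2"
proof -
  have "0 \<le> ip p (\<lambda>k. \<rho> * u k - v k) (\<lambda>k. \<rho> * u k - v k)" by (rule ip_self_nonneg)
  then have "2 * \<rho> * ip p u v \<le> \<rho> * \<rho> * ip p u u + ip p v v"
    by (simp add: ip_linear ip_commute[of p v u] algebra_simps)
  then have "2 * \<rho> * ip p u v / (2 * \<rho>) \<le> (\<rho> * \<rho> * ip p u u + ip p v v) / (2 * \<rho>)"
    using assms by (intro divide_right_mono) auto
  then show ?thesis using assms by (simp add: field_simps)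
qed

context indep_array
begin

definition Lc :: real where "Lc = lin_const (2 * q) K"
definition c1 :: real where "c1 = lin_const 2 (1 + K)"
definition cb :: "real \<Rightarrow> real" where "cb \<theta> = 2 powr q * (1 + (Lc * \<theta>) powr q)"

lemma Lc_nonneg: "Lc \<ge> 0" and c1_pos: "c1 > 0" and cb_pos: "cb \<theta> > 0"
  using K0 q3 by (simp_all add: Lc_def c1_def cb_def lin_const_def step_const_def add_pos_nonneg)

lemma sum_J:
  assumes J: "J \<subseteq> {..<p}" and z: "\<And>k. k < p \<Longrightarrow> k \<notin> J \<Longrightarrow> f k = 0"
  shows "ip p f f = (\<Sum>k\<in>J. (f k)\<^sup>2)"
proof -
  have "ip p f f = (\<Sum>k<p. (f k)\<^sup>2)" by (simp add: ip_def power2_eq_square)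
  also have "\<dots> = (\<Sum>k\<in>J. (f k)\<^sup>2)" using J z by (intro sum.mono_neutral_right) auto
  finally show ?thesis .
qed

text \<open>Given \<open>Y\<close>, the vector \<open>yv\<close> consists of linear forms with squared norms summing to at most the
  trace of the ridge inverse, which is at most \<open>p * t\<close> on the good event.\<close>

lemma bv_moment:
  assumes j: "j < p" and J: "J \<subseteq> {..<p}" "j \<notin> J" and Y: "Y = keep J Y" and g: "good n p l t J Y"
    and t: "t \<ge> 0" and l: "l > 0"
  shows "(\<integral>\<^sup>+\<omega>. ennreal (bv n p l Y (\<lambda>i. Z \<omega> i j) powr q) \<partial>M) \<le> ennreal (cb (real p * t))"
proof -
  have fJ: "finite J" using J finite_subset by auto
  have Y0: "Y i k = 0" if "k \<notin> J" for i k using Y that by (metis keep_def)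
  note F = forms_fixed[where Y = Y and j = j and n = n, OF j l Y0[OF J(2)]]
  let ?S = "\<lambda>\<omega>. \<Sum>k\<in>J. (ip n (gv n p l Y k) (\<lambda>i. Z \<omega> i j))\<^sup>2"
  have yz: "yv n p l Y c k = 0" if "k < p" "k \<notin> J" for k c
    using F(1)[OF that(1)] F(5)[OF that(1) Y0[OF that(2)]] by (simp add: ip_def)
  have bv: "bv n p l Y (\<lambda>i. Z \<omega> i j) = 1 + ?S \<omega>" for \<omega>
  proof -
    have "ip p (yv n p l Y (\<lambda>i. Z \<omega> i j)) (yv n p l Y (\<lambda>i. Z \<omega> i j)) = (\<Sum>k\<in>J. (yv n p l Y (\<lambda>i. Z \<omega> i j) k)\<^sup>2)"
      by (rule sum_J[OF J(1) yz])
    also have "\<dots> = ?S \<omega>" using J by (intro sum.cong refl) (subst F(1), auto)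
    finally show ?thesis by (simp add: bv_def)
  qed
  have ipm[measurable]: "(\<lambda>\<omega>. ip n u (\<lambda>i. Z \<omega> i j)) \<in> borel_measurable M" for u
    unfolding ip_def by measurable
  have "(\<integral>\<^sup>+\<omega>. ennreal (bv n p l Y (\<lambda>i. Z \<omega> i j) powr q) \<partial>M)
     \<le> (\<integral>\<^sup>+\<omega>. ennreal (2 powr q) * (1 + ennreal (?S \<omega> powr q)) \<partial>M)"
  proof (rule nn_integral_mono)
    fix \<omega>
    have "?S \<omega> \<ge> 0" by (intro sum_nonneg) auto
    then have "bv n p l Y (\<lambda>i. Z \<omega> i j) powr q \<le> 2 powr q * (1 + ?S \<omega> powr q)"
      using powr_add_upper[of q 1 "?S \<omega>"] q3 by (simp add: bv)
    then show "ennreal (bv n p l Y (\<lambda>i. Z \<omega> i j) powr q) \<le> ennreal (2 powr q) * (1 + ennreal (?S \<omega> powr q))"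
      by (simp add: ennreal_mult[symmetric] ennreal_plus[symmetric] ennreal_1[symmetric] ennreal_leI del: ennreal_plus ennreal_1)
  qed
  also have "\<dots> = ennreal (2 powr q) * (1 + (\<integral>\<^sup>+\<omega>. ennreal (?S \<omega> powr q) \<partial>M))"
    by (simp add: nn_integral_cmult nn_integral_add emeasure_space_1)
  also have "\<dots> \<le> ennreal (2 powr q) * (1 + ennreal ((Lc * (real p * t)) powr q))"
  proof (intro mult_left_mono add_left_mono)
    have "(\<integral>\<^sup>+\<omega>. ennreal (?S \<omega> powr q) \<partial>M) \<le> ennreal ((lin_const (2 * q) K * (\<Sum>k\<in>J. ip n (gv n p l Y k) (gv n p l Y k))) powr q)"
      using q3 K0 mean int mom j fJ by (intro linear_forms_moment col_indep) auto
    also have "\<dots> \<le> ennreal ((Lc * (real p * t)) powr q)"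
    proof (intro ennreal_leI powr_mono2 mult_mono)
      have "(\<Sum>k\<in>J. ip n (gv n p l Y k) (gv n p l Y k)) \<le> (\<Sum>k\<in>J. t)"
        using F(3) J g by (intro sum_mono) (auto simp: good_def intro: order_trans)
      also have "\<dots> \<le> real p * t" using card_mono[OF _ J(1)] t by (simp add: mult_right_mono)
      finally show "(\<Sum>k\<in>J. ip n (gv n p l Y k) (gv n p l Y k)) \<le> real p * t" .
    qed (use q3 Lc_nonneg in \<open>auto simp: Lc_def ip_self_nonneg intro!: sum_nonneg mult_nonneg_nonneg\<close>)
    finally show "(\<integral>\<^sup>+\<omega>. ennreal (?S \<omega> powr q) \<partial>M) \<le> ennreal ((Lc * (real p * t)) powr q)" .
  qed auto
  also have "\<dots> = ennreal (cb (real p * t))"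
    by (simp add: cb_def ennreal_mult[symmetric] ennreal_plus[symmetric] ennreal_1[symmetric] del: ennreal_plus ennreal_1)
  finally show ?thesis .
qed

text \<open>Given \<open>Y\<close>, the expectation is at most a multiple of the trace of the third power of the ridge inverse.
  The arithmetic-geometric mean inequality splits this trace into traces of the second and the
  fourth power; the weight \<open>\<rho>\<close> is left free in order to absorb the fourth power later.\<close>

lemma uv_moment:
  assumes j: "j < p" and J: "J \<subseteq> {..<p}" "j \<notin> J" and Y: "Y = keep J Y"
    and l: "l > 0" and \<rho>: "\<rho> > 0"
  shows "(\<integral>\<^sup>+\<omega>. ennreal (uv n p l Y (\<lambda>i. Z \<omega> i j)) \<partial>M)
     \<le> ennreal (c1 * ((\<rho> * trace2 n p l J Y + trace4 n p l J Y / \<rho>) / 2))"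
proof -
  have fJ: "finite J" using J finite_subset by auto
  have Y0: "Y i k = 0" if "k \<notin> J" for i k using Y that by (metis keep_def)
  note F = forms_fixed[where Y = Y and j = j and n = n, OF j l Y0[OF J(2)]]
  let ?S = "\<lambda>\<omega>. \<Sum>k\<in>J. (ip n (hv n p l Y k) (\<lambda>i. Z \<omega> i j))\<^sup>2"
  have wz: "wv n p l Y c k = 0" if "k < p" "k \<notin> J" for k c
    using F(2)[OF that(1)] F(6)[OF that(1) Y0[OF that(2)]] by (simp add: ip_def)
  have uv: "uv n p l Y (\<lambda>i. Z \<omega> i j) = ?S \<omega>" for \<omega>
  proof -
    have "ip p (wv n p l Y (\<lambda>i. Z \<omega> i j)) (wv n p l Y (\<lambda>i. Z \<omega> i j)) = (\<Sum>k\<in>J. (wv n p l Y (\<lambda>i. Z \<omega> i j) k)\<^sup>2)"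
      by (rule sum_J[OF J(1) wz])
    also have "\<dots> = ?S \<omega>" using J by (intro sum.cong refl) (subst F(2), auto)
    finally show ?thesis by (simp add: uv_def)
  qed
  have S0: "?S \<omega> \<ge> 0" for \<omega> by (intro sum_nonneg) auto
  have H0: "(\<Sum>k\<in>J. ip n (hv n p l Y k) (hv n p l Y k)) \<ge> 0" by (intro sum_nonneg ip_self_nonneg)
  have "(\<integral>\<^sup>+\<omega>. ennreal (?S \<omega> powr 1) \<partial>M) \<le> ennreal ((lin_const (2 * 1) (1 + K) * (\<Sum>k\<in>J. ip n (hv n p l Y k) (hv n p l Y k))) powr 1)"
    using K0 mean j fJ second_moment by (intro linear_forms_moment col_indep) auto
  then have "(\<integral>\<^sup>+\<omega>. ennreal (uv n p l Y (\<lambda>i. Z \<omega> i j)) \<partial>M) \<le> ennreal (c1 * (\<Sum>k\<in>J. ip n (hv n p l Y k) (hv n p l Y k)))"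
    using S0 H0 c1_pos by (simp add: uv c1_def)
  also have "\<dots> \<le> ennreal (c1 * ((\<rho> * trace2 n p l J Y + trace4 n p l J Y / \<rho>) / 2))"
  proof (intro ennreal_leI mult_left_mono)
    let ?u = "\<lambda>k m. rinv n p l Y m k" and ?v = "\<lambda>k. mv p (rinv n p l Y) (\<lambda>m. rinv n p l Y m k)"
    have "(\<Sum>k\<in>J. ip n (hv n p l Y k) (hv n p l Y k)) \<le> (\<Sum>k\<in>J. (\<rho> * ip p (?u k) (?u k) + ip p (?v k) (?v k) / \<rho>) / 2)"
      using F(4) J by (intro sum_mono order_trans[OF _ ip_le_weighted[OF \<rho>]]) auto
    also have "\<dots> = (\<rho> * trace2 n p l J Y + trace4 n p l J Y / \<rho>) / 2"
      by (simp add: trace2_def trace4_def ip_def power2_eq_square sum.distrib sum_divide_distrib sum_distrib_left add_divide_distrib)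
    finally show "(\<Sum>k\<in>J. ip n (hv n p l Y k) (hv n p l Y k)) \<le> (\<rho> * trace2 n p l J Y + trace4 n p l J Y / \<rho>) / 2" .
  qed (use c1_pos in auto)
  finally show ?thesis .
qed

definition good_trace2 :: "real \<Rightarrow> real \<Rightarrow> real \<Rightarrow> nat set \<Rightarrow> (nat \<Rightarrow> nat \<Rightarrow> real) \<Rightarrow> ennreal" where
  "good_trace2 l t s J Y = (if good n p l t J Y then ennreal (trace2 n p l J Y powr s) else 0)"

definition good_trace4 :: "real \<Rightarrow> real \<Rightarrow> nat set \<Rightarrow> (nat \<Rightarrow> nat \<Rightarrow> real) \<Rightarrow> ennreal" where
  "good_trace4 l t J Y = (if good n p l t J Y then ennreal (trace4 n p l J Y) else 0)"

lemma meas_good_trace2: "(\<And>i k. (\<lambda>\<omega>. Y \<omega> i k) \<in> borel_measurable N) \<Longrightarrow> finite J \<Longrightarrow> (\<lambda>\<omega>. good_trace2 l t s J (Y \<omega>)) \<in> borel_measurable N"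
  and meas_good_trace4: "(\<And>i k. (\<lambda>\<omega>. Y \<omega> i k) \<in> borel_measurable N) \<Longrightarrow> finite J \<Longrightarrow> (\<lambda>\<omega>. good_trace4 l t J (Y \<omega>)) \<in> borel_measurable N"
proof -
  assume Y: "\<And>i k. (\<lambda>\<omega>. Y \<omega> i k) \<in> borel_measurable N" and J: "finite J"
  note [measurable] = meas_good[OF Y J] meas_trace2[OF Y] meas_trace4[OF Y]
  show "(\<lambda>\<omega>. good_trace2 l t s J (Y \<omega>)) \<in> borel_measurable N" unfolding good_trace2_def by measurable
  show "(\<lambda>\<omega>. good_trace4 l t J (Y \<omega>)) \<in> borel_measurable N" unfolding good_trace4_def by measurable
qed

lemma keep_meas: "(\<lambda>\<omega>. keep J (Z \<omega>) i k) \<in> borel_measurable M"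
  by (intro meas_keep Z_meas)

lemma bv_expect:
  assumes j: "j < p" and J: "J \<subseteq> {..<p}" "j \<notin> J" and t: "t \<ge> 0" and l: "l > 0"
  shows "(\<integral>\<^sup>+\<omega>. (if good n p l t J (keep J (Z \<omega>)) then ennreal (bv n p l (keep J (Z \<omega>)) (\<lambda>i. Z \<omega> i j) powr q) else 0) \<partial>M)
     \<le> ennreal (cb (real p * t))"
proof -
  have fJ: "finite J" using J finite_subset by auto
  have "(\<integral>\<^sup>+\<omega>. (\<lambda>Y c. if good n p l t J Y then ennreal (bv n p l Y c powr q) else 0) (keep J (Z \<omega>)) (\<lambda>i. Z \<omega> i j) \<partial>M)
     \<le> (\<integral>\<^sup>+\<omega>. (\<lambda>Y. ennreal (cb (real p * t))) (keep J (Z \<omega>)) \<partial>M)"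
  proof (rule col_freeze[OF j J])
    fix N :: "((nat \<times> nat \<Rightarrow> real) \<times> (nat \<times> nat \<Rightarrow> real)) measure" and Y :: "_ \<Rightarrow> nat \<Rightarrow> nat \<Rightarrow> real" and c :: "_ \<Rightarrow> nat \<Rightarrow> real"
    assume Y: "\<And>i k. (\<lambda>\<omega>. Y \<omega> i k) \<in> borel_measurable N" and c: "\<And>i. (\<lambda>\<omega>. c \<omega> i) \<in> borel_measurable N"
    note [measurable] = meas_good[OF Y fJ] meas_bv[OF Y c]
    show "(\<lambda>\<omega>. if good n p l t J (Y \<omega>) then ennreal (bv n p l (Y \<omega>) (c \<omega>) powr q) else 0) \<in> borel_measurable N"
      by measurable
  next
    fix Y assume "Y = keep J Y"
    from bv_moment[OF j J this _ t l]
    show "(\<integral>\<^sup>+\<omega>. (if good n p l t J Y then ennreal (bv n p l Y (\<lambda>i. Z \<omega> i j) powr q) else 0) \<partial>M) \<le> ennreal (cb (real p * t))"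
      by (cases "good n p l t J Y") auto
  qed auto
  then show ?thesis by (simp add: emeasure_space_1)
qed

text \<open>The squared norm of column \<open>j\<close> of the inverse is \<open>t\<^sup>2\<close> times a quantity with bounded moments.
  In the bound \<open>(p t\<^sup>2) powr s\<close> nothing is lost: for \<open>t\<close> of the order \<open>1 / n\<close> the trace of the second
  power is of the order \<open>1 / n\<close>.\<close>

lemma good_trace2_expect:
  assumes J: "J \<subseteq> {..<p}" and t: "t \<ge> 0" and l: "l > 0" and s: "1 \<le> s" "s \<le> q"
  shows "(\<integral>\<^sup>+\<omega>. good_trace2 l t s J (keep J (Z \<omega>)) \<partial>M) \<le> ennreal ((real p * t\<^sup>2) powr s * cb (real p * t))"
proof -
  have fJ: "finite J" using J finite_subset by auto
  have cJ: "real (card J) \<le> real p" using card_mono[OF _ J] by simp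
  let ?E = "\<lambda>j \<omega>. (if good n p l t (J - {j}) (keep (J - {j}) (Z \<omega>)) then ennreal (bv n p l (keep (J - {j}) (Z \<omega>)) (\<lambda>i. Z \<omega> i j) powr q) else 0)"
  let ?a = "(real p * t\<^sup>2) powr (s - 1)"
  have Em[measurable]: "?E j \<in> borel_measurable M" for j
  proof -
    have f: "finite (J - {j})" using fJ by simp
    have 1: "{\<omega> \<in> space M. good n p l t (J - {j}) (keep (J - {j}) (Z \<omega>))} \<in> sets M"
      by (rule meas_good[OF keep_meas f])
    note [measurable] = meas_bv[OF keep_meas Z_meas]
    show ?thesis by (rule measurable_If[OF _ _ 1]) measurable
  qed
  have "(\<integral>\<^sup>+\<omega>. good_trace2 l t s J (keep J (Z \<omega>)) \<partial>M) \<le> (\<integral>\<^sup>+\<omega>. ennreal ?a * (\<Sum>j\<in>J. ennreal (t\<^sup>2) * ?E j \<omega>) \<partial>M)"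
  proof (rule nn_integral_mono)
    fix \<omega>
    show "good_trace2 l t s J (keep J (Z \<omega>)) \<le> ennreal ?a * (\<Sum>j\<in>J. ennreal (t\<^sup>2) * ?E j \<omega>)"
    proof (cases "good n p l t J (keep J (Z \<omega>))")
      case False then show ?thesis by (simp add: good_trace2_def)
    next
      case g: True
      let ?b = "\<lambda>j. bv n p l (keep (J - {j}) (Z \<omega>)) (\<lambda>i. Z \<omega> i j)"
      note CB = column_bounds[OF _ J l g]
      have "trace2 n p l J (keep J (Z \<omega>)) \<le> (\<Sum>j\<in>J. t\<^sup>2 * ?b j)"
        unfolding trace2_def by (intro sum_mono CB(2))
      then have "trace2 n p l J (keep J (Z \<omega>)) powr s \<le> (\<Sum>j\<in>J. t\<^sup>2 * ?b j) powr s"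
        using s by (intro powr_mono2 trace2_nonneg) auto
      also have "\<dots> \<le> (\<Sum>j\<in>J. t\<^sup>2) powr (s - 1) * (\<Sum>j\<in>J. t\<^sup>2 * ?b j powr s)"
        using s fJ bv_ge by (intro powr_sum_le) (auto intro: order_trans[OF zero_le_one])
      also have "\<dots> \<le> ?a * (\<Sum>j\<in>J. t\<^sup>2 * ?b j powr q)"
        using s cJ bv_ge by (intro mult_mono powr_mono2 sum_mono mult_left_mono powr_mono) (auto intro!: sum_nonneg mult_right_mono)
      finally have "ennreal (trace2 n p l J (keep J (Z \<omega>)) powr s) \<le> ennreal (?a * (\<Sum>j\<in>J. t\<^sup>2 * ?b j powr q))" by (rule ennreal_leI)
      also have "\<dots> = ennreal ?a * (\<Sum>j\<in>J. ennreal (t\<^sup>2) * ennreal (?b j powr q))"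
        by (simp add: ennreal_mult' ennreal_mult sum_ennreal[symmetric])
      also have "\<dots> = ennreal ?a * (\<Sum>j\<in>J. ennreal (t\<^sup>2) * ?E j \<omega>)"
        using CB(1) by (intro arg_cong[where f = "(*) (ennreal ?a)"] sum.cong) auto
      finally show ?thesis using g by (simp add: good_trace2_def)
    qed
  qed
  also have "\<dots> = ennreal ?a * (\<Sum>j\<in>J. ennreal (t\<^sup>2) * (\<integral>\<^sup>+\<omega>. ?E j \<omega> \<partial>M))"
    by (simp add: nn_integral_cmult nn_integral_sum)
  also have "\<dots> \<le> ennreal ?a * (\<Sum>j\<in>J. ennreal (t\<^sup>2) * ennreal (cb (real p * t)))"
    using J t l by (intro mult_left_mono sum_mono bv_expect) auto
  also have "\<dots> = ennreal (?a * (real (card J) * (t\<^sup>2 * cb (real p * t))))"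
    using cb_pos[of "real p * t"] by (simp add: ennreal_mult[symmetric] ennreal_of_nat_eq_real_of_nat)
  also have "\<dots> \<le> ennreal ((real p * t\<^sup>2) powr s * cb (real p * t))"
  proof (rule ennreal_leI)
    have "?a * (real (card J) * (t\<^sup>2 * cb (real p * t))) \<le> ?a * (real p * (t\<^sup>2 * cb (real p * t)))"
      using cJ cb_pos[of "real p * t"] by (intro mult_left_mono mult_right_mono) auto
    also have "\<dots> = (?a * (real p * t\<^sup>2)) * cb (real p * t)" by simp
    also have "?a * (real p * t\<^sup>2) = (real p * t\<^sup>2) powr s"
      by (cases "real p * t\<^sup>2 = 0") (auto simp: powr_diff)
    finally show "?a * (real (card J) * (t\<^sup>2 * cb (real p * t))) \<le> (real p * t\<^sup>2) powr s * cb (real p * t)" .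
  qed
  finally show ?thesis .
qed

text \<open>For \<open>t\<close> of the order \<open>1 / n\<close> and \<open>p\<close> at most \<open>n\<close> this is of the order \<open>n powr -3\<close>, as it should
  be for the trace of the fourth power of an inverse with eigenvalues of the order \<open>1 / n\<close>.\<close>

definition trace4_const :: "real \<Rightarrow> real" where
  "trace4_const t = 4 * (real p * t ^ 4 * cb (real p * t)) + 4 * ((real p * t\<^sup>2) ^ 3 * c1\<^sup>2 * cb (real p * t))"

text \<open>Each column contributes a term that feeds back the same trace for the array without this column. The
  choice of \<open>\<rho>\<close> damps the total feedback to a factor one half, and the bound is the fixed point of the
  resulting recursion over the columns.\<close>

lemma good_trace4_expect:
  assumes "J \<subseteq> {..<p}" and t: "t > 0" and l: "l > 0"
  shows "(\<integral>\<^sup>+\<omega>. good_trace4 l t J (keep J (Z \<omega>)) \<partial>M) \<le> ennreal (trace4_const t)"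
  using assms(1)
proof (induction "card J" arbitrary: J rule: less_induct)
  case less
  note J = less.prems
  have fJ: "finite J" using J finite_subset by auto
  show ?case
  proof (cases "J = {}")
    case True then show ?thesis by (simp add: good_trace4_def trace4_def good_def)
  next
    case False
    with J have p: "real p > 0" by auto
    have cJ: "real (card J) \<le> real p" using card_mono[OF _ J] by simp
    let ?cb = "cb (real p * t)"
    have cb: "?cb > 0" by (rule cb_pos)
    \<comment> \<open>Makes the coefficient of the trace for the smaller array equal to \<open>1 / (2 * p)\<close>.\<close>
    define \<rho> where "\<rho> = 2 * real p * t\<^sup>2 * c1"
    have \<rho>: "\<rho> > 0" using p t c1_pos by (simp add: \<rho>_def)
    let ?F = "\<lambda>j Y c. if good n p l t (J - {j}) Y then ennreal (2 * t\<^sup>2 * (t\<^sup>2 * bv n p l Y c powr q)) + ennreal (2 * t\<^sup>2 * uv n p l Y c) else 0"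
    let ?G = "\<lambda>j Y. ennreal (2 * t\<^sup>2 * (t\<^sup>2 * ?cb)) + (ennreal (t\<^sup>2 * c1 * \<rho>) * good_trace2 l t 1 (J - {j}) Y + ennreal (t\<^sup>2 * c1 / \<rho>) * good_trace4 l t (J - {j}) Y)"
    let ?f = "\<lambda>j \<omega>. ?F j (keep (J - {j}) (Z \<omega>)) (\<lambda>i. Z \<omega> i j)"
    have fm[measurable]: "?f j \<in> borel_measurable M" for j
    proof -
      have f: "finite (J - {j})" using fJ by simp
      have 1: "{\<omega> \<in> space M. good n p l t (J - {j}) (keep (J - {j}) (Z \<omega>))} \<in> sets M"
        by (rule meas_good[OF keep_meas f])
      note [measurable] = meas_bv[OF keep_meas Z_meas] meas_uv[OF keep_meas Z_meas]
      show ?thesis by (rule measurable_If[OF _ _ 1]) measurable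
    qed
    have step: "(\<integral>\<^sup>+\<omega>. ?f j \<omega> \<partial>M) \<le> ennreal (2 * t\<^sup>2 * (t\<^sup>2 * ?cb) + t\<^sup>2 * c1 * \<rho> * (real p * t\<^sup>2 * ?cb) + t\<^sup>2 * c1 / \<rho> * trace4_const t)"
      if j: "j \<in> J" for j
    proof -
      let ?J = "J - {j}"
      have jp: "j < p" and J': "?J \<subseteq> {..<p}" "j \<notin> ?J" "finite ?J" using j J fJ by auto
      have "(\<integral>\<^sup>+\<omega>. ?f j \<omega> \<partial>M) \<le> (\<integral>\<^sup>+\<omega>. ?G j (keep ?J (Z \<omega>)) \<partial>M)"
      proof (rule col_freeze[OF jp J'(1,2), where F = "?F j" and G = "?G j"])
        fix N :: "((nat \<times> nat \<Rightarrow> real) \<times> (nat \<times> nat \<Rightarrow> real)) measure" and Y :: "_ \<Rightarrow> nat \<Rightarrow> nat \<Rightarrow> real" and c :: "_ \<Rightarrow> nat \<Rightarrow> real"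
        assume Y: "\<And>i k. (\<lambda>\<omega>. Y \<omega> i k) \<in> borel_measurable N" and c: "\<And>i. (\<lambda>\<omega>. c \<omega> i) \<in> borel_measurable N"
        note [measurable] = meas_good[OF Y J'(3)] meas_bv[OF Y c] meas_uv[OF Y c]
        show "(\<lambda>\<omega>. ?F j (Y \<omega>) (c \<omega>)) \<in> borel_measurable N" by measurable
      next
        fix N :: "(nat \<times> nat \<Rightarrow> real) measure" and Y :: "_ \<Rightarrow> nat \<Rightarrow> nat \<Rightarrow> real"
        assume Y: "\<And>i k. (\<lambda>\<omega>. Y \<omega> i k) \<in> borel_measurable N"
        note [measurable] = meas_good_trace2[OF Y J'(3)] meas_good_trace4[OF Y J'(3)]
        show "(\<lambda>\<omega>. ?G j (Y \<omega>)) \<in> borel_measurable N" by measurable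
      next
        fix Y assume Y: "Y = keep ?J Y"
        show "(\<integral>\<^sup>+\<omega>. ?F j Y (\<lambda>i. Z \<omega> i j) \<partial>M) \<le> ?G j Y"
        proof (cases "good n p l t ?J Y")
          case False then show ?thesis by simp
        next
          case g: True
          have Ym: "(\<lambda>\<omega>. Y i k) \<in> borel_measurable M" for i k by simp
          note [measurable] = meas_bv[OF Ym Z_meas] meas_uv[OF Ym Z_meas]
          have "(\<integral>\<^sup>+\<omega>. ?F j Y (\<lambda>i. Z \<omega> i j) \<partial>M)
            = (\<integral>\<^sup>+\<omega>. ennreal (2 * t\<^sup>2 * t\<^sup>2) * ennreal (bv n p l Y (\<lambda>i. Z \<omega> i j) powr q) + ennreal (2 * t\<^sup>2) * ennreal (uv n p l Y (\<lambda>i. Z \<omega> i j)) \<partial>M)"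
            using g uv_nonneg by (simp add: ennreal_mult[symmetric] mult.assoc)
          also have "\<dots> = ennreal (2 * t\<^sup>2 * t\<^sup>2) * (\<integral>\<^sup>+\<omega>. ennreal (bv n p l Y (\<lambda>i. Z \<omega> i j) powr q) \<partial>M) + ennreal (2 * t\<^sup>2) * (\<integral>\<^sup>+\<omega>. ennreal (uv n p l Y (\<lambda>i. Z \<omega> i j)) \<partial>M)"
            by (simp add: nn_integral_add nn_integral_cmult)
          also have "\<dots> \<le> ennreal (2 * t\<^sup>2 * t\<^sup>2) * ennreal ?cb + ennreal (2 * t\<^sup>2) * ennreal (c1 * ((\<rho> * trace2 n p l ?J Y + trace4 n p l ?J Y / \<rho>) / 2))"
            using t l \<rho> by (intro add_mono mult_left_mono bv_moment[OF jp J'(1,2) Y g] uv_moment[OF jp J'(1,2) Y]) auto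
          also have "\<dots> = ennreal (2 * t\<^sup>2 * (t\<^sup>2 * ?cb) + (t\<^sup>2 * c1 * \<rho> * trace2 n p l ?J Y + t\<^sup>2 * c1 / \<rho> * trace4 n p l ?J Y))"
            using cb c1_pos \<rho> trace2_nonneg[of n p l ?J Y] trace4_nonneg[of n p l ?J Y]
            by (simp add: ennreal_mult[symmetric] ennreal_plus[symmetric] algebra_simps add_divide_distrib del: ennreal_plus)
          also have "\<dots> = ?G j Y"
            using g cb c1_pos \<rho> trace2_nonneg[of n p l ?J Y] trace4_nonneg[of n p l ?J Y]
            by (simp add: good_trace2_def good_trace4_def ennreal_mult[symmetric] ennreal_plus[symmetric] del: ennreal_plus)
          finally show ?thesis .
        qed
      qed
      also have "\<dots> = ennreal (2 * t\<^sup>2 * (t\<^sup>2 * ?cb)) + (ennreal (t\<^sup>2 * c1 * \<rho>) * (\<integral>\<^sup>+\<omega>. good_trace2 l t 1 ?J (keep ?J (Z \<omega>)) \<partial>M)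
           + ennreal (t\<^sup>2 * c1 / \<rho>) * (\<integral>\<^sup>+\<omega>. good_trace4 l t ?J (keep ?J (Z \<omega>)) \<partial>M))"
      proof -
        note [measurable] = meas_good_trace2[OF keep_meas J'(3)] meas_good_trace4[OF keep_meas J'(3)]
        show ?thesis by (simp add: nn_integral_add nn_integral_cmult emeasure_space_1)
      qed
      also have "\<dots> \<le> ennreal (2 * t\<^sup>2 * (t\<^sup>2 * ?cb)) + (ennreal (t\<^sup>2 * c1 * \<rho>) * ennreal ((real p * t\<^sup>2) powr 1 * ?cb)
           + ennreal (t\<^sup>2 * c1 / \<rho>) * ennreal (trace4_const t))"
      proof (intro add_mono mult_left_mono order_refl)
        show "(\<integral>\<^sup>+\<omega>. good_trace2 l t 1 ?J (keep ?J (Z \<omega>)) \<partial>M) \<le> ennreal ((real p * t\<^sup>2) powr 1 * ?cb)"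
          using t l q3 J' by (intro good_trace2_expect) auto
        show "(\<integral>\<^sup>+\<omega>. good_trace4 l t ?J (keep ?J (Z \<omega>)) \<partial>M) \<le> ennreal (trace4_const t)"
          using card_Diff1_less[OF fJ j] J' by (intro less.hyps) auto
      qed auto
      also have "\<dots> = ennreal (2 * t\<^sup>2 * (t\<^sup>2 * ?cb) + t\<^sup>2 * c1 * \<rho> * (real p * t\<^sup>2 * ?cb) + t\<^sup>2 * c1 / \<rho> * trace4_const t)"
        using cb c1_pos \<rho> p by (simp add: ennreal_mult[symmetric] ennreal_plus[symmetric] trace4_const_def algebra_simps del: ennreal_plus)
      finally show ?thesis .
    qed
    have "(\<integral>\<^sup>+\<omega>. good_trace4 l t J (keep J (Z \<omega>)) \<partial>M) \<le> (\<integral>\<^sup>+\<omega>. (\<Sum>j\<in>J. ?f j \<omega>) \<partial>M)"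
    proof (rule nn_integral_mono)
      fix \<omega>
      show "good_trace4 l t J (keep J (Z \<omega>)) \<le> (\<Sum>j\<in>J. ?f j \<omega>)"
      proof (cases "good n p l t J (keep J (Z \<omega>))")
        case False then show ?thesis by (simp add: good_trace4_def)
      next
        case g: True
        let ?b = "\<lambda>j. bv n p l (keep (J - {j}) (Z \<omega>)) (\<lambda>i. Z \<omega> i j)"
        let ?u = "\<lambda>j. uv n p l (keep (J - {j}) (Z \<omega>)) (\<lambda>i. Z \<omega> i j)"
        note CB = column_bounds[OF _ J l g]
        have b3: "?b j ^ 3 \<le> ?b j powr q" for j
        proof -
          have "?b j ^ 3 = ?b j powr 3" using bv_ge[of n p l "keep (J - {j}) (Z \<omega>)" "\<lambda>i. Z \<omega> i j"] by (simp add: powr_numeral)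
          also have "\<dots> \<le> ?b j powr q" using bv_ge q3 by (intro powr_mono) auto
          finally show ?thesis .
        qed
        have "trace4 n p l J (keep J (Z \<omega>)) \<le> (\<Sum>j\<in>J. 2 * t\<^sup>2 * (t\<^sup>2 * ?b j ^ 3 + ?u j))"
          unfolding trace4_def by (intro sum_mono CB(3))
        also have "\<dots> \<le> (\<Sum>j\<in>J. 2 * t\<^sup>2 * (t\<^sup>2 * ?b j powr q + ?u j))"
          using b3 by (intro sum_mono mult_left_mono add_right_mono) auto
        finally have "ennreal (trace4 n p l J (keep J (Z \<omega>))) \<le> ennreal (\<Sum>j\<in>J. 2 * t\<^sup>2 * (t\<^sup>2 * ?b j powr q + ?u j))" by (rule ennreal_leI)
        also have "\<dots> = (\<Sum>j\<in>J. ennreal (2 * t\<^sup>2 * (t\<^sup>2 * ?b j powr q)) + ennreal (2 * t\<^sup>2 * ?u j))"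
          using uv_nonneg by (simp add: sum_ennreal[symmetric] ennreal_plus[symmetric] distrib_left del: ennreal_plus)
        also have "\<dots> = (\<Sum>j\<in>J. ?f j \<omega>)" using CB(1) by (intro sum.cong) auto
        finally show ?thesis using g by (simp add: good_trace4_def)
      qed
    qed
    also have "\<dots> = (\<Sum>j\<in>J. \<integral>\<^sup>+\<omega>. ?f j \<omega> \<partial>M)" by (rule nn_integral_sum) simp
    also have "\<dots> \<le> (\<Sum>j\<in>J. ennreal (2 * t\<^sup>2 * (t\<^sup>2 * ?cb) + t\<^sup>2 * c1 * \<rho> * (real p * t\<^sup>2 * ?cb) + t\<^sup>2 * c1 / \<rho> * trace4_const t))"
      by (intro sum_mono step)
    also have "\<dots> = ennreal (real (card J) * (2 * t\<^sup>2 * (t\<^sup>2 * ?cb) + t\<^sup>2 * c1 * \<rho> * (real p * t\<^sup>2 * ?cb) + t\<^sup>2 * c1 / \<rho> * trace4_const t))"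
      by (simp add: ennreal_mult' ennreal_of_nat_eq_real_of_nat)
    also have "\<dots> \<le> ennreal (real p * (2 * t\<^sup>2 * (t\<^sup>2 * ?cb) + t\<^sup>2 * c1 * \<rho> * (real p * t\<^sup>2 * ?cb) + t\<^sup>2 * c1 / \<rho> * trace4_const t))"
      using cJ cb c1_pos \<rho> p t by (intro ennreal_leI mult_right_mono add_nonneg_nonneg) (auto simp: trace4_const_def)
    also have "real p * (2 * t\<^sup>2 * (t\<^sup>2 * ?cb) + t\<^sup>2 * c1 * \<rho> * (real p * t\<^sup>2 * ?cb) + t\<^sup>2 * c1 / \<rho> * trace4_const t) = trace4_const t"
    proof -
      have 1: "real p * (t\<^sup>2 * c1 / \<rho>) = 1/2" using p t c1_pos by (simp add: \<rho>_def)
      have "real p * (t\<^sup>2 * c1 / \<rho> * trace4_const t) = 1/2 * trace4_const t" by (subst 1[symmetric]) simp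
      then show ?thesis by (simp add: trace4_const_def \<rho>_def power2_eq_square power3_eq_cube power4_eq_xxxx algebra_simps)
    qed
    finally show ?thesis .
  qed
qed

end

section \<open>Three exceptional events\<close>

text \<open>The penalized inverse is smaller as a quadratic form.\<close>

lemma ridge_le_ols:
  assumes x: "is_rinv n p l Z x" and x0: "is_rinv n p 0 Z x0" and l: "l \<ge> 0"
  shows "ip p v (mv p x v) \<le> ip p v (mv p x0 v)"
proof -
  let ?w = "mv p x v"
  define u where "u k = v k - l * ?w k" for k
  have w: "?w k = mv p x0 u k" if k: "k < p" for k
  proof -
    have "rop n p 0 Z ?w m = u m" if "m < p" for m
      using rinv_solves[OF x that, of v] by (simp add: rop_def u_def)
    then show ?thesis by (rule rinv_unique[OF x0 _ k])
  qed
  have ipw: "ip p a (mv p x0 u) = ip p a ?w" for a by (intro ip_cong) (simp_all add: w)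
  have le: "ip p u ?w \<le> ip p v ?w"
    using l ip_self_nonneg[of p ?w] by (simp add: u_def[abs_def] ip_linear)
  have "(ip p v ?w)\<^sup>2 \<le> ip p v (mv p x0 v) * ip p u ?w"
    using rinv_cauchy[OF x0, of v u] by (simp add: ipw)
  also have "\<dots> \<le> ip p v (mv p x0 v) * ip p v ?w"
    using le rinv_psd[OF x0] by (intro mult_left_mono) auto
  finally have *: "ip p v ?w * ip p v ?w \<le> ip p v (mv p x0 v) * ip p v ?w" by (simp add: power2_eq_square)
  show ?thesis
  proof (cases "ip p v ?w = 0")
    case True then show ?thesis using rinv_psd[OF x0, of v] by simp
  next
    case False
    then have "ip p v ?w > 0" using rinv_psd[OF x l, of v] by simp
    with * show ?thesis by (rule mult_right_le_imp_le)
  qed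
qed

lemma rinv_diag_form: "k < p \<Longrightarrow> ip p (\<lambda>m. if m = k then 1 else 0) (mv p x (\<lambda>m. if m = k then 1 else 0)) = x k k"
  by (simp add: ip_unit_left mv_unit)

lemma cauchy_ip: "(ip p u v)\<^sup>2 \<le> ip p u u * ip p v v"
  using Cauchy_Schwarz_ineq_sum[of u v "{..<p}"] by (simp add: ip_def power2_eq_square)

lemma (in prob_space) quadratic_form_nn:
  fixes z :: "nat \<Rightarrow> 'a \<Rightarrow> real" and B :: "nat \<Rightarrow> nat \<Rightarrow> real"
  assumes q: "q \<ge> 2" and K: "K \<ge> 0"
    and ind: "indep_vars (\<lambda>_. borel) z {..<N}"
    and mean: "\<And>i. i < N \<Longrightarrow> (\<integral>\<omega>. z i \<omega> \<partial>M) = 0"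
    and var: "\<And>i. i < N \<Longrightarrow> (\<integral>\<omega>. (z i \<omega>)\<^sup>2 \<partial>M) = 1"
    and int: "\<And>i. i < N \<Longrightarrow> integrable M (\<lambda>\<omega>. \<bar>z i \<omega>\<bar> powr (2 * q))"
    and mom: "\<And>i. i < N \<Longrightarrow> (\<integral>\<omega>. \<bar>z i \<omega>\<bar> powr (2 * q) \<partial>M) \<le> K"
  shows "(\<integral>\<^sup>+\<omega>. ennreal (\<bar>ip N (\<lambda>i. z i \<omega>) (mv N B (\<lambda>i. z i \<omega>)) - (\<Sum>i<N. B i i)\<bar> powr q) \<partial>M)
    \<le> ennreal ((quad_const q K * (\<Sum>i<N. \<Sum>k<N. (B i k)\<^sup>2)) powr (q/2))"
proof -
  note Q = quadratic_form_moment[OF q K ind mean int mom, of B]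
  have e: "(\<Sum>i<N. \<Sum>k<N. B i k * z i \<omega> * z k \<omega>) - (\<Sum>i<N. B i i * (\<integral>\<omega>. (z i \<omega>)\<^sup>2 \<partial>M))
     = ip N (\<lambda>i. z i \<omega>) (mv N B (\<lambda>i. z i \<omega>)) - (\<Sum>i<N. B i i)" for \<omega>
    using var by (simp add: ip_def mv_def sum_distrib_left ac_simps)
  show ?thesis
    using nn_integral_eq_integral[OF Q(1)] Q(2) by (simp add: e ennreal_leI)
qed

lemma (in prob_space) one_form_nn:
  fixes z :: "nat \<Rightarrow> 'a \<Rightarrow> real"
  assumes q: "q \<ge> 1" and K: "K \<ge> 0"
    and ind: "indep_vars (\<lambda>_. borel) z {..<N}"
    and mean: "\<And>i. i < N \<Longrightarrow> (\<integral>\<omega>. z i \<omega> \<partial>M) = 0"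
    and int: "\<And>i. i < N \<Longrightarrow> integrable M (\<lambda>\<omega>. \<bar>z i \<omega>\<bar> powr (2 * q))"
    and mom: "\<And>i. i < N \<Longrightarrow> (\<integral>\<omega>. \<bar>z i \<omega>\<bar> powr (2 * q) \<partial>M) \<le> K"
  shows "(\<integral>\<^sup>+\<omega>. ennreal (((ip N g (\<lambda>i. z i \<omega>))\<^sup>2) powr q) \<partial>M)
     \<le> ennreal ((lin_const (2 * q) K * ip N g g) powr q)"
  using linear_forms_moment[OF assms, of "{()}" "\<lambda>_. g"] by simp

context indep_array
begin

lemma zrow_array: "indep_array M (\<lambda>\<omega>. zrow r (Z \<omega>)) n p q K"
proof (unfold_locales)
  have "indep_vars (\<lambda>_. borel) (\<lambda>ik \<omega>. (if fst ik = r then (\<lambda>_. 0) else (\<lambda>x. x)) ((\<lambda>(i, k) \<omega>. Z \<omega> i k) ik \<omega>)) ({..<n} \<times> {..<p})"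
    by (rule indep_vars_compose2[OF ind]) auto
  also have "(\<lambda>ik \<omega>. (if fst ik = r then (\<lambda>_. 0) else (\<lambda>x. x)) ((\<lambda>(i, k) \<omega>. Z \<omega> i k) ik \<omega>)) = (\<lambda>(i, k) \<omega>. zrow r (Z \<omega>) i k)"
    by (auto simp: zrow_def fun_eq_iff)
  finally show "indep_vars (\<lambda>_. borel) (\<lambda>(i, k) \<omega>. zrow r (Z \<omega>) i k) ({..<n} \<times> {..<p})" .
  show "integrable M (\<lambda>\<omega>. \<bar>zrow r (Z \<omega>) i k\<bar> powr (2 * q))" if "i < n" "k < p" for i k
    using int[OF that] by (cases "i = r") (auto simp: zrow_def)
  show "(\<integral>\<omega>. \<bar>zrow r (Z \<omega>) i k\<bar> powr (2 * q) \<partial>M) \<le> K" if "i < n" "k < p" for i k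
    using mom[OF that] K0 by (cases "i = r") (auto simp: zrow_def)
  show "(\<integral>\<omega>. zrow r (Z \<omega>) i k \<partial>M) = 0" if "i < n" "k < p" for i k
    using mean[OF that] by (cases "i = r") (auto simp: zrow_def)
qed (use q3 K0 out in \<open>auto simp: zrow_def\<close>)

lemma zrow_meas: "(\<lambda>\<omega>. zrow r (Z \<omega>) i k) \<in> borel_measurable M"
  by (simp add: zrow_def)

lemma keep_all: "keep {..<p} (zrow r (Z \<omega>)) = zrow r (Z \<omega>)" "keep {..<p} (Z \<omega>) = Z \<omega>"
  using out[of _ _ \<omega>] by (auto simp: keep_def zrow_def fun_eq_iff not_less)

lemma keep_col: "keep ({..<p} - {j}) (Z \<omega>) = zcol j (Z \<omega>)"
  using out[of _ _ \<omega>] by (auto simp: keep_def zcol_def fun_eq_iff not_less)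

definition Qc :: real where "Qc = quad_const q K"
lemma Qc_pos: "Qc > 0" using quad_const_pos[OF K0] q3 by (simp add: Qc_def)

abbreviation rs :: "real \<Rightarrow> (nat \<Rightarrow> nat \<Rightarrow> real) \<Rightarrow> (nat \<Rightarrow> real) \<Rightarrow> nat \<Rightarrow> real" where
  "rs l Y \<equiv> res n p Y (rinv n p l Y)"
abbreviation rm :: "real \<Rightarrow> (nat \<Rightarrow> nat \<Rightarrow> real) \<Rightarrow> nat \<Rightarrow> nat \<Rightarrow> real" where
  "rm l Y \<equiv> resmat n p Y (rinv n p l Y)"

lemma meas_rm: "(\<And>i k. (\<lambda>\<omega>. Y \<omega> i k) \<in> borel_measurable N) \<Longrightarrow> (\<lambda>\<omega>. rm l (Y \<omega>) i k) \<in> borel_measurable N"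
  unfolding resmat_def by (intro borel_measurable_diff borel_measurable_const borel_measurable_sum borel_measurable_times meas_rinv) auto

lemma meas_rs: "(\<And>i k. (\<lambda>\<omega>. Y \<omega> i k) \<in> borel_measurable N) \<Longrightarrow> (\<And>i. (\<lambda>\<omega>. c \<omega> i) \<in> borel_measurable N) \<Longrightarrow>
    (\<lambda>\<omega>. rs l (Y \<omega>) (c \<omega>) i) \<in> borel_measurable N"
  unfolding res_def by (intro borel_measurable_diff meas_mv meas_ip meas_rinv) auto

text \<open>The complement of this event is the hypothesis of \<open>row_col_removal\<close>.\<close>

definition large_residual_entry :: "real \<Rightarrow> real \<Rightarrow> nat \<Rightarrow> nat \<Rightarrow> 'a set" where
  "large_residual_entry l e j r = {\<omega> \<in> space M. e * rm l (zcol j (Z \<omega>)) r r < (rs l (zcol j (Z \<omega>)) (\<lambda>i. Z \<omega> i j) r)\<^sup>2}"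

lemma zcol_meas: "(\<lambda>\<omega>. zcol j (Z \<omega>) i k) \<in> borel_measurable M"
  by (simp add: zcol_def)

lemma large_residual_entry_sets: "large_residual_entry l e j r \<in> sets M"
proof -
  note [measurable] = meas_rm[OF zcol_meas] meas_rs[OF zcol_meas Z_meas]
  show ?thesis unfolding large_residual_entry_def by measurable
qed

text \<open>The residual entry is a linear form in column \<open>j\<close> with a coefficient vector that depends on the other
  columns and has squared norm at most the entry \<open>r\<close> of the diagonal, so in Markov's inequality
  with the moment of order \<open>2 * q\<close> that entry cancels.\<close>

lemma large_residual_entry_prob:
  assumes j: "j < p" and r: "r < n" and l: "l > 0" and e: "e > 0"
  shows "emeasure M (large_residual_entry l e j r) \<le> ennreal ((Lc / e) powr q)"
proof -
  let ?J = "{..<p} - {j}"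
  have J: "?J \<subseteq> {..<p}" "j \<notin> ?J" by auto
  let ?F = "\<lambda>Y c. ennreal (((rs l Y c r)\<^sup>2) powr q / (e * rm l Y r r) powr q)"
  have rmk: "rs l Y c r = ip n (rm l Y r) c" for Y c
    using r by (simp add: res_resmat ip_def)
  have P: "ip n (rm l Y r) (rm l Y r) \<le> rm l Y r r" for Y
  proof -
    have "rm l Y r k = rm l Y k r" if "k < n" for k
      using res_sym[OF ridge_inv[OF l, of n p Y], where w = "\<lambda>m. if m = r then 1 else 0" and w' = "\<lambda>m. if m = k then 1 else 0"] r that
      by (simp add: ip_unit_left ip_unit resmat_eq[OF ridge_inv[OF l]])
    then have "ip n (rm l Y r) (rm l Y r) = (\<Sum>k<n. (rm l Y k r)\<^sup>2)" by (simp add: ip_def power2_eq_square)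
    also have "\<dots> \<le> rm l Y r r" using resmat_col_norm[OF ridge_inv[OF l] _ r] l by simp
    finally show ?thesis .
  qed
  have P0: "rm l Y r r \<ge> 0" for Y using order_trans[OF ip_self_nonneg P] .
  have "emeasure M (large_residual_entry l e j r) = (\<integral>\<^sup>+\<omega>. indicator (large_residual_entry l e j r) \<omega> \<partial>M)"
    by (simp add: large_residual_entry_sets)
  also have "\<dots> \<le> (\<integral>\<^sup>+\<omega>. ?F (keep ?J (Z \<omega>)) (\<lambda>i. Z \<omega> i j) \<partial>M)"
  proof (rule nn_integral_mono)
    fix \<omega>
    let ?s = "rs l (zcol j (Z \<omega>)) (\<lambda>i. Z \<omega> i j) r" and ?P = "rm l (zcol j (Z \<omega>)) r r"
    show "indicator (large_residual_entry l e j r) \<omega> \<le> ?F (keep ?J (Z \<omega>)) (\<lambda>i. Z \<omega> i j)"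
    proof (cases "\<omega> \<in> large_residual_entry l e j r")
      case True
      then have b: "e * ?P < ?s\<^sup>2" by (simp add: large_residual_entry_def)
      have "?P \<noteq> 0"
      proof
        assume z: "?P = 0"
        then have "ip n (rm l (zcol j (Z \<omega>)) r) (rm l (zcol j (Z \<omega>)) r) = 0" using P[of "zcol j (Z \<omega>)"] ip_self_nonneg[of n "rm l (zcol j (Z \<omega>)) r"] by simp
        then have "?s = 0" using ip_self_zero[of n "rm l (zcol j (Z \<omega>)) r"] unfolding rmk by (simp add: ip_def[of n _ "\<lambda>i. Z \<omega> i j"])
        with b z show False by simp
      qed
      then have eP: "e * ?P > 0" using P0[of "zcol j (Z \<omega>)"] e by (simp add: less_le)
      have "(e * ?P) powr q \<le> (?s\<^sup>2) powr q" using b eP q3 by (intro powr_mono2) auto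
      then have "1 \<le> (?s\<^sup>2) powr q / (e * ?P) powr q" using eP by (subst le_divide_eq_1_pos) auto
      then have "ennreal 1 \<le> ennreal ((?s\<^sup>2) powr q / (e * ?P) powr q)" by (rule ennreal_leI)
      then show ?thesis using True by (simp add: keep_col)
    qed simp
  qed
  also have "\<dots> \<le> (\<integral>\<^sup>+\<omega>. (\<lambda>Y. ennreal ((Lc / e) powr q)) (keep ?J (Z \<omega>)) \<partial>M)"
  proof (rule col_freeze[OF j J])
    fix N :: "((nat \<times> nat \<Rightarrow> real) \<times> (nat \<times> nat \<Rightarrow> real)) measure" and Y :: "_ \<Rightarrow> nat \<Rightarrow> nat \<Rightarrow> real" and c :: "_ \<Rightarrow> nat \<Rightarrow> real"
    assume Y: "\<And>i k. (\<lambda>\<omega>. Y \<omega> i k) \<in> borel_measurable N" and c: "\<And>i. (\<lambda>\<omega>. c \<omega> i) \<in> borel_measurable N"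
    note [measurable] = meas_rm[OF Y] meas_rs[OF Y c]
    show "(\<lambda>\<omega>. ?F (Y \<omega>) (c \<omega>)) \<in> borel_measurable N" by measurable
  next
    fix Y
    let ?D = "(e * rm l Y r r) powr q"
    have [measurable]: "(\<lambda>\<omega>. rs l Y (\<lambda>i. Z \<omega> i j) r) \<in> borel_measurable M"
      by (intro meas_rs) auto
    have "(\<integral>\<^sup>+\<omega>. ?F Y (\<lambda>i. Z \<omega> i j) \<partial>M) = (\<integral>\<^sup>+\<omega>. ennreal (1 / ?D) * ennreal (((rs l Y (\<lambda>i. Z \<omega> i j) r)\<^sup>2) powr q) \<partial>M)"
      by (simp add: ennreal_mult[symmetric])
    also have "\<dots> = ennreal (1 / ?D) * (\<integral>\<^sup>+\<omega>. ennreal (((ip n (rm l Y r) (\<lambda>i. Z \<omega> i j))\<^sup>2) powr q) \<partial>M)"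
      by (subst nn_integral_cmult) (auto simp: rmk[symmetric])
    also have "\<dots> \<le> ennreal (1 / ?D) * ennreal ((lin_const (2 * q) K * ip n (rm l Y r) (rm l Y r)) powr q)"
      using q3 K0 mean int mom j by (intro mult_left_mono one_form_nn col_indep) auto
    also have "\<dots> \<le> ennreal (1 / ?D) * ennreal ((Lc * rm l Y r r) powr q)"
      using q3 P[of Y] Lc_nonneg ip_self_nonneg by (intro mult_left_mono ennreal_leI powr_mono2) (auto simp: Lc_def intro!: mult_left_mono)
    also have "\<dots> = ennreal (1 / ?D * (Lc * rm l Y r r) powr q)" by (simp add: ennreal_mult[symmetric])
    also have "\<dots> \<le> ennreal ((Lc / e) powr q)"
    proof (rule ennreal_leI)
      show "1 / ?D * (Lc * rm l Y r r) powr q \<le> (Lc / e) powr q"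
        using Lc_nonneg e P0[of Y] q3 by (cases "rm l Y r r = 0") (auto simp: powr_mult powr_divide)
    qed
    finally show "(\<integral>\<^sup>+\<omega>. ?F Y (\<lambda>i. Z \<omega> i j) \<partial>M) \<le> ennreal ((Lc / e) powr q)" .
  qed auto
  also have "\<dots> = ennreal ((Lc / e) powr q)" by (simp add: emeasure_space_1)
  finally show ?thesis .
qed

end

text \<open>Unit variances centre the quadratic forms at the traces of their matrices.\<close>

locale unit_array = indep_array +
  assumes var: "i < n \<Longrightarrow> k < p \<Longrightarrow> (\<integral>\<omega>. (Z \<omega> i k)\<^sup>2 \<partial>M) = 1"
begin

text \<open>The residual sum of squares of column \<open>j\<close> on the other columns falls below \<open>m\<close>. Its inverse
  bounds the diagonal entry \<open>j\<close> of the inverse.\<close>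

definition small_residual :: "real \<Rightarrow> real \<Rightarrow> nat \<Rightarrow> 'a set" where
  "small_residual l m j = {\<omega> \<in> space M. ip n (\<lambda>i. Z \<omega> i j) (rs l (zcol j (Z \<omega>)) (\<lambda>i. Z \<omega> i j)) < m}"

lemma small_residual_sets: "small_residual l m j \<in> sets M"
proof -
  have [measurable]: "(\<lambda>\<omega>. ip n (\<lambda>i. Z \<omega> i j) (rs l (zcol j (Z \<omega>)) (\<lambda>i. Z \<omega> i j))) \<in> borel_measurable M"
    by (intro meas_ip meas_rs zcol_meas Z_meas)
  show ?thesis unfolding small_residual_def by measurable
qed

text \<open>Given the other columns this is a quadratic form whose matrix has trace at least \<open>n - p\<close> and squared
  Frobenius norm at most \<open>n\<close>.\<close>

lemma small_residual_prob:
  assumes j: "j < p" and l: "l > 0" and m: "m < real n - real p"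
  shows "emeasure M (small_residual l m j) \<le> ennreal ((Qc * real n) powr (q/2) / (real n - real p - m) powr q)"
proof -
  let ?J = "{..<p} - {j}"
  have J: "?J \<subseteq> {..<p}" "j \<notin> ?J" by auto
  define D where "D = real n - real p - m"
  have D: "D > 0" using m by (simp add: D_def)
  let ?F = "\<lambda>Y c. ennreal (\<bar>ip n c (rs l Y c) - (\<Sum>i<n. rm l Y i i)\<bar> powr q / D powr q)"
  have "emeasure M (small_residual l m j) = (\<integral>\<^sup>+\<omega>. indicator (small_residual l m j) \<omega> \<partial>M)"
    by (simp add: small_residual_sets)
  also have "\<dots> \<le> (\<integral>\<^sup>+\<omega>. ?F (keep ?J (Z \<omega>)) (\<lambda>i. Z \<omega> i j) \<partial>M)"
  proof (rule nn_integral_mono)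
    fix \<omega>
    let ?Y = "zcol j (Z \<omega>)" and ?c = "\<lambda>i. Z \<omega> i j"
    show "indicator (small_residual l m j) \<omega> \<le> ?F (keep ?J (Z \<omega>)) ?c"
    proof (cases "\<omega> \<in> small_residual l m j")
      case True
      then have b: "ip n ?c (rs l ?Y ?c) < m" by (simp add: small_residual_def)
      have "(\<Sum>i<n. rm l ?Y i i) \<ge> real n - real p"
        using l by (intro resmat_trace[OF ridge_inv[OF l]]) simp
      then have "D \<le> \<bar>ip n ?c (rs l ?Y ?c) - (\<Sum>i<n. rm l ?Y i i)\<bar>" using b by (simp add: D_def)
      then have "D powr q \<le> \<bar>ip n ?c (rs l ?Y ?c) - (\<Sum>i<n. rm l ?Y i i)\<bar> powr q"
        using D q3 by (intro powr_mono2) auto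
      then have "1 \<le> \<bar>ip n ?c (rs l ?Y ?c) - (\<Sum>i<n. rm l ?Y i i)\<bar> powr q / D powr q" using D by simp
      then have "ennreal 1 \<le> ennreal (\<bar>ip n ?c (rs l ?Y ?c) - (\<Sum>i<n. rm l ?Y i i)\<bar> powr q / D powr q)" by (rule ennreal_leI)
      then show ?thesis using True by (simp add: keep_col)
    qed simp
  qed
  also have "\<dots> \<le> (\<integral>\<^sup>+\<omega>. (\<lambda>Y. ennreal ((Qc * real n) powr (q/2) / D powr q)) (keep ?J (Z \<omega>)) \<partial>M)"
  proof (rule col_freeze[OF j J])
    fix N :: "((nat \<times> nat \<Rightarrow> real) \<times> (nat \<times> nat \<Rightarrow> real)) measure" and Y :: "_ \<Rightarrow> nat \<Rightarrow> nat \<Rightarrow> real" and c :: "_ \<Rightarrow> nat \<Rightarrow> real"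
    assume Y: "\<And>i k. (\<lambda>\<omega>. Y \<omega> i k) \<in> borel_measurable N" and c: "\<And>i. (\<lambda>\<omega>. c \<omega> i) \<in> borel_measurable N"
    note [measurable] = meas_rm[OF Y] meas_ip[OF c meas_rs[OF Y c]]
    show "(\<lambda>\<omega>. ?F (Y \<omega>) (c \<omega>)) \<in> borel_measurable N" by measurable
  next
    fix Y
    have e: "ip n c (rs l Y c) = ip n c (mv n (rm l Y) c)" for c
      by (intro ip_cong) (simp_all add: res_resmat mv_def)
    have [measurable]: "(\<lambda>\<omega>. ip n (\<lambda>i. Z \<omega> i j) (mv n (rm l Y) (\<lambda>i. Z \<omega> i j))) \<in> borel_measurable M"
      by (intro meas_ip meas_mv) auto
    have "(\<integral>\<^sup>+\<omega>. ?F Y (\<lambda>i. Z \<omega> i j) \<partial>M) = (\<integral>\<^sup>+\<omega>. ennreal (1 / D powr q) * ennreal (\<bar>ip n (\<lambda>i. Z \<omega> i j) (mv n (rm l Y) (\<lambda>i. Z \<omega> i j)) - (\<Sum>i<n. rm l Y i i)\<bar> powr q) \<partial>M)"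
      by (simp add: ennreal_mult[symmetric] e)
    also have "\<dots> = ennreal (1 / D powr q) * (\<integral>\<^sup>+\<omega>. ennreal (\<bar>ip n (\<lambda>i. Z \<omega> i j) (mv n (rm l Y) (\<lambda>i. Z \<omega> i j)) - (\<Sum>i<n. rm l Y i i)\<bar> powr q) \<partial>M)"
      by (subst nn_integral_cmult) auto
    also have "\<dots> \<le> ennreal (1 / D powr q) * ennreal ((Qc * (\<Sum>i<n. \<Sum>k<n. (rm l Y i k)\<^sup>2)) powr (q/2))"
      unfolding Qc_def using q3 K0 mean int mom var j by (intro mult_left_mono quadratic_form_nn col_indep) auto
    also have "\<dots> \<le> ennreal (1 / D powr q) * ennreal ((Qc * real n) powr (q/2))"
      using q3 Qc_pos resmat_frob[OF ridge_inv[OF l, of n p Y]] l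
      by (intro mult_left_mono ennreal_leI powr_mono2) (auto intro!: sum_nonneg mult_nonneg_nonneg)
    also have "\<dots> = ennreal ((Qc * real n) powr (q/2) / D powr q)" by (simp add: ennreal_mult[symmetric])
    finally show "(\<integral>\<^sup>+\<omega>. ?F Y (\<lambda>i. Z \<omega> i j) \<partial>M) \<le> ennreal ((Qc * real n) powr (q/2) / D powr q)" .
  qed auto
  also have "\<dots> = ennreal ((Qc * real n) powr (q/2) / D powr q)" by (simp add: emeasure_space_1)
  finally show ?thesis by (simp add: D_def)
qed

abbreviation qf :: "real \<Rightarrow> (nat \<Rightarrow> nat \<Rightarrow> real) \<Rightarrow> (nat \<Rightarrow> real) \<Rightarrow> real" where
  "qf l Y z \<equiv> ip p z (mv p (rinv n p l Y) z)"

text \<open>The leverage of row \<open>r\<close> is a quadratic form in that row with the inverse of the remaining array as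
  its matrix; the event is an upward deviation from the trace.\<close>

definition large_leverage :: "real \<Rightarrow> real \<Rightarrow> real \<Rightarrow> nat \<Rightarrow> 'a set" where
  "large_leverage l t e r = {\<omega> \<in> space M. good n p l t {..<p} (zrow r (Z \<omega>)) \<and>
     (\<Sum>k<p. rinv n p l (zrow r (Z \<omega>)) k k) + e < qf l (zrow r (Z \<omega>)) (Z \<omega> r)}"

lemma large_leverage_sets: "large_leverage l t e r \<in> sets M"
proof -
  note [measurable] = meas_good[OF zrow_meas, of "{..<p}"] meas_rinv[OF zrow_meas]
  have [measurable]: "(\<lambda>\<omega>. qf l (zrow r (Z \<omega>)) (Z \<omega> r)) \<in> borel_measurable M"
    by (intro meas_ip meas_mv meas_rinv zrow_meas Z_meas)
  have "large_leverage l t e r = {\<omega> \<in> space M. good n p l t {..<p} (zrow r (Z \<omega>))} \<inter>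
     {\<omega> \<in> space M. (\<Sum>k<p. rinv n p l (zrow r (Z \<omega>)) k k) + e < qf l (zrow r (Z \<omega>)) (Z \<omega> r)}"
    by (auto simp: large_leverage_def)
  also have "\<dots> \<in> sets M"
    by (intro sets.Int meas_good[OF zrow_meas]) measurable
  finally show ?thesis .
qed

text \<open>The squared Frobenius norm is the trace of the second power, which is random. Its moment of order
  \<open>q / 2\<close> from \<open>good_trace2_expect\<close> is what keeps the full rate.\<close>

lemma large_leverage_prob:
  assumes r: "r < n" and l: "l > 0" and t: "t \<ge> 0" and e: "e > 0"
  shows "emeasure M (large_leverage l t e r) \<le> ennreal (Qc powr (q/2) / e powr q * ((real p * t\<^sup>2) powr (q/2) * cb (real p * t)))"
proof -
  interpret R: indep_array M "\<lambda>\<omega>. zrow r (Z \<omega>)" n p q K by (rule zrow_array)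
  let ?g = "good n p l t {..<p}"
  let ?F = "\<lambda>Y z. if ?g Y then ennreal (\<bar>qf l Y z - (\<Sum>k<p. rinv n p l Y k k)\<bar> powr q / e powr q) else 0"
  let ?G = "\<lambda>Y. ennreal (Qc powr (q/2) / e powr q) * good_trace2 l t (q/2) {..<p} Y"
  have "emeasure M (large_leverage l t e r) = (\<integral>\<^sup>+\<omega>. indicator (large_leverage l t e r) \<omega> \<partial>M)"
    by (simp add: large_leverage_sets)
  also have "\<dots> \<le> (\<integral>\<^sup>+\<omega>. ?F (zrow r (Z \<omega>)) (Z \<omega> r) \<partial>M)"
  proof (rule nn_integral_mono)
    fix \<omega>
    let ?Y = "zrow r (Z \<omega>)" and ?z = "Z \<omega> r"
    let ?d = "\<bar>qf l ?Y ?z - (\<Sum>k<p. rinv n p l ?Y k k)\<bar>"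
    show "indicator (large_leverage l t e r) \<omega> \<le> ?F ?Y ?z"
    proof (cases "\<omega> \<in> large_leverage l t e r")
      case True
      then have g: "?g ?Y" and "e \<le> ?d" by (auto simp: large_leverage_def)
      then have "e powr q \<le> ?d powr q" using e q3 by (intro powr_mono2) auto
      then have "1 \<le> ?d powr q / e powr q" using e by simp
      then have "ennreal 1 \<le> ennreal (?d powr q / e powr q)" by (rule ennreal_leI)
      then show ?thesis using True g by simp
    qed simp
  qed
  also have "\<dots> \<le> (\<integral>\<^sup>+\<omega>. ?G (zrow r (Z \<omega>)) \<partial>M)"
  proof (rule row_freeze[OF r, where F = ?F and G = ?G])
    fix N :: "((nat \<times> nat \<Rightarrow> real) \<times> (nat \<times> nat \<Rightarrow> real)) measure" and Y :: "_ \<Rightarrow> nat \<Rightarrow> nat \<Rightarrow> real" and c :: "_ \<Rightarrow> nat \<Rightarrow> real"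
    assume Y: "\<And>i k. (\<lambda>\<omega>. Y \<omega> i k) \<in> borel_measurable N" and c: "\<And>i. (\<lambda>\<omega>. c \<omega> i) \<in> borel_measurable N"
    note [measurable] = meas_good[OF Y finite_lessThan] meas_rinv[OF Y] meas_ip[OF c meas_mv[OF meas_rinv[OF Y] c]]
    show "(\<lambda>\<omega>. ?F (Y \<omega>) (c \<omega>)) \<in> borel_measurable N" by measurable
  next
    fix N :: "(nat \<times> nat \<Rightarrow> real) measure" and Y :: "_ \<Rightarrow> nat \<Rightarrow> nat \<Rightarrow> real"
    assume Y: "\<And>i k. (\<lambda>\<omega>. Y \<omega> i k) \<in> borel_measurable N"
    note [measurable] = meas_good_trace2[OF Y finite_lessThan]
    show "(\<lambda>\<omega>. ?G (Y \<omega>)) \<in> borel_measurable N" by measurable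
  next
    fix Y
    show "(\<integral>\<^sup>+\<omega>. ?F Y (Z \<omega> r) \<partial>M) \<le> ?G Y"
    proof (cases "?g Y")
      case False then show ?thesis by simp
    next
      case True
      have [measurable]: "(\<lambda>\<omega>. qf l Y (Z \<omega> r)) \<in> borel_measurable M" by (intro meas_ip meas_mv) auto
      have "(\<integral>\<^sup>+\<omega>. ?F Y (Z \<omega> r) \<partial>M) = (\<integral>\<^sup>+\<omega>. ennreal (1 / e powr q) * ennreal (\<bar>qf l Y (Z \<omega> r) - (\<Sum>k<p. rinv n p l Y k k)\<bar> powr q) \<partial>M)"
        using True by (simp add: ennreal_mult[symmetric])
      also have "\<dots> = ennreal (1 / e powr q) * (\<integral>\<^sup>+\<omega>. ennreal (\<bar>qf l Y (Z \<omega> r) - (\<Sum>k<p. rinv n p l Y k k)\<bar> powr q) \<partial>M)"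
        by (subst nn_integral_cmult) auto
      also have "\<dots> \<le> ennreal (1 / e powr q) * ennreal ((Qc * (\<Sum>i<p. \<Sum>k<p. (rinv n p l Y i k)\<^sup>2)) powr (q/2))"
        unfolding Qc_def using q3 K0 mean int mom var r by (intro mult_left_mono quadratic_form_nn row_indep) auto
      also have "(\<Sum>i<p. \<Sum>k<p. (rinv n p l Y i k)\<^sup>2) = trace2 n p l {..<p} Y"
        unfolding trace2_def by (rule sum.swap)
      also have "ennreal (1 / e powr q) * ennreal ((Qc * trace2 n p l {..<p} Y) powr (q/2)) = ?G Y"
        using True Qc_pos trace2_nonneg[of n p l "{..<p}" Y] by (simp add: good_trace2_def ennreal_mult[symmetric] powr_mult)
      finally show ?thesis .
    qed
  qed
  also have "\<dots> = ennreal (Qc powr (q/2) / e powr q) * (\<integral>\<^sup>+\<omega>. good_trace2 l t (q/2) {..<p} (zrow r (Z \<omega>)) \<partial>M)"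
  proof -
    note [measurable] = meas_good_trace2[OF zrow_meas finite_lessThan]
    show ?thesis by (subst nn_integral_cmult) auto
  qed
  also have "(\<integral>\<^sup>+\<omega>. good_trace2 l t (q/2) {..<p} (zrow r (Z \<omega>)) \<partial>M) = (\<integral>\<^sup>+\<omega>. R.good_trace2 l t (q/2) {..<p} (keep {..<p} (zrow r (Z \<omega>))) \<partial>M)"
    by (simp add: keep_all)
  also have "ennreal (Qc powr (q/2) / e powr q) * \<dots> \<le> ennreal (Qc powr (q/2) / e powr q) * ennreal ((real p * t\<^sup>2) powr (q/2) * cb (real p * t))"
    using t l q3 by (intro mult_left_mono R.good_trace2_expect) auto
  also have "\<dots> = ennreal (Qc powr (q/2) / e powr q * ((real p * t\<^sup>2) powr (q/2) * cb (real p * t)))"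
    using cb_pos[of "real p * t"] by (subst ennreal_mult[symmetric]) auto
  finally show ?thesis .
qed

end

section \<open>Well-conditioned arrays\<close>

text \<open>The properties of the design on which the error analysis rests, now without a penalty: small diagonal
  entries of the inverse, and leverages at most \<open>h\<close>, where \<open>h\<close> will be below one half.\<close>

definition well_conditioned :: "nat \<Rightarrow> nat \<Rightarrow> real \<Rightarrow> real \<Rightarrow> (nat \<Rightarrow> nat \<Rightarrow> real) \<Rightarrow> bool" where
  "well_conditioned n p t h Z \<longleftrightarrow> det (gram n p 0 Z) \<noteq> 0 \<and> (\<forall>k<p. rinv n p 0 Z k k \<le> t) \<and>
     (\<forall>r<n. ip p (Z r) (mv p (rinv n p 0 Z) (Z r)) \<le> h)"

text \<open>First \<open>row_col_removal\<close> bounds the diagonals of all inverses with one row deleted by \<open>t = 1 / (m - e)\<close>.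
  Then the trace and the deviation bound give a leverage of at most \<open>A / (1 + A)\<close> in the full array,
  which for \<open>A\<close> near the ratio of \<open>p\<close> and \<open>n - p\<close> is near \<open>p / n\<close>. Removing the penalty costs
  the remaining factors.\<close>

lemma good_array:
  fixes Z :: "nat \<Rightarrow> nat \<Rightarrow> real"
  assumes l: "l > 0" and e: "e \<ge> 0" and me: "m - e > 0" and n: "n > 0"
    and b1: "\<And>j. j < p \<Longrightarrow> m \<le> ip n (\<lambda>i. Z i j) (res n p (zcol j Z) (rinv n p l (zcol j Z)) (\<lambda>i. Z i j))"
    and b2: "\<And>j r. j < p \<Longrightarrow> r < n \<Longrightarrow> (res n p (zcol j Z) (rinv n p l (zcol j Z)) (\<lambda>i. Z i j) r)\<^sup>2
        \<le> e * resmat n p (zcol j Z) (rinv n p l (zcol j Z)) r r"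
    and b3: "\<And>r. r < n \<Longrightarrow> good n p l (1 / (m - e)) {..<p} (zrow r Z) \<Longrightarrow>
        ip p (Z r) (mv p (rinv n p l (zrow r Z)) (Z r)) \<le> (\<Sum>k<p. rinv n p l (zrow r Z) k k) + \<eta>"
    and lpt: "l * (real p * (1 / (m - e))) \<le> 1/2"
    and A: "A = real p * (1 / (m - e)) + \<eta>" and \<eta>: "\<eta> \<ge> 0"
  shows "well_conditioned n p (2 * (1 / (m - e))) (A / (1 + A) / (1 - l * (real p * (1 / (m - e))))) Z"
proof -
  define t where "t = 1 / (m - e)"
  have t: "t > 0" using me by (simp add: t_def)
  let ?x = "rinv n p l Z" and ?xz = "rinv n p 0 Z"
  have x: "is_rinv n p l Z ?x" by (rule ridge_inv[OF l])
  have l0: "l \<ge> 0" using l by simp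
  have x'jj: "rinv n p l (zrow r Z) j j \<le> t" if j: "j < p" and r: "r < n" for j r
  proof -
    have CA: "col_split n p l Z ?x (rinv n p l (zcol j Z)) j" by (rule col_split_ridge[OF j l refl])
    have CB: "col_split n p l (zrow r Z) (rinv n p l (zrow r Z)) (rinv n p l (zcol j (zrow r Z))) j"
      by (rule col_split_ridge[OF j l refl])
    interpret B: col_split n p l "zrow r Z" "rinv n p l (zrow r Z)" "rinv n p l (zcol j (zrow r Z))" j by (rule CB)
    have "m - e \<le> 1 / rinv n p l (zrow r Z) j j"
      using row_col_removal[OF CA CB r e b2[OF j r]] b1[OF j] by linarith
    moreover have "rinv n p l (zrow r Z) j j > 0" using B.x_diag_j B.d_pos by simp
    ultimately show ?thesis using me by (simp add: t_def field_simps)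
  qed
  have xjj: "?x j j \<le> t" if j: "j < p" for j
  proof -
    have CA: "col_split n p l Z ?x (rinv n p l (zcol j Z)) j" by (rule col_split_ridge[OF j l refl])
    interpret A: col_split n p l Z ?x "rinv n p l (zcol j Z)" j by (rule CA)
    have "m - e \<le> A.d" using b1[OF j] e l by (simp add: A.d_def A.r_def A.c_def[abs_def])
    then show ?thesis using A.x_diag_j A.d_pos me by (simp add: t_def frac_le)
  qed
  define T where "T = (\<Sum>k<p. ?x k k)"
  have T: "T \<le> real p * t" unfolding T_def using sum_mono[of "{..<p}" "\<lambda>k. ?x k k" "\<lambda>_. t"] xjj by simp
  have T0: "T \<ge> 0" unfolding T_def using rinv_diag_nonneg[OF x l0] by (intro sum_nonneg) auto
  have lT': "l * T \<le> l * (real p * t)" using T l by (intro mult_left_mono) auto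
  have lT: "l * T \<le> 1/2" by (rule order_trans[OF lT' lpt[folded t_def]])
  have pt: "1 - l * (real p * t) > 0" using lpt[folded t_def] by linarith
  have det: "det (gram n p 0 Z) \<noteq> 0" using ols_det[OF x l] lT by (simp add: T_def)
  have x0: "is_rinv n p 0 Z ?xz" by (rule rinv_is_rinv[OF det])
  have cmp: "ip p v (mv p ?xz v) \<le> ip p v (mv p ?x v) / (1 - l * (real p * t))" for v
  proof -
    have "ip p v (mv p ?xz v) \<le> ip p v (mv p ?x v) / (1 - l * T)"
      unfolding T_def using lT by (intro ridge_to_ols(1)[OF x x0 l]) (simp add: T_def)
    also have "\<dots> \<le> ip p v (mv p ?x v) / (1 - l * (real p * t))"
      using lT' pt rinv_psd[OF x l0, of v] by (intro divide_left_mono mult_pos_pos) auto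
    finally show ?thesis .
  qed
  have "?xz k k \<le> 2 * t" if k: "k < p" for k
  proof -
    have "?xz k k \<le> ?x k k / (1 - l * (real p * t))"
      using cmp[of "\<lambda>m. if m = k then 1 else 0"] k by (simp add: rinv_diag_form)
    also have "\<dots> \<le> t / (1/2)"
      using xjj[OF k] rinv_diag_nonneg[OF x l0, of k] lpt t by (intro frac_le) (auto simp: t_def)
    finally show ?thesis by simp
  qed
  moreover have "ip p (Z r) (mv p ?xz (Z r)) \<le> A / (1 + A) / (1 - l * (real p * t))" if r: "r < n" for r
  proof -
    let ?x' = "rinv n p l (zrow r Z)"
    have x': "is_rinv n p l (zrow r Z) ?x'" by (rule ridge_inv[OF l])
    let ?a = "ip p (Z r) (mv p ?x' (Z r))" and ?h = "ip p (Z r) (mv p ?x (Z r))"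
    have a0: "?a \<ge> 0" by (rule rinv_psd[OF x' l0])
    have "good n p l (1 / (m - e)) {..<p} (zrow r Z)" using x'jj[OF _ r] by (simp add: good_def t_def)
    then have "?a \<le> (\<Sum>k<p. ?x' k k) + \<eta>" by (rule b3[OF r])
    also have "\<dots> \<le> A" unfolding A using sum_mono[of "{..<p}" "\<lambda>k. ?x' k k" "\<lambda>_. t"] x'jj[OF _ r] by (simp add: t_def)
    finally have aA: "?a \<le> A" .
    have "?h = ?a / (1 + ?a)" using row_removal(2)[OF x x' r] a0 by (simp add: field_simps)
    also have "\<dots> \<le> A / (1 + A)" using aA a0 by (simp add: divide_simps) (simp add: algebra_simps)
    finally have h: "?h \<le> A / (1 + A)" .
    have "ip p (Z r) (mv p ?xz (Z r)) \<le> ?h / (1 - l * (real p * t))" by (rule cmp)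
    also have "\<dots> \<le> A / (1 + A) / (1 - l * (real p * t))" using h pt by (intro divide_right_mono) auto
    finally show ?thesis .
  qed
  ultimately show ?thesis using det by (simp add: well_conditioned_def t_def)
qed

lemma meas_well_conditioned:
  assumes Y: "\<And>i k. (\<lambda>\<omega>. Y \<omega> i k) \<in> borel_measurable N"
  shows "{\<omega> \<in> space N. well_conditioned n p t h (Y \<omega>)} \<in> sets N"
proof -
  note [measurable] = borel_measurable_det_gram[OF Y] meas_rinv[OF Y]
  have [measurable]: "(\<lambda>\<omega>. ip p (Y \<omega> r) (mv p (rinv n p 0 (Y \<omega>)) (Y \<omega> r))) \<in> borel_measurable N" for r
    by (intro meas_ip meas_mv meas_rinv Y)
  show ?thesis unfolding well_conditioned_def by measurable
qed

context unit_array
begin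

text \<open>The union bound over \<open>p\<close> columns, \<open>p * n\<close> entries and \<open>n\<close> rows. For \<open>m\<close>, \<open>n - p - m\<close> and \<open>e\<close> of the order
  \<open>n\<close> the three terms are of the orders \<open>n powr (1 - q/2)\<close>, \<open>n powr (2 - q)\<close> and \<open>n powr (1 - q/2)\<close>.\<close>

lemma well_conditioned_prob:
  assumes l: "l > 0" and e: "e > 0" and me: "m - e > 0" and n: "n > 0" and \<eta>: "\<eta> > 0"
    and m: "m < real n - real p"
    and lpt: "l * (real p * (1 / (m - e))) \<le> 1/2"
    and A: "A = real p * (1 / (m - e)) + \<eta>"
  defines "t \<equiv> 1 / (m - e)"
  shows "emeasure M {\<omega> \<in> space M. \<not> well_conditioned n p (2 * t) (A / (1 + A) / (1 - l * (real p * t))) (Z \<omega>)}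
    \<le> ennreal (real p * ((Qc * real n) powr (q/2) / (real n - real p - m) powr q)
        + real p * real n * (Lc / e) powr q
        + real n * (Qc powr (q/2) / \<eta> powr q * ((real p * t\<^sup>2) powr (q/2) * cb (real p * t))))"
proof -
  let ?B1 = "\<Union>j\<in>{..<p}. small_residual l m j" and ?B2 = "\<Union>jr\<in>{..<p} \<times> {..<n}. large_residual_entry l e (fst jr) (snd jr)" and ?B3 = "\<Union>r\<in>{..<n}. large_leverage l t \<eta> r"
  have S[simp]: "?B1 \<in> sets M" "?B2 \<in> sets M" "?B3 \<in> sets M"
    using small_residual_sets large_residual_entry_sets large_leverage_sets by (auto intro!: sets.finite_UN)
  have t0: "t \<ge> 0" using me by (simp add: t_def)
  have sub: "{\<omega> \<in> space M. \<not> well_conditioned n p (2 * t) (A / (1 + A) / (1 - l * (real p * t))) (Z \<omega>)} \<subseteq> ?B1 \<union> ?B2 \<union> ?B3"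
  proof
    fix \<omega> assume w: "\<omega> \<in> {\<omega> \<in> space M. \<not> well_conditioned n p (2 * t) (A / (1 + A) / (1 - l * (real p * t))) (Z \<omega>)}"
    show "\<omega> \<in> ?B1 \<union> ?B2 \<union> ?B3"
    proof (rule ccontr)
      assume nb: "\<omega> \<notin> ?B1 \<union> ?B2 \<union> ?B3"
      have "well_conditioned n p (2 * (1 / (m - e))) (A / (1 + A) / (1 - l * (real p * (1 / (m - e))))) (Z \<omega>)"
      proof (rule good_array[OF l _ me n])
        show "m \<le> ip n (\<lambda>i. Z \<omega> i j) (res n p (zcol j (Z \<omega>)) (rinv n p l (zcol j (Z \<omega>))) (\<lambda>i. Z \<omega> i j))" if "j < p" for j
          using nb w that by (auto simp: small_residual_def not_less)
        show "(res n p (zcol j (Z \<omega>)) (rinv n p l (zcol j (Z \<omega>))) (\<lambda>i. Z \<omega> i j) r)\<^sup>2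
           \<le> e * resmat n p (zcol j (Z \<omega>)) (rinv n p l (zcol j (Z \<omega>))) r r" if "j < p" "r < n" for j r
        proof -
          have "\<omega> \<notin> large_residual_entry l e j r" using nb that by force
          then show ?thesis using w by (auto simp: large_residual_entry_def not_less)
        qed
        show "ip p (Z \<omega> r) (mv p (rinv n p l (zrow r (Z \<omega>))) (Z \<omega> r)) \<le> (\<Sum>k<p. rinv n p l (zrow r (Z \<omega>)) k k) + \<eta>"
          if "r < n" "good n p l (1 / (m - e)) {..<p} (zrow r (Z \<omega>))" for r
          using nb w that by (auto simp: large_leverage_def not_less t_def)
      qed (use e \<eta> lpt A in auto)
      then show False using w by (simp add: t_def)
    qed
  qed
  have "emeasure M {\<omega> \<in> space M. \<not> well_conditioned n p (2 * t) (A / (1 + A) / (1 - l * (real p * t))) (Z \<omega>)} \<le> emeasure M (?B1 \<union> ?B2 \<union> ?B3)"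
    using sub by (rule emeasure_mono) (intro sets.Un S)
  also have "\<dots> \<le> emeasure M ?B1 + emeasure M ?B2 + emeasure M ?B3"
    by (intro order_trans[OF emeasure_subadditive] add_right_mono emeasure_subadditive) auto
  also have "\<dots> \<le> (\<Sum>j\<in>{..<p}. ennreal ((Qc * real n) powr (q/2) / (real n - real p - m) powr q))
     + (\<Sum>jr\<in>{..<p} \<times> {..<n}. ennreal ((Lc / e) powr q))
     + (\<Sum>r\<in>{..<n}. ennreal (Qc powr (q/2) / \<eta> powr q * ((real p * t\<^sup>2) powr (q/2) * cb (real p * t))))"
  proof (intro add_mono)
    show "emeasure M ?B1 \<le> (\<Sum>j\<in>{..<p}. ennreal ((Qc * real n) powr (q/2) / (real n - real p - m) powr q))"
      using small_residual_prob l m by (intro order_trans[OF emeasure_subadditive_finite] sum_mono) (auto simp: small_residual_sets)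
    show "emeasure M ?B2 \<le> (\<Sum>jr\<in>{..<p} \<times> {..<n}. ennreal ((Lc / e) powr q))"
      using large_residual_entry_prob l e by (intro order_trans[OF emeasure_subadditive_finite] sum_mono) (auto simp: large_residual_entry_sets)
    show "emeasure M ?B3 \<le> (\<Sum>r\<in>{..<n}. ennreal (Qc powr (q/2) / \<eta> powr q * ((real p * t\<^sup>2) powr (q/2) * cb (real p * t))))"
      using large_leverage_prob l \<eta> t0 by (intro order_trans[OF emeasure_subadditive_finite] sum_mono) (auto simp: large_leverage_sets)
  qed
  also have "\<dots> = ennreal (real p * ((Qc * real n) powr (q/2) / (real n - real p - m) powr q))
     + ennreal (real p * real n * (Lc / e) powr q)
     + ennreal (real n * (Qc powr (q/2) / \<eta> powr q * ((real p * t\<^sup>2) powr (q/2) * cb (real p * t))))"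
    using cb_pos[of "real p * t"]
    by (simp add: ennreal_of_nat_eq_real_of_nat ennreal_mult'[symmetric] ennreal_mult[symmetric] del: ennreal_plus)
  also have "\<dots> = ennreal (real p * ((Qc * real n) powr (q/2) / (real n - real p - m) powr q)
        + real p * real n * (Lc / e) powr q
        + real n * (Qc powr (q/2) / \<eta> powr q * ((real p * t\<^sup>2) powr (q/2) * cb (real p * t))))"
    using cb_pos[of "real p * t"] by (simp add: ennreal_plus[symmetric] del: ennreal_plus)
  finally show ?thesis .
qed

end

section \<open>Fourth powers of the entries of the coefficient matrix\<close>

text \<open>The hypotheses on \<open>R\<close> say that it has norm at most the square root of \<open>\<kappa>\<close>; it will be the inverse square
  root of a covariance matrix.\<close>

lemma sum_fourth_le_trace4:
  fixes R :: "nat \<Rightarrow> nat \<Rightarrow> real"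
  assumes x: "is_rinv n p l Y (rinv n p l Y)"
    and R: "\<And>v. (\<Sum>j<p. (ip p (R j) v)\<^sup>2) \<le> \<kappa> * ip p v v" and Rn: "\<And>j. j < p \<Longrightarrow> ip p (R j) (R j) \<le> \<kappa>" and k: "\<kappa> \<ge> 0"
  shows "(\<Sum>j<p. (ip p (mv p (rinv n p l Y) (R j)) (mv p (rinv n p l Y) (R j)))\<^sup>2) \<le> \<kappa>\<^sup>2 * trace4 n p l {..<p} Y"
proof -
  let ?x = "rinv n p l Y"
  let ?s = "\<lambda>k. mv p ?x (\<lambda>m. ?x m k)"
  have e: "ip p (mv p ?x (R j)) (mv p ?x (R j)) = ip p (R j) (mv p ?x (mv p ?x (R j)))" for j
    by (rule ip_mv_rinv_sym[OF x, symmetric])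
  have s: "mv p ?x (mv p ?x (R j)) k = ip p (R j) (?s k)" if k: "k < p" for j k
  proof -
    have "mv p ?x (mv p ?x (R j)) k = ip p (\<lambda>m. ?x m k) (mv p ?x (R j))"
      by (simp add: mv_def[of p ?x "mv p ?x (R j)"] ip_def rinv_sym[OF x, of k])
    also have "\<dots> = ip p (mv p ?x (\<lambda>m. ?x m k)) (R j)" by (rule ip_mv_rinv_sym[OF x])
    finally show ?thesis by (simp only: ip_commute)
  qed
  have "(\<Sum>j<p. (ip p (mv p ?x (R j)) (mv p ?x (R j)))\<^sup>2) \<le> (\<Sum>j<p. \<kappa> * ip p (mv p ?x (mv p ?x (R j))) (mv p ?x (mv p ?x (R j))))"
  proof (rule sum_mono)
    fix j assume "j \<in> {..<p}"
    then have j: "j < p" by simp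
    have "(ip p (mv p ?x (R j)) (mv p ?x (R j)))\<^sup>2 \<le> ip p (R j) (R j) * ip p (mv p ?x (mv p ?x (R j))) (mv p ?x (mv p ?x (R j)))"
      unfolding e by (rule cauchy_ip)
    also have "\<dots> \<le> \<kappa> * ip p (mv p ?x (mv p ?x (R j))) (mv p ?x (mv p ?x (R j)))"
      using Rn[OF j] by (intro mult_right_mono ip_self_nonneg)
    finally show "(ip p (mv p ?x (R j)) (mv p ?x (R j)))\<^sup>2 \<le> \<kappa> * ip p (mv p ?x (mv p ?x (R j))) (mv p ?x (mv p ?x (R j)))" .
  qed
  also have "\<dots> = \<kappa> * (\<Sum>j<p. \<Sum>k<p. (ip p (R j) (?s k))\<^sup>2)"
    unfolding sum_distrib_left[symmetric] by (simp add: ip_def[of p "mv p ?x (mv p ?x _)"] s power2_eq_square)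
  also have "(\<Sum>j<p. \<Sum>k<p. (ip p (R j) (?s k))\<^sup>2) = (\<Sum>k<p. \<Sum>j<p. (ip p (R j) (?s k))\<^sup>2)" by (rule sum.swap)
  also have "\<kappa> * \<dots> \<le> \<kappa> * (\<Sum>k<p. \<kappa> * ip p (?s k) (?s k))"
    using R k by (intro mult_left_mono sum_mono) auto
  also have "\<dots> = \<kappa>\<^sup>2 * trace4 n p l {..<p} Y"
    by (simp add: trace4_def ip_def power2_eq_square sum_distrib_left mult.assoc)
  finally show ?thesis .
qed

context indep_array
begin

definition c4 :: real where "c4 = (lin_const 4 (1 + K))\<^sup>2"

lemma fourth_moment:
  assumes "i < n" "k < p"
  shows "integrable M (\<lambda>\<omega>. \<bar>Z \<omega> i k\<bar> powr 4)" "(\<integral>\<omega>. \<bar>Z \<omega> i k\<bar> powr 4 \<partial>M) \<le> 1 + K"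
  using lower_moment[OF Z_meas _ _ int[OF assms] mom[OF assms], of 4] q3 by auto

lemma row_fourth:
  assumes r: "r < n"
  shows "(\<integral>\<^sup>+\<omega>. ennreal ((ip p u (Z \<omega> r)) ^ 4) \<partial>M) \<le> ennreal (c4 * (ip p u u)\<^sup>2)"
proof -
  have L: "lin_const 4 (1 + K) \<ge> 0" using K0 by (simp add: lin_const_def step_const_def)
  have "(\<integral>\<^sup>+\<omega>. ennreal (((ip p u (Z \<omega> r))\<^sup>2) powr 2) \<partial>M) \<le> ennreal ((lin_const (2 * 2) (1 + K) * ip p u u) powr 2)"
    using K0 mean fourth_moment r by (intro one_form_nn row_indep) auto
  moreover have "((ip p u (Z \<omega> r))\<^sup>2) powr 2 = (ip p u (Z \<omega> r)) ^ 4" for \<omega>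
    by (simp add: powr_numeral flip: power_mult)
  moreover have "(lin_const (2 * 2) (1 + K) * ip p u u) powr 2 = c4 * (ip p u u)\<^sup>2"
    using L ip_self_nonneg[of p u] by (simp add: powr_numeral c4_def power_mult_distrib)
  ultimately show ?thesis by simp
qed

text \<open>Deleting row \<open>r\<close> makes the coefficient a linear form in that row with a coefficient vector independent
  of it, whose fourth moment is at most a multiple of the fourth power of the norm. The factor 16 is the
  fourth power of the factor two of \<open>ridge_to_ols\<close>. Summing over the rows leaves traces of fourth powers.\<close>

lemma coef_fourth:
  fixes R :: "nat \<Rightarrow> nat \<Rightarrow> real"
  assumes R: "\<And>v. (\<Sum>j<p. (ip p (R j) v)\<^sup>2) \<le> \<kappa> * ip p v v" and Rn: "\<And>j. j < p \<Longrightarrow> ip p (R j) (R j) \<le> \<kappa>" and k: "\<kappa> \<ge> 0"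
    and l: "l > 0" and t: "t > 0" and lpt: "l * (real p * (2 * t)) \<le> 1/2" and h: "h \<le> 1/2"
  shows "(\<integral>\<^sup>+\<omega>. (if well_conditioned n p t h (Z \<omega>) then ennreal (\<Sum>r<n. \<Sum>j<p. (ip p (R j) (mv p (rinv n p 0 (Z \<omega>)) (Z \<omega> r))) ^ 4) else 0) \<partial>M)
     \<le> ennreal (real n * (c4 * (16 * (\<kappa>\<^sup>2 * trace4_const (2 * t)))))"
proof -
  define g where "g Y \<longleftrightarrow> det (gram n p 0 Y) \<noteq> 0 \<and> (\<forall>k<p. rinv n p 0 Y k k \<le> 2 * t)" for Y
  let ?u = "\<lambda>Y j. mv p (rinv n p 0 Y) (R j)"
  let ?F = "\<lambda>Y z. if g Y then ennreal (\<Sum>j<p. (ip p (?u Y j) z) ^ 4) else 0"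
  let ?G = "\<lambda>Y. ennreal (c4 * (16 * \<kappa>\<^sup>2)) * good_trace4 l (2 * t) {..<p} Y"
  have l0: "l \<ge> 0" using l by simp
  have c4: "c4 \<ge> 0" by (simp add: c4_def)
  have gm: "{\<omega> \<in> space N. g (Y \<omega>)} \<in> sets N" if Y: "\<And>i k. (\<lambda>\<omega>. Y \<omega> i k) \<in> borel_measurable N" for N :: "'x measure" and Y
  proof -
    note [measurable] = borel_measurable_det_gram[OF Y] meas_rinv[OF Y]
    show ?thesis unfolding g_def by measurable
  qed
  have one: "(\<integral>\<^sup>+\<omega>. ?F (zrow r (Z \<omega>)) (Z \<omega> r) \<partial>M) \<le> ennreal (c4 * (16 * (\<kappa>\<^sup>2 * trace4_const (2 * t))))" if r: "r < n" for r
  proof -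
    interpret R: indep_array M "\<lambda>\<omega>. zrow r (Z \<omega>)" n p q K by (rule zrow_array)
    have "(\<integral>\<^sup>+\<omega>. ?F (zrow r (Z \<omega>)) (Z \<omega> r) \<partial>M) \<le> (\<integral>\<^sup>+\<omega>. ?G (zrow r (Z \<omega>)) \<partial>M)"
    proof (rule row_freeze[OF r, where F = ?F and G = ?G])
      fix N :: "((nat \<times> nat \<Rightarrow> real) \<times> (nat \<times> nat \<Rightarrow> real)) measure" and Y :: "_ \<Rightarrow> nat \<Rightarrow> nat \<Rightarrow> real" and c :: "_ \<Rightarrow> nat \<Rightarrow> real"
      assume Y: "\<And>i k. (\<lambda>\<omega>. Y \<omega> i k) \<in> borel_measurable N" and c: "\<And>i. (\<lambda>\<omega>. c \<omega> i) \<in> borel_measurable N"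
      have [measurable]: "(\<lambda>\<omega>. ip p (?u (Y \<omega>) j) (c \<omega>)) \<in> borel_measurable N" for j
        by (intro meas_ip meas_mv meas_rinv Y c) auto
      show "(\<lambda>\<omega>. ?F (Y \<omega>) (c \<omega>)) \<in> borel_measurable N"
        by (rule measurable_If[OF _ _ gm[OF Y]]) measurable
    next
      fix N :: "(nat \<times> nat \<Rightarrow> real) measure" and Y :: "_ \<Rightarrow> nat \<Rightarrow> nat \<Rightarrow> real"
      assume Y: "\<And>i k. (\<lambda>\<omega>. Y \<omega> i k) \<in> borel_measurable N"
      note [measurable] = meas_good_trace4[OF Y finite_lessThan]
      show "(\<lambda>\<omega>. ?G (Y \<omega>)) \<in> borel_measurable N" by measurable
    next
      fix Y
      show "(\<integral>\<^sup>+\<omega>. ?F Y (Z \<omega> r) \<partial>M) \<le> ?G Y"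
      proof (cases "g Y")
        case False then show ?thesis by simp
      next
        case gY: True
        let ?x = "rinv n p l Y" and ?xz = "rinv n p 0 Y"
        have x: "is_rinv n p l Y ?x" by (rule ridge_inv[OF l])
        have x0: "is_rinv n p 0 Y ?xz" using gY by (intro rinv_is_rinv) (simp add: g_def)
        have xk: "?x k k \<le> 2 * t" if k: "k < p" for k
        proof -
          have "?x k k \<le> ?xz k k"
            using ridge_le_ols[OF x x0 l0, of "\<lambda>m. if m = k then 1 else 0"] k by (simp add: rinv_diag_form)
          then show ?thesis using gY k by (force simp: g_def)
        qed
        then have good: "good n p l (2 * t) {..<p} Y" by (simp add: good_def)
        have "(\<Sum>k<p. ?x k k) \<le> real p * (2 * t)" using sum_mono[of "{..<p}" "\<lambda>k. ?x k k" "\<lambda>_. 2 * t"] xk by simp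
        then have "l * (\<Sum>k<p. ?x k k) \<le> l * (real p * (2 * t))" using l by (intro mult_left_mono) auto
        then have lT: "l * (\<Sum>k<p. ?x k k) \<le> 1/2" using lpt by (rule order_trans)
        have [measurable]: "(\<lambda>\<omega>. ip p (?u Y j) (Z \<omega> r)) \<in> borel_measurable M" for j by (intro meas_ip) auto
        have "(\<integral>\<^sup>+\<omega>. ?F Y (Z \<omega> r) \<partial>M) = (\<Sum>j<p. \<integral>\<^sup>+\<omega>. ennreal ((ip p (?u Y j) (Z \<omega> r)) ^ 4) \<partial>M)"
          using gY by (subst nn_integral_sum[symmetric]) (auto simp: sum_ennreal)
        also have "\<dots> \<le> (\<Sum>j<p. ennreal (c4 * (ip p (?u Y j) (?u Y j))\<^sup>2))"
          by (intro sum_mono row_fourth[OF r])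
        also have "\<dots> = ennreal (c4 * (\<Sum>j<p. (ip p (?u Y j) (?u Y j))\<^sup>2))"
          using c4 by (simp add: sum_ennreal sum_distrib_left)
        also have "\<dots> \<le> ennreal (c4 * (16 * (\<kappa>\<^sup>2 * trace4 n p l {..<p} Y)))"
        proof (intro ennreal_leI mult_left_mono c4)
          have "(\<Sum>j<p. (ip p (?u Y j) (?u Y j))\<^sup>2) \<le> (\<Sum>j<p. (4 * ip p (mv p ?x (R j)) (mv p ?x (R j)))\<^sup>2)"
            by (intro sum_mono power_mono ridge_to_ols(2)[OF x x0 l lT] ip_self_nonneg)
          also have "\<dots> = 16 * (\<Sum>j<p. (ip p (mv p ?x (R j)) (mv p ?x (R j)))\<^sup>2)"
            by (simp add: power_mult_distrib sum_distrib_left)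
          also have "\<dots> \<le> 16 * (\<kappa>\<^sup>2 * trace4 n p l {..<p} Y)"
            using sum_fourth_le_trace4[OF x R Rn k] by simp
          finally show "(\<Sum>j<p. (ip p (?u Y j) (?u Y j))\<^sup>2) \<le> 16 * (\<kappa>\<^sup>2 * trace4 n p l {..<p} Y)" .
        qed
        also have "\<dots> = ?G Y" using good c4 trace4_nonneg[of n p l "{..<p}" Y] by (simp add: good_trace4_def ennreal_mult[symmetric] mult.assoc)
        finally show ?thesis .
      qed
    qed
    also have "\<dots> = ennreal (c4 * (16 * \<kappa>\<^sup>2)) * (\<integral>\<^sup>+\<omega>. good_trace4 l (2 * t) {..<p} (zrow r (Z \<omega>)) \<partial>M)"
    proof -
      note [measurable] = meas_good_trace4[OF zrow_meas finite_lessThan]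
      show ?thesis by (subst nn_integral_cmult) auto
    qed
    also have "(\<integral>\<^sup>+\<omega>. good_trace4 l (2 * t) {..<p} (zrow r (Z \<omega>)) \<partial>M) = (\<integral>\<^sup>+\<omega>. good_trace4 l (2 * t) {..<p} (keep {..<p} (zrow r (Z \<omega>))) \<partial>M)"
      by (simp add: keep_all)
    also have "ennreal (c4 * (16 * \<kappa>\<^sup>2)) * \<dots> \<le> ennreal (c4 * (16 * \<kappa>\<^sup>2)) * ennreal (trace4_const (2 * t))"
      using t l by (intro mult_left_mono R.good_trace4_expect) auto
    also have "\<dots> = ennreal (c4 * (16 * (\<kappa>\<^sup>2 * trace4_const (2 * t))))"
      using c4 cb_pos[of "real p * (2 * t)"] by (subst ennreal_mult[symmetric]) (auto simp: trace4_const_def mult.assoc)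
    finally show ?thesis .
  qed
  have "(\<integral>\<^sup>+\<omega>. (if well_conditioned n p t h (Z \<omega>) then ennreal (\<Sum>r<n. \<Sum>j<p. (ip p (R j) (mv p (rinv n p 0 (Z \<omega>)) (Z \<omega> r))) ^ 4) else 0) \<partial>M)
    \<le> (\<integral>\<^sup>+\<omega>. (\<Sum>r<n. ?F (zrow r (Z \<omega>)) (Z \<omega> r)) \<partial>M)"
  proof (rule nn_integral_mono)
    fix \<omega>
    show "(if well_conditioned n p t h (Z \<omega>) then ennreal (\<Sum>r<n. \<Sum>j<p. (ip p (R j) (mv p (rinv n p 0 (Z \<omega>)) (Z \<omega> r))) ^ 4) else 0)
      \<le> (\<Sum>r<n. ?F (zrow r (Z \<omega>)) (Z \<omega> r))"
    proof (cases "well_conditioned n p t h (Z \<omega>)")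
      case False then show ?thesis by simp
    next
      case G: True
      let ?x = "rinv n p 0 (Z \<omega>)"
      have x: "is_rinv n p 0 (Z \<omega>) ?x" using G by (intro rinv_is_rinv) (simp add: well_conditioned_def)
      have each: "ennreal (\<Sum>j<p. (ip p (R j) (mv p ?x (Z \<omega> r))) ^ 4) \<le> ?F (zrow r (Z \<omega>)) (Z \<omega> r)" if r: "r < n" for r
      proof -
        let ?z = "Z \<omega> r" and ?x' = "rinv n p 0 (zrow r (Z \<omega>))"
        have hr: "ip p ?z (mv p ?x ?z) \<le> 1/2" using G r h by (force simp: well_conditioned_def)
        then have "ip p ?z (mv p ?x ?z) < 1" by simp
        from rinv_eq(2)[OF row_removal_exists[OF x r this]]
        have det: "det (gram n p 0 (zrow r (Z \<omega>))) \<noteq> 0" .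
        have x': "is_rinv n p 0 (zrow r (Z \<omega>)) ?x'" by (rule rinv_is_rinv[OF det])
        have gY: "g (zrow r (Z \<omega>))"
        proof -
          have "?x' k k \<le> 2 * t" if k: "k < p" for k
            using row_removal_diag[OF x _ x' r hr k] G k by (force simp: well_conditioned_def)
          then show ?thesis using det by (simp add: g_def)
        qed
        let ?a = "ip p ?z (mv p ?x' ?z)"
        have a: "?a \<ge> 0" by (rule rinv_psd[OF x']) simp
        have "(ip p (R j) (mv p ?x ?z)) ^ 4 \<le> (ip p (?u (zrow r (Z \<omega>)) j) ?z) ^ 4" for j
        proof -
          have "ip p (?u (zrow r (Z \<omega>)) j) ?z = ip p (R j) (mv p ?x' ?z)"
            by (rule ip_mv_rinv_sym[OF x', symmetric])
          also have "\<dots> = ip p (R j) (\<lambda>k. (1 + ?a) * mv p ?x ?z k)"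
            using row_removal(1)[OF x x' r] by (intro ip_cong) auto
          also have "\<dots> = (1 + ?a) * ip p (R j) (mv p ?x ?z)" by (rule ip_scale_right)
          finally have "(ip p (?u (zrow r (Z \<omega>)) j) ?z) ^ 4 = (1 + ?a) ^ 4 * (ip p (R j) (mv p ?x ?z)) ^ 4"
            by (simp only: power_mult_distrib)
          moreover have "1 * (ip p (R j) (mv p ?x ?z)) ^ 4 \<le> (1 + ?a) ^ 4 * (ip p (R j) (mv p ?x ?z)) ^ 4"
            using a by (intro mult_right_mono) (auto simp: one_le_power)
          ultimately show ?thesis by simp
        qed
        then show ?thesis using gY by (simp add: ennreal_leI sum_mono)
      qed
      have "ennreal (\<Sum>r<n. \<Sum>j<p. (ip p (R j) (mv p ?x (Z \<omega> r))) ^ 4) = (\<Sum>r<n. ennreal (\<Sum>j<p. (ip p (R j) (mv p ?x (Z \<omega> r))) ^ 4))"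
        by (subst sum_ennreal) (auto intro!: sum_nonneg)
      also have "\<dots> \<le> (\<Sum>r<n. ?F (zrow r (Z \<omega>)) (Z \<omega> r))" by (intro sum_mono each) auto
      finally show ?thesis using G by simp
    qed
  qed
  also have "\<dots> = (\<Sum>r<n. \<integral>\<^sup>+\<omega>. ?F (zrow r (Z \<omega>)) (Z \<omega> r) \<partial>M)"
  proof (rule nn_integral_sum)
    fix r
    have [measurable]: "(\<lambda>\<omega>. ip p (?u (zrow r (Z \<omega>)) j) (Z \<omega> r)) \<in> borel_measurable M" for j
      by (intro meas_ip meas_mv meas_rinv zrow_meas Z_meas) auto
    show "(\<lambda>\<omega>. ?F (zrow r (Z \<omega>)) (Z \<omega> r)) \<in> borel_measurable M"
      by (rule measurable_If[OF _ _ gm[OF zrow_meas]]) measurable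
  qed
  also have "\<dots> \<le> (\<Sum>r<n. ennreal (c4 * (16 * (\<kappa>\<^sup>2 * trace4_const (2 * t)))))" by (intro sum_mono one) auto
  also have "\<dots> = ennreal (real n * (c4 * (16 * (\<kappa>\<^sup>2 * trace4_const (2 * t)))))"
    by (simp add: ennreal_mult' ennreal_of_nat_eq_real_of_nat)
  finally show ?thesis .
qed

end

section \<open>The estimation error for a fixed design\<close>

text \<open>The objects of the estimation problem in terms of the whitened design \<open>Z\<close>, where \<open>Ri\<close> is the inverse
  square root of the covariance matrix: the matrices \<open>S\<close>, \<open>Q\<close>, \<open>Q\<odot>Q\<close> and \<open>(S\<odot>S)(Q\<odot>Q)\<^sup>-\<^sup>1\<close>.\<close>

definition ols_coef :: "nat \<Rightarrow> nat \<Rightarrow> (nat \<Rightarrow> nat \<Rightarrow> real) \<Rightarrow> (nat \<Rightarrow> nat \<Rightarrow> real) \<Rightarrow> nat \<Rightarrow> nat \<Rightarrow> real" where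
  "ols_coef n p Ri Z j r = ip p (Ri j) (mv p (rinv n p 0 Z) (Z r))"

definition proj :: "nat \<Rightarrow> nat \<Rightarrow> (nat \<Rightarrow> nat \<Rightarrow> real) \<Rightarrow> nat \<Rightarrow> nat \<Rightarrow> real" where
  "proj n p Z = resmat n p Z (rinv n p 0 Z)"

definition projsq :: "nat \<Rightarrow> nat \<Rightarrow> (nat \<Rightarrow> nat \<Rightarrow> real) \<Rightarrow> real mat" where
  "projsq n p Z = Matrix.mat n n (\<lambda>(i, k). (proj n p Z i k)\<^sup>2)"

definition est_coef :: "nat \<Rightarrow> nat \<Rightarrow> (nat \<Rightarrow> nat \<Rightarrow> real) \<Rightarrow> (nat \<Rightarrow> nat \<Rightarrow> real) \<Rightarrow> nat \<Rightarrow> nat \<Rightarrow> real" where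
  "est_coef n p Ri Z j i = (\<Sum>m<n. (ols_coef n p Ri Z j m)\<^sup>2 * minv (projsq n p Z) $$ (m, i))"

text \<open>The weight with which the squared variance of the noise in observation \<open>k\<close> enters the bound for
  the mean squared error. The weights of the observations are exchangeable, and only their sum
  has to be controlled.\<close>

definition noise_weight :: "nat \<Rightarrow> nat \<Rightarrow> (nat \<Rightarrow> nat \<Rightarrow> real) \<Rightarrow> (nat \<Rightarrow> nat \<Rightarrow> real) \<Rightarrow> nat \<Rightarrow> real" where
  "noise_weight n p Ri Z k = (\<Sum>j<p. \<Sum>i<n. (est_coef n p Ri Z j i)\<^sup>2 * (proj n p Z i k)\<^sup>2)"

lemma noise_weight_nonneg: "noise_weight n p Ri Z k \<ge> 0"
  by (simp add: noise_weight_def sum_nonneg)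

locale design =
  fixes n p :: nat and Z Ri :: "nat \<Rightarrow> nat \<Rightarrow> real" and \<kappa> :: real
  assumes det: "det (gram n p 0 Z) \<noteq> 0"
    and \<kappa>: "\<kappa> > 0"
    and lev: "r < n \<Longrightarrow> ip p (Z r) (mv p (rinv n p 0 Z) (Z r)) \<le> 1/2 - \<kappa>"
begin

abbreviation "x \<equiv> rinv n p 0 Z"
abbreviation "P \<equiv> proj n p Z"
abbreviation "S \<equiv> ols_coef n p Ri Z"
abbreviation "A \<equiv> est_coef n p Ri Z"

lemma x: "is_rinv n p 0 Z x" by (rule rinv_is_rinv[OF det])

lemma res_P: "i < n \<Longrightarrow> res n p Z x w i = ip n (P i) w"
  by (simp add: res_resmat proj_def ip_def)

lemma P_res: "i < n \<Longrightarrow> k < n \<Longrightarrow> P i k = res n p Z x (\<lambda>m. if m = k then 1 else 0) i"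
  by (simp add: proj_def resmat_eq[OF x])

lemma P_sym: assumes "i < n" "k < n" shows "P i k = P k i"
  using res_sym[OF x, where w = "\<lambda>m. if m = i then 1 else 0" and w' = "\<lambda>m. if m = k then 1 else 0"] assms
  by (simp add: ip_unit_left ip_unit P_res)

lemma P_col: assumes k: "k < n" shows "(\<Sum>i<n. (P i k)\<^sup>2) = P k k"
proof -
  let ?e = "\<lambda>m. if m = k then (1::real) else 0"
  have "(\<Sum>i<n. (P i k)\<^sup>2) = ip n (res n p Z x ?e) (res n p Z x ?e)"
    using k by (simp add: ip_def P_res power2_eq_square)
  also have "\<dots> = ip n ?e (res n p Z x ?e)" using res_form[OF x, of ?e ?e] by simp
  also have "\<dots> = P k k" using k by (simp add: ip_unit_left P_res)
  finally show ?thesis .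
qed

lemma P_row: assumes "i < n" shows "(\<Sum>k<n. (P i k)\<^sup>2) = P i i"
  using P_col[OF assms] P_sym assms by simp

lemma P_diag: assumes r: "r < n" shows "P r r = 1 - ip p (Z r) (mv p x (Z r))"
  by (simp add: proj_def resmat_def ip_def mv_def sum_distrib_left mult.assoc)

lemma P_diag_ge: assumes r: "r < n" shows "P r r \<ge> 1/2 + \<kappa>"
  using lev[OF r] P_diag[OF r] by linarith

lemma P_diag_le: "r < n \<Longrightarrow> P r r \<le> 1"
  unfolding proj_def by (rule resmat_diag_le_1[OF x]) auto

lemma res_contract: "ip n (res n p Z x w) (res n p Z x w) \<le> ip n w w"
proof -
  have "ip n w (res n p Z x w) \<le> ip n w w"
    using res_variational[OF x order_refl, of w "\<lambda>_. 0"] by (simp add: mv_def[of p Z "\<lambda>_. 0"])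
  then show ?thesis using res_form[OF x, of w w] by simp
qed

text \<open>Expanding \<open>(v i + v k)\<^sup>2\<close> shows that \<open>Q\<odot>Q\<close> is bounded below by the diagonal matrix with entries
  \<open>2 * (P i i)\<^sup>2 - P i i\<close>, since the rows of the projection have squared norm \<open>P i i\<close>. These entries are positive
  exactly when the leverage is below one half, which is the reason for the condition on the ratio of
  the dimensions.\<close>

lemma projsq_form:
  "\<kappa> * ip n v v \<le> (\<Sum>i<n. \<Sum>k<n. v i * (P i k)\<^sup>2 * v k)"
proof -
  have "4 * (\<Sum>i<n. (P i i)\<^sup>2 * (v i)\<^sup>2) = (\<Sum>i<n. \<Sum>k<n. if k = i then (P i k)\<^sup>2 * (v i + v k)\<^sup>2 else 0)"
    by (simp add: sum_distrib_left power2_eq_square algebra_simps)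
  also have "\<dots> \<le> (\<Sum>i<n. \<Sum>k<n. (P i k)\<^sup>2 * (v i + v k)\<^sup>2)"
    by (intro sum_mono) auto
  also have "\<dots> = (\<Sum>i<n. \<Sum>k<n. (P i k)\<^sup>2 * (v i)\<^sup>2) + (\<Sum>i<n. \<Sum>k<n. (P i k)\<^sup>2 * (v k)\<^sup>2) + 2 * (\<Sum>i<n. \<Sum>k<n. v i * (P i k)\<^sup>2 * v k)"
  proof -
    have "(P i k)\<^sup>2 * (v i + v k)\<^sup>2 = (P i k)\<^sup>2 * (v i)\<^sup>2 + (P i k)\<^sup>2 * (v k)\<^sup>2 + 2 * (v i * (P i k)\<^sup>2 * v k)" for i k
      by (simp add: power2_sum algebra_simps)
    then show ?thesis by (simp only: sum.distrib sum_distrib_left[symmetric])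
  qed
  also have "(\<Sum>i<n. \<Sum>k<n. (P i k)\<^sup>2 * (v i)\<^sup>2) = (\<Sum>i<n. P i i * (v i)\<^sup>2)"
    by (simp add: sum_distrib_right[symmetric] P_row)
  also have "(\<Sum>i<n. \<Sum>k<n. (P i k)\<^sup>2 * (v k)\<^sup>2) = (\<Sum>i<n. P i i * (v i)\<^sup>2)"
    by (subst sum.swap) (simp add: sum_distrib_right[symmetric] P_col)
  finally have 1: "2 * (\<Sum>i<n. (P i i)\<^sup>2 * (v i)\<^sup>2) - (\<Sum>i<n. P i i * (v i)\<^sup>2) \<le> (\<Sum>i<n. \<Sum>k<n. v i * (P i k)\<^sup>2 * v k)" by simp
  have "\<kappa> * ip n v v = (\<Sum>i<n. \<kappa> * (v i)\<^sup>2)" by (simp add: ip_def sum_distrib_left power2_eq_square)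
  also have "\<dots> \<le> (\<Sum>i<n. (2 * (P i i)\<^sup>2 - P i i) * (v i)\<^sup>2)"
  proof (intro sum_mono mult_right_mono)
    fix i assume "i \<in> {..<n}"
    then have Pi: "P i i \<ge> 1/2 + \<kappa>" by (simp add: P_diag_ge)
    have "1/2 * (2 * \<kappa>) \<le> P i i * (2 * P i i - 1)"
      using Pi \<kappa> by (intro mult_mono) auto
    then show "\<kappa> \<le> 2 * (P i i)\<^sup>2 - P i i" by (simp add: power2_eq_square algebra_simps)
  qed auto
  also have "\<dots> = 2 * (\<Sum>i<n. (P i i)\<^sup>2 * (v i)\<^sup>2) - (\<Sum>i<n. P i i * (v i)\<^sup>2)"
    by (simp add: sum_subtractf sum_distrib_left left_diff_distrib mult.assoc)
  finally show ?thesis using 1 by linarith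
qed

lemma projsq_carrier[simp]: "projsq n p Z \<in> carrier_mat n n" by (simp add: projsq_def)

lemma projsq_det: "det (projsq n p Z) \<noteq> 0"
proof
  assume "det (projsq n p Z) = 0"
  then obtain v where v: "v \<in> carrier_vec n" "v \<noteq> 0\<^sub>v n" "projsq n p Z *\<^sub>v v = 0\<^sub>v n"
    using det_0_iff_vec_prod_zero_field[OF projsq_carrier] by auto
  have "(\<Sum>k<n. (P i k)\<^sup>2 * v $ k) = 0" if i: "i < n" for i
  proof -
    have "(projsq n p Z *\<^sub>v v) $ i = (\<Sum>k<n. (P i k)\<^sup>2 * v $ k)"
      using i v(1) by (auto simp: scalar_prod_def projsq_def atLeast0LessThan intro!: sum.cong)
    then show ?thesis using v(3) i by simp
  qed
  then have "(\<Sum>i<n. \<Sum>k<n. v $ i * (P i k)\<^sup>2 * v $ k) = 0"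
    by (simp add: mult.assoc sum_distrib_left[symmetric])
  then have "\<kappa> * ip n (($) v) (($) v) \<le> 0" using projsq_form[of "($) v"] by simp
  then have "ip n (($) v) (($) v) = 0" using \<kappa> ip_self_nonneg[of n "($) v"] by (simp add: mult_le_0_iff)
  then have "v = 0\<^sub>v n" using ip_self_zero[of n "($) v"] v(1) by (intro eq_vecI) auto
  with v(2) show False by simp
qed

lemma A_projsq: assumes k: "k < n" shows "(\<Sum>i<n. A j i * (P i k)\<^sup>2) = (S j k)\<^sup>2"
proof -
  let ?N = "minv (projsq n p Z)"
  note I = minv_inverse[OF projsq_carrier projsq_det]
  have e: "(\<Sum>i<n. ?N $$ (m, i) * (P i k)\<^sup>2) = (if m = k then 1 else 0)" if m: "m < n" for m
  proof -
    have "(?N * projsq n p Z) $$ (m, k) = (\<Sum>i<n. ?N $$ (m, i) * (P i k)\<^sup>2)"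
      using m k I(1) by (auto simp: scalar_prod_def projsq_def atLeast0LessThan intro!: sum.cong)
    then show ?thesis using I(3) m k by simp
  qed
  have "(\<Sum>i<n. A j i * (P i k)\<^sup>2) = (\<Sum>m<n. (S j m)\<^sup>2 * (\<Sum>i<n. ?N $$ (m, i) * (P i k)\<^sup>2))"
    unfolding est_coef_def sum_distrib_right sum_distrib_left by (subst sum.swap) (simp add: mult.assoc)
  also have "\<dots> = (\<Sum>m<n. (S j m)\<^sup>2 * (if m = k then 1 else 0))" by (intro sum.cong) (auto simp: e)
  also have "\<dots> = (S j k)\<^sup>2" using k by (simp add: if_distrib[of "\<lambda>a. _ * a"] cong: if_cong)
  finally show ?thesis .
qed

lemma A_norm: "(\<Sum>i<n. (A j i)\<^sup>2) \<le> (\<Sum>k<n. (S j k) ^ 4) / \<kappa>\<^sup>2"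
proof -
  let ?a = "ip n (A j) (A j)" and ?s = "\<lambda>k. (S j k)\<^sup>2"
  have "\<kappa> * ?a \<le> (\<Sum>i<n. \<Sum>k<n. A j i * (P i k)\<^sup>2 * A j k)" by (rule projsq_form)
  also have "\<dots> = (\<Sum>k<n. (\<Sum>i<n. A j i * (P i k)\<^sup>2) * A j k)"
    by (subst sum.swap) (simp add: sum_distrib_right)
  also have "\<dots> = ip n ?s (A j)" by (simp add: A_projsq ip_def)
  finally have 1: "\<kappa> * ?a \<le> ip n ?s (A j)" .
  have "(\<kappa> * ?a)\<^sup>2 \<le> (ip n ?s (A j))\<^sup>2" using 1 \<kappa> ip_self_nonneg[of n "A j"] by (intro power_mono) auto
  also have "\<dots> \<le> ip n ?s ?s * ?a" by (rule cauchy_ip)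
  finally have 2: "(\<kappa>\<^sup>2 * ?a) * ?a \<le> ip n ?s ?s * ?a" by (simp add: power2_eq_square algebra_simps)
  have "\<kappa>\<^sup>2 * ?a \<le> ip n ?s ?s"
  proof (cases "?a = 0")
    case True then show ?thesis using ip_self_nonneg[of n ?s] by simp
  next
    case False
    then have "?a > 0" using ip_self_nonneg[of n "A j"] by simp
    with 2 show ?thesis by (rule mult_right_le_imp_le)
  qed
  also have "ip n ?s ?s = (\<Sum>k<n. (S j k) ^ 4)" by (simp add: ip_def power4_eq_xxxx power2_eq_square mult.assoc)
  finally show ?thesis using \<kappa> by (simp add: pos_le_divide_eq ip_def power2_eq_square mult.commute)
qed

lemma sum_noise_weight: "(\<Sum>k<n. noise_weight n p Ri Z k) \<le> (\<Sum>r<n. \<Sum>j<p. (S j r) ^ 4) / \<kappa>\<^sup>2"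
proof -
  have "(\<Sum>k<n. noise_weight n p Ri Z k) = (\<Sum>j<p. \<Sum>k<n. \<Sum>i<n. (A j i)\<^sup>2 * (P i k)\<^sup>2)"
    unfolding noise_weight_def by (rule sum.swap)
  also have "\<dots> = (\<Sum>j<p. \<Sum>i<n. \<Sum>k<n. (A j i)\<^sup>2 * (P i k)\<^sup>2)"
    by (intro sum.cong refl sum.swap)
  also have "\<dots> = (\<Sum>j<p. \<Sum>i<n. (A j i)\<^sup>2 * P i i)"
    by (simp add: sum_distrib_left[symmetric] P_row)
  also have "\<dots> \<le> (\<Sum>j<p. \<Sum>i<n. (A j i)\<^sup>2 * 1)"
    using P_diag_le by (intro sum_mono mult_left_mono) auto
  also have "\<dots> \<le> (\<Sum>j<p. (\<Sum>k<n. (S j k) ^ 4) / \<kappa>\<^sup>2)"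
    using A_norm by (intro sum_mono) simp
  also have "\<dots> = (\<Sum>r<n. \<Sum>j<p. (S j r) ^ 4) / \<kappa>\<^sup>2"
    unfolding sum_divide_distrib[symmetric] by (subst sum.swap) simp
  finally show ?thesis .
qed

text \<open>The residuals are linear in the noise, so the estimator is a quadratic form in it. Its diagonal
  coefficients are exactly those of the variance to be estimated, because of the inverse of \<open>Q\<odot>Q\<close>: the
  estimator is unbiased and the error is a centred quadratic form.\<close>

definition Bq :: "nat \<Rightarrow> nat \<Rightarrow> nat \<Rightarrow> real" where
  "Bq j k m = (\<Sum>i<n. A j i * P i k * P i m)"

lemma Bq_diag: "k < n \<Longrightarrow> Bq j k k = (S j k)\<^sup>2"
  using A_projsq[of k j] by (simp add: Bq_def power2_eq_square mult.assoc)

lemma Bq_row: assumes k: "k < n" shows "(\<Sum>m<n. (Bq j k m)\<^sup>2) \<le> (\<Sum>i<n. (A j i)\<^sup>2 * (P i k)\<^sup>2)"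
proof -
  let ?w = "\<lambda>i. A j i * P i k"
  have "(\<Sum>m<n. (Bq j k m)\<^sup>2) = ip n (res n p Z x ?w) (res n p Z x ?w)"
  proof -
    have "Bq j k m = res n p Z x ?w m" if m: "m < n" for m
      using m by (simp add: Bq_def res_P ip_def P_sym[OF m] mult.commute mult.left_commute)
    then show ?thesis by (simp add: ip_def power2_eq_square)
  qed
  also have "\<dots> \<le> ip n ?w ?w" by (rule res_contract)
  finally show ?thesis by (simp add: ip_def power2_eq_square algebra_simps)
qed

lemma error_form:
  "(\<Sum>i<n. A j i * (res n p Z x w i)\<^sup>2) - (\<Sum>k<n. (S j k)\<^sup>2 * v k)
    = (\<Sum>k<n. \<Sum>m<n. Bq j k m * w k * w m) - (\<Sum>k<n. Bq j k k * v k)"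
proof -
  have "(\<Sum>i<n. A j i * (res n p Z x w i)\<^sup>2) = (\<Sum>i<n. \<Sum>k<n. \<Sum>m<n. A j i * P i k * P i m * w k * w m)"
  proof (rule sum.cong[OF refl])
    fix i assume "i \<in> {..<n}"
    then have "(res n p Z x w i)\<^sup>2 = (\<Sum>k<n. \<Sum>m<n. (P i k * w k) * (P i m * w m))"
      by (simp add: res_P ip_def power2_eq_square sum_product)
    then show "A j i * (res n p Z x w i)\<^sup>2 = (\<Sum>k<n. \<Sum>m<n. A j i * P i k * P i m * w k * w m)"
      by (simp add: sum_distrib_left ac_simps)
  qed
  also have "\<dots> = (\<Sum>k<n. \<Sum>i<n. \<Sum>m<n. A j i * P i k * P i m * w k * w m)" by (rule sum.swap)
  also have "\<dots> = (\<Sum>k<n. \<Sum>m<n. \<Sum>i<n. A j i * P i k * P i m * w k * w m)" by (intro sum.cong refl sum.swap)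
  also have "\<dots> = (\<Sum>k<n. \<Sum>m<n. Bq j k m * w k * w m)" by (simp add: Bq_def sum_distrib_right)
  finally show ?thesis by (simp add: Bq_diag)
qed

end

text \<open>The moment bound for quadratic forms with exponent two, after rescaling the noise to unit variance. The
  mixed products of variances are split symmetrically, so that each variance is paired with one row
  of the matrix.\<close>

lemma (in prob_space) quadratic_noise:
  fixes \<epsilon> :: "nat \<Rightarrow> 'a \<Rightarrow> real" and B :: "nat \<Rightarrow> nat \<Rightarrow> real"
  assumes C: "C \<ge> 0"
    and ind: "indep_vars (\<lambda>_. borel) \<epsilon> {..<N}"
    and mean: "\<And>i. i < N \<Longrightarrow> (\<integral>\<omega>. \<epsilon> i \<omega> \<partial>M) = 0"
    and v: "\<And>i. i < N \<Longrightarrow> (\<integral>\<omega>. (\<epsilon> i \<omega>)\<^sup>2 \<partial>M) = v i" "\<And>i. i < N \<Longrightarrow> v i > 0"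
    and int: "\<And>i. i < N \<Longrightarrow> integrable M (\<lambda>\<omega>. (\<epsilon> i \<omega>) ^ 4)"
    and mom: "\<And>i. i < N \<Longrightarrow> (\<integral>\<omega>. (\<epsilon> i \<omega>) ^ 4 \<partial>M) \<le> C * (v i)\<^sup>2"
    and Bsym: "\<And>k m. k < N \<Longrightarrow> m < N \<Longrightarrow> B k m = B m k"
  shows "(\<integral>\<^sup>+\<omega>. ennreal (((\<Sum>k<N. \<Sum>m<N. B k m * \<epsilon> k \<omega> * \<epsilon> m \<omega>) - (\<Sum>k<N. B k k * v k))\<^sup>2) \<partial>M)
    \<le> ennreal (quad_const 2 C * (\<Sum>k<N. (v k)\<^sup>2 * (\<Sum>m<N. (B k m)\<^sup>2)))"
proof -
  define s where "s i = sqrt (v i)" for i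
  have s: "s i > 0" "s i * s i = v i" if "i < N" for i using v(2)[OF that] by (auto simp: s_def)
  define z where "z i \<omega> = \<epsilon> i \<omega> / s i" for i \<omega>
  have indz: "indep_vars (\<lambda>_. borel) z {..<N}"
    using indep_vars_compose2[OF ind, of "\<lambda>i u. u / s i" "\<lambda>_. borel"] by (simp add: z_def[abs_def])
  have e4: "\<bar>u\<bar> powr (2 * 2) = u ^ 4" for u :: real
  proof -
    have "\<bar>u\<bar> powr 4 = \<bar>u\<bar> ^ 4" by (cases "u = 0") (auto simp: powr_numeral)
    then show ?thesis by simp
  qed
  have z4: "\<bar>z i \<omega>\<bar> powr (2 * 2) = (\<epsilon> i \<omega>) ^ 4 / (v i)\<^sup>2" if "i < N" for i \<omega>
  proof -
    have "s i ^ 4 = (v i)\<^sup>2" using s(2)[OF that] by (simp add: power4_eq_xxxx power2_eq_square)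
    then show ?thesis unfolding e4 by (simp add: z_def power_divide)
  qed
  have v1: "(\<integral>\<omega>. (z i \<omega>)\<^sup>2 \<partial>M) = 1" if "i < N" for i
  proof -
    have "(z i \<omega>)\<^sup>2 = (\<epsilon> i \<omega>)\<^sup>2 / v i" for \<omega> using s[OF that] by (simp add: z_def power_divide power2_eq_square)
    then show ?thesis using v[OF that] by simp
  qed
  have zint: "integrable M (\<lambda>\<omega>. \<bar>z i \<omega>\<bar> powr (2 * 2))" if "i < N" for i
    unfolding z4[OF that] using int[OF that] by simp
  have zmom: "(\<integral>\<omega>. \<bar>z i \<omega>\<bar> powr (2 * 2) \<partial>M) \<le> C" if "i < N" for i
  proof -
    have "(\<integral>\<omega>. \<bar>z i \<omega>\<bar> powr (2 * 2) \<partial>M) = (\<integral>\<omega>. (\<epsilon> i \<omega>) ^ 4 \<partial>M) / (v i)\<^sup>2" unfolding z4[OF that] by simp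
    also have "\<dots> \<le> C" using mom[OF that] v(2)[OF that] by (simp add: pos_divide_le_eq)
    finally show ?thesis .
  qed
  let ?B = "\<lambda>k m. B k m * s k * s m"
  note Q = quadratic_form_moment[of 2 C z N ?B, OF _ C indz _ zint zmom]
  have zm: "(\<integral>\<omega>. z i \<omega> \<partial>M) = 0" if "i < N" for i using mean[OF that] by (simp add: z_def)
  have T: "(\<Sum>i<N. \<Sum>k<N. ?B i k * z i \<omega> * z k \<omega>) - (\<Sum>i<N. ?B i i * (\<integral>\<omega>. (z i \<omega>)\<^sup>2 \<partial>M))
     = (\<Sum>k<N. \<Sum>m<N. B k m * \<epsilon> k \<omega> * \<epsilon> m \<omega>) - (\<Sum>k<N. B k k * v k)" for \<omega>
  proof -
    have "?B i k * z i \<omega> * z k \<omega> = B i k * \<epsilon> i \<omega> * \<epsilon> k \<omega>" if "i < N" "k < N" for i k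
      using s(1)[OF that(1)] s(1)[OF that(2)] by (simp add: z_def)
    moreover have "?B i i * (\<integral>\<omega>. (z i \<omega>)\<^sup>2 \<partial>M) = B i i * v i" if "i < N" for i
      using s(2)[OF that] v1[OF that] by (simp add: mult.assoc)
    ultimately show ?thesis by (intro arg_cong2[where f = "(-)"] sum.cong refl) auto
  qed
  have sq: "\<bar>u\<bar> powr 2 = u\<^sup>2" for u :: real by (cases "u = 0") (auto simp: powr_numeral)
  have I: "integrable M (\<lambda>\<omega>. ((\<Sum>k<N. \<Sum>m<N. B k m * \<epsilon> k \<omega> * \<epsilon> m \<omega>) - (\<Sum>k<N. B k k * v k))\<^sup>2)"
    using Q(1) zm by (simp add: T sq)
  have "(\<integral>\<^sup>+\<omega>. ennreal (((\<Sum>k<N. \<Sum>m<N. B k m * \<epsilon> k \<omega> * \<epsilon> m \<omega>) - (\<Sum>k<N. B k k * v k))\<^sup>2) \<partial>M)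
     = ennreal (\<integral>\<omega>. ((\<Sum>k<N. \<Sum>m<N. B k m * \<epsilon> k \<omega> * \<epsilon> m \<omega>) - (\<Sum>k<N. B k k * v k))\<^sup>2 \<partial>M)"
    using I by (intro nn_integral_eq_integral) auto
  also have "\<dots> \<le> ennreal ((quad_const 2 C * (\<Sum>i<N. \<Sum>k<N. (?B i k)\<^sup>2)) powr (2/2))"
    using Q(2) zm by (intro ennreal_leI) (simp add: T sq)
  also have "\<dots> = ennreal (quad_const 2 C * (\<Sum>i<N. \<Sum>k<N. (?B i k)\<^sup>2))"
    using quad_const_pos[OF C, of 2] by (simp add: sum_nonneg)
  also have "\<dots> \<le> ennreal (quad_const 2 C * (\<Sum>k<N. (v k)\<^sup>2 * (\<Sum>m<N. (B k m)\<^sup>2)))"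
  proof (intro ennreal_leI mult_left_mono)
    have "(?B i k)\<^sup>2 \<le> (B i k)\<^sup>2 * (v i)\<^sup>2 / 2 + (B i k)\<^sup>2 * (v k)\<^sup>2 / 2" if "i < N" "k < N" for i k
    proof -
      have "0 \<le> (v i - v k)\<^sup>2" by simp
      then have "v i * v k \<le> ((v i)\<^sup>2 + (v k)\<^sup>2) / 2" by (simp add: power2_eq_square algebra_simps)
      then have le: "(B i k)\<^sup>2 * (v i * v k) \<le> (B i k)\<^sup>2 * (((v i)\<^sup>2 + (v k)\<^sup>2) / 2)" by (intro mult_left_mono) auto
      have "(?B i k)\<^sup>2 = (B i k)\<^sup>2 * ((s i * s i) * (s k * s k))" by (simp add: power2_eq_square)
      also have "\<dots> = (B i k)\<^sup>2 * (v i * v k)" by (simp only: s(2)[OF that(1)] s(2)[OF that(2)])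
      also note le
      also have "(B i k)\<^sup>2 * (((v i)\<^sup>2 + (v k)\<^sup>2) / 2) = (B i k)\<^sup>2 * (v i)\<^sup>2 / 2 + (B i k)\<^sup>2 * (v k)\<^sup>2 / 2"
        by (simp add: distrib_left add_divide_distrib)
      finally show ?thesis .
    qed
    then have "(\<Sum>i<N. \<Sum>k<N. (?B i k)\<^sup>2) \<le> (\<Sum>i<N. \<Sum>k<N. (B i k)\<^sup>2 * (v i)\<^sup>2 / 2) + (\<Sum>i<N. \<Sum>k<N. (B i k)\<^sup>2 * (v k)\<^sup>2 / 2)"
      unfolding sum.distrib[symmetric] by (intro sum_mono) auto
    also have "(\<Sum>i<N. \<Sum>k<N. (B i k)\<^sup>2 * (v k)\<^sup>2 / 2) = (\<Sum>i<N. \<Sum>k<N. (B i k)\<^sup>2 * (v i)\<^sup>2 / 2)"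
      using Bsym by (subst sum.swap) (auto intro!: sum.cong)
    also have "(\<Sum>i<N. \<Sum>k<N. (B i k)\<^sup>2 * (v i)\<^sup>2 / 2) + (\<Sum>i<N. \<Sum>k<N. (B i k)\<^sup>2 * (v i)\<^sup>2 / 2) = (\<Sum>k<N. (v k)\<^sup>2 * (\<Sum>m<N. (B k m)\<^sup>2))"
      by (simp add: sum_divide_distrib[symmetric] sum_distrib_left mult.commute)
    finally show "(\<Sum>i<N. \<Sum>k<N. (?B i k)\<^sup>2) \<le> (\<Sum>k<N. (v k)\<^sup>2 * (\<Sum>m<N. (B k m)\<^sup>2))" .
  qed (use quad_const_pos[OF C, of 2] in auto)
  finally show ?thesis .
qed

context design
begin

lemma Bq_sym: "Bq j k m = Bq j m k" by (simp add: Bq_def ac_simps)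

lemma error_second_moment:
  fixes \<epsilon> :: "nat \<Rightarrow> 'a \<Rightarrow> real"
  assumes "prob_space M" and C: "C \<ge> 0"
    and ind: "prob_space.indep_vars M (\<lambda>_. borel) \<epsilon> {..<n}"
    and mean: "\<And>i. i < n \<Longrightarrow> (\<integral>\<omega>. \<epsilon> i \<omega> \<partial>M) = 0"
    and v: "\<And>i. i < n \<Longrightarrow> (\<integral>\<omega>. (\<epsilon> i \<omega>)\<^sup>2 \<partial>M) = v i" "\<And>i. i < n \<Longrightarrow> v i > 0"
    and int: "\<And>i. i < n \<Longrightarrow> integrable M (\<lambda>\<omega>. (\<epsilon> i \<omega>) ^ 4)"
    and mom: "\<And>i. i < n \<Longrightarrow> (\<integral>\<omega>. (\<epsilon> i \<omega>) ^ 4 \<partial>M) \<le> C * (v i)\<^sup>2"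
  shows "(\<integral>\<^sup>+\<omega>. ennreal (\<Sum>j<p. ((\<Sum>i<n. A j i * (res n p Z x (\<lambda>i. \<epsilon> i \<omega>) i)\<^sup>2) - (\<Sum>k<n. (S j k)\<^sup>2 * v k))\<^sup>2) \<partial>M)
    \<le> ennreal (quad_const 2 C * (\<Sum>k<n. (v k)\<^sup>2 * noise_weight n p Ri Z k))"
proof -
  interpret prob_space M by fact
  have Q0: "quad_const 2 C \<ge> 0" using quad_const_pos[OF C, of 2] by simp
  have em[measurable]: "\<epsilon> i \<in> borel_measurable M" if "i < n" for i
    using ind that by (auto simp: indep_vars_def)
  let ?q = "\<lambda>j \<omega>. (\<Sum>k<n. \<Sum>m<n. Bq j k m * \<epsilon> k \<omega> * \<epsilon> m \<omega>) - (\<Sum>k<n. Bq j k k * v k)"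
  have qm[measurable]: "?q j \<in> borel_measurable M" for j
    by (intro borel_measurable_diff borel_measurable_sum borel_measurable_times borel_measurable_const em) auto
  have "(\<integral>\<^sup>+\<omega>. ennreal (\<Sum>j<p. ((\<Sum>i<n. A j i * (res n p Z x (\<lambda>i. \<epsilon> i \<omega>) i)\<^sup>2) - (\<Sum>k<n. (S j k)\<^sup>2 * v k))\<^sup>2) \<partial>M)
    = (\<Sum>j<p. \<integral>\<^sup>+\<omega>. ennreal ((?q j \<omega>)\<^sup>2) \<partial>M)"
    unfolding error_form by (subst nn_integral_sum[symmetric]) (auto simp: sum_ennreal)
  also have "\<dots> \<le> (\<Sum>j<p. ennreal (quad_const 2 C * (\<Sum>k<n. (v k)\<^sup>2 * (\<Sum>m<n. (Bq j k m)\<^sup>2))))"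
    by (intro sum_mono quadratic_noise C ind mean v int mom Bq_sym)
  also have "\<dots> \<le> (\<Sum>j<p. ennreal (quad_const 2 C * (\<Sum>k<n. (v k)\<^sup>2 * (\<Sum>i<n. (A j i)\<^sup>2 * (P i k)\<^sup>2))))"
  proof (rule sum_mono, rule ennreal_leI, rule mult_left_mono[OF _ Q0])
    fix j
    show "(\<Sum>k<n. (v k)\<^sup>2 * (\<Sum>m<n. (Bq j k m)\<^sup>2)) \<le> (\<Sum>k<n. (v k)\<^sup>2 * (\<Sum>i<n. (A j i)\<^sup>2 * (P i k)\<^sup>2))"
      using Bq_row[of _ j] by (intro sum_mono[where K = "{..<n}" and f = "\<lambda>k. (v k)\<^sup>2 * (\<Sum>m<n. (Bq j k m)\<^sup>2)"]
        mult_left_mono[where c = "(v _)\<^sup>2"]) auto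
  qed
  also have "\<dots> = ennreal (\<Sum>j<p. quad_const 2 C * (\<Sum>k<n. (v k)\<^sup>2 * (\<Sum>i<n. (A j i)\<^sup>2 * (P i k)\<^sup>2)))"
    using Q0 by (intro sum_ennreal mult_nonneg_nonneg sum_nonneg) auto
  also have "(\<Sum>j<p. quad_const 2 C * (\<Sum>k<n. (v k)\<^sup>2 * (\<Sum>i<n. (A j i)\<^sup>2 * (P i k)\<^sup>2)))
     = quad_const 2 C * (\<Sum>k<n. (v k)\<^sup>2 * noise_weight n p Ri Z k)"
    unfolding sum_distrib_left[symmetric] noise_weight_def
    by (subst sum.swap) (simp add: sum_distrib_left)
  finally show ?thesis .
qed

end

section \<open>Entries of matrix products\<close>

definition mfun :: "real mat \<Rightarrow> nat \<Rightarrow> nat \<Rightarrow> real" where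
  "mfun A i k = A $$ (i, k)"

lemma mat_vec_mv: "A \<in> carrier_mat n m \<Longrightarrow> v \<in> carrier_vec m \<Longrightarrow> i < n \<Longrightarrow> (A *\<^sub>v v) $ i = mv m (mfun A) (($) v) i"
  by (auto simp: scalar_prod_def mv_def mfun_def atLeast0LessThan intro!: sum.cong)

lemma scalar_prod_ip: "u \<in> carrier_vec m \<Longrightarrow> v \<in> carrier_vec m \<Longrightarrow> u \<bullet> v = ip m (($) u) (($) v)"
  by (auto simp: scalar_prod_def ip_def atLeast0LessThan)

lemma mat_mat_entry: "A \<in> carrier_mat n m \<Longrightarrow> B \<in> carrier_mat m q \<Longrightarrow> i < n \<Longrightarrow> k < q \<Longrightarrow>
    (A * B) $$ (i, k) = (\<Sum>j<m. A $$ (i, j) * B $$ (j, k))"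
  by (auto simp: scalar_prod_def atLeast0LessThan intro!: sum.cong)

section \<open>The smallest singular value\<close>

text \<open>Used to bound a positive definite form away from zero through its inverse.\<close>

lemma psd_cauchy:
  assumes sym: "\<And>j k. j < m \<Longrightarrow> k < m \<Longrightarrow> B j k = B k j"
    and psd: "\<And>v. ip m v (mv m B v) \<ge> 0"
  shows "(ip m v (mv m B w))\<^sup>2 \<le> ip m v (mv m B v) * ip m w (mv m B w)"
proof (rule discriminant_bound[OF _ psd])
  fix t :: real
  have s: "ip m w (mv m B v) = ip m v (mv m B w)"
  proof -
    have "ip m w (mv m B v) = ip m (\<lambda>k. ip m (\<lambda>i. B i k) w) v" by (rule ip_mv_adjoint)
    also have "\<dots> = ip m (mv m B w) v" by (rule ip_cong) (auto simp: ip_def mv_def sym intro!: sum.cong)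
    finally show ?thesis by (simp only: ip_commute[of m "mv m B w"])
  qed
  have "ip m (\<lambda>k. v k + t * w k) (mv m B (\<lambda>k. v k + t * w k)) \<ge> 0" by (rule psd)
  then show "ip m v (mv m B v) + 2 * t * ip m v (mv m B w) + t\<^sup>2 * ip m w (mv m B w) \<ge> 0"
    by (simp add: mv_linear[abs_def] ip_linear s power2_eq_square algebra_simps)
qed

text \<open>The infimum \<open>a\<close> of the form over the unit sphere is an eigenvalue: otherwise \<open>G - a\<close> would have an inverse,
  and the Cauchy--Schwarz inequality for the form of \<open>G - a\<close> would bound that form away from zero on the
  sphere.\<close>

lemma min_eigenvalue:
  assumes G: "psd_mat m G" and m: "m > 0"
  obtains a v where "\<And>w. a * ip m w w \<le> ip m w (mv m (mfun G) w)" "a \<ge> 0" "v \<in> carrier_vec m" "v \<noteq> 0\<^sub>v m" "G *\<^sub>v v = a \<cdot>\<^sub>v v"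
proof -
  have Gc: "G \<in> carrier_mat m m" and Gs: "transpose_mat G = G" and Gp: "\<And>v. v \<in> carrier_vec m \<Longrightarrow> 0 \<le> v \<bullet> (G *\<^sub>v v)"
    using G by (auto simp: psd_mat_def)
  let ?G = "mfun G"
  have sym: "?G j k = ?G k j" if "j < m" "k < m" for j k
    using that Gc by (subst Gs[symmetric]) (simp add: mfun_def)
  have psd: "ip m w (mv m ?G w) \<ge> 0" for w
  proof -
    let ?v = "Matrix.vec m w"
    have "?v \<bullet> (G *\<^sub>v ?v) = ip m (($) ?v) (($) (G *\<^sub>v ?v))" using Gc by (intro scalar_prod_ip) auto
    also have "\<dots> = ip m w (mv m ?G w)"
    proof (rule ip_cong)
      fix k assume k: "k < m"
      then show "?v $ k = w k" by simp
      have "(G *\<^sub>v ?v) $ k = mv m ?G (($) ?v) k" using k by (intro mat_vec_mv[OF Gc]) auto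
      also have "\<dots> = mv m ?G w k" by (rule mv_cong) simp
      finally show "(G *\<^sub>v ?v) $ k = mv m ?G w k" .
    qed
    finally show ?thesis using Gp[of ?v] by simp
  qed
  let ?U = "{ip m w (mv m ?G w) |w. ip m w w = 1}"
  have ne: "?U \<noteq> {}"
    using m by (auto intro!: exI[of _ "\<lambda>k. if k = 0 then 1 else 0"] simp: ip_unit_left)
  have bdd: "bdd_below ?U" using psd by (auto intro!: bdd_belowI[of _ 0])
  define a where "a = Inf ?U"
  have a0: "a \<ge> 0" unfolding a_def using ne psd by (intro cInf_greatest) auto
  have lower: "a * ip m w w \<le> ip m w (mv m ?G w)" for w
  proof (cases "ip m w w = 0")
    case True then show ?thesis using psd by simp
  next
    case False
    then have pos: "ip m w w > 0" using ip_self_nonneg[of m w] by simp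
    define s where "s = sqrt (ip m w w)"
    have s: "s > 0" "s * s = ip m w w" using pos by (auto simp: s_def)
    let ?u = "\<lambda>k. (1 / s) * w k"
    have "ip m ?u ?u = (1 / s) * ((1 / s) * ip m w w)" by (simp only: ip_scale_left ip_scale_right)
    then have "ip m ?u ?u = 1" using s(1) by (simp add: s(2)[symmetric])
    then have "a \<le> ip m ?u (mv m ?G ?u)" unfolding a_def by (intro cInf_lower bdd) auto
    also have "\<dots> = ip m w (mv m ?G w) / (s * s)"
      by (simp only: mv_scale[abs_def] ip_scale_left ip_scale_right) simp
    finally show ?thesis using s pos by (simp add: pos_le_divide_eq)
  qed
  define B where "B = G - a \<cdot>\<^sub>m 1\<^sub>m m"
  have Bc: "B \<in> carrier_mat m m" unfolding B_def by (rule minus_carrier_mat) simp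
  have Be: "mfun B j k = ?G j k - (if j = k then a else 0)" if "j < m" "k < m" for j k
    using that Gc by (simp add: B_def mfun_def)
  have Bmv: "mv m (mfun B) w j = mv m ?G w j - a * w j" if "j < m" for w j
    using that by (simp add: mv_def Be left_diff_distrib sum_subtractf if_distrib[of "\<lambda>a. a * _"] cong: if_cong)
  have Bform: "ip m u (mv m (mfun B) w) = ip m u (mv m ?G w) - a * ip m u w" for u w
  proof -
    have "ip m u (mv m (mfun B) w) = ip m u (\<lambda>j. mv m ?G w j - a * w j)" by (intro ip_cong) (auto simp: Bmv)
    then show ?thesis by (simp add: ip_linear)
  qed
  have Bpsd: "ip m w (mv m (mfun B) w) \<ge> 0" for w using lower by (simp add: Bform)
  have Bsym: "mfun B j k = mfun B k j" if "j < m" "k < m" for j k using that sym by (simp add: Be)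
  have "det B = 0"
  proof (rule ccontr)
    assume d: "det B \<noteq> 0"
    note I = minv_inverse[OF Bc d]
    let ?N = "mfun (minv B)"
    define Kb where "Kb = (\<Sum>i<m. \<Sum>j<m. \<bar>?N i j\<bar>)"
    have Kb: "Kb \<ge> 0" by (auto simp: Kb_def intro!: sum_nonneg)
    have "a + 1 / (Kb + 1) \<le> b" if b: "b \<in> ?U" for b
    proof -
      from b obtain w where w: "ip m w w = 1" "b = ip m w (mv m ?G w)" by auto
      have w1: "\<bar>w i\<bar> \<le> 1" if "i < m" for i
      proof -
        have "(w i)\<^sup>2 \<le> (\<Sum>k<m. (w k)\<^sup>2)" using that by (intro member_le_sum) auto
        also have "\<dots> = 1" using w(1) by (simp add: ip_def power2_eq_square)
        finally show ?thesis by (simp add: abs_square_le_1)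
      qed
      let ?u = "mv m ?N w"
      have Bu: "mv m (mfun B) ?u j = w j" if j: "j < m" for j
      proof -
        have "mv m (mfun B) ?u j = (\<Sum>k<m. (\<Sum>i<m. B $$ (j, i) * minv B $$ (i, k)) * w k)"
          unfolding mv_def mfun_def sum_distrib_left sum_distrib_right by (subst sum.swap) (simp add: mult.assoc)
        also have "\<dots> = (\<Sum>k<m. (if j = k then 1 else 0) * w k)"
        proof (rule sum.cong[OF refl])
          fix k assume "k \<in> {..<m}"
          then show "(\<Sum>i<m. B $$ (j, i) * minv B $$ (i, k)) * w k = (if j = k then 1 else 0) * w k"
            using mat_mat_entry[OF Bc I(1) j, of k] I(2) j by simp
        qed
        also have "\<dots> = w j" using j by (simp add: if_distrib[of "\<lambda>a. a * _"] cong: if_cong)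
        finally show ?thesis .
      qed
      have e1: "ip m c (mv m (mfun B) ?u) = ip m c w" for c by (intro ip_cong) (auto simp: Bu)
      have uw: "ip m ?u w \<le> Kb"
      proof -
        have "ip m ?u w = (\<Sum>i<m. \<Sum>j<m. ?N i j * w j * w i)" by (simp add: ip_def mv_def sum_distrib_right)
        also have "\<dots> \<le> Kb" unfolding Kb_def
        proof (intro sum_mono)
          fix i j assume "i \<in> {..<m}" "j \<in> {..<m}"
          then have "\<bar>w j\<bar> * \<bar>w i\<bar> \<le> 1 * 1" using w1 by (intro mult_mono) auto
          then have "\<bar>?N i j\<bar> * (\<bar>w j\<bar> * \<bar>w i\<bar>) \<le> \<bar>?N i j\<bar> * 1" by (intro mult_left_mono) auto
          then show "?N i j * w j * w i \<le> \<bar>?N i j\<bar>"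
            using abs_ge_self[of "?N i j * w j * w i"] by (simp add: abs_mult mult.assoc)
        qed
        finally show ?thesis .
      qed
      have "(ip m w (mv m (mfun B) ?u))\<^sup>2 \<le> ip m w (mv m (mfun B) w) * ip m ?u (mv m (mfun B) ?u)"
        by (rule psd_cauchy[OF Bsym Bpsd])
      then have "1 \<le> ip m w (mv m (mfun B) w) * ip m ?u w" using w(1) by (simp add: e1)
      also have "\<dots> \<le> ip m w (mv m (mfun B) w) * (Kb + 1)" using uw Bpsd by (intro mult_left_mono) auto
      finally have "1 / (Kb + 1) \<le> ip m w (mv m (mfun B) w)" using Kb by (simp add: pos_divide_le_eq)
      then show ?thesis using w by (simp add: Bform)
    qed
    then have "a + 1 / (Kb + 1) \<le> a" unfolding a_def using ne by (intro cInf_greatest) auto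
    then show False using Kb by simp
  qed
  then obtain v where v: "v \<in> carrier_vec m" "v \<noteq> 0\<^sub>v m" "B *\<^sub>v v = 0\<^sub>v m"
    using det_0_iff_vec_prod_zero_field[OF Bc] by auto
  have "G *\<^sub>v v = a \<cdot>\<^sub>v v"
  proof (rule eq_vecI)
    fix j assume "j < dim_vec (a \<cdot>\<^sub>v v)"
    then have j: "j < m" using v by simp
    have "(B *\<^sub>v v) $ j = mv m (mfun B) (($) v) j" by (rule mat_vec_mv[OF Bc v(1) j])
    then have "mv m ?G (($) v) j = a * v $ j" using v(3) j by (simp add: Bmv)
    then show "(G *\<^sub>v v) $ j = (a \<cdot>\<^sub>v v) $ j" using mat_vec_mv[OF Gc v(1) j] j v(1) by simp
  qed (use Gc v in auto)
  then show ?thesis using that lower a0 v by blast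
qed

text \<open>A positive semidefinite matrix has its smallest eigenvalue among its singular values.\<close>

lemma sigma_min_bound:
  assumes G: "psd_mat m G" and inv: "invertible_mat G" and m: "m > 0"
  shows "sigma_min G > 0" "sigma_min G * ip m w w \<le> ip m w (mv m (mfun G) w)"
proof -
  have Gc: "G \<in> carrier_mat m m" and Gs: "transpose_mat G = G" using G by (auto simp: psd_mat_def)
  obtain a v where a: "\<And>w. a * ip m w w \<le> ip m w (mv m (mfun G) w)" "a \<ge> 0" and v: "v \<in> carrier_vec m" "v \<noteq> 0\<^sub>v m" "G *\<^sub>v v = a \<cdot>\<^sub>v v"
    using min_eigenvalue[OF G m] by metis
  let ?H = "transpose_mat G * G"
  have Hc: "?H \<in> carrier_mat m m" using Gc by simp
  have fin: "finite (spectrum ?H)" by (rule card_finite_spectrum(1)[OF Hc])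
  have "?H *\<^sub>v v = a\<^sup>2 \<cdot>\<^sub>v v"
  proof -
    have "?H *\<^sub>v v = G *\<^sub>v (G *\<^sub>v v)" using Gc v(1) by (simp add: Gs assoc_mult_mat_vec[of _ m m _ m])
    also have "\<dots> = a \<cdot>\<^sub>v (G *\<^sub>v v)" using Gc v by (simp add: mult_mat_vec)
    finally show ?thesis using v by (simp add: smult_smult_assoc power2_eq_square)
  qed
  then have "a\<^sup>2 \<in> spectrum ?H" using v Gc by (auto simp: spectrum_def eigenvalue_def eigenvector_def)
  then have mem: "a \<in> sqrt ` spectrum ?H" using a(2) by (intro image_eqI[of _ _ "a\<^sup>2"]) auto
  have le: "sigma_min G \<le> a" unfolding sigma_min_def using fin mem by (intro Min_le) auto
  have det: "det G \<noteq> 0" using inv invertible_mat_iff_det[OF Gc] by simp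
  have "0 < s" if "s \<in> sqrt ` spectrum ?H" for s
  proof -
    from that obtain c where c: "s = sqrt c" "c \<in> spectrum ?H" by auto
    then obtain u where u: "u \<in> carrier_vec m" "u \<noteq> 0\<^sub>v m" "?H *\<^sub>v u = c \<cdot>\<^sub>v u"
      using Gc by (auto simp: spectrum_def eigenvalue_def eigenvector_def)
    let ?g = "G *\<^sub>v u"
    have gc: "?g \<in> carrier_vec m" by (rule mult_mat_vec_carrier[OF Gc u(1)])
    have g0: "?g \<noteq> 0\<^sub>v m" using det_0_iff_vec_prod_zero_field[OF Gc] det u by auto
    have "?g \<bullet> ?g = u \<bullet> (transpose_mat G *\<^sub>v ?g)"
      using transpose_vec_mult_scalar[OF Gc u(1) gc] comm_scalar_prod[OF u(1), of "transpose_mat G *\<^sub>v ?g"] Gc gc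
      by (metis mult_mat_vec_carrier transpose_carrier_mat)
    also have "transpose_mat G *\<^sub>v ?g = c \<cdot>\<^sub>v u"
      using u(3) assoc_mult_mat_vec[OF transpose_carrier_mat[THEN iffD2, OF Gc] Gc u(1)] by simp
    also have "u \<bullet> (c \<cdot>\<^sub>v u) = c * (u \<bullet> u)" using u by simp
    finally have e: "?g \<bullet> ?g = c * (u \<bullet> u)" .
    have "ip m (($) ?g) (($) ?g) \<noteq> 0" using g0 gc Gc ip_self_zero[of m "($) ?g"] by (auto intro!: eq_vecI)
    then have "c * (u \<bullet> u) > 0" unfolding e[symmetric] scalar_prod_ip[OF gc gc] using ip_self_nonneg[of m "($) ?g"] by simp
    moreover have "u \<bullet> u \<ge> 0" unfolding scalar_prod_ip[OF u(1) u(1)] by (rule ip_self_nonneg)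
    ultimately have "c > 0" by (auto simp: zero_less_mult_iff)
    then show ?thesis by (simp add: c)
  qed
  then show "sigma_min G > 0" unfolding sigma_min_def using fin mem by (subst Min_gr_iff) auto
  show "sigma_min G * ip m w w \<le> ip m w (mv m (mfun G) w)"
    using le a(1)[of w] ip_self_nonneg[of m w] by (meson mult_right_mono order_trans)
qed

text \<open>The inverse matrix as an array that vanishes outside of the index range.\<close>

definition inv_fun :: "nat \<Rightarrow> real mat \<Rightarrow> nat \<Rightarrow> nat \<Rightarrow> real" where
  "inv_fun m R j k = (if j < m \<and> k < m then minv R $$ (j, k) else 0)"

text \<open>The last two facts are the norm bounds required of \<open>R\<close> in \<open>coef_fourth\<close>, with the reciprocal of the
  smallest singular value as the constant.\<close>

lemma inv_sqrt_facts:
  assumes R: "is_sqrt_mat m R G" and G: "psd_mat m G" and inv: "invertible_mat G" and m: "m > 0"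
  defines "Ri \<equiv> inv_fun m R"
  shows "j < m \<Longrightarrow> k < m \<Longrightarrow> Ri j k = Ri k j"
    and "j < m \<Longrightarrow> mv m (mfun R) (mv m Ri v) j = v j"
    and "j < m \<Longrightarrow> mv m Ri (mv m (mfun R) v) j = v j"
    and "j < m \<Longrightarrow> k < m \<Longrightarrow> mfun R j k = mfun R k j"
    and "(\<Sum>j<m. (ip m (Ri j) v)\<^sup>2) \<le> 1 / sigma_min G * ip m v v"
    and "j < m \<Longrightarrow> ip m (Ri j) (Ri j) \<le> 1 / sigma_min G"
proof -
  have Rc: "R \<in> carrier_mat m m" and Rs: "transpose_mat R = R" and RR: "R * R = G"
    using R by (auto simp: is_sqrt_mat_def psd_mat_def)
  have Gc: "G \<in> carrier_mat m m" using G by (auto simp: psd_mat_def)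
  have "det R * det R = det G" using det_mult[OF Rc Rc] RR by simp
  then have det: "det R \<noteq> 0" using inv invertible_mat_iff_det[OF Gc] by auto
  note I = minv_inverse[OF Rc det]
  have Rsym: "mfun R j k = mfun R k j" if "j < m" "k < m" for j k
    using that Rc by (subst Rs[symmetric]) (simp add: mfun_def)
  show "j < m \<Longrightarrow> k < m \<Longrightarrow> mfun R j k = mfun R k j" by (rule Rsym)
  have "R * transpose_mat (minv R) = 1\<^sub>m m"
  proof -
    have "transpose_mat (minv R * R) = transpose_mat R * transpose_mat (minv R)" using I Rc by (intro transpose_mult[of _ m m _ m]) auto
    then show ?thesis using I Rs by simp
  qed
  then have T: "minv R = transpose_mat (minv R)" using minv_unique(1)[OF Rc, of "transpose_mat (minv R)"] I by auto
  have Risym: "Ri j k = Ri k j" for j k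
  proof (cases "j < m \<and> k < m")
    case True
    then have "minv R $$ (j, k) = minv R $$ (k, j)" using I(1) by (subst T) auto
    then show ?thesis using True by (simp add: Ri_def inv_fun_def)
  qed (auto simp: Ri_def inv_fun_def)
  then show "j < m \<Longrightarrow> k < m \<Longrightarrow> Ri j k = Ri k j" by simp
  have comp: "mv m A (mv m B v) j = v j" if AB: "\<And>k. k < m \<Longrightarrow> (\<Sum>i<m. A j i * B i k) = (if j = k then 1 else 0)" and j: "j < m" for A B v j
  proof -
    have "mv m A (mv m B v) j = (\<Sum>k<m. (\<Sum>i<m. A j i * B i k) * v k)"
      unfolding mv_def sum_distrib_left sum_distrib_right by (subst sum.swap) (simp add: mult.assoc)
    also have "\<dots> = (\<Sum>k<m. (if j = k then 1 else 0) * v k)" by (intro sum.cong) (auto simp: AB)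
    also have "\<dots> = v j" using j by (simp add: if_distrib[of "\<lambda>a. a * _"] cong: if_cong)
    finally show ?thesis .
  qed
  have RRi: "mv m (mfun R) (mv m Ri v) j = v j" if j: "j < m" for j v
  proof (rule comp[OF _ j])
    fix k assume k: "k < m"
    have "(\<Sum>i<m. mfun R j i * Ri i k) = (R * minv R) $$ (j, k)"
      unfolding mat_mat_entry[OF Rc I(1) j k] using j k by (intro sum.cong) (auto simp: mfun_def Ri_def inv_fun_def)
    then show "(\<Sum>i<m. mfun R j i * Ri i k) = (if j = k then 1 else 0)" using I j k by simp
  qed
  then show "j < m \<Longrightarrow> mv m (mfun R) (mv m Ri v) j = v j" .
  show "mv m Ri (mv m (mfun R) v) j = v j" if j: "j < m"
  proof (rule comp[OF _ j])
    fix k assume k: "k < m"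
    have "(\<Sum>i<m. Ri j i * mfun R i k) = (minv R * R) $$ (j, k)"
      unfolding mat_mat_entry[OF I(1) Rc j k] using j k by (intro sum.cong) (auto simp: mfun_def Ri_def inv_fun_def)
    then show "(\<Sum>i<m. Ri j i * mfun R i k) = (if j = k then 1 else 0)" using I j k by simp
  qed
  note s = sigma_min_bound[OF G inv m]
  show A: "(\<Sum>j<m. (ip m (Ri j) v)\<^sup>2) \<le> 1 / sigma_min G * ip m v v" for v
  proof -
    let ?w = "mv m Ri v"
    have w: "ip m (Ri j) v = ?w j" for j by (simp add: ip_def mv_def)
    have Gw: "mv m (mfun G) ?w j = mv m (mfun R) (mv m (mfun R) ?w) j" if j: "j < m" for j
    proof -
      have "mv m (mfun G) ?w j = (\<Sum>k<m. (\<Sum>i<m. R $$ (j, i) * R $$ (i, k)) * ?w k)"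
        unfolding mv_def[of m "mfun G"] using mat_mat_entry[OF Rc Rc j] RR by (intro sum.cong) (auto simp: mfun_def)
      also have "\<dots> = mv m (mfun R) (mv m (mfun R) ?w) j"
        unfolding mv_def[of m "mfun R"] mfun_def sum_distrib_left sum_distrib_right by (subst sum.swap) (simp add: mult.assoc)
      finally show ?thesis .
    qed
    have "ip m ?w (mv m (mfun G) ?w) = ip m ?w (mv m (mfun R) (mv m (mfun R) ?w))" by (intro ip_cong) (auto simp: Gw)
    also have "\<dots> = ip m (\<lambda>k. ip m (\<lambda>i. mfun R i k) ?w) (mv m (mfun R) ?w)" by (rule ip_mv_adjoint)
    also have "\<dots> = ip m v v"
    proof (intro ip_cong)
      fix k assume k: "k < m"
      have "ip m (\<lambda>i. mfun R i k) ?w = mv m (mfun R) ?w k" using Rsym[OF _ k] by (simp add: ip_def mv_def)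
      then show "ip m (\<lambda>i. mfun R i k) ?w = v k" using RRi[OF k] by simp
      show "mv m (mfun R) ?w k = v k" by (rule RRi[OF k])
    qed
    finally have "sigma_min G * ip m ?w ?w \<le> ip m v v" using s(2)[of ?w] by simp
    then have "ip m ?w ?w \<le> 1 / sigma_min G * ip m v v" using s(1) by (simp add: pos_le_divide_eq mult.commute)
    moreover have "(\<Sum>j<m. (ip m (Ri j) v)\<^sup>2) = ip m ?w ?w" unfolding w by (simp add: ip_def power2_eq_square)
    ultimately show ?thesis by simp
  qed
  show "ip m (Ri j) (Ri j) \<le> 1 / sigma_min G" if j: "j < m"
  proof -
    have "ip m (Ri j) (Ri j) = (\<Sum>i<m. (ip m (Ri i) (\<lambda>k. if k = j then 1 else 0))\<^sup>2)"
      using j Risym by (simp add: ip_unit) (simp add: ip_def power2_eq_square)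
    also have "\<dots> \<le> 1 / sigma_min G * ip m (\<lambda>k. if k = j then 1 else 0) (\<lambda>k. if k = j then 1 else 0)" by (rule A)
    also have "\<dots> = 1 / sigma_min G" using j by (simp add: ip_unit)
    finally show ?thesis .
  qed
qed

section \<open>The estimator in the whitened coordinates\<close>

lemma gram_mat: "transpose_mat (Matrix.mat n p (\<lambda>(i, k). Z i k)) * Matrix.mat n p (\<lambda>(i, k). Z i k) = gram n p 0 Z"
  by (rule eq_matI) (auto simp: gram_def scalar_prod_def ip_def atLeast0LessThan)

lemma enorm_square: "v \<in> carrier_vec m \<Longrightarrow> (enorm v)\<^sup>2 = (\<Sum>j<m. (v $ j)\<^sup>2)"
  by (simp add: enorm_def scalar_prod_ip ip_self_nonneg) (simp add: ip_def power2_eq_square)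

text \<open>In the coordinates \<open>X = Z R\<close> the square root \<open>R\<close> cancels from the residual projection and leaves only a factor
  \<open>minv R\<close> on the left of \<open>S\<close>.\<close>

locale whitened =
  fixes n p :: nat and X R :: "real mat" and Z :: "nat \<Rightarrow> nat \<Rightarrow> real"
  assumes Rc: "R \<in> carrier_mat p p" and Rs: "transpose_mat R = R" and Rd: "det R \<noteq> 0"
    and Xc: "X \<in> carrier_mat n p"
    and XZ: "\<And>i k. i < n \<Longrightarrow> k < p \<Longrightarrow> X $$ (i, k) = mv p (mfun R) (Z i) k"
    and Zd: "det (gram n p 0 Z) \<noteq> 0"
begin

abbreviation "Zm \<equiv> Matrix.mat n p (\<lambda>(i, k). Z i k)"
abbreviation "N \<equiv> minv R"
abbreviation "W \<equiv> minv (gram n p 0 Z)"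
abbreviation "Ri \<equiv> inv_fun p R"

lemma Zc: "Zm \<in> carrier_mat n p" and Gc: "gram n p 0 Z \<in> carrier_mat p p" and ZTc: "transpose_mat Zm \<in> carrier_mat p n" by auto

lemmas I = minv_inverse[OF Rc Rd] minv_inverse[OF Gc Zd]
lemma Nc: "N \<in> carrier_mat p p" and Wc: "W \<in> carrier_mat p p" using I by auto
lemmas carriers = Rc Xc Zc Gc Nc Wc ZTc

lemma X_eq: "X = Zm * R"
proof (rule eq_matI)
  fix i k assume "i < dim_row (Zm * R)" "k < dim_col (Zm * R)"
  then have ik: "i < n" "k < p" using Rc by auto
  have "R $$ (j, k) = R $$ (k, j)" if "j < p" for j
    using that ik Rc by (subst Rs[symmetric]) simp
  then show "X $$ (i, k) = (Zm * R) $$ (i, k)"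
    using ik by (simp add: XZ mat_mat_entry[OF Zc Rc] mv_def mfun_def mult.commute del: index_mult_mat(1))
qed (use Rc Xc in auto)

lemma XT: "transpose_mat X = R * transpose_mat Zm"
  unfolding X_eq using transpose_mult[OF Zc Rc] Rs by simp

lemma XTX: "transpose_mat X * X = R * gram n p 0 Z * R"
proof -
  have "transpose_mat X * X = R * transpose_mat Zm * (Zm * R)" unfolding XT by (simp only: X_eq)
  also have "\<dots> = R * (transpose_mat Zm * (Zm * R))" by (rule assoc_mult_mat[of _ p p _ n _ p]) (use carriers in auto)
  also have "transpose_mat Zm * (Zm * R) = (transpose_mat Zm * Zm) * R" by (rule assoc_mult_mat[of _ p n _ p _ p, symmetric]) (use carriers in auto)
  also have "\<dots> = gram n p 0 Z * R" by (simp only: gram_mat)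
  also have "R * (gram n p 0 Z * R) = R * gram n p 0 Z * R" by (rule assoc_mult_mat[of _ p p _ p _ p, symmetric]) (use carriers in auto)
  finally show ?thesis .
qed

lemma cancel:
  fixes A B D :: "real mat"
  assumes "A \<in> carrier_mat p p" "B \<in> carrier_mat p p" "A * B = 1\<^sub>m p" "D \<in> carrier_mat p m"
  shows "A * (B * D) = D"
  using assms(3) assoc_mult_mat[OF assms(1,2,4)] left_mult_one_mat[OF assms(4)] by simp

lemma XTX_inv: "minv (transpose_mat X * X) = N * (W * N)" "det (transpose_mat X * X) \<noteq> 0"
proof -
  have c: "transpose_mat X * X \<in> carrier_mat p p" "N * (W * N) \<in> carrier_mat p p" using carriers by auto
  have "transpose_mat X * X * (N * (W * N)) = R * gram n p 0 Z * (R * (N * (W * N)))"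
    unfolding XTX by (rule assoc_mult_mat[of _ p p _ p _ p]) (use carriers in auto)
  also have "R * (N * (W * N)) = W * N" by (rule cancel[of _ _ _ p]) (use carriers I in auto)
  also have "R * gram n p 0 Z * (W * N) = R * (gram n p 0 Z * (W * N))"
    by (rule assoc_mult_mat[of _ p p _ p _ p]) (use carriers in auto)
  also have "gram n p 0 Z * (W * N) = N" by (rule cancel[of _ _ _ p]) (use carriers I in auto)
  finally have "transpose_mat X * X * (N * (W * N)) = 1\<^sub>m p" using I by simp
  from minv_unique[OF c this] show "minv (transpose_mat X * X) = N * (W * N)" "det (transpose_mat X * X) \<noteq> 0" .
qed

lemma S_eq: "ols_S X = N * (W * transpose_mat Zm)"
proof -
  have "ols_S X = N * (W * N) * (R * transpose_mat Zm)" unfolding ols_S_def XTX_inv by (simp only: XT)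
  also have "\<dots> = N * ((W * N) * (R * transpose_mat Zm))" by (rule assoc_mult_mat[of _ p p _ p _ n]) (use carriers in auto)
  also have "(W * N) * (R * transpose_mat Zm) = W * (N * (R * transpose_mat Zm))" by (rule assoc_mult_mat[of _ p p _ p _ n]) (use carriers in auto)
  also have "N * (R * transpose_mat Zm) = transpose_mat Zm" by (rule cancel[of _ _ _ n]) (use carriers I in auto)
  finally show ?thesis .
qed

lemma S_carrier: "ols_S X \<in> carrier_mat p n" unfolding S_eq using carriers by auto

lemma S_entry: assumes "j < p" "r < n" shows "ols_S X $$ (j, r) = ols_coef n p Ri Z j r"
proof -
  have WZ: "W * transpose_mat Zm \<in> carrier_mat p n" using carriers by auto
  have "(W * transpose_mat Zm) $$ (a, r) = mv p (rinv n p 0 Z) (Z r) a" if "a < p" for a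
    using that assms(2) by (simp add: mat_mat_entry[OF Wc ZTc] mv_def rinv_def del: index_mult_mat(1))
  then show ?thesis unfolding S_eq using assms
    by (simp add: mat_mat_entry[OF Nc WZ] ols_coef_def ip_def inv_fun_def del: index_mult_mat(1))
qed

lemma XS: "X * minv (transpose_mat X * X) * transpose_mat X = Zm * (W * transpose_mat Zm)"
proof -
  have "X * minv (transpose_mat X * X) * transpose_mat X = X * ols_S X"
    unfolding ols_S_def by (rule assoc_mult_mat[of _ n p _ p _ n]) (use carriers XTX_inv in auto)
  also have "\<dots> = Zm * R * (N * (W * transpose_mat Zm))" unfolding S_eq by (simp only: X_eq[symmetric])
  also have "\<dots> = Zm * (R * (N * (W * transpose_mat Zm)))" by (rule assoc_mult_mat[of _ n p _ p _ n]) (use carriers in auto)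
  also have "R * (N * (W * transpose_mat Zm)) = W * transpose_mat Zm" by (rule cancel[of _ _ _ n]) (use carriers I in auto)
  finally show ?thesis .
qed

lemma Q_eq: "ols_Q X = 1\<^sub>m n - Zm * (W * transpose_mat Zm)"
  unfolding ols_Q_def XS using Xc by simp

lemma Q_carrier: "ols_Q X \<in> carrier_mat n n" unfolding Q_eq using carriers by auto

lemma Q_entry: assumes "i < n" "k < n" shows "ols_Q X $$ (i, k) = proj n p Z i k"
proof -
  have WZ: "W * transpose_mat Zm \<in> carrier_mat p n" using carriers by auto
  have e: "(W * transpose_mat Zm) $$ (a, k) = mv p (rinv n p 0 Z) (Z k) a" if "a < p" for a
    using that assms(2) by (simp add: mat_mat_entry[OF Wc ZTc] mv_def rinv_def del: index_mult_mat(1))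
  have "(Zm * (W * transpose_mat Zm)) $$ (i, k) = (\<Sum>a<p. Z i a * mv p (rinv n p 0 Z) (Z k) a)"
    using assms by (simp add: mat_mat_entry[OF Zc WZ] e del: index_mult_mat(1))
  then show ?thesis unfolding Q_eq using assms carriers
    by (simp add: proj_def resmat_def mv_def sum_distrib_left mult.assoc del: index_mult_mat(1))
qed

lemma QX: "ols_Q X *\<^sub>v (X *\<^sub>v b) = 0\<^sub>v n" if b: "b \<in> carrier_vec p"
proof -
  have "X * minv (transpose_mat X * X) * transpose_mat X * X = X * minv (transpose_mat X * X) * (transpose_mat X * X)"
    by (rule assoc_mult_mat[of _ n p _ n _ p]) (use carriers XTX_inv in auto)
  also have "\<dots> = X * (minv (transpose_mat X * X) * (transpose_mat X * X))"
    by (rule assoc_mult_mat[of _ n p _ p _ p]) (use carriers XTX_inv in auto)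
  also have "minv (transpose_mat X * X) * (transpose_mat X * X) = 1\<^sub>m p"
    using minv_inverse(3)[of "transpose_mat X * X" p] XTX_inv(2) Xc by auto
  finally have h: "X * minv (transpose_mat X * X) * transpose_mat X * X = X" using Xc by simp
  have H: "X * minv (transpose_mat X * X) * transpose_mat X \<in> carrier_mat n n" using carriers by (auto simp: XS)
  have "ols_Q X *\<^sub>v (X *\<^sub>v b) = 1\<^sub>m n *\<^sub>v (X *\<^sub>v b) - X * minv (transpose_mat X * X) * transpose_mat X *\<^sub>v (X *\<^sub>v b)"
    unfolding ols_Q_def using Xc b H by (subst minus_mult_distrib_mat_vec[of _ n n]) auto
  also have "X * minv (transpose_mat X * X) * transpose_mat X *\<^sub>v (X *\<^sub>v b) = X *\<^sub>v b"
    using assoc_mult_mat_vec[OF H Xc b] h by simp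
  finally show ?thesis using mult_mat_vec_carrier[OF Xc b] by simp
qed

lemma resid_entry:
  assumes b: "b \<in> carrier_vec p" and e: "e \<in> carrier_vec n"
  shows "i < n \<Longrightarrow> ols_resid X (X *\<^sub>v b + e) $ i = res n p Z (rinv n p 0 Z) (($) e) i"
    and "ols_resid X (X *\<^sub>v b + e) \<in> carrier_vec n"
proof -
  have Xb: "X *\<^sub>v b \<in> carrier_vec n" by (rule mult_mat_vec_carrier[OF Xc b])
  let ?Y = "X *\<^sub>v b + e"
  have Y: "?Y \<in> carrier_vec n" using Xb e by simp
  have Sc: "minv (transpose_mat X * X) * transpose_mat X \<in> carrier_mat p n" using S_carrier by (simp add: ols_S_def)
  have H: "X * minv (transpose_mat X * X) * transpose_mat X \<in> carrier_mat n n" using carriers by (auto simp: XS)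
  have "X *\<^sub>v ols_beta X ?Y = X * (minv (transpose_mat X * X) * transpose_mat X) *\<^sub>v ?Y"
    unfolding ols_beta_def by (rule assoc_mult_mat_vec[OF Xc Sc Y, symmetric])
  also have "X * (minv (transpose_mat X * X) * transpose_mat X) = X * minv (transpose_mat X * X) * transpose_mat X"
    by (rule assoc_mult_mat[of _ n p _ p _ n, symmetric]) (use carriers XTX_inv in auto)
  finally have "ols_resid X ?Y = 1\<^sub>m n *\<^sub>v ?Y - X * minv (transpose_mat X * X) * transpose_mat X *\<^sub>v ?Y"
    using one_mult_mat_vec[OF Y] by (simp only: ols_resid_def)
  also have "\<dots> = ols_Q X *\<^sub>v ?Y"
    unfolding ols_Q_def using Xc Y H by (subst minus_mult_distrib_mat_vec[of _ n n]) auto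
  also have "\<dots> = ols_Q X *\<^sub>v (X *\<^sub>v b) + ols_Q X *\<^sub>v e" by (rule mult_add_distrib_mat_vec[OF Q_carrier Xb e])
  also have "\<dots> = ols_Q X *\<^sub>v e" unfolding QX[OF b] using mult_mat_vec_carrier[OF Q_carrier e] by simp
  finally have r: "ols_resid X ?Y = ols_Q X *\<^sub>v e" .
  then show "ols_resid X ?Y \<in> carrier_vec n" using mult_mat_vec_carrier[OF Q_carrier e] by simp
  assume i: "i < n"
  have "(ols_Q X *\<^sub>v e) $ i = (\<Sum>k<n. proj n p Z i k * e $ k)"
    unfolding mat_vec_mv[OF Q_carrier e i] mv_def mfun_def using Q_entry[OF i] by (intro sum.cong) auto
  then show "ols_resid X ?Y $ i = res n p Z (rinv n p 0 Z) (($) e) i"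
    unfolding r using i by (simp add: res_resmat proj_def)
qed

lemma Q_square: "ols_Q X \<odot>\<^sub>m ols_Q X = projsq n p Z"
  using Q_carrier by (intro eq_matI) (auto simp: hadamard_mat_def projsq_def Q_entry power2_eq_square)

lemma defined:
  assumes "det (projsq n p Z) \<noteq> 0"
  shows "hadamard_est_defined X"
proof -
  have "transpose_mat X * X \<in> carrier_mat p p" "projsq n p Z \<in> carrier_mat n n" using Xc by (auto simp: projsq_def)
  then show ?thesis unfolding hadamard_est_defined_def Q_square
    using assms XTX_inv(2) by (simp add: invertible_mat_iff_det)
qed

lemma est_entry:
  assumes b: "b \<in> carrier_vec p" and e: "e \<in> carrier_vec n" and d: "det (projsq n p Z) \<noteq> 0"
  shows "hadamard_est X (X *\<^sub>v b + e) \<in> carrier_vec p"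
    and "j < p \<Longrightarrow> hadamard_est X (X *\<^sub>v b + e) $ j = (\<Sum>i<n. est_coef n p Ri Z j i * (res n p Z (rinv n p 0 Z) (($) e) i)\<^sup>2)"
proof -
  let ?Y = "X *\<^sub>v b + e"
  let ?A = "(ols_S X \<odot>\<^sub>m ols_S X) * minv (projsq n p Z)"
  have Pc: "projsq n p Z \<in> carrier_mat n n" by (simp add: projsq_def)
  note J = minv_inverse[OF Pc d]
  have SS: "ols_S X \<odot>\<^sub>m ols_S X \<in> carrier_mat p n" using S_carrier by (auto simp: hadamard_mat_def)
  have Ac: "?A \<in> carrier_mat p n" using SS J by auto
  have Ae: "?A $$ (j, i) = est_coef n p Ri Z j i" if "j < p" "i < n" for i j
    using that S_carrier unfolding mat_mat_entry[OF SS J(1) that]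
    by (simp add: est_coef_def hadamard_mat_def S_entry power2_eq_square)
  have rc: "ols_resid X ?Y \<in> carrier_vec n" by (rule resid_entry(2)[OF b e])
  let ?r = "ols_resid X ?Y \<odot>\<^sub>v ols_resid X ?Y"
  have rr: "?r \<in> carrier_vec n" unfolding hadamard_vec_def using carrier_vecD[OF rc] by (intro carrier_vecI) (simp only: dim_vec)
  have re: "?r $ i = (res n p Z (rinv n p 0 Z) (($) e) i)\<^sup>2" if "i < n" for i
  proof -
    have "?r $ i = ols_resid X ?Y $ i * ols_resid X ?Y $ i"
      unfolding hadamard_vec_def using that carrier_vecD[OF rc] by (simp only: index_vec)
    then show ?thesis by (simp only: resid_entry(1)[OF b e that] power2_eq_square)
  qed
  have h: "hadamard_est X ?Y = ?A *\<^sub>v ?r" unfolding hadamard_est_def Q_square ..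
  show "hadamard_est X ?Y \<in> carrier_vec p" unfolding h by (rule mult_mat_vec_carrier[OF Ac rr])
  show "hadamard_est X ?Y $ j = (\<Sum>i<n. est_coef n p Ri Z j i * (res n p Z (rinv n p 0 Z) (($) e) i)\<^sup>2)" if j: "j < p"
    unfolding h mat_vec_mv[OF Ac rr j] mv_def mfun_def by (intro sum.cong) (simp_all add: Ae re j)
qed

lemma var_entry:
  assumes S: "\<Sigma> \<in> carrier_mat n n" "diagonal_mat \<Sigma>"
  shows "ols_var X \<Sigma> \<in> carrier_vec p"
    and "j < p \<Longrightarrow> ols_var X \<Sigma> $ j = (\<Sum>k<n. (ols_coef n p Ri Z j k)\<^sup>2 * \<Sigma> $$ (k, k))"
proof -
  have Sc: "ols_S X \<in> carrier_mat p n" and SSc: "ols_S X * \<Sigma> \<in> carrier_mat p n" and STc: "transpose_mat (ols_S X) \<in> carrier_mat n p"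
    using S_carrier S by auto
  show "ols_var X \<Sigma> \<in> carrier_vec p" unfolding ols_var_def diag_vec_def using carrier_matD(1)[OF SSc] by (intro carrier_vecI) simp
  assume j: "j < p"
  have 1: "(ols_S X * \<Sigma>) $$ (j, k) = ols_coef n p Ri Z j k * \<Sigma> $$ (k, k)" if k: "k < n" for k
  proof -
    have "(ols_S X * \<Sigma>) $$ (j, k) = (\<Sum>m<n. if m = k then ols_coef n p Ri Z j k * \<Sigma> $$ (k, k) else 0)"
      unfolding mat_mat_entry[OF Sc S(1) j k]
    proof (rule sum.cong[OF refl])
      fix m assume m: "m \<in> {..<n}"
      show "ols_S X $$ (j, m) * \<Sigma> $$ (m, k) = (if m = k then ols_coef n p Ri Z j k * \<Sigma> $$ (k, k) else 0)"
        using S m k j by (auto simp: diagonal_mat_def S_entry)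
    qed
    then show ?thesis using k by simp
  qed
  have "(ols_S X * \<Sigma> * transpose_mat (ols_S X)) $$ (j, j) = (\<Sum>k<n. (ols_coef n p Ri Z j k)\<^sup>2 * \<Sigma> $$ (k, k))"
    unfolding mat_mat_entry[OF SSc STc j j]
  proof (rule sum.cong[OF refl])
    fix k assume "k \<in> {..<n}"
    then have k: "k < n" by simp
    then show "(ols_S X * \<Sigma>) $$ (j, k) * transpose_mat (ols_S X) $$ (k, j) = (ols_coef n p Ri Z j k)\<^sup>2 * \<Sigma> $$ (k, k)"
      unfolding 1[OF k] using S_carrier j by (simp add: S_entry power2_eq_square)
  qed
  then show "ols_var X \<Sigma> $ j = (\<Sum>k<n. (ols_coef n p Ri Z j k)\<^sup>2 * \<Sigma> $$ (k, k))"
    using j S_carrier by (simp add: ols_var_def diag_vec_def del: index_mult_mat(1))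
qed

text \<open>The link between the estimator as defined with matrices and the sums for which the error bound is proved.\<close>

lemma error_enorm:
  assumes "b \<in> carrier_vec p" "e \<in> carrier_vec n" "det (projsq n p Z) \<noteq> 0" "\<Sigma> \<in> carrier_mat n n" "diagonal_mat \<Sigma>"
  shows "(enorm (hadamard_est X (X *\<^sub>v b + e) - ols_var X \<Sigma>))\<^sup>2
    = (\<Sum>j<p. ((\<Sum>i<n. est_coef n p Ri Z j i * (res n p Z (rinv n p 0 Z) (($) e) i)\<^sup>2)
        - (\<Sum>k<n. (ols_coef n p Ri Z j k)\<^sup>2 * \<Sigma> $$ (k, k)))\<^sup>2)"
proof -
  note 1 = est_entry[OF assms(1-3)] and 2 = var_entry[OF assms(4-5)]
  have c: "hadamard_est X (X *\<^sub>v b + e) - ols_var X \<Sigma> \<in> carrier_vec p" using 1(1) 2(1) by simp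
  show ?thesis unfolding enorm_square[OF c]
  proof (rule sum.cong[OF refl])
    fix j assume "j \<in> {..<p}"
    then have j: "j < p" by simp
    then have "j < dim_vec (ols_var X \<Sigma>)" using 2(1) by simp
    then show "((hadamard_est X (X *\<^sub>v b + e) - ols_var X \<Sigma>) $ j)\<^sup>2 = ((\<Sum>i<n. est_coef n p Ri Z j i * (res n p Z (rinv n p 0 Z) (($) e) i)\<^sup>2)
        - (\<Sum>k<n. (ols_coef n p Ri Z j k)\<^sup>2 * \<Sigma> $$ (k, k)))\<^sup>2"
      by (simp add: 1(2)[OF j] 2(2)[OF j])
  qed
qed

end

section \<open>Exchangeability of the observations\<close>

context
  fixes n p :: nat and \<pi> :: "nat \<Rightarrow> nat"
  assumes perm: "\<pi> permutes {..<n}"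
begin

lemma perm_lt: "\<pi> i < n \<longleftrightarrow> i < n"
  using permutes_in_image[OF perm] by auto

lemma perm_eq: "\<pi> i = \<pi> k \<longleftrightarrow> i = k"
  using permutes_inj[OF perm] by (auto simp: inj_def)

lemma sum_perm: "(\<Sum>i<n. f (\<pi> i)) = (\<Sum>i<n. (f i :: real))"
  using sum.permute[OF perm, of f] by (simp add: o_def)

lemma gram_perm: "gram n p l (\<lambda>i. Z (\<pi> i)) = gram n p l Z"
  unfolding gram_def ip_def using sum_perm[of "\<lambda>i. Z i _ * Z i _"] by (intro cong_mat) auto

lemma rinv_perm: "rinv n p l (\<lambda>i. Z (\<pi> i)) = rinv n p l Z"
  by (intro ext) (simp add: rinv_def gram_perm)

lemma ols_coef_perm: "ols_coef n p Ri (\<lambda>i. Z (\<pi> i)) j r = ols_coef n p Ri Z j (\<pi> r)"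
  by (simp add: ols_coef_def rinv_perm)

lemma proj_perm: "proj n p (\<lambda>i. Z (\<pi> i)) i k = proj n p Z (\<pi> i) (\<pi> k)"
  by (simp add: proj_def resmat_def rinv_perm perm_eq)

text \<open>Permuting the observations conjugates \<open>Q\<odot>Q\<close> by a permutation matrix, hence also its inverse.\<close>

lemma projsq_inverse_perm:
  assumes d: "det (projsq n p Z) \<noteq> 0" and mi: "m < n" "i < n"
  shows "minv (projsq n p (\<lambda>i. Z (\<pi> i))) $$ (m, i) = minv (projsq n p Z) $$ (\<pi> m, \<pi> i)"
proof -
  let ?P = "projsq n p Z" and ?Q = "projsq n p (\<lambda>i. Z (\<pi> i))"
  let ?B = "Matrix.mat n n (\<lambda>(m, i). minv ?P $$ (\<pi> m, \<pi> i))"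
  have Pc: "?P \<in> carrier_mat n n" and Qc: "?Q \<in> carrier_mat n n" and Bc: "?B \<in> carrier_mat n n" by (auto simp: projsq_def)
  note J = minv_inverse[OF Pc d]
  have Qe: "?Q $$ (i, a) = ?P $$ (\<pi> i, \<pi> a)" if "i < n" "a < n" for i a
    using that by (simp add: projsq_def proj_perm perm_lt)
  have "?Q * ?B = 1\<^sub>m n"
  proof (rule eq_matI)
    fix i k assume "i < dim_row (1\<^sub>m n :: real mat)" "k < dim_col (1\<^sub>m n :: real mat)"
    then have ik: "i < n" "k < n" by auto
    have "(?Q * ?B) $$ (i, k) = (\<Sum>a<n. ?P $$ (\<pi> i, \<pi> a) * minv ?P $$ (\<pi> a, \<pi> k))"
      unfolding mat_mat_entry[OF Qc Bc ik] using ik by (intro sum.cong) (auto simp: Qe)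
    also have "\<dots> = (\<Sum>a<n. ?P $$ (\<pi> i, a) * minv ?P $$ (a, \<pi> k))" by (rule sum_perm)
    also have "\<dots> = (?P * minv ?P) $$ (\<pi> i, \<pi> k)"
      using ik by (subst mat_mat_entry[OF Pc J(1)]) (auto simp: perm_lt)
    also have "\<dots> = 1\<^sub>m n $$ (i, k)" using ik by (simp add: J(2) perm_lt perm_eq)
    finally show "(?Q * ?B) $$ (i, k) = 1\<^sub>m n $$ (i, k)" .
  qed (auto simp: projsq_def)
  from minv_unique(1)[OF Qc Bc this] show ?thesis using mi by simp
qed

lemma est_coef_perm:
  assumes "det (projsq n p Z) \<noteq> 0" "i < n"
  shows "est_coef n p Ri (\<lambda>i. Z (\<pi> i)) j i = est_coef n p Ri Z j (\<pi> i)"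
proof -
  have "est_coef n p Ri (\<lambda>i. Z (\<pi> i)) j i = (\<Sum>m<n. (ols_coef n p Ri Z j (\<pi> m))\<^sup>2 * minv (projsq n p Z) $$ (\<pi> m, \<pi> i))"
    unfolding est_coef_def using projsq_inverse_perm[OF assms(1) _ assms(2)] by (simp add: ols_coef_perm)
  also have "\<dots> = est_coef n p Ri Z j (\<pi> i)" unfolding est_coef_def by (rule sum_perm)
  finally show ?thesis .
qed

lemma noise_weight_perm:
  assumes "det (projsq n p Z) \<noteq> 0"
  shows "noise_weight n p Ri (\<lambda>i. Z (\<pi> i)) k = noise_weight n p Ri Z (\<pi> k)"
  unfolding noise_weight_def
proof (rule sum.cong[OF refl])
  fix j
  have "(\<Sum>i<n. (est_coef n p Ri (\<lambda>i. Z (\<pi> i)) j i)\<^sup>2 * (proj n p (\<lambda>i. Z (\<pi> i)) i k)\<^sup>2)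
    = (\<Sum>i<n. (est_coef n p Ri Z j (\<pi> i))\<^sup>2 * (proj n p Z (\<pi> i) (\<pi> k))\<^sup>2)"
    by (simp add: est_coef_perm[OF assms] proj_perm)
  also have "\<dots> = (\<Sum>i<n. (est_coef n p Ri Z j i)\<^sup>2 * (proj n p Z i (\<pi> k))\<^sup>2)" by (rule sum_perm)
  finally show "(\<Sum>i<n. (est_coef n p Ri (\<lambda>i. Z (\<pi> i)) j i)\<^sup>2 * (proj n p (\<lambda>i. Z (\<pi> i)) i k)\<^sup>2) = \<dots>" .
qed

lemma well_conditioned_perm: "well_conditioned n p t h (\<lambda>i. Z (\<pi> i)) \<longleftrightarrow> well_conditioned n p t h Z"
proof -
  have "(\<forall>r<n. Q (\<pi> r)) \<longleftrightarrow> (\<forall>r<n. Q r)" for Q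
  proof -
    have "(\<forall>r\<in>{..<n}. Q (\<pi> r)) \<longleftrightarrow> (\<forall>r\<in>\<pi> ` {..<n}. Q r)" by simp
    then show ?thesis by (simp add: permutes_image[OF perm] Ball_def)
  qed
  from this[of "\<lambda>r. ip p (Z r) (mv p (rinv n p 0 Z) (Z r)) \<le> h"] show ?thesis by (simp add: well_conditioned_def gram_perm rinv_perm)
qed

end

lemma meas_proj: "(\<And>i k. (\<lambda>\<omega>. Y \<omega> i k) \<in> borel_measurable N) \<Longrightarrow> (\<lambda>\<omega>. proj n p (Y \<omega>) i k) \<in> borel_measurable N"
  unfolding proj_def resmat_def by (intro borel_measurable_diff borel_measurable_const borel_measurable_sum borel_measurable_times meas_rinv) auto

lemma meas_est_coef:
  assumes Y: "\<And>i k. (\<lambda>\<omega>. Y \<omega> i k) \<in> borel_measurable N" and i: "i < n"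
  shows "(\<lambda>\<omega>. est_coef n p Ri (Y \<omega>) j i) \<in> borel_measurable N"
proof -
  have "(\<lambda>\<omega>. minv (projsq n p (Y \<omega>)) $$ (m, i)) \<in> borel_measurable N" if "m < n" for m
  proof (rule borel_measurable_minv[OF _ _ that i])
    show "projsq n p (Y \<omega>) \<in> carrier_mat n n" for \<omega> by (simp add: projsq_def)
    show "(\<lambda>\<omega>. projsq n p (Y \<omega>) $$ (i, j)) \<in> borel_measurable N" if "i < n" "j < n" for i j
      using that by (simp add: projsq_def) (intro borel_measurable_power meas_proj Y)
  qed
  then show ?thesis unfolding est_coef_def ols_coef_def
    by (intro borel_measurable_sum borel_measurable_times borel_measurable_power meas_ip meas_mv meas_rinv Y) auto
qed

lemma meas_noise_weight:
  "(\<And>i k. (\<lambda>\<omega>. Y \<omega> i k) \<in> borel_measurable N) \<Longrightarrow> (\<lambda>\<omega>. noise_weight n p Ri (Y \<omega>) k) \<in> borel_measurable N"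
  unfolding noise_weight_def
  by (intro borel_measurable_sum borel_measurable_times borel_measurable_power meas_est_coef meas_proj) auto

lemma well_conditioned_design: "well_conditioned n p t h Z \<Longrightarrow> h \<le> 1/2 - \<kappa> \<Longrightarrow> \<kappa> > 0 \<Longrightarrow> design n p Z \<kappa>"
  unfolding well_conditioned_def design_def by force

text \<open>Equal marginals across the rows suffice for exchangeability, as the entries are independent.\<close>

locale exchangeable_array = unit_array +
  assumes same: "i < n \<Longrightarrow> i' < n \<Longrightarrow> k < p \<Longrightarrow> distr M borel (\<lambda>\<omega>. Z \<omega> i k) = distr M borel (\<lambda>\<omega>. Z \<omega> i' k)"
begin

lemma row_perm_law:
  assumes perm: "\<pi> permutes {..<n}" and np: "n > 0" "p > 0"
    and F: "\<And>(N :: (nat \<times> nat \<Rightarrow> real) measure) Y. (\<And>i k. (\<lambda>\<omega>. Y \<omega> i k) \<in> borel_measurable N) \<Longrightarrow> (\<lambda>\<omega>. F (Y \<omega>)) \<in> borel_measurable N"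
  shows "(\<integral>\<^sup>+\<omega>. F (\<lambda>i. Z \<omega> (\<pi> i)) \<partial>M) = (\<integral>\<^sup>+\<omega>. (F (Z \<omega>) :: ennreal) \<partial>M)"
proof -
  let ?I = "{..<n} \<times> {..<p}"
  let ?B = "PiM ?I (\<lambda>_. borel :: real measure)"
  define D where "D = (\<lambda>(i, k). distr M borel (\<lambda>\<omega>. Z \<omega> i k))"
  define f where "f = (\<lambda>(i, k). (\<pi> i, k :: nat))"
  define arr where "arr u i k = (if (i, k) \<in> ?I then u (i, k) else (0::real))" for u :: "nat \<times> nat \<Rightarrow> real" and i k
  let ?W = "\<lambda>\<omega>. \<lambda>ik\<in>?I. (case ik of (i, k) \<Rightarrow> \<lambda>\<omega>. Z \<omega> i k) \<omega>"
  let ?g = "\<lambda>w. \<lambda>ik\<in>?I. w (f ik)"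
  have lt: "\<pi> i < n \<longleftrightarrow> i < n" for i using permutes_in_image[OF perm] by auto
  have finj: "inj_on f ?I" using permutes_inj[OF perm] by (auto simp: f_def inj_on_def inj_def)
  have fI: "f \<in> ?I \<rightarrow> ?I" by (auto simp: f_def lt)
  have D: "prob_space (D ik)" "sets (D ik) = sets borel" for ik
    by (auto simp: D_def split: prod.splits intro!: prob_space_distr)
  have I0: "?I \<noteq> {}" using np by (metis SigmaI empty_iff lessThan_iff)
  have Wm: "?W \<in> measurable M ?B" by (intro measurable_restrict) (auto split: prod.splits)
  have WD: "distr M ?B ?W = PiM ?I D"
  proof -
    have "distr M ?B ?W = PiM ?I (\<lambda>ik. distr M borel (case ik of (i, k) \<Rightarrow> \<lambda>\<omega>. Z \<omega> i k))"
      using ind by (subst (asm) indep_vars_iff_distr_eq_PiM'[OF I0]) (auto split: prod.splits)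
    also have "\<dots> = PiM ?I D" by (intro PiM_cong refl) (auto simp: D_def)
    finally show ?thesis .
  qed
  have sB: "sets (PiM ?I D) = sets ?B" by (intro sets_PiM_cong refl D)
  have gm: "?g \<in> measurable (PiM ?I D) ?B"
    unfolding measurable_cong_sets[OF sB refl] using fI by (intro measurable_restrict measurable_component_singleton) auto
  have gD: "distr (PiM ?I D) ?B ?g = PiM ?I D"
  proof -
    have "distr (PiM ?I D) (PiM ?I (\<lambda>ik. D (f ik))) ?g = PiM ?I (\<lambda>ik. D (f ik))"
      by (rule distr_PiM_reindex[OF D(1) finj fI])
    moreover have "PiM ?I (\<lambda>ik. D (f ik)) = PiM ?I D"
    proof (intro PiM_cong refl)
      fix ik assume "ik \<in> ?I"
      then obtain i k where ik: "ik = (i, k)" "i < n" "k < p" by auto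
      then show "D (f ik) = D ik" using same[of "\<pi> i" i k] by (simp add: D_def f_def lt)
    qed
    moreover have "distr (PiM ?I D) ?B ?g = distr (PiM ?I D) (PiM ?I D) ?g" by (intro distr_cong refl sB[symmetric])
    ultimately show ?thesis by simp
  qed
  have arrm: "(\<lambda>u. arr u i k) \<in> borel_measurable ?B" for i k
    by (cases "(i, k) \<in> ?I") (auto simp: arr_def)
  have Fm: "(\<lambda>u. F (arr u)) \<in> borel_measurable ?B" by (rule F) (rule arrm)
  have FD: "(\<lambda>u. F (arr u)) \<in> borel_measurable (PiM ?I D)" using Fm unfolding measurable_cong_sets[OF sB refl] .
  have arrW: "arr (?W \<omega>) = Z \<omega>" for \<omega>
    by (intro ext) (auto simp: arr_def out)
  have arrg: "arr (?g (?W \<omega>)) = (\<lambda>i. Z \<omega> (\<pi> i))" for \<omega>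
    using lt out by (intro ext) (auto simp: arr_def f_def not_less[symmetric])
  have "(\<integral>\<^sup>+\<omega>. F (Z \<omega>) \<partial>M) = (\<integral>\<^sup>+u. F (arr u) \<partial>distr M ?B ?W)"
    by (subst nn_integral_distr[OF Wm]) (simp_all only: Fm arrW measurable_distr_eq1)
  also have "\<dots> = (\<integral>\<^sup>+u. F (arr u) \<partial>distr (distr M ?B ?W) ?B ?g)" by (simp only: WD gD)
  also have "\<dots> = (\<integral>\<^sup>+w. F (arr (?g w)) \<partial>distr M ?B ?W)"
    using gm Fm by (subst nn_integral_distr) (simp_all only: WD measurable_distr_eq1)
  also have "\<dots> = (\<integral>\<^sup>+\<omega>. F (arr (?g (?W \<omega>))) \<partial>M)"
  proof (rule nn_integral_distr[OF Wm])
    show "(\<lambda>w. F (arr (?g w))) \<in> borel_measurable (distr M ?B ?W)"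
      using measurable_compose[OF gm Fm] by (simp only: WD)
  qed
  finally show ?thesis by (simp only: arrg)
qed

text \<open>By exchangeability the expected weight of one observation is the \<open>n\<close>-th part of the expected sum. Without
  this averaging the variances of the noise, which may differ arbitrarily, could not be factored out.\<close>

lemma noise_weight_expect:
  fixes R :: "nat \<Rightarrow> nat \<Rightarrow> real"
  assumes R: "\<And>v. (\<Sum>j<p. (ip p (R j) v)\<^sup>2) \<le> \<tau> * ip p v v" and Rn: "\<And>j. j < p \<Longrightarrow> ip p (R j) (R j) \<le> \<tau>" and tau: "\<tau> \<ge> 0"
    and l: "l > 0" and t: "t > 0" and lpt: "l * (real p * (2 * t)) \<le> 1/2"
    and h: "h \<le> 1/2 - \<kappa>" and \<kappa>: "\<kappa> > 0" and p: "p > 0" and k: "k < n"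
  shows "(\<integral>\<^sup>+\<omega>. (if well_conditioned n p t h (Z \<omega>) then ennreal (noise_weight n p R (Z \<omega>) k) else 0) \<partial>M)
     \<le> ennreal (c4 * (16 * (\<tau>\<^sup>2 * trace4_const (2 * t))) / \<kappa>\<^sup>2)"
proof -
  let ?F = "\<lambda>k Z. if well_conditioned n p t h Z then ennreal (noise_weight n p R Z k) else 0"
  have n: "n > 0" using k by simp
  have Fm: "(\<lambda>\<omega>. ?F k (Y \<omega>)) \<in> borel_measurable N" if Y: "\<And>i k. (\<lambda>\<omega>. Y \<omega> i k) \<in> borel_measurable N" for k and N :: "'x measure" and Y
    by (intro measurable_If measurable_compose[OF _ measurable_ennreal] meas_noise_weight meas_well_conditioned Y) auto
  have eq: "(\<integral>\<^sup>+\<omega>. ?F k (Z \<omega>) \<partial>M) = (\<integral>\<^sup>+\<omega>. ?F k' (Z \<omega>) \<partial>M)" if k': "k' < n" for k'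
  proof -
    \<comment> \<open>Exchanging two observations maps one weight to the other.\<close>
    let ?\<pi> = "Transposition.transpose k k'"
    have perm: "?\<pi> permutes {..<n}" using k k' by (intro permutes_swap_id) auto
    have e: "?F k' (\<lambda>i. Z' (?\<pi> i)) = ?F k Z'" for Z'
    proof (cases "well_conditioned n p t h Z'")
      case True
      then have "det (projsq n p Z') \<noteq> 0" using design.projsq_det[OF well_conditioned_design[OF _ h \<kappa>]] by blast
      then show ?thesis using noise_weight_perm[OF perm, of p Z' R k'] by (simp add: well_conditioned_perm[OF perm])
    qed (simp add: well_conditioned_perm[OF perm])
    have "(\<integral>\<^sup>+\<omega>. ?F k' (\<lambda>i. Z \<omega> (?\<pi> i)) \<partial>M) = (\<integral>\<^sup>+\<omega>. ?F k' (Z \<omega>) \<partial>M)"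
      by (rule row_perm_law[OF perm n p]) (rule Fm)
    then show ?thesis unfolding e .
  qed
  have "ennreal (real n) * (\<integral>\<^sup>+\<omega>. ?F k (Z \<omega>) \<partial>M) = (\<Sum>k'<n. \<integral>\<^sup>+\<omega>. ?F k' (Z \<omega>) \<partial>M)"
  proof -
    have "(\<Sum>k'<n. \<integral>\<^sup>+\<omega>. ?F k' (Z \<omega>) \<partial>M) = (\<Sum>k'<n. \<integral>\<^sup>+\<omega>. ?F k (Z \<omega>) \<partial>M)"
      by (rule sum.cong[OF refl], rule eq[symmetric]) simp
    then show ?thesis by (simp add: ennreal_of_nat_eq_real_of_nat)
  qed
  also have "\<dots> = (\<integral>\<^sup>+\<omega>. (\<Sum>k'<n. ?F k' (Z \<omega>)) \<partial>M)"
    by (subst nn_integral_sum) (auto intro!: Fm)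
  also have "\<dots> \<le> (\<integral>\<^sup>+\<omega>. ennreal (1 / \<kappa>\<^sup>2) * (if well_conditioned n p t h (Z \<omega>) then ennreal (\<Sum>r<n. \<Sum>j<p. (ip p (R j) (mv p (rinv n p 0 (Z \<omega>)) (Z \<omega> r))) ^ 4) else 0) \<partial>M)"
  proof (rule nn_integral_mono)
    fix \<omega>
    show "(\<Sum>k'<n. ?F k' (Z \<omega>)) \<le> ennreal (1 / \<kappa>\<^sup>2) * (if well_conditioned n p t h (Z \<omega>) then ennreal (\<Sum>r<n. \<Sum>j<p. (ip p (R j) (mv p (rinv n p 0 (Z \<omega>)) (Z \<omega> r))) ^ 4) else 0)"
    proof (cases "well_conditioned n p t h (Z \<omega>)")
      case True
      interpret design n p "Z \<omega>" R \<kappa> by (rule well_conditioned_design[OF True h \<kappa>])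
      have "(\<Sum>k'<n. ?F k' (Z \<omega>)) = ennreal (\<Sum>k'<n. noise_weight n p R (Z \<omega>) k')"
        using True by (simp add: sum_ennreal noise_weight_nonneg)
      also have "\<dots> \<le> ennreal ((\<Sum>r<n. \<Sum>j<p. (ols_coef n p R (Z \<omega>) j r) ^ 4) / \<kappa>\<^sup>2)"
        by (intro ennreal_leI sum_noise_weight)
      also have "\<dots> = ennreal (1 / \<kappa>\<^sup>2) * ennreal (\<Sum>r<n. \<Sum>j<p. (ip p (R j) (mv p (rinv n p 0 (Z \<omega>)) (Z \<omega> r))) ^ 4)"
        by (simp add: ols_coef_def ennreal_mult[symmetric] sum_nonneg)
      finally show ?thesis using True by simp
    qed simp
  qed
  also have "\<dots> = ennreal (1 / \<kappa>\<^sup>2) * (\<integral>\<^sup>+\<omega>. (if well_conditioned n p t h (Z \<omega>) then ennreal (\<Sum>r<n. \<Sum>j<p. (ip p (R j) (mv p (rinv n p 0 (Z \<omega>)) (Z \<omega> r))) ^ 4) else 0) \<partial>M)"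
  proof (rule nn_integral_cmult)
    show "(\<lambda>\<omega>. if well_conditioned n p t h (Z \<omega>) then ennreal (\<Sum>r<n. \<Sum>j<p. (ip p (R j) (mv p (rinv n p 0 (Z \<omega>)) (Z \<omega> r))) ^ 4) else 0) \<in> borel_measurable M"
    proof (rule measurable_If)
      show "{\<omega> \<in> space M. well_conditioned n p t h (Z \<omega>)} \<in> sets M" by (rule meas_well_conditioned) simp
      show "(\<lambda>\<omega>. ennreal (\<Sum>r<n. \<Sum>j<p. (ip p (R j) (mv p (rinv n p 0 (Z \<omega>)) (Z \<omega> r))) ^ 4)) \<in> borel_measurable M"
        by (intro measurable_compose[OF _ measurable_ennreal] borel_measurable_sum borel_measurable_power meas_ip meas_mv meas_rinv) auto
    qed simp
  qed
  also have "\<dots> \<le> ennreal (1 / \<kappa>\<^sup>2) * ennreal (real n * (c4 * (16 * (\<tau>\<^sup>2 * trace4_const (2 * t)))))"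
    using h \<kappa> by (intro mult_left_mono coef_fourth[OF R Rn tau l t lpt]) auto
  also have "\<dots> = ennreal (real n) * ennreal (c4 * (16 * (\<tau>\<^sup>2 * trace4_const (2 * t))) / \<kappa>\<^sup>2)"
    by (simp add: ennreal_mult'[symmetric] ennreal_mult''[symmetric])
  finally show ?thesis using n by (subst (asm) ennreal_mult_le_mult_iff) auto
qed

end

section \<open>Independence of all entries, and of noise and design\<close>

text \<open>Independence of the rows and independence within each row give joint independence of all entries, provided
  that the entries are functions of the rows.\<close>

lemma (in prob_space) indep_vars_nested:
  fixes n p :: nat
  assumes rows: "indep_vars (\<lambda>_. S) U {..<n}" and n: "n > 0" and p: "p > 0"
    and f: "\<And>k. k < p \<Longrightarrow> f k \<in> borel_measurable S"
    and Z: "\<And>i k \<omega>. i < n \<Longrightarrow> k < p \<Longrightarrow> \<omega> \<in> space M \<Longrightarrow> Z i k \<omega> = (f k (U i \<omega>) :: real)"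
    and cols: "\<And>i. i < n \<Longrightarrow> indep_vars (\<lambda>_. borel) (Z i) {..<p}"
  shows "indep_vars (\<lambda>_. borel) (\<lambda>(i, k). Z i k) ({..<n} \<times> {..<p})"
proof -
  let ?I = "{..<n} \<times> {..<p}"
  have I: "?I \<noteq> {}" "finite ?I" using n p by auto
  have rv: "random_variable borel (Z i k)" if "i < n" "k < p" for i k
    using cols[OF that(1)] that(2) unfolding indep_vars_def by auto
  have U: "random_variable S (U i)" if "i < n" for i
    using rows that unfolding indep_vars_def by auto
  have "prob (\<Inter>ik\<in>?I. (case ik of (i, k) \<Rightarrow> Z i k) -` A ik \<inter> space M) = (\<Prod>ik\<in>?I. prob ((case ik of (i, k) \<Rightarrow> Z i k) -` A ik \<inter> space M))"
    if A: "A \<in> ?I \<rightarrow> sets borel" for A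
  proof -
    let ?E = "\<lambda>i k. Z i k -` A (i, k) \<inter> space M"
    define B where "B i = {u \<in> space S. \<forall>k<p. f k u \<in> A (i, k)}" for i
    have B: "B i \<in> sets S" if i: "i < n" for i
    proof -
      have m: "f k -` A (i, k) \<inter> space S \<in> sets S" if "k < p" for k
        using f[OF that] A i that by (intro measurable_sets) auto
      have eq: "B i = (\<Inter>k\<in>{..<p}. f k -` A (i, k) \<inter> space S)" using p by (auto simp: B_def)
      show ?thesis unfolding eq using p by (intro sets.finite_INT m) auto
    qed
    have e: "U i -` B i \<inter> space M = (\<Inter>k\<in>{..<p}. ?E i k)" if i: "i < n" for i
      using p i Z[OF i] measurable_space[OF U[OF i]] by (auto simp: B_def)
    have "(\<Inter>ik\<in>?I. (case ik of (i, k) \<Rightarrow> Z i k) -` A ik \<inter> space M) = (\<Inter>i\<in>{..<n}. U i -` B i \<inter> space M)"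
      using e p n by auto
    also have "prob \<dots> = (\<Prod>i<n. prob (U i -` B i \<inter> space M))"
      using n B by (intro indep_varsD[OF rows]) auto
    also have "\<dots> = (\<Prod>i<n. \<Prod>k<p. prob (?E i k))"
    proof (rule prod.cong[OF refl])
      fix i assume "i \<in> {..<n}"
      then have i: "i < n" by simp
      show "prob (U i -` B i \<inter> space M) = (\<Prod>k<p. prob (?E i k))"
        unfolding e[OF i] using p A i by (intro indep_varsD[OF cols[OF i]]) auto
    qed
    also have "\<dots> = (\<Prod>ik\<in>?I. prob ((case ik of (i, k) \<Rightarrow> Z i k) -` A ik \<inter> space M))"
      by (subst prod.cartesian_product) (auto intro!: prod.cong)
    finally show ?thesis .
  qed
  then show ?thesis
  proof (subst indep_vars_finite[OF I, where E = "\<lambda>_. sets borel"])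
    show "Int_stable (sets (borel :: real measure))" for i :: "nat \<times> nat" by (rule sets.Int_stable)
  qed (use rv in \<open>auto simp: sets.sigma_sets_eq[of borel, simplified] intro: sets.top\<close>)
qed

lemma (in prob_space) indep_rvs_product:
  assumes "indep_rvs M S X T Y"
  shows "distr M T Y \<Otimes>\<^sub>M distr M S X = distr M (T \<Otimes>\<^sub>M S) (\<lambda>\<omega>. (Y \<omega>, X \<omega>))"
proof -
  have X[measurable]: "X \<in> measurable M S" and Y[measurable]: "Y \<in> measurable M T"
    and ind: "indep_set (sigma_sets (space M) {X -` A \<inter> space M |A. A \<in> sets S})
       (sigma_sets (space M) {Y -` A \<inter> space M |A. A \<in> sets T})"
    using assms by (auto simp: indep_rvs_def)
  interpret X: prob_space "distr M S X" by (rule prob_space_distr) (rule X)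
  interpret Y: prob_space "distr M T Y" by (rule prob_space_distr) (rule Y)
  show ?thesis
  proof (rule pair_measure_eqI)
    show "sigma_finite_measure (distr M T Y)" ..
    show "sigma_finite_measure (distr M S X)" ..
    show "sets (distr M T Y \<Otimes>\<^sub>M distr M S X) = sets (distr M (T \<Otimes>\<^sub>M S) (\<lambda>\<omega>. (Y \<omega>, X \<omega>)))"
      by (simp cong: sets_pair_measure_cong)
    fix A B assume "A \<in> sets (distr M T Y)" "B \<in> sets (distr M S X)"
    then have A[measurable]: "A \<in> sets T" and B[measurable]: "B \<in> sets S" by auto
    have "prob ((X -` B \<inter> space M) \<inter> (Y -` A \<inter> space M)) = prob (X -` B \<inter> space M) * prob (Y -` A \<inter> space M)"
      using A B by (intro indep_setD[OF ind] sigma_sets.Basic) auto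
    moreover have "(\<lambda>\<omega>. (Y \<omega>, X \<omega>)) -` (A \<times> B) \<inter> space M = (X -` B \<inter> space M) \<inter> (Y -` A \<inter> space M)" by auto
    ultimately show "emeasure (distr M T Y) A * emeasure (distr M S X) B = emeasure (distr M (T \<Otimes>\<^sub>M S) (\<lambda>\<omega>. (Y \<omega>, X \<omega>))) (A \<times> B)"
      by (simp add: emeasure_distr emeasure_eq_measure ennreal_mult[symmetric] mult.commute)
  qed
qed

section \<open>The error probability in fixed dimension\<close>

text \<open>The assumptions of the theorem for one member of the sequence, with \<open>2 * q\<close> for the moment exponent.\<close>

locale hadamard_model = prob_space M for M :: "'a measure" +
  fixes n p :: nat and q K C :: real and G R :: "real mat"
    and z :: "nat \<Rightarrow> 'a \<Rightarrow> real Matrix.vec" and X :: "'a \<Rightarrow> real mat" and \<beta> :: "real Matrix.vec"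
    and \<epsilon> Y :: "'a \<Rightarrow> real Matrix.vec" and \<Sigma> :: "real mat"
  assumes n: "n > 0" and p: "p > 0" and q: "q \<ge> 3"
    and G: "psd_mat p G" "invertible_mat G" and R: "is_sqrt_mat p R G"
    and z_iid: "\<And>i. i < n \<Longrightarrow> iid_vars M borel (\<lambda>j \<omega>. z i \<omega> $ j) {..<p}"
    and z_dim: "\<And>i \<omega>. i < n \<Longrightarrow> \<omega> \<in> space M \<Longrightarrow> z i \<omega> \<in> carrier_vec p"
    and z_mean: "\<And>i j. i < n \<Longrightarrow> j < p \<Longrightarrow> (\<integral>\<omega>. z i \<omega> $ j \<partial>M) = 0"
    and z_var: "\<And>i j. i < n \<Longrightarrow> j < p \<Longrightarrow> variance (\<lambda>\<omega>. z i \<omega> $ j) = 1"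
    and z_int: "\<And>i j. i < n \<Longrightarrow> j < p \<Longrightarrow> integrable M (\<lambda>\<omega>. \<bar>z i \<omega> $ j\<bar> powr (2 * q))"
    and z_moment: "\<And>i j. i < n \<Longrightarrow> j < p \<Longrightarrow> (\<integral>\<omega>. \<bar>z i \<omega> $ j\<bar> powr (2 * q) \<partial>M) \<le> K"
    and X_dim: "\<And>\<omega>. \<omega> \<in> space M \<Longrightarrow> X \<omega> \<in> carrier_mat n p"
    and X_rows: "\<And>i \<omega>. i < n \<Longrightarrow> \<omega> \<in> space M \<Longrightarrow> Matrix.row (X \<omega>) i = R *\<^sub>v z i \<omega>"
    and X_iid: "iid_vars M (vec_space_borel p) (\<lambda>i \<omega>. vec_coords p (Matrix.row (X \<omega>) i)) {..<n}"
    and eps_dim: "\<And>\<omega>. \<omega> \<in> space M \<Longrightarrow> \<epsilon> \<omega> \<in> carrier_vec n"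
    and eps_indep_X: "indep_rvs M (vec_space_borel n) (\<lambda>\<omega>. vec_coords n (\<epsilon> \<omega>))
      (mat_space_borel n p) (\<lambda>\<omega>. mat_coords n p (X \<omega>))"
    and eps_indep: "indep_vars (\<lambda>_. borel) (\<lambda>i \<omega>. \<epsilon> \<omega> $ i) {..<n}"
    and eps_mean: "\<And>i. i < n \<Longrightarrow> (\<integral>\<omega>. \<epsilon> \<omega> $ i \<partial>M) = 0"
    and Sigma_def: "\<Sigma> = cov_mat M n \<epsilon>"
    and Sigma_diag: "diagonal_mat \<Sigma>"
    and C: "C \<ge> 0"
    and eps_int: "\<And>i. i < n \<Longrightarrow> integrable M (\<lambda>\<omega>. (\<epsilon> \<omega> $ i) ^ 4)"
    and eps_fourth: "\<And>i. i < n \<Longrightarrow> (\<integral>\<omega>. (\<epsilon> \<omega> $ i) ^ 4 \<partial>M) < C * (variance (\<lambda>\<omega>. \<epsilon> \<omega> $ i))\<^sup>2"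
    and beta_dim: "\<beta> \<in> carrier_vec p"
    and Y_model: "\<And>\<omega>. \<omega> \<in> space M \<Longrightarrow> Y \<omega> = X \<omega> *\<^sub>v \<beta> + \<epsilon> \<omega>"
begin

definition Z :: "'a \<Rightarrow> nat \<Rightarrow> nat \<Rightarrow> real" where
  "Z \<omega> i k = (if i < n \<and> k < p then z i \<omega> $ k else 0)"

abbreviation "Ri \<equiv> inv_fun p R"
abbreviation "\<sigma> \<equiv> sigma_min G"

lemmas Ri = inv_sqrt_facts[OF R G p]

text \<open>Recovers a row of the whitened design from a row of \<open>X\<close>. It shows that the entries \<open>z i \<omega> $ k\<close> are
  measurable functions of the rows of \<open>X\<close>, which is how independence of the rows, and of the noise, is
  transferred to them.\<close>

definition white :: "(nat \<Rightarrow> real) \<Rightarrow> nat \<Rightarrow> real" where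
  "white u k = (\<Sum>j<p. Ri k j * u j)"

lemma X_entry: assumes "i < n" "k < p" "\<omega> \<in> space M"
  shows "X \<omega> $$ (i, k) = mv p (mfun R) (($) (z i \<omega>)) k"
proof -
  have Rc: "R \<in> carrier_mat p p" using R by (auto simp: is_sqrt_mat_def psd_mat_def)
  have "X \<omega> $$ (i, k) = Matrix.row (X \<omega>) i $ k" using X_dim[OF assms(3)] assms by simp
  then show ?thesis using mat_vec_mv[OF Rc z_dim[OF assms(1,3)] assms(2)] X_rows[OF assms(1,3)] by simp
qed

lemma white_X: assumes "i < n" "k < p" "\<omega> \<in> space M" shows "white (\<lambda>j. X \<omega> $$ (i, j)) k = z i \<omega> $ k"
proof -
  have "white (\<lambda>j. X \<omega> $$ (i, j)) k = mv p Ri (mv p (mfun R) (($) (z i \<omega>))) k"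
    unfolding white_def mv_def[of p Ri] using assms X_entry by (intro sum.cong) auto
  then show ?thesis using Ri(3)[OF assms(2)] by simp
qed

lemma white_meas: "(\<lambda>u. white u k) \<in> borel_measurable (vec_space_borel p)"
  unfolding white_def vec_space_borel_def
  by (intro borel_measurable_sum borel_measurable_times borel_measurable_const measurable_component_singleton) auto

lemma white_row: assumes "i < n" "k < p" "\<omega> \<in> space M"
  shows "white (vec_coords p (Matrix.row (X \<omega>) i)) k = z i \<omega> $ k"
proof -
  have "white (vec_coords p (Matrix.row (X \<omega>) i)) k = white (\<lambda>j. X \<omega> $$ (i, j)) k"
    unfolding white_def using assms X_dim[OF assms(3)] by (intro sum.cong) (auto simp: vec_coords_def)
  then show ?thesis using white_X[OF assms] by simp
qed

lemma entries_indep: "indep_vars (\<lambda>_. borel) (\<lambda>(i, k) \<omega>. Z \<omega> i k) ({..<n} \<times> {..<p})"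
proof -
  have "indep_vars (\<lambda>_. borel) (\<lambda>(i, k). (\<lambda>\<omega>. z i \<omega> $ k)) ({..<n} \<times> {..<p})"
  proof (rule indep_vars_nested[OF _ n p])
    show "indep_vars (\<lambda>_. vec_space_borel p) (\<lambda>i \<omega>. vec_coords p (Matrix.row (X \<omega>) i)) {..<n}"
      using X_iid by (simp add: iid_vars_def)
    show "(\<lambda>u. white u k) \<in> borel_measurable (vec_space_borel p)" for k by (rule white_meas)
    show "z i \<omega> $ k = white (vec_coords p (Matrix.row (X \<omega>) i)) k" if "i < n" "k < p" "\<omega> \<in> space M" for i k \<omega>
      using white_row[OF that] by simp
    show "indep_vars (\<lambda>_. borel) (\<lambda>k \<omega>. z i \<omega> $ k) {..<p}" if "i < n" for i
      using z_iid[OF that] by (simp add: iid_vars_def)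
  qed
  then show ?thesis by (subst indep_vars_cong[OF refl _ refl]) (auto simp: Z_def)
qed

lemma z_same: assumes "i < n" "i' < n" "k < p"
  shows "distr M borel (\<lambda>\<omega>. z i \<omega> $ k) = distr M borel (\<lambda>\<omega>. z i' \<omega> $ k)"
proof -
  let ?V = "\<lambda>i \<omega>. vec_coords p (Matrix.row (X \<omega>) i)"
  have V: "?V i \<in> measurable M (vec_space_borel p)" if "i < n" for i
    using X_iid that unfolding iid_vars_def indep_vars_def by auto
  have W: "(\<lambda>u. white u k) \<in> borel_measurable (vec_space_borel p)" by (rule white_meas)
  have e: "distr M borel (\<lambda>\<omega>. z i \<omega> $ k) = distr (distr M (vec_space_borel p) (?V i)) borel (\<lambda>u. white u k)" if i: "i < n" for i
    unfolding distr_distr[OF W V[OF i]] using white_row[OF i assms(3)] by (intro distr_cong refl) (simp add: o_def)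
  have "distr M (vec_space_borel p) (?V i) = distr M (vec_space_borel p) (?V i')"
    using X_iid assms unfolding iid_vars_def by blast
  then show ?thesis using e assms by simp
qed

sublocale A: exchangeable_array M Z n p q K
proof
  show "3 \<le> q" by (rule q)
  have "0 \<le> (\<integral>\<omega>. \<bar>z 0 \<omega> $ 0\<bar> powr (2 * q) \<partial>M)" by (intro integral_nonneg_AE) auto
  then show "0 \<le> K" using z_moment[OF n p] by linarith
  show "indep_vars (\<lambda>_. borel) (\<lambda>(i, k) \<omega>. Z \<omega> i k) ({..<n} \<times> {..<p})" by (rule entries_indep)
  show "n \<le> i \<or> p \<le> k \<Longrightarrow> Z \<omega> i k = 0" for \<omega> i k by (auto simp: Z_def)
  show "(\<integral>\<omega>. Z \<omega> i k \<partial>M) = 0" if "i < n" "k < p" for i k using that by (simp add: Z_def z_mean)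
  show "integrable M (\<lambda>\<omega>. \<bar>Z \<omega> i k\<bar> powr (2 * q))" if "i < n" "k < p" for i k using that by (simp add: Z_def z_int)
  show "(\<integral>\<omega>. \<bar>Z \<omega> i k\<bar> powr (2 * q) \<partial>M) \<le> K" if "i < n" "k < p" for i k using that by (simp add: Z_def z_moment)
  show "(\<integral>\<omega>. (Z \<omega> i k)\<^sup>2 \<partial>M) = 1" if "i < n" "k < p" for i k using that z_var[OF that] by (simp add: Z_def z_mean)
  show "distr M borel (\<lambda>\<omega>. Z \<omega> i k) = distr M borel (\<lambda>\<omega>. Z \<omega> i' k)" if "i < n" "i' < n" "k < p" for i i' k
    using that z_same[OF that] by (simp add: Z_def)
qed

definition v :: "nat \<Rightarrow> real" where "v i = variance (\<lambda>\<omega>. \<epsilon> \<omega> $ i)"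

lemma v_eq: "i < n \<Longrightarrow> v i = (\<integral>\<omega>. (\<epsilon> \<omega> $ i)\<^sup>2 \<partial>M)" by (simp add: v_def eps_mean)

text \<open>The strict inequality for the fourth moment excludes degenerate noise.\<close>

lemma v_pos: assumes "i < n" shows "v i > 0"
proof -
  have "0 \<le> (\<integral>\<omega>. (\<epsilon> \<omega> $ i) ^ 4 \<partial>M)" by (intro integral_nonneg_AE) auto
  then have "C * (v i)\<^sup>2 > 0" using eps_fourth[OF assms] unfolding v_def by linarith
  then have "v i \<noteq> 0" by auto
  moreover have "v i \<ge> 0" unfolding v_eq[OF assms] by (intro integral_nonneg_AE) auto
  ultimately show ?thesis by simp
qed

lemma Sigma_carrier: "\<Sigma> \<in> carrier_mat n n" by (simp add: Sigma_def cov_mat_def)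

lemma Sigma_entry: "i < n \<Longrightarrow> \<Sigma> $$ (i, i) = v i"
  by (simp add: Sigma_def cov_mat_def v_def power2_eq_square)

lemma Sigma_norm: "(enorm (diag_vec \<Sigma>))\<^sup>2 = (\<Sum>k<n. (v k)\<^sup>2)"
proof -
  have c: "diag_vec \<Sigma> \<in> carrier_vec n" using Sigma_carrier by (intro carrier_vecI) (simp add: diag_vec_def)
  show ?thesis unfolding enorm_square[OF c] using Sigma_carrier by (intro sum.cong) (auto simp: diag_vec_def Sigma_entry)
qed

text \<open>The squared norm of the estimation error as a function of the whitened design and the noise.\<close>

definition err :: "(nat \<Rightarrow> nat \<Rightarrow> real) \<Rightarrow> (nat \<Rightarrow> real) \<Rightarrow> real" where
  "err W e = (\<Sum>j<p. ((\<Sum>i<n. est_coef n p Ri W j i * (res n p W (rinv n p 0 W) e i)\<^sup>2)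
        - (\<Sum>k<n. (ols_coef n p Ri W j k)\<^sup>2 * v k))\<^sup>2)"

lemma meas_err:
  assumes W: "\<And>i k. (\<lambda>w. W w i k) \<in> borel_measurable N" and e: "\<And>i. i < n \<Longrightarrow> (\<lambda>w. e w i) \<in> borel_measurable N"
  shows "(\<lambda>w. err (W w) (e w)) \<in> borel_measurable N"
proof -
  have r: "(\<lambda>w. (\<Sum>i<n. est_coef n p Ri (W w) j i * (res n p (W w) (rinv n p 0 (W w)) (e w) i)\<^sup>2)) \<in> borel_measurable N" for j
  proof (rule borel_measurable_sum)
    fix i assume i: "i \<in> {..<n}"
    then have eq: "res n p (W w) (rinv n p 0 (W w)) (e w) i = (\<Sum>k<n. proj n p (W w) i k * e w k)" for w
      by (simp add: res_resmat proj_def)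
    show "(\<lambda>w. est_coef n p Ri (W w) j i * (res n p (W w) (rinv n p 0 (W w)) (e w) i)\<^sup>2) \<in> borel_measurable N"
      unfolding eq using i by (intro borel_measurable_times borel_measurable_power borel_measurable_sum meas_est_coef meas_proj W e) auto
  qed
  show ?thesis unfolding err_def ols_coef_def
    by (intro borel_measurable_sum borel_measurable_power borel_measurable_diff r borel_measurable_times meas_ip meas_mv meas_rinv W borel_measurable_const)
qed

lemma err_nonneg: "err W e \<ge> 0" by (simp add: err_def sum_nonneg)

lemma est_error:
  assumes w: "\<omega> \<in> space M" and D: "design n p (Z \<omega>) \<kappa>"
  shows "hadamard_est_defined (X \<omega>)"
    and "(enorm (hadamard_est (X \<omega>) (Y \<omega>) - ols_var (X \<omega>) \<Sigma>))\<^sup>2 = err (Z \<omega>) (vec_coords n (\<epsilon> \<omega>))"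
proof -
  have Rc: "R \<in> carrier_mat p p" "transpose_mat R = R" and RR: "R * R = G" using R by (auto simp: is_sqrt_mat_def psd_mat_def)
  have Gc: "G \<in> carrier_mat p p" using G by (auto simp: psd_mat_def)
  have "det R * det R = det G" using det_mult[OF Rc(1) Rc(1)] RR by simp
  then have Rd: "det R \<noteq> 0" using G(2) invertible_mat_iff_det[OF Gc] by auto
  interpret D: design n p "Z \<omega>" Ri \<kappa> by (rule D)
  interpret W: whitened n p "X \<omega>" R "Z \<omega>"
  proof
    show "X \<omega> $$ (i, k) = mv p (mfun R) (Z \<omega> i) k" if "i < n" "k < p" for i k
      using X_entry[OF that w] that by (simp add: Z_def cong: mv_cong)
  qed (use Rc Rd X_dim[OF w] D.det in auto)
  show "hadamard_est_defined (X \<omega>)" by (rule W.defined[OF D.projsq_det])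
  have r: "res n p (Z \<omega>) (rinv n p 0 (Z \<omega>)) (($) (\<epsilon> \<omega>)) i = res n p (Z \<omega>) (rinv n p 0 (Z \<omega>)) (vec_coords n (\<epsilon> \<omega>)) i" if "i < n" for i
    using that by (simp add: res_resmat vec_coords_def)
  show "(enorm (hadamard_est (X \<omega>) (Y \<omega>) - ols_var (X \<omega>) \<Sigma>))\<^sup>2 = err (Z \<omega>) (vec_coords n (\<epsilon> \<omega>))"
    unfolding Y_model[OF w] W.error_enorm[OF beta_dim eps_dim[OF w] D.projsq_det Sigma_carrier Sigma_diag] err_def
    by (simp add: r Sigma_entry)
qed

definition arr :: "(nat \<times> nat \<Rightarrow> real) \<Rightarrow> nat \<Rightarrow> nat \<Rightarrow> real" where
  "arr u i k = (if i < n \<and> k < p then white (\<lambda>j. u (i, j)) k else 0)"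

lemma arr_X: "\<omega> \<in> space M \<Longrightarrow> arr (mat_coords n p (X \<omega>)) = Z \<omega>"
proof (intro ext)
  fix i k assume w: "\<omega> \<in> space M"
  have "white (\<lambda>j. mat_coords n p (X \<omega>) (i, j)) k = white (\<lambda>j. X \<omega> $$ (i, j)) k" if "i < n"
    unfolding white_def using that by (intro sum.cong) (auto simp: mat_coords_def)
  then show "arr (mat_coords n p (X \<omega>)) i k = Z \<omega> i k" using white_X[OF _ _ w] by (simp add: arr_def Z_def)
qed

lemma arr_meas: "(\<lambda>u. arr u i k) \<in> borel_measurable (mat_space_borel n p)"
  unfolding arr_def white_def mat_space_borel_def
  by (cases "i < n \<and> k < p") (auto intro!: borel_measurable_sum borel_measurable_times measurable_component_singleton)

text \<open>First the noise is integrated with the design fixed, then the design, using that the noise weights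
  have equal and small expectations.\<close>

lemma error_expect:
  assumes h: "h \<le> 1/2 - \<kappa>" and \<kappa>: "\<kappa> > 0" and l: "l > 0" and t: "t > 0" and lpt: "l * (real p * (2 * t)) \<le> 1/2"
  shows "(\<integral>\<^sup>+\<omega>. (if well_conditioned n p t h (Z \<omega>) then ennreal (err (Z \<omega>) (vec_coords n (\<epsilon> \<omega>))) else 0) \<partial>M)
    \<le> ennreal (quad_const 2 C * (A.c4 * (16 * ((1 / \<sigma>)\<^sup>2 * A.trace4_const (2 * t))) / \<kappa>\<^sup>2) * (\<Sum>k<n. (v k)\<^sup>2))"
proof -
  let ?S = "mat_space_borel n p" and ?T = "vec_space_borel n"
  let ?U = "\<lambda>\<omega>. mat_coords n p (X \<omega>)" and ?V = "\<lambda>\<omega>. vec_coords n (\<epsilon> \<omega>)"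
  let ?f = "\<lambda>w. if well_conditioned n p t h (arr (fst w)) then ennreal (err (arr (fst w)) (snd w)) else 0"
  let ?g = "\<lambda>u. if well_conditioned n p t h (arr u) then ennreal (quad_const 2 C * (\<Sum>k<n. (v k)\<^sup>2 * noise_weight n p Ri (arr u) k)) else 0"
  define B where "B = A.c4 * (16 * ((1 / \<sigma>)\<^sup>2 * A.trace4_const (2 * t))) / \<kappa>\<^sup>2"
  have Q0: "quad_const 2 C \<ge> 0" using quad_const_pos[OF C, of 2] by simp
  have Vm: "?V \<in> measurable M ?T" and Um: "?U \<in> measurable M ?S" using eps_indep_X by (auto simp: indep_rvs_def)
  have fstm: "(\<lambda>w. arr (fst w) i k) \<in> borel_measurable (?S \<Otimes>\<^sub>M ?T)" for i k
    using measurable_compose[OF measurable_fst arr_meas] .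
  have sndm: "(\<lambda>w. snd w i) \<in> borel_measurable (?S \<Otimes>\<^sub>M ?T)" if "i < n" for i
    using measurable_compose[OF measurable_snd, of "\<lambda>v. v i" ?T borel ?S] that by (simp add: vec_space_borel_def)
  have errm: "(\<lambda>w. err (arr (fst w)) (snd w)) \<in> borel_measurable (?S \<Otimes>\<^sub>M ?T)"
    by (intro meas_err fstm sndm)
  have fm: "?f \<in> borel_measurable (?S \<Otimes>\<^sub>M ?T)"
    by (intro measurable_If measurable_compose[OF _ measurable_ennreal] errm meas_well_conditioned fstm) auto
  have gm: "?g \<in> borel_measurable ?S"
    by (intro measurable_If measurable_compose[OF _ measurable_ennreal] borel_measurable_sum borel_measurable_times
        borel_measurable_const meas_noise_weight meas_well_conditioned arr_meas)
  have "(\<integral>\<^sup>+\<omega>. ?f (?U \<omega>, ?V \<omega>) \<partial>M) \<le> (\<integral>\<^sup>+\<omega>. ?g (?U \<omega>) \<partial>M)"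
  proof (rule nn_freeze[OF Um Vm indep_rvs_product[OF eps_indep_X] fm gm])
    fix u
    show "(\<integral>\<^sup>+\<omega>. ?f (u, ?V \<omega>) \<partial>M) \<le> ?g u"
    proof (cases "well_conditioned n p t h (arr u)")
      case True
      interpret D: design n p "arr u" Ri \<kappa> by (rule well_conditioned_design[OF True h \<kappa>])
      have c: "?V \<omega> i = \<epsilon> \<omega> $ i" if "i < n" for i \<omega> using that by (simp add: vec_coords_def)
      have "(\<integral>\<^sup>+\<omega>. ennreal (\<Sum>j<p. ((\<Sum>i<n. est_coef n p Ri (arr u) j i * (res n p (arr u) (rinv n p 0 (arr u)) (\<lambda>i. ?V \<omega> i) i)\<^sup>2)
          - (\<Sum>k<n. (ols_coef n p Ri (arr u) j k)\<^sup>2 * v k))\<^sup>2) \<partial>M)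
        \<le> ennreal (quad_const 2 C * (\<Sum>k<n. (v k)\<^sup>2 * noise_weight n p Ri (arr u) k))"
      proof (rule D.error_second_moment[OF prob_space_axioms C])
        show "indep_vars (\<lambda>_. borel) (\<lambda>i \<omega>. ?V \<omega> i) {..<n}"
          using eps_indep by (subst indep_vars_cong[OF refl _ refl]) (auto simp: c)
        show "(\<integral>\<omega>. ?V \<omega> i \<partial>M) = 0" if "i < n" for i using that by (simp add: c eps_mean)
        show "(\<integral>\<omega>. (?V \<omega> i)\<^sup>2 \<partial>M) = v i" if "i < n" for i using that by (simp add: c v_eq)
        show "v i > 0" if "i < n" for i using that by (rule v_pos)
        show "integrable M (\<lambda>\<omega>. (?V \<omega> i) ^ 4)" if "i < n" for i using that by (simp add: c eps_int)
        show "(\<integral>\<omega>. (?V \<omega> i) ^ 4 \<partial>M) \<le> C * (v i)\<^sup>2" if "i < n" for i using eps_fourth[OF that] that by (simp add: c v_def)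
      qed
      then show ?thesis using True by (simp add: err_def)
    qed simp
  qed
  also have "\<dots> = (\<integral>\<^sup>+\<omega>. (\<Sum>k<n. ennreal (quad_const 2 C * (v k)\<^sup>2) * (if well_conditioned n p t h (Z \<omega>) then ennreal (noise_weight n p Ri (Z \<omega>) k) else 0)) \<partial>M)"
  proof (rule nn_integral_cong)
    fix \<omega> assume w: "\<omega> \<in> space M"
    show "?g (?U \<omega>) = (\<Sum>k<n. ennreal (quad_const 2 C * (v k)\<^sup>2) * (if well_conditioned n p t h (Z \<omega>) then ennreal (noise_weight n p Ri (Z \<omega>) k) else 0))"
      using Q0 by (auto simp: arr_X[OF w] sum_distrib_left mult.assoc ennreal_mult'[symmetric] noise_weight_nonneg)
  qed
  also have "\<dots> = (\<Sum>k<n. ennreal (quad_const 2 C * (v k)\<^sup>2) * (\<integral>\<^sup>+\<omega>. (if well_conditioned n p t h (Z \<omega>) then ennreal (noise_weight n p Ri (Z \<omega>) k) else 0) \<partial>M))"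
  proof -
    have m: "(\<lambda>\<omega>. if well_conditioned n p t h (Z \<omega>) then ennreal (noise_weight n p Ri (Z \<omega>) k) else 0) \<in> borel_measurable M" for k
      by (intro measurable_If measurable_compose[OF _ measurable_ennreal] meas_noise_weight meas_well_conditioned A.Z_meas) auto
    show ?thesis by (subst nn_integral_sum) (auto intro!: m sum.cong nn_integral_cmult borel_measurable_times_ennreal)
  qed
  also have "\<dots> \<le> (\<Sum>k<n. ennreal (quad_const 2 C * (v k)\<^sup>2) * ennreal B)"
    unfolding B_def using sigma_min_bound(1)[OF G p]
    by (intro sum_mono mult_left_mono A.noise_weight_expect[OF Ri(5) Ri(6) _ l t lpt h \<kappa> p]) auto
  also have "\<dots> = ennreal (quad_const 2 C * B * (\<Sum>k<n. (v k)\<^sup>2))"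
  proof -
    have "A.cb x \<ge> 0" for x using A.cb_pos[of x] by simp
    then have "A.trace4_const (2 * t) \<ge> 0" "A.c4 \<ge> 0" unfolding A.trace4_const_def A.c4_def by (simp_all add: zero_le_mult_iff)
    then have B0: "B \<ge> 0" by (simp add: B_def)
    have "(\<Sum>k<n. ennreal (quad_const 2 C * (v k)\<^sup>2) * ennreal B) = (\<Sum>k<n. ennreal (quad_const 2 C * B * (v k)\<^sup>2))"
      using B0 Q0 by (intro sum.cong) (auto simp: ennreal_mult'[symmetric] ac_simps)
    then show ?thesis using B0 Q0 by (simp add: sum_ennreal sum_distrib_left)
  qed
  finally have "(\<integral>\<^sup>+\<omega>. ?f (?U \<omega>, ?V \<omega>) \<partial>M) \<le> ennreal (quad_const 2 C * B * (\<Sum>k<n. (v k)\<^sup>2))" .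
  also have "(\<integral>\<^sup>+\<omega>. ?f (?U \<omega>, ?V \<omega>) \<partial>M) = (\<integral>\<^sup>+\<omega>. (if well_conditioned n p t h (Z \<omega>) then ennreal (err (Z \<omega>) (?V \<omega>)) else 0) \<partial>M)"
    by (intro nn_integral_cong) (simp add: arr_X)
  finally show ?thesis by (simp only: B_def)
qed

text \<open>The event need not be measurable, and the measure of a set that is not is zero by convention; in either case
  its measure is at most the integral of a measurable function that dominates its indicator.
  That function adds the indicator of an ill-conditioned design to the integrand of Markov's inequality.\<close>

lemma error_prob:
  assumes l: "l > 0" and e: "e > 0" and me: "m - e > 0" and \<eta>: "\<eta> > 0" and m: "m < real n - real p"
    and lpt: "l * (real p * (4 / (m - e))) \<le> 1/2"
    and A: "A = real p * (1 / (m - e)) + \<eta>"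
    and h: "A / (1 + A) / (1 - l * (real p * (1 / (m - e)))) \<le> 1/2 - \<kappa>" and \<kappa>: "\<kappa> > 0" and s: "s > 0"
  shows "measure M {\<omega> \<in> space M. \<not> hadamard_est_defined (X \<omega>) \<or>
        enorm (hadamard_est (X \<omega>) (Y \<omega>) - ols_var (X \<omega>) \<Sigma>) / enorm (diag_vec \<Sigma>) \<ge> s}
    \<le> real p * ((A.Qc * real n) powr (q/2) / (real n - real p - m) powr q)
        + real p * real n * (A.Lc / e) powr q
        + real n * (A.Qc powr (q/2) / \<eta> powr q * ((real p * (1 / (m - e))\<^sup>2) powr (q/2) * A.cb (real p * (1 / (m - e)))))
      + quad_const 2 C * (A.c4 * (16 * ((1 / \<sigma>)\<^sup>2 * A.trace4_const (4 / (m - e)))) / \<kappa>\<^sup>2) / s\<^sup>2"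
    (is "measure M ?bad \<le> ?P1 + ?P2")
proof -
  define t where "t = 1 / (m - e)"
  define H where "H = A / (1 + A) / (1 - l * (real p * t))"
  define N where "N = (\<Sum>k<n. (v k)\<^sup>2)"
  define P1 where "P1 = ?P1"
  define E where "E = quad_const 2 C * (A.c4 * (16 * ((1 / \<sigma>)\<^sup>2 * A.trace4_const (2 * (2 * t)))) / \<kappa>\<^sup>2)"
  have cb: "A.cb x \<ge> 0" for x using A.cb_pos[of x] by simp
  have "A.trace4_const (2 * (2 * t)) \<ge> 0" "A.c4 \<ge> 0" using cb unfolding A.trace4_const_def A.c4_def by (simp_all add: zero_le_mult_iff)
  then have E0: "E \<ge> 0" using quad_const_pos[OF C, of 2] by (simp add: E_def)
  have P10: "P1 \<ge> 0" unfolding P1_def using cb by (intro add_nonneg_nonneg mult_nonneg_nonneg divide_nonneg_nonneg) auto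
  have t: "t > 0" using me by (simp add: t_def)
  have Npos: "N > 0" unfolding N_def using n by (intro sum_pos zero_less_power v_pos) auto
  define D where "D = {\<omega> \<in> space M. \<not> well_conditioned n p (2 * t) H (Z \<omega>)}"
  let ?F = "\<lambda>\<omega>. if well_conditioned n p (2 * t) H (Z \<omega>) then ennreal (err (Z \<omega>) (vec_coords n (\<epsilon> \<omega>))) else 0"
  have H: "H \<le> 1/2 - \<kappa>" using h by (simp add: H_def t_def)
  have Dm: "D \<in> sets M"
  proof -
    have "{\<omega> \<in> space M. well_conditioned n p (2 * t) H (Z \<omega>)} \<in> sets M" by (intro meas_well_conditioned A.Z_meas)
    then have "space M - {\<omega> \<in> space M. well_conditioned n p (2 * t) H (Z \<omega>)} \<in> sets M" by auto
    also have "space M - {\<omega> \<in> space M. well_conditioned n p (2 * t) H (Z \<omega>)} = D" by (auto simp: D_def)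
    finally show ?thesis .
  qed
  have em: "(\<lambda>\<omega>. vec_coords n (\<epsilon> \<omega>) i) \<in> borel_measurable M" if "i < n" for i
    using eps_indep that unfolding indep_vars_def by (auto simp: vec_coords_def)
  have Fm: "?F \<in> borel_measurable M"
    by (intro measurable_If measurable_compose[OF _ measurable_ennreal] meas_err meas_well_conditioned A.Z_meas em) auto
  have ind: "indicator ?bad \<omega> \<le> indicator D \<omega> + ennreal (1 / (s\<^sup>2 * N)) * ?F \<omega>" for \<omega>
  proof (cases "\<omega> \<in> ?bad \<and> \<omega> \<notin> D")
    case True
    then have w: "\<omega> \<in> space M" and g: "well_conditioned n p (2 * t) H (Z \<omega>)" by (auto simp: D_def)
    note err = est_error[OF w well_conditioned_design[OF g H \<kappa>]]
    let ?e = "enorm (hadamard_est (X \<omega>) (Y \<omega>) - ols_var (X \<omega>) \<Sigma>)" and ?d = "enorm (diag_vec \<Sigma>)"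
    have dc: "diag_vec \<Sigma> \<in> carrier_vec n" using Sigma_carrier by (intro carrier_vecI) (simp add: diag_vec_def)
    have d0: "?d \<ge> 0" using ip_self_nonneg by (simp add: enorm_def scalar_prod_ip[OF dc dc])
    have d2: "?d\<^sup>2 = N" unfolding N_def by (rule Sigma_norm)
    have "?d \<noteq> 0" using d2 Npos by auto
    then have d: "?d > 0" using d0 by simp
    have "s * ?d \<le> ?e" using True err(1) d by (simp add: pos_le_divide_eq)
    then have "(s * ?d)\<^sup>2 \<le> ?e\<^sup>2" using s d by (intro power_mono) auto
    then have "s\<^sup>2 * N \<le> err (Z \<omega>) (vec_coords n (\<epsilon> \<omega>))" by (simp add: err(2) power_mult_distrib d2)
    then have "1 \<le> 1 / (s\<^sup>2 * N) * err (Z \<omega>) (vec_coords n (\<epsilon> \<omega>))" using s Npos by (simp add: pos_le_divide_eq)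
    then have "ennreal 1 \<le> ennreal (1 / (s\<^sup>2 * N) * err (Z \<omega>) (vec_coords n (\<epsilon> \<omega>)))" by (rule ennreal_leI)
    also have "\<dots> = ennreal (1 / (s\<^sup>2 * N)) * ?F \<omega>" using g s Npos err_nonneg by (subst ennreal_mult) auto
    finally show ?thesis using True by simp
  next
    case False
    then show ?thesis by (auto simp: indicator_def)
  qed
  have "ennreal (measure M ?bad) \<le> emeasure M D + ennreal (1 / (s\<^sup>2 * N)) * (\<integral>\<^sup>+\<omega>. ?F \<omega> \<partial>M)"
  proof (cases "?bad \<in> sets M")
    case True
    have "ennreal (measure M ?bad) = (\<integral>\<^sup>+\<omega>. indicator ?bad \<omega> \<partial>M)"
      using nn_integral_indicator[OF True] by (simp only: emeasure_eq_measure)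
    also have "\<dots> \<le> (\<integral>\<^sup>+\<omega>. indicator D \<omega> + ennreal (1 / (s\<^sup>2 * N)) * ?F \<omega> \<partial>M)" by (intro nn_integral_mono ind)
    also have "\<dots> \<le> (\<integral>\<^sup>+\<omega>. indicator D \<omega> \<partial>M) + (\<integral>\<^sup>+\<omega>. ennreal (1 / (s\<^sup>2 * N)) * ?F \<omega> \<partial>M)"
      using Dm Fm by (subst nn_integral_add) auto
    also have "\<dots> = emeasure M D + ennreal (1 / (s\<^sup>2 * N)) * (\<integral>\<^sup>+\<omega>. ?F \<omega> \<partial>M)"
      using Dm Fm by (simp add: nn_integral_cmult)
    finally show ?thesis .
  qed (simp add: measure_notin_sets)
  also have "\<dots> \<le> ennreal P1 + ennreal (1 / (s\<^sup>2 * N)) * ennreal (E * N)"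
  proof (intro add_mono mult_left_mono)
    have "l * (real p * (1 / (m - e))) \<le> l * (real p * (4 / (m - e)))" using l me by (intro mult_left_mono divide_right_mono) auto
    then have lpt': "l * (real p * (1 / (m - e))) \<le> 1/2" using lpt by linarith
    show "emeasure M D \<le> ennreal P1" unfolding D_def H_def t_def P1_def by (rule A.well_conditioned_prob[OF l e me n \<eta> m lpt' A])
    have "l * (real p * (2 * (2 * t))) \<le> 1/2" using lpt by (simp add: t_def)
    then show "(\<integral>\<^sup>+\<omega>. ?F \<omega> \<partial>M) \<le> ennreal (E * N)"
      unfolding N_def E_def using t by (intro error_expect[OF H \<kappa> l]) auto
  qed auto
  also have "ennreal (1 / (s\<^sup>2 * N)) * ennreal (E * N) = ennreal (E / s\<^sup>2)"
    using E0 Npos s by (subst ennreal_mult[symmetric]) auto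
  also have "ennreal P1 + ennreal (E / s\<^sup>2) = ennreal (P1 + E / s\<^sup>2)"
    using P10 E0 by (simp add: ennreal_plus[symmetric] del: ennreal_plus)
  finally have "measure M ?bad \<le> P1 + E / s\<^sup>2"
    using P10 E0 by (subst (asm) ennreal_le_iff) auto
  then show ?thesis by (simp add: P1_def E_def t_def)
qed

end

section \<open>Choice of the parameters and the limit\<close>

text \<open>As \<open>\<theta>\<close> tends to zero, the bound for the leverages tends to \<open>g\<close>, which is below one half. One small number
  \<open>\<theta>\<close> serves as the penalty and as all relative margins.\<close>

lemma threshold_exists:
  assumes g: "0 \<le> g" "g < 1/2"
  obtains \<theta> :: real where "0 < \<theta>" "\<theta> < 1/4" "4 * \<theta> * (g / (1 - g) / (1 - 2 * \<theta>)) \<le> 1/2"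
    "(g / (1 - g) / (1 - 2 * \<theta>) + \<theta>) / (1 + (g / (1 - g) / (1 - 2 * \<theta>) + \<theta>)) / (1 - \<theta> * (g / (1 - g) / (1 - 2 * \<theta>))) \<le> 1/2 - (1/2 - g) / 2"
proof -
  define r where "r = g / (1 - g)"
  have r: "r \<ge> 0" "r / (1 + r) = g" using g by (auto simp: r_def field_simps)
  let ?\<tau> = "\<lambda>\<theta>::real. r / (1 - 2 * \<theta>)"
  have T: "(?\<tau> \<longlongrightarrow> r) (at_right 0)" by (auto intro!: tendsto_eq_intros)
  have A: "((\<lambda>\<theta>. 4 * \<theta> * ?\<tau> \<theta>) \<longlongrightarrow> 0) (at_right 0)" by (rule tendsto_eq_intros T refl | simp)+
  have B: "((\<lambda>\<theta>. (?\<tau> \<theta> + \<theta>) / (1 + (?\<tau> \<theta> + \<theta>)) / (1 - \<theta> * ?\<tau> \<theta>)) \<longlongrightarrow> g) (at_right 0)"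
  proof -
    have "((\<lambda>\<theta>. (?\<tau> \<theta> + \<theta>) / (1 + (?\<tau> \<theta> + \<theta>)) / (1 - \<theta> * ?\<tau> \<theta>)) \<longlongrightarrow> (r + 0) / (1 + (r + 0)) / (1 - 0 * r)) (at_right 0)"
      using r(1) by (intro tendsto_divide tendsto_add tendsto_diff tendsto_mult T tendsto_const tendsto_ident_at) auto
    then show ?thesis using r(2) by simp
  qed
  have "eventually (\<lambda>\<theta>. 0 < \<theta> \<and> \<theta> < 1/4 \<and> 4 * \<theta> * ?\<tau> \<theta> < 1/2 \<and>
      (?\<tau> \<theta> + \<theta>) / (1 + (?\<tau> \<theta> + \<theta>)) / (1 - \<theta> * ?\<tau> \<theta>) < 1/2 - (1/2 - g) / 2) (at_right (0::real))"
  proof (intro eventually_conj)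
    show "\<forall>\<^sub>F \<theta> in at_right 0. 0 < (\<theta>::real)" by (rule eventually_at_right_less)
    show "\<forall>\<^sub>F \<theta> in at_right 0. \<theta> < (1/4::real)" by (rule order_tendstoD(2)[OF tendsto_ident_at]) simp
    show "\<forall>\<^sub>F \<theta> in at_right 0. 4 * \<theta> * ?\<tau> \<theta> < 1/2" by (rule order_tendstoD(2)[OF A]) simp
    show "\<forall>\<^sub>F \<theta> in at_right 0. (?\<tau> \<theta> + \<theta>) / (1 + (?\<tau> \<theta> + \<theta>)) / (1 - \<theta> * ?\<tau> \<theta>) < 1/2 - (1/2 - g) / 2"
    proof (rule order_tendstoD(2)[OF B])
      show "g < 1/2 - (1/2 - g) / 2" using g(2) by (simp add: field_simps)
    qed
  qed
  from eventually_happens'[OF trivial_limit_at_right_real this] obtain \<theta> where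
    "0 < \<theta>" "\<theta> < 1/4" "4 * \<theta> * ?\<tau> \<theta> < 1/2"
    "(?\<tau> \<theta> + \<theta>) / (1 + (?\<tau> \<theta> + \<theta>)) / (1 - \<theta> * ?\<tau> \<theta>) < 1/2 - (1/2 - g) / 2"
    by blast
  from this[unfolded r_def, THEN less_imp_le] this(1,2) show ?thesis by (intro that)
qed

text \<open>The constants collected from \<open>error_prob\<close> for \<open>m = (1 - \<theta>) (n - p)\<close>, \<open>e = \<theta> (n - p)\<close> and
  \<open>n - p \<ge> (1 - g) n\<close>.\<close>

definition tail_const :: "real \<Rightarrow> real \<Rightarrow> real \<Rightarrow> real \<Rightarrow> real" where
  "tail_const q K g \<theta> = (let a = 1 - g; b = (1 - 2 * \<theta>) * a in
     indep_array.Qc q K powr (q/2) / (\<theta> * a) powr q + (indep_array.Lc q K / (\<theta> * a)) powr q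
     + indep_array.Qc q K powr (q/2) / \<theta> powr q * ((1 / b\<^sup>2) powr (q/2) * indep_array.cb q K (1 / b)))"

definition var_const :: "real \<Rightarrow> real \<Rightarrow> real \<Rightarrow> real \<Rightarrow> real \<Rightarrow> real" where
  "var_const q K C g \<theta> = (let b = (1 - 2 * \<theta>) * (1 - g) in
     quad_const 2 C * (indep_array.c4 K * (16 * (4 * ((4 / b) ^ 4 * indep_array.cb q K (4 / b))
       + 4 * (((4 / b)\<^sup>2) ^ 3 * (indep_array.c1 K)\<^sup>2 * indep_array.cb q K (4 / b))))) / ((1/2 - g) / 2)\<^sup>2)"

context hadamard_model
begin

text \<open>With \<open>s = t / n\<close> the second term is of the order \<open>1 / (n * t\<^sup>2 * \<sigma>\<^sup>2)\<close>: the mean squared relative error is of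
  the order \<open>n powr -3\<close>, and the level \<open>t / n\<close> costs two powers of \<open>n\<close>.\<close>

lemma error_rate:
  assumes g: "real p \<le> g * real n" "0 \<le> g" "g < 1/2"
    and \<theta>: "0 < \<theta>" "\<theta> < 1/4" "4 * \<theta> * (g / (1 - g) / (1 - 2 * \<theta>)) \<le> 1/2"
    and h: "(g / (1 - g) / (1 - 2 * \<theta>) + \<theta>) / (1 + (g / (1 - g) / (1 - 2 * \<theta>) + \<theta>)) / (1 - \<theta> * (g / (1 - g) / (1 - 2 * \<theta>))) \<le> 1/2 - (1/2 - g) / 2"
    and s: "s > 0"
  shows "measure M {\<omega> \<in> space M. \<not> hadamard_est_defined (X \<omega>) \<or>
        enorm (hadamard_est (X \<omega>) (Y \<omega>) - ols_var (X \<omega>) \<Sigma>) / enorm (diag_vec \<Sigma>) \<ge> s}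
    \<le> tail_const q K g \<theta> * real n powr (1 - q/2) + var_const q K C g \<theta> / (\<sigma>\<^sup>2 * real n ^ 3 * s\<^sup>2)"
proof -
  define a where "a = 1 - g"
  define b where "b = (1 - 2 * \<theta>) * a"
  define d where "d = real n - real p"
  define m where "m = (1 - \<theta>) * d"
  define e where "e = \<theta> * d"
  define N where "N = real n"
  define t where "t = 1 / (m - e)"
  have N: "N \<ge> 1" using n by (simp add: N_def)
  have a: "a > 0" using g by (simp add: a_def)
  have b: "b > 0" using a \<theta> by (simp add: b_def)
  have d: "a * N \<le> d" "d > 0"
  proof -
    show ad: "a * N \<le> d" using g(1) by (simp add: a_def d_def N_def algebra_simps)
    have "a * N > 0" using a N by simp
    with ad show "d > 0" by linarith
  qed
  have "g * N \<le> 1 * N" using g N by (intro mult_right_mono) auto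
  then have pN: "real p \<le> N" using g(1) unfolding N_def by linarith
  have med: "m - e = (1 - 2 * \<theta>) * d" by (simp add: m_def e_def algebra_simps)
  have me: "m - e > 0" unfolding med using \<theta> d by simp
  have bN: "b * N \<le> m - e" unfolding med b_def using \<theta> d(1) by (simp add: mult.assoc mult_left_mono)
  have bN0: "b * N > 0" using b N by simp
  have t0: "t > 0" using me by (simp add: t_def)
  have tb: "t \<le> 1 / (b * N)" unfolding t_def using bN bN0 by (intro divide_left_mono) auto
  have pt: "real p * t \<le> g / (1 - g) / (1 - 2 * \<theta>)"
  proof -
    have "real p * (1 - g) \<le> g * d" using g by (simp add: d_def algebra_simps)
    then have "real p / d \<le> g / (1 - g)" using d(2) g by (simp add: field_simps)
    then have "real p / d / (1 - 2 * \<theta>) \<le> g / (1 - g) / (1 - 2 * \<theta>)" using \<theta> by (intro divide_right_mono) auto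
    then show ?thesis by (simp add: t_def med mult.commute)
  qed
  have ptb: "real p * t \<le> 1 / b"
  proof -
    have "real p * t \<le> N * (1 / (b * N))" using pN tb t0 by (intro mult_mono) (use N in auto)
    then show ?thesis using N by simp
  qed
  define \<tau> where "\<tau> = g / (1 - g) / (1 - 2 * \<theta>)"
  note pt = pt[folded \<tau>_def] and \<theta>' = \<theta>(3)[folded \<tau>_def] and h = h[folded \<tau>_def]
  have pt0: "real p * t \<ge> 0" using t0 by simp
  define A where "A = real p * (1 / (m - e)) + \<theta>"
  have At: "A = real p * t + \<theta>" by (simp add: A_def t_def)
  have \<theta>\<tau>: "\<theta> * \<tau> \<le> 1/8" using \<theta>' by linarith
  have hb: "A / (1 + A) / (1 - \<theta> * (real p * (1 / (m - e)))) \<le> 1/2 - (1/2 - g) / 2"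
  proof -
    have A0: "A \<ge> 0" using pt0 \<theta> by (simp add: At)
    have AA: "A \<le> \<tau> + \<theta>" using pt by (simp add: At)
    have 1: "A / (1 + A) \<le> (\<tau> + \<theta>) / (1 + (\<tau> + \<theta>))"
    proof -
      have "A / (1 + A) = 1 - 1 / (1 + A)" using A0 by (simp add: field_simps)
      also have "\<dots> \<le> 1 - 1 / (1 + (\<tau> + \<theta>))" using A0 AA by (intro diff_left_mono divide_left_mono mult_pos_pos) linarith+
      also have "\<dots> = (\<tau> + \<theta>) / (1 + (\<tau> + \<theta>))"
      proof -
        have "1 + (\<tau> + \<theta>) \<noteq> 0" using A0 AA by linarith
        moreover have "1 - 1 / (1 + y) = y / (1 + y)" if "1 + y \<noteq> 0" for y :: real using that by (simp add: field_simps)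
        ultimately show ?thesis by blast
      qed
      finally show ?thesis .
    qed
    have \<tau>t: "\<theta> * (real p * t) \<le> \<theta> * \<tau>" using pt \<theta> by (intro mult_left_mono) auto
    have "A / (1 + A) / (1 - \<theta> * (real p * t)) \<le> (\<tau> + \<theta>) / (1 + (\<tau> + \<theta>)) / (1 - \<theta> * \<tau>)"
    proof (rule frac_le)
      show "0 \<le> (\<tau> + \<theta>) / (1 + (\<tau> + \<theta>))" using A0 AA by (intro divide_nonneg_nonneg) linarith+
      show "A / (1 + A) \<le> (\<tau> + \<theta>) / (1 + (\<tau> + \<theta>))" by (rule 1)
      show "0 < 1 - \<theta> * \<tau>" using \<theta>\<tau> by linarith
      show "1 - \<theta> * \<tau> \<le> 1 - \<theta> * (real p * t)" using \<tau>t by linarith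
    qed
    with h show ?thesis by (simp add: t_def)
  qed
  have lpt: "\<theta> * (real p * (4 / (m - e))) \<le> 1/2"
  proof -
    have "\<theta> * (real p * (4 / (m - e))) = 4 * \<theta> * (real p * t)" by (simp add: t_def)
    also have "\<dots> \<le> 4 * \<theta> * \<tau>" using pt \<theta> by (intro mult_left_mono) auto
    finally show ?thesis using \<theta>' by linarith
  qed
  have e0: "e > 0" using \<theta> d by (simp add: e_def)
  have mnp: "m < real n - real p" using \<theta> d by (simp add: m_def d_def[symmetric] algebra_simps)
  have \<kappa>: "(1/2 - g) / 2 > 0" using g by simp
  note bound = error_prob[OF \<theta>(1) e0 me \<theta>(1) mnp lpt A_def hb \<kappa> s]
  have q0: "q > 0" using q by simp
  have Q0: "A.Qc \<ge> 0" "A.Lc \<ge> 0" "A.cb x \<ge> 0" for x using A.Qc_pos A.Lc_nonneg A.cb_pos[of x] by auto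
  have cbm: "A.cb x \<le> A.cb y" if "0 \<le> x" "x \<le> y" for x y
    unfolding A.cb_def using that Q0 q0 by (intro mult_left_mono add_left_mono powr_mono2 mult_mono) auto
  have \<theta>aN: "\<theta> * a * N > 0" using \<theta> a N by simp
  have Nq: "N powr (1 - q/2) = N * N powr (q/2) / N powr q"
  proof -
    have "1 - q/2 = 1 + q/2 - q" by simp
    then have "N powr (1 - q/2) = N powr 1 * N powr (q/2) / N powr q" by (simp only: powr_add powr_diff)
    then show ?thesis using N by simp
  qed
  have T1: "real p * ((A.Qc * real n) powr (q/2) / (real n - real p - m) powr q)
      \<le> A.Qc powr (q/2) / (\<theta> * a) powr q * N powr (1 - q/2)"
  proof -
    have "\<theta> * a * N \<le> real n - real p - m" using d \<theta> by (simp add: m_def d_def[symmetric] algebra_simps)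
    then have "(\<theta> * a * N) powr q \<le> (real n - real p - m) powr q" using \<theta>aN q0 by (intro powr_mono2) auto
    then have "real p * ((A.Qc * real n) powr (q/2) / (real n - real p - m) powr q) \<le> N * ((A.Qc * N) powr (q/2) / (\<theta> * a * N) powr q)"
      using pN \<theta>aN N by (intro mult_mono frac_le) (auto simp: N_def)
    also have "\<dots> = A.Qc powr (q/2) / (\<theta> * a) powr q * N powr (1 - q/2)"
      using Q0 N \<theta> a by (simp add: Nq powr_mult)
    finally show ?thesis .
  qed
  have T2: "real p * real n * (A.Lc / e) powr q \<le> (A.Lc / (\<theta> * a)) powr q * N powr (1 - q/2)"
  proof -
    have "\<theta> * a * N \<le> e" using d(1) \<theta>(1) by (simp add: e_def mult.assoc mult_left_mono)
    then have "(A.Lc / e) powr q \<le> (A.Lc / (\<theta> * a * N)) powr q"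
      using \<theta>aN e0 Q0 q0 by (intro powr_mono2 divide_left_mono) auto
    then have "real p * real n * (A.Lc / e) powr q \<le> N * N * (A.Lc / (\<theta> * a * N)) powr q"
      using pN N by (intro mult_mono) (auto simp: N_def)
    also have "\<dots> = (A.Lc / (\<theta> * a)) powr q * (N powr 2 / N powr q)"
    proof -
      have "A.Lc / (\<theta> * a * N) = A.Lc / (\<theta> * a) * (1 / N)" by simp
      moreover have "(A.Lc / (\<theta> * a) * (1 / N)) powr q = (A.Lc / (\<theta> * a)) powr q * (1 / N) powr q"
        by (rule powr_mult)
      moreover have "(1 / N) powr q = 1 / N powr q" using N by (simp add: powr_divide)
      ultimately show ?thesis using N by (simp add: powr_numeral power2_eq_square)
    qed
    also have "N powr 2 / N powr q = N powr (2 - q)" by (rule powr_diff[symmetric])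
    also have "(A.Lc / (\<theta> * a)) powr q * N powr (2 - q) \<le> (A.Lc / (\<theta> * a)) powr q * N powr (1 - q/2)"
      using N q by (intro mult_left_mono powr_mono) auto
    finally show ?thesis .
  qed
  have ptt: "real p * t\<^sup>2 \<le> 1 / b\<^sup>2 * (1 / N)"
  proof -
    have "real p * t\<^sup>2 \<le> N * (1 / (b * N))\<^sup>2" using pN tb t0 N by (intro mult_mono power_mono) auto
    also have "\<dots> = 1 / b\<^sup>2 * (1 / N)" using N b by (simp add: power2_eq_square field_simps)
    finally show ?thesis .
  qed
  have T3: "real n * (A.Qc powr (q/2) / \<theta> powr q * ((real p * (1 / (m - e))\<^sup>2) powr (q/2) * A.cb (real p * (1 / (m - e)))))
      \<le> A.Qc powr (q/2) / \<theta> powr q * ((1 / b\<^sup>2) powr (q/2) * A.cb (1 / b)) * N powr (1 - q/2)"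
  proof -
    have "(real p * t\<^sup>2) powr (q/2) * A.cb (real p * t) \<le> (1 / b\<^sup>2 * (1 / N)) powr (q/2) * A.cb (1 / b)"
    proof (rule mult_mono[OF _ cbm[OF pt0 ptb]])
      show "(real p * t\<^sup>2) powr (q/2) \<le> (1 / b\<^sup>2 * (1 / N)) powr (q/2)" by (rule powr_mono2[OF _ _ ptt]) (use q0 in auto)
    qed (use Q0 in auto)
    also have "(1 / b\<^sup>2 * (1 / N)) powr (q/2) = (1 / b\<^sup>2) powr (q/2) * (1 / N powr (q/2))"
      using N b by (subst powr_mult) (auto simp: powr_divide)
    finally have "N * (A.Qc powr (q/2) / \<theta> powr q * ((real p * t\<^sup>2) powr (q/2) * A.cb (real p * t)))
      \<le> N * (A.Qc powr (q/2) / \<theta> powr q * ((1 / b\<^sup>2) powr (q/2) * (1 / N powr (q/2)) * A.cb (1 / b)))"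
      using N by (intro mult_left_mono) auto
    also have "\<dots> = A.Qc powr (q/2) / \<theta> powr q * ((1 / b\<^sup>2) powr (q/2) * A.cb (1 / b)) * N powr (1 - q/2)"
      using N by (simp add: powr_diff)
    finally show ?thesis by (simp add: t_def N_def)
  qed
  have trace4_const: "A.trace4_const (4 * t) \<le> (4 * ((4 / b) ^ 4 * A.cb (4 / b)) + 4 * (((4 / b)\<^sup>2) ^ 3 * A.c1\<^sup>2 * A.cb (4 / b))) / N ^ 3"
  proof -
    have T4: "4 * t \<le> 4 / b / N" using tb by simp
    have p4: "real p * (4 * t) \<le> 4 / b" using ptb by simp
    have "real p * (4 * t) ^ 4 \<le> N * (4 / b / N) ^ 4" using pN T4 t0 N by (intro mult_mono power_mono) auto
    also have "\<dots> = (4 / b) ^ 4 / N ^ 3" using N by (simp add: power_divide power4_eq_xxxx power3_eq_cube)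
    finally have 1: "real p * (4 * t) ^ 4 * A.cb (real p * (4 * t)) \<le> (4 / b) ^ 4 / N ^ 3 * A.cb (4 / b)"
      using N b t0 Q0 by (intro mult_mono cbm p4) auto
    have "real p * (4 * t)\<^sup>2 \<le> N * (4 / b / N)\<^sup>2" using pN T4 t0 N by (intro mult_mono power_mono) auto
    also have "\<dots> = (4 / b)\<^sup>2 / N" using N by (simp add: power_divide power2_eq_square)
    finally have "(real p * (4 * t)\<^sup>2) ^ 3 \<le> ((4 / b)\<^sup>2 / N) ^ 3" by (intro power_mono) auto
    also have "\<dots> = ((4 / b)\<^sup>2) ^ 3 / N ^ 3" by (rule power_divide)
    finally have "(real p * (4 * t)\<^sup>2) ^ 3 * A.c1\<^sup>2 \<le> ((4 / b)\<^sup>2) ^ 3 / N ^ 3 * A.c1\<^sup>2" by (intro mult_right_mono) auto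
    then have 2: "(real p * (4 * t)\<^sup>2) ^ 3 * A.c1\<^sup>2 * A.cb (real p * (4 * t)) \<le> ((4 / b)\<^sup>2) ^ 3 / N ^ 3 * A.c1\<^sup>2 * A.cb (4 / b)"
      using N b t0 Q0 by (intro mult_mono[OF _ cbm] p4) auto
    show ?thesis unfolding A.trace4_const_def using 1 2 by (simp add: add_divide_distrib)
  qed
  let ?B = "4 * ((4 / b) ^ 4 * A.cb (4 / b)) + 4 * (((4 / b)\<^sup>2) ^ 3 * A.c1\<^sup>2 * A.cb (4 / b))"
  have "quad_const 2 C * (A.c4 * (16 * ((1 / \<sigma>)\<^sup>2 * A.trace4_const (4 / (m - e)))) / ((1/2 - g) / 2)\<^sup>2) / s\<^sup>2
     \<le> quad_const 2 C * (A.c4 * (16 * ((1 / \<sigma>)\<^sup>2 * (?B / N ^ 3))) / ((1/2 - g) / 2)\<^sup>2) / s\<^sup>2"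
    using trace4_const quad_const_pos[OF C, of 2] unfolding A.c4_def
    by (intro divide_right_mono mult_left_mono) (auto simp: t_def)
  also have "\<dots> = var_const q K C g \<theta> / (\<sigma>\<^sup>2 * N ^ 3 * s\<^sup>2)"
    by (simp add: var_const_def Let_def b_def a_def power_divide mult_ac)
  finally have T4: "quad_const 2 C * (A.c4 * (16 * ((1 / \<sigma>)\<^sup>2 * A.trace4_const (4 / (m - e)))) / ((1/2 - g) / 2)\<^sup>2) / s\<^sup>2
     \<le> var_const q K C g \<theta> / (\<sigma>\<^sup>2 * N ^ 3 * s\<^sup>2)" .
  have "tail_const q K g \<theta> * N powr (1 - q/2) = A.Qc powr (q/2) / (\<theta> * a) powr q * N powr (1 - q/2)
      + (A.Lc / (\<theta> * a)) powr q * N powr (1 - q/2)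
      + A.Qc powr (q/2) / \<theta> powr q * ((1 / b\<^sup>2) powr (q/2) * A.cb (1 / b)) * N powr (1 - q/2)"
    unfolding tail_const_def Let_def a_def[symmetric] b_def[symmetric] by (simp only: distrib_right)
  with bound T1 T2 T3 T4 show ?thesis unfolding N_def[symmetric] by linarith
qed

end

theorem mainTheorem7:
  fixes \<delta> K C :: real
    and n p :: "nat \<Rightarrow> nat"
    and M :: "nat \<Rightarrow> 'a measure"
    and \<Gamma> \<Gamma>sqrt :: "nat \<Rightarrow> real mat"
    and z :: "nat \<Rightarrow> nat \<Rightarrow> 'a \<Rightarrow> real Matrix.vec"
    and X :: "nat \<Rightarrow> 'a \<Rightarrow> real mat"
    and \<beta> :: "nat \<Rightarrow> real Matrix.vec"
    and \<epsilon> Y :: "nat \<Rightarrow> 'a \<Rightarrow> real Matrix.vec"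
    and \<Sigma> :: "nat \<Rightarrow> real mat"
    and \<gamma> :: "nat \<Rightarrow> real"
  assumes delta: "\<delta> > 0"
    and n_lim: "filterlim n at_top sequentially"
    and p_lim: "filterlim p at_top sequentially"
    and gamma_def: "\<And>k. \<gamma> k = real (p k) / real (n k)"
    and gamma_lim: "limsup (\<lambda>k. ereal (\<gamma> k)) < ereal (1/2)"
    and prob: "\<And>k. prob_space (M k)"
    and Gamma_cov: "\<And>k. psd_mat (p k) (\<Gamma> k)"
    and Gamma_inv: "\<And>k. invertible_mat (\<Gamma> k)"
    and Gamma_sqrt: "\<And>k. is_sqrt_mat (p k) (\<Gamma>sqrt k) (\<Gamma> k)"
    and z_dim: "\<And>k i \<omega>. i < n k \<Longrightarrow> \<omega> \<in> space (M k) \<Longrightarrow> z k i \<omega> \<in> carrier_vec (p k)"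
    and z_iid: "\<And>k i. i < n k \<Longrightarrow> iid_vars (M k) borel (\<lambda>j \<omega>. z k i \<omega> $ j) {..<p k}"
    and z_mean: "\<And>k i j. i < n k \<Longrightarrow> j < p k \<Longrightarrow> (\<integral>\<omega>. z k i \<omega> $ j \<partial>M k) = 0"
    and z_var: "\<And>k i j. i < n k \<Longrightarrow> j < p k \<Longrightarrow>
      prob_space.variance (M k) (\<lambda>\<omega>. z k i \<omega> $ j) = 1"
    and z_int: "\<And>k i j. i < n k \<Longrightarrow> j < p k \<Longrightarrow>
      integrable (M k) (\<lambda>\<omega>. \<bar>z k i \<omega> $ j\<bar> powr (8 + \<delta>))"
    and z_moment: "\<And>k i j. i < n k \<Longrightarrow> j < p k \<Longrightarrow>
      (\<integral>\<omega>. \<bar>z k i \<omega> $ j\<bar> powr (8 + \<delta>) \<partial>M k) \<le> K"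
    and X_dim: "\<And>k \<omega>. \<omega> \<in> space (M k) \<Longrightarrow> X k \<omega> \<in> carrier_mat (n k) (p k)"
    and X_rows: "\<And>k i \<omega>. i < n k \<Longrightarrow> \<omega> \<in> space (M k) \<Longrightarrow>
      Matrix.row (X k \<omega>) i = \<Gamma>sqrt k *\<^sub>v z k i \<omega>"
    and X_iid: "\<And>k. iid_vars (M k) (vec_space_borel (p k))
      (\<lambda>i \<omega>. vec_coords (p k) (Matrix.row (X k \<omega>) i)) {..<n k}"
    and eps_dim: "\<And>k \<omega>. \<omega> \<in> space (M k) \<Longrightarrow> \<epsilon> k \<omega> \<in> carrier_vec (n k)"
    and eps_indep_X: "\<And>k. indep_rvs (M k)
      (vec_space_borel (n k)) (\<lambda>\<omega>. vec_coords (n k) (\<epsilon> k \<omega>))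
      (mat_space_borel (n k) (p k)) (\<lambda>\<omega>. mat_coords (n k) (p k) (X k \<omega>))"
    and eps_indep: "\<And>k. prob_space.indep_vars (M k) (\<lambda>_. borel) (\<lambda>i \<omega>. \<epsilon> k \<omega> $ i) {..<n k}"
    and eps_mean: "\<And>k i. i < n k \<Longrightarrow> (\<integral>\<omega>. \<epsilon> k \<omega> $ i \<partial>M k) = 0"
    and Sigma_def: "\<And>k. \<Sigma> k = cov_mat (M k) (n k) (\<epsilon> k)"
    and Sigma_diag: "\<And>k. diagonal_mat (\<Sigma> k)"
    and C_ge: "C \<ge> 3"
    and eps_int: "\<And>k i. i < n k \<Longrightarrow> integrable (M k) (\<lambda>\<omega>. (\<epsilon> k \<omega> $ i) ^ 4)"
    and eps_fourth: "\<And>k i. i < n k \<Longrightarrow>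
      (\<integral>\<omega>. (\<epsilon> k \<omega> $ i) ^ 4 \<partial>M k) < C * (prob_space.variance (M k) (\<lambda>\<omega>. \<epsilon> k \<omega> $ i))\<^sup>2"
    and beta_dim: "\<And>k. \<beta> k \<in> carrier_vec (p k)"
    and Y_model: "\<And>k \<omega>. \<omega> \<in> space (M k) \<Longrightarrow> Y k \<omega> = X k \<omega> *\<^sub>v \<beta> k + \<epsilon> k \<omega>"
  shows "\<forall>c>1. \<exists>C'>1. \<forall>\<^sub>F k in sequentially. \<forall>t>0.
    measure (M k) {\<omega> \<in> space (M k).
        \<not> hadamard_est_defined (X k \<omega>) \<or>
        enorm (hadamard_est (X k \<omega>) (Y k \<omega>) - ols_var (X k \<omega>) (\<Sigma> k)) / enorm (diag_vec (\<Sigma> k))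
          \<ge> t / real (n k)}
    \<le> 2 * c / t\<^sup>2 * (1 / (sigma_min (\<Gamma> k) * (1 - \<gamma> k powr (1/2))\<^sup>2 * (1 - 2 * \<gamma> k))\<^sup>2)
      + C' * real (n k) powr (- 1 - \<delta> / 4)"
proof (intro allI impI)
  fix c :: real assume c: "c > 1"
  obtain g1 where g1: "limsup (\<lambda>k. ereal (\<gamma> k)) < ereal g1" "ereal g1 < ereal (1/2)"
    using ereal_dense2[OF gamma_lim] by blast
  define g where "g = max g1 0"
  have g: "0 \<le> g" "g < 1/2" using g1(2) by (auto simp: g_def)
  obtain \<theta> where \<theta>: "0 < \<theta>" "\<theta> < 1/4" "4 * \<theta> * (g / (1 - g) / (1 - 2 * \<theta>)) \<le> 1/2"
    "(g / (1 - g) / (1 - 2 * \<theta>) + \<theta>) / (1 + (g / (1 - g) / (1 - 2 * \<theta>) + \<theta>)) / (1 - \<theta> * (g / (1 - g) / (1 - 2 * \<theta>))) \<le> 1/2 - (1/2 - g) / 2"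
    using threshold_exists[OF g] by blast
  \<comment> \<open>The exponent for which \<open>1 - q/2\<close> is the rate \<open>- 1 - \<delta>/4\<close>.\<close>
  define q where "q = 4 + \<delta> / 2"
  define D where "D = var_const q K C g \<theta>"
  define C' where "C' = max 2 (tail_const q K g \<theta>)"
  have C': "C' > 1" "tail_const q K g \<theta> \<le> C'" by (auto simp: C'_def)
  have ev: "\<forall>\<^sub>F k in sequentially. \<gamma> k < g1"
    using Limsup_lessD[OF g1(1)] by simp
  \<comment> \<open>Beyond \<open>D / 2\<close> the error of order \<open>1 / n\<close> is dominated by the first term of the claim, as \<open>x \<le> 1\<close> below.\<close>
  have evn: "\<forall>\<^sub>F k in sequentially. real (n k) \<ge> max 1 (D / 2)"
    using filterlim_compose[OF filterlim_real_sequentially n_lim] unfolding filterlim_at_top by blast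
  have evp: "\<forall>\<^sub>F k in sequentially. p k \<ge> 1"
    using p_lim by (auto simp: filterlim_at_top)
  have "\<forall>\<^sub>F k in sequentially. \<forall>t>0.
    measure (M k) {\<omega> \<in> space (M k).
        \<not> hadamard_est_defined (X k \<omega>) \<or>
        enorm (hadamard_est (X k \<omega>) (Y k \<omega>) - ols_var (X k \<omega>) (\<Sigma> k)) / enorm (diag_vec (\<Sigma> k))
          \<ge> t / real (n k)}
    \<le> 2 * c / t\<^sup>2 * (1 / (sigma_min (\<Gamma> k) * (1 - \<gamma> k powr (1/2))\<^sup>2 * (1 - 2 * \<gamma> k))\<^sup>2)
      + C' * real (n k) powr (- 1 - \<delta> / 4)"
    using ev evn evp
  proof eventually_elim
    case (elim k)
    have nk: "n k > 0" and pk: "p k > 0" and nD: "D / 2 \<le> real (n k)" using elim by auto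
    have q2: "2 * q = 8 + \<delta>" by (simp add: q_def)
    interpret H: hadamard_model "M k" "n k" "p k" q K C "\<Gamma> k" "\<Gamma>sqrt k" "z k" "X k" "\<beta> k" "\<epsilon> k" "Y k" "\<Sigma> k"
      unfolding hadamard_model_def hadamard_model_axioms_def q2
      using prob[of k] nk pk Gamma_cov[of k] Gamma_inv[of k] Gamma_sqrt[of k] Sigma_diag[of k] beta_dim[of k] X_iid[of k]
        eps_indep_X[of k] eps_indep[of k] Sigma_def[of k] C_ge delta
      by (intro conjI allI impI z_iid z_dim z_mean z_var z_int z_moment X_dim X_rows eps_dim eps_mean eps_int eps_fourth Y_model)
        (simp_all add: q_def)
    let ?\<sigma> = "sigma_min (\<Gamma> k)"
    have \<sigma>: "?\<sigma> > 0" by (rule sigma_min_bound(1)[OF Gamma_cov Gamma_inv pk])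
    have \<gamma>: "0 \<le> \<gamma> k" "\<gamma> k < 1/2" "real (p k) \<le> g * real (n k)"
    proof -
      show "0 \<le> \<gamma> k" by (simp add: gamma_def)
      have "\<gamma> k < g" using elim(1) by (simp add: g_def)
      then show "\<gamma> k < 1/2" using g(2) by (rule less_trans)
      show "real (p k) \<le> g * real (n k)" using \<open>\<gamma> k < g\<close> nk by (simp add: gamma_def pos_divide_less_eq)
    qed
    define x where "x = (1 - \<gamma> k powr (1/2))\<^sup>2 * (1 - 2 * \<gamma> k)"
    have x: "0 < x" "x \<le> 1"
    proof -
      have s: "0 \<le> sqrt (\<gamma> k)" "sqrt (\<gamma> k) < 1" using \<gamma> by auto
      have xs: "x = (1 - sqrt (\<gamma> k))\<^sup>2 * (1 - 2 * \<gamma> k)" using \<gamma>(1) by (simp add: x_def powr_half_sqrt)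
      show "0 < x" unfolding xs using s \<gamma> by simp
      have "(1 - sqrt (\<gamma> k))\<^sup>2 \<le> 1" using s by (intro power_le_one) auto
      then have "x \<le> 1 * 1" unfolding xs using \<gamma> by (intro mult_mono) auto
      then show "x \<le> 1" by simp
    qed
    show ?case
    proof (intro allI impI)
      fix t :: real assume t: "t > 0"
      let ?N = "real (n k)"
      let ?P = "measure (M k) {\<omega> \<in> space (M k). \<not> hadamard_est_defined (X k \<omega>) \<or>
        enorm (hadamard_est (X k \<omega>) (Y k \<omega>) - ols_var (X k \<omega>) (\<Sigma> k)) / enorm (diag_vec (\<Sigma> k)) \<ge> t / ?N}"
      have N: "?N > 0" using nk by simp
      have "?P \<le> tail_const q K g \<theta> * ?N powr (1 - q/2) + D / (?\<sigma>\<^sup>2 * ?N ^ 3 * (t / ?N)\<^sup>2)"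
        unfolding D_def using t N by (intro H.error_rate[OF \<gamma>(3) g \<theta>]) simp
      also have "tail_const q K g \<theta> * ?N powr (1 - q/2) \<le> C' * ?N powr (- 1 - \<delta> / 4)"
      proof -
        have "1 - q/2 = - 1 - \<delta> / 4" by (simp add: q_def field_simps)
        then show ?thesis using C'(2) by (simp only:) (rule mult_right_mono, simp_all)
      qed
      also have "D / (?\<sigma>\<^sup>2 * ?N ^ 3 * (t / ?N)\<^sup>2) \<le> 2 * c / t\<^sup>2 * (1 / (?\<sigma> * x)\<^sup>2)"
      proof -
        have "?N ^ 3 * (t / ?N)\<^sup>2 = ?N * t\<^sup>2" using N by (simp add: power_divide power2_eq_square power3_eq_cube)
        then have "D / (?\<sigma>\<^sup>2 * ?N ^ 3 * (t / ?N)\<^sup>2) = (D / ?N) * (1 / t\<^sup>2 * (1 / ?\<sigma>\<^sup>2))" by (simp add: mult.assoc)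
        also have "\<dots> \<le> (2 * c) * (1 / t\<^sup>2 * (1 / ?\<sigma>\<^sup>2))"
        proof (rule mult_right_mono)
          have "D \<le> 2 * ?N" using nD by simp
          also have "\<dots> \<le> 2 * c * ?N" using c N by simp
          finally show "D / ?N \<le> 2 * c" using N by (simp add: pos_divide_le_eq)
        qed simp
        also have "\<dots> \<le> (2 * c) * (1 / t\<^sup>2 * (1 / (?\<sigma> * x)\<^sup>2))"
        proof (intro mult_left_mono divide_left_mono)
          have "?\<sigma> * x \<le> ?\<sigma> * 1" using \<sigma> x by (intro mult_left_mono) auto
          then show "(?\<sigma> * x)\<^sup>2 \<le> ?\<sigma>\<^sup>2" using \<sigma> x by (intro power_mono) auto
        qed (use \<sigma> x c in auto)
        finally show ?thesis by simp
      qed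
      finally show "?P \<le> 2 * c / t\<^sup>2 * (1 / (?\<sigma> * (1 - \<gamma> k powr (1/2))\<^sup>2 * (1 - 2 * \<gamma> k))\<^sup>2) + C' * ?N powr (- 1 - \<delta> / 4)"
        by (simp add: x_def mult.assoc add.commute)
    qed
  qed
  with C'(1) show "\<exists>C'>1. \<forall>\<^sub>F k in sequentially. \<forall>t>0.
    measure (M k) {\<omega> \<in> space (M k).
        \<not> hadamard_est_defined (X k \<omega>) \<or>
        enorm (hadamard_est (X k \<omega>) (Y k \<omega>) - ols_var (X k \<omega>) (\<Sigma> k)) / enorm (diag_vec (\<Sigma> k))
          \<ge> t / real (n k)}
    \<le> 2 * c / t\<^sup>2 * (1 / (sigma_min (\<Gamma> k) * (1 - \<gamma> k powr (1/2))\<^sup>2 * (1 - 2 * \<gamma> k))\<^sup>2)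
      + C' * real (n k) powr (- 1 - \<delta> / 4)" by blast
qed

end
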